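(* Let $(u_h^{(k)},p_h^{(k)},\lambda_h^{(k)})_{k\ge1}$ be generated as follows: choose an arbitrary $\lambda_h^{(1)}\in\tilde\Lambda_h$ and $\rho>0$, and for $k=1,2,\dots$: Step 1. With $\lambda_h^{(k)}$ known, determine $(u_h^{(k)},p_h^{(k)})\in V_{\tau h}\times Q_h$ by $$a(u_h^{(k)},v_h)+b(v_h,p_h^{(k)})=(f,v_h)_{L^2(\Omega)^2}-(v_{hn},\lambda_h^{(k)})_{\Lambda_h}\quad(\forall v_h\in V_{\tau h}),\qquad b(u_h^{(k)},q_h)=0\quad(\forall q_h\in Q_h).$$ Step 2. Put $\lambda_h^{(k+1)}=\mathrm{Proj}_{\tilde\Lambda_h}(\lambda_h^{(k)}+\rho u_{hn}^{(k)})\in\tilde\Lambda_h$. Then there exists a constant $\rho_0>0$ independent of $h$ such that if $0<\rho<\rho_0$, then $(u_h^{(k)},p_h^{(k)},\lambda_h^{(k)})$ converges to some solution of Problem $\mathrm{VE}_h$ in $H^1(\Omega)^2\times L^2(\Omega)\times\Lambda_h$ as $k\to\infty$.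
   Context: Geometry. $\Omega\subset\mathbf R^2$ is a bounded polygonal domain with boundary $\Gamma=\partial\Omega=\overline\Gamma_0\cup\overline\Gamma_1$, where $\Gamma_0,\Gamma_1$ are disjoint nonempty relatively open subsets of $\Gamma$ and $\overline\Gamma_1$ is exactly one whole side of the polygon, with endpoints $M_1,M_{m+1}$. On $\Gamma_1$, $n=(n_1,n_2)$ is the (constant) outer unit normal and $\tau=(n_2,-n_1)$; for a vector field $v$, $v_n=v\cdot n$, $v_\tau=v\cdot\tau$ on $\Gamma_1$ (and $v_{hn}$, $v_{h\tau}$ for $v_h$). Data. $\nu>0$, $f\in L^2(\Omega)^2$, $g\in C^0(\overline\Gamma_1)$ with $g>0$ on $\Gamma_1$. Mesh. $\{\mathscr T_h\}_h$ is a family of triangulations of $\overline\Omega$, $h$ being the length of the greatest side, such that: two distinct triangles meet in a side, a node or $\emptyset$; the triangles cover $\overline\Omega$ and the boundary vertices belong to $\Gamma$; for some constants $K,K'>0$ independent of $h$ each triangle contains a circle of radius $Kh$ and is contained in a circle of radius $K'h$; each triangle has at least one vertex not on $\Gamma$. $\Sigma_h$ is the set of all vertices and all midpoints of sides of triangles. $\Gamma_{0,h}=\overline\Gamma_0\cap\Sigma_h$, $\overline\Gamma_1\cap\Sigma_h=\{M_1,M_{3/2},M_2,\dots,M_{m+1/2},M_{m+1}\}$, where $M_1,\dots,M_{m+1}$ are the vertices on $\overline\Gamma_1$ in order along $\overline\Gamma_1$ ($m$ depends on $h$) and $M_{i+1/2}$ is the midpoint of $e_i=[M_i,M_{i+1}]$,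 of length $|e_i|$; $\mathring\Gamma_{1,h}=\Gamma_1\cap\Sigma_h$. Spaces ($\mathscr P_k$ = polynomials of degree $\le k$). $V_h=\{v_h\in C^0(\overline\Omega)^2: v_h|_T\in\mathscr P_2(T)^2\ \forall T\in\mathscr T_h\}$, $Q_h=\{q_h\in C^0(\overline\Omega): q_h|_T\in\mathscr P_1(T)\ \forall T\in\mathscr T_h\}$, $V_{\tau h}=\{v_h\in V_h: v_h(M)=0\ \forall M\in\Gamma_{0,h},\ v_{h\tau}(M)=0\ \forall M\in\mathring\Gamma_{1,h}\}$. $\Lambda_h=\{\mu_h\in C^0(\overline\Gamma_1):\mu_h|_{e_i}\in\mathscr P_2(e_i)\ (1\le i\le m),\ \mu_h(M_1)=\mu_h(M_{m+1})=0\}$ is a Hilbert space with inner product (writing $g_i=g(M_i)$, $\lambda_{h,i}=\lambda_h(M_i)$, etc., also for half-integer indices) $$(\lambda_h,\mu_h)_{\Lambda_h}=\frac16\sum_{i=1}^m|e_i|\big(g_i\lambda_{h,i}\mu_{h,i}+4g_{i+\frac12}\lambda_{h,i+\frac12}\mu_{h,i+\frac12}+g_{i+1}\lambda_{h,i+1}\mu_{h,i+1}\big).$$ $\tilde\Lambda_h=\{\mu_h\in\Lambda_h:|\mu_h(M)|\le1\ \forall M\in\mathring\Gamma_{1,h}\}$, and $\mathrm{Proj}_{\tilde\Lambda_h}:\Lambda_h\to\tilde\Lambda_h$ is the orthogonal projection onto this closed convex set in $\Lambda_h$; explicitly, $\mathrm{Proj}_{\tilde\Lambda_h}(\mu_h)$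 is obtained by truncating each nodal value $\mu_h(M)$ to $[-1,1]$. Forms. $a(u,v)=2\nu\sum_{i,j=1}^2\int_\Omega e_{ij}(u)e_{ij}(v)\,dx$ with $e_{ij}(u)=\frac12(\partial u_i/\partial x_j+\partial u_j/\partial x_i)$; $b(v,q)=-\int_\Omega(\mathrm{div}\,v)q\,dx$. Problem $\mathrm{VE}_h$: find $(u_h,p_h,\lambda_h)\in V_{\tau h}\times Q_h\times\tilde\Lambda_h$ with $a(u_h,v_h)+b(v_h,p_h)+(v_{hn},\lambda_h)_{\Lambda_h}=(f,v_h)_{L^2(\Omega)^2}$ for all $v_h\in V_{\tau h}$, $b(u_h,q_h)=0$ for all $q_h\in Q_h$, and $(u_{hn},\mu_h-\lambda_h)_{\Lambda_h}\le0$ for all $\mu_h\in\tilde\Lambda_h$. *)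

theory Defs
  imports "HOL-Analysis.Analysis"
begin

section \<open>Polygonal domains\<close>

definition polygon_side :: "(real^2) list \<Rightarrow> nat \<Rightarrow> (real^2) set" where
  "polygon_side vs i = closed_segment (vs ! i) (vs ! (Suc i mod length vs))"

definition polygon_sides :: "(real^2) list \<Rightarrow> (real^2) set set" where
  "polygon_sides vs = polygon_side vs ` {..<length vs}"

text \<open>Two different sides meet only in common endpoints; the last condition makes every
  listed vertex a genuine corner, so that each side is a whole side of the polygon.\<close>

definition simple_polygon :: "(real^2) list \<Rightarrow> bool" where
  "simple_polygon vs \<longleftrightarrow> 3 \<le> length vs \<and> distinct vs \<and>
     (\<forall>i<length vs. \<forall>j<length vs. i \<noteq> j \<longrightarrow>
        polygon_side vs i \<inter> polygon_side vs j =
          {vs ! i, vs ! (Suc i mod length vs)} \<inter> {vs ! j, vs ! (Suc j mod length vs)}) \<and>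
     (\<forall>i<length vs. \<not> collinear {vs ! i, vs ! (Suc i mod length vs),
                                    vs ! (Suc (Suc i) mod length vs)})"

text \<open>\<open>\<P>\<close> collects the closed polygonal lines forming the boundary: one if \<open>\<Omega>\<close> is simply
  connected, and one more for each hole. By the Jordan curve theorem a connected \<open>\<Omega>\<close> lies on
  one side of each of them, so slits are excluded.\<close>

definition polygonal_domain :: "(real^2) set \<Rightarrow> (real^2) list set \<Rightarrow> bool" where
  "polygonal_domain \<Omega> \<P> \<longleftrightarrow>
     open \<Omega> \<and> connected \<Omega> \<and> bounded \<Omega> \<and> \<Omega> \<noteq> {} \<and>
     finite \<P> \<and> (\<forall>vs\<in>\<P>. simple_polygon vs) \<and>
     pairwise (\<lambda>vs ws. disjnt (\<Union>(polygon_sides vs)) (\<Union>(polygon_sides ws))) \<P> \<and>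
     frontier \<Omega> = (\<Union>vs\<in>\<P>. \<Union>(polygon_sides vs))"

definition outer_unit_normal :: "(real^2) set \<Rightarrow> (real^2) set \<Rightarrow> real^2 \<Rightarrow> bool" where
  "outer_unit_normal \<Omega> S n \<longleftrightarrow> norm n = 1 \<and>
     (\<forall>x\<in>S. \<forall>y\<in>S. (y - x) \<bullet> n = 0) \<and>
     (\<forall>x\<in>S. \<exists>\<epsilon>>0. \<forall>t. 0 < t \<and> t < \<epsilon> \<longrightarrow>
        x + t *\<^sub>R n \<notin> closure \<Omega> \<and> x - t *\<^sub>R n \<in> \<Omega>)"

definition tangent :: "real^2 \<Rightarrow> real^2" where
  "tangent n = vector [n $ 2, - (n $ 1)]"


section \<open>Weak derivatives, norms and bilinear forms\<close>

definition partial_deriv :: "2 \<Rightarrow> (real^2 \<Rightarrow> real) \<Rightarrow> real^2 \<Rightarrow> real" where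
  "partial_deriv j \<phi> x = frechet_derivative \<phi> (at x) (axis j 1)"

primrec C_diff :: "nat \<Rightarrow> (real^2 \<Rightarrow> real) \<Rightarrow> bool" where
  "C_diff 0 \<phi> \<longleftrightarrow> continuous_on UNIV \<phi>"
| "C_diff (Suc k) \<phi> \<longleftrightarrow>
     (\<forall>x. \<phi> differentiable (at x)) \<and> (\<forall>j. C_diff k (partial_deriv j \<phi>))"

definition test_function :: "(real^2) set \<Rightarrow> (real^2 \<Rightarrow> real) \<Rightarrow> bool" where
  "test_function \<Omega> \<phi> \<longleftrightarrow> (\<forall>k. C_diff k \<phi>) \<and>
     compact (closure {x. \<phi> x \<noteq> 0}) \<and> closure {x. \<phi> x \<noteq> 0} \<subseteq> \<Omega>"

definition has_weak_deriv ::
  "(real^2) set \<Rightarrow> 2 \<Rightarrow> (real^2 \<Rightarrow> real) \<Rightarrow> (real^2 \<Rightarrow> real) \<Rightarrow> bool" where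
  "has_weak_deriv \<Omega> j w w' \<longleftrightarrow>
     (\<forall>C. compact C \<and> C \<subseteq> \<Omega> \<longrightarrow> w absolutely_integrable_on C \<and> w' absolutely_integrable_on C) \<and>
     (\<forall>\<phi>. test_function \<Omega> \<phi> \<longrightarrow>
        (LINT x|lebesgue_on \<Omega>. w x * partial_deriv j \<phi> x) =
        - (LINT x|lebesgue_on \<Omega>. w' x * \<phi> x))"

text \<open>Weak derivatives are unique up to null sets, and \<open>weak_deriv\<close> is only used under
  integrals and for functions that have one.\<close>

definition weak_deriv :: "(real^2) set \<Rightarrow> 2 \<Rightarrow> (real^2 \<Rightarrow> real) \<Rightarrow> real^2 \<Rightarrow> real" where
  "weak_deriv \<Omega> j w = (SOME w'. has_weak_deriv \<Omega> j w w')"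

definition L2 :: "(real^2) set \<Rightarrow> (real^2 \<Rightarrow> 'a::euclidean_space) set" where
  "L2 \<Omega> = {w. w \<in> borel_measurable (lebesgue_on \<Omega>) \<and>
                integrable (lebesgue_on \<Omega>) (\<lambda>x. (norm (w x))\<^sup>2)}"

definition L2_inner ::
  "(real^2) set \<Rightarrow> (real^2 \<Rightarrow> 'a::euclidean_space) \<Rightarrow> (real^2 \<Rightarrow> 'a) \<Rightarrow> real" where
  "L2_inner \<Omega> v w = (LINT x|lebesgue_on \<Omega>. v x \<bullet> w x)"

definition L2_norm :: "(real^2) set \<Rightarrow> (real^2 \<Rightarrow> 'a::euclidean_space) \<Rightarrow> real" where
  "L2_norm \<Omega> w = sqrt (L2_inner \<Omega> w w)"

abbreviation weak_deriv_comp ::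
  "(real^2) set \<Rightarrow> 2 \<Rightarrow> 2 \<Rightarrow> (real^2 \<Rightarrow> real^2) \<Rightarrow> real^2 \<Rightarrow> real" where
  "weak_deriv_comp \<Omega> i j v \<equiv> weak_deriv \<Omega> j (\<lambda>y. v y $ i)"

definition H1_norm :: "(real^2) set \<Rightarrow> (real^2 \<Rightarrow> real^2) \<Rightarrow> real" where
  "H1_norm \<Omega> v = sqrt ((L2_norm \<Omega> v)\<^sup>2 +
     (\<Sum>i\<in>UNIV. \<Sum>j\<in>UNIV. (L2_norm \<Omega> (weak_deriv_comp \<Omega> i j v))\<^sup>2))"

definition strain ::
  "(real^2) set \<Rightarrow> 2 \<Rightarrow> 2 \<Rightarrow> (real^2 \<Rightarrow> real^2) \<Rightarrow> real^2 \<Rightarrow> real" where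
  "strain \<Omega> i j v x = (weak_deriv_comp \<Omega> i j v x + weak_deriv_comp \<Omega> j i v x) / 2"

definition divergence :: "(real^2) set \<Rightarrow> (real^2 \<Rightarrow> real^2) \<Rightarrow> real^2 \<Rightarrow> real" where
  "divergence \<Omega> v x = (\<Sum>i\<in>UNIV. weak_deriv_comp \<Omega> i i v x)"

definition a_form ::
  "(real^2) set \<Rightarrow> real \<Rightarrow> (real^2 \<Rightarrow> real^2) \<Rightarrow> (real^2 \<Rightarrow> real^2) \<Rightarrow> real" where
  "a_form \<Omega> \<nu> u v = 2 * \<nu> *
     (\<Sum>i\<in>UNIV. \<Sum>j\<in>UNIV. LINT x|lebesgue_on \<Omega>. strain \<Omega> i j u x * strain \<Omega> i j v x)"

definition b_form ::
  "(real^2) set \<Rightarrow> (real^2 \<Rightarrow> real^2) \<Rightarrow> (real^2 \<Rightarrow> real) \<Rightarrow> real" where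
  "b_form \<Omega> v q = - (LINT x|lebesgue_on \<Omega>. divergence \<Omega> v x * q x)"


section \<open>Triangulations\<close>

definition vertices_of :: "(real^2) set \<Rightarrow> (real^2) set" where
  "vertices_of T = {v. v extreme_point_of T}"

definition mesh_vertices :: "(real^2) set set \<Rightarrow> (real^2) set" where
  "mesh_vertices \<T> = (\<Union>T\<in>\<T>. vertices_of T)"

definition mesh_nodes :: "(real^2) set set \<Rightarrow> (real^2) set" where
  "mesh_nodes \<T> = mesh_vertices \<T> \<union>
     {midpoint a b | a b T. T \<in> \<T> \<and> a \<in> vertices_of T \<and> b \<in> vertices_of T \<and> a \<noteq> b}"

definition mesh_size :: "(real^2) set set \<Rightarrow> real" where
  "mesh_size \<T> =
     Max {dist a b | a b T. T \<in> \<T> \<and> a \<in> vertices_of T \<and> b \<in> vertices_of T \<and> a \<noteq> b}"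

text \<open>\<open>triangulation\<close> makes the intersection of two triangles a common face of both: empty, a
  vertex, a side or, when they coincide, the triangle itself.\<close>

definition admissible_mesh ::
  "(real^2) set \<Rightarrow> real \<Rightarrow> real \<Rightarrow> real \<Rightarrow> (real^2) set set \<Rightarrow> bool" where
  "admissible_mesh \<Omega> K K' h \<T> \<longleftrightarrow>
     triangulation \<T> \<and> (\<forall>T\<in>\<T>. 2 simplex T) \<and>
     \<Union>\<T> = closure \<Omega> \<and> mesh_vertices \<T> \<inter> frontier (\<Union>\<T>) \<subseteq> frontier \<Omega> \<and>
     h = mesh_size \<T> \<and>
     (\<forall>T\<in>\<T>. (\<exists>c. cball c (K * h) \<subseteq> T) \<and> (\<exists>c. T \<subseteq> cball c (K' * h))) \<and>
     (\<forall>T\<in>\<T>. \<exists>v\<in>vertices_of T. v \<notin> frontier \<Omega>)"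

text \<open>\<open>M 1, \<dots>, M (m + 1)\<close> are the mesh vertices on the segment from \<open>A\<close> to \<open>B\<close>, in order.\<close>

definition boundary_vertices ::
  "real^2 \<Rightarrow> real^2 \<Rightarrow> (real^2) set set \<Rightarrow> nat \<Rightarrow> (nat \<Rightarrow> real^2) \<Rightarrow> bool" where
  "boundary_vertices A B \<T> m M \<longleftrightarrow>
     M 1 = A \<and> M (m + 1) = B \<and>
     strict_mono_on {1..m + 1} (\<lambda>i. dist A (M i)) \<and>
     M ` {1..m + 1} = mesh_vertices \<T> \<inter> closed_segment A B"

text \<open>The point written $M_{i+1/2}$, where \<open>i\<close> runs through \<open>1, \<dots>, m\<close>.\<close>

abbreviation half_node :: "(nat \<Rightarrow> real^2) \<Rightarrow> nat \<Rightarrow> real^2" where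
  "half_node M i \<equiv> midpoint (M i) (M (i + 1))"


section \<open>Finite element spaces\<close>

text \<open>On a segment of the plane, the restrictions of the polynomials of degree \<open>\<le> k\<close> in two
  variables are exactly the polynomials of degree \<open>\<le> k\<close> in arc length, so that \<open>poly_on\<close> serves
  for both triangles and edges. All finite element functions below are constrained only
  on \<open>closure \<Omega>\<close>, or on \<open>closure \<Gamma>1\<close> for multipliers; their values elsewhere are irrelevant.\<close>

definition poly_on :: "nat \<Rightarrow> (real^2) set \<Rightarrow> (real^2 \<Rightarrow> real) \<Rightarrow> bool" where
  "poly_on k S w \<longleftrightarrow> (\<exists>c :: nat \<Rightarrow> nat \<Rightarrow> real. \<forall>x\<in>S.
     w x = (\<Sum>i\<le>k. \<Sum>j\<le>k - i. c i j * (x $ 1) ^ i * (x $ 2) ^ j))"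

definition V_space :: "(real^2) set \<Rightarrow> (real^2) set set \<Rightarrow> (real^2 \<Rightarrow> real^2) set" where
  "V_space \<Omega> \<T> = {v. continuous_on (closure \<Omega>) v \<and>
     (\<forall>T\<in>\<T>. \<forall>i. poly_on 2 T (\<lambda>x. v x $ i))}"

definition Q_space :: "(real^2) set \<Rightarrow> (real^2) set set \<Rightarrow> (real^2 \<Rightarrow> real) set" where
  "Q_space \<Omega> \<T> = {q. continuous_on (closure \<Omega>) q \<and> (\<forall>T\<in>\<T>. poly_on 1 T q)}"

definition V_tau_space ::
  "(real^2) set \<Rightarrow> (real^2) set \<Rightarrow> (real^2) set \<Rightarrow> real^2 \<Rightarrow> (real^2) set set \<Rightarrow>
   (real^2 \<Rightarrow> real^2) set" where
  "V_tau_space \<Omega> \<Gamma>0 \<Gamma>1 n \<T> = {v \<in> V_space \<Omega> \<T>.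
     (\<forall>x \<in> closure \<Gamma>0 \<inter> mesh_nodes \<T>. v x = 0) \<and>
     (\<forall>x \<in> \<Gamma>1 \<inter> mesh_nodes \<T>. v x \<bullet> tangent n = 0)}"

definition Lam_space ::
  "(real^2) set \<Rightarrow> nat \<Rightarrow> (nat \<Rightarrow> real^2) \<Rightarrow> (real^2 \<Rightarrow> real) set" where
  "Lam_space \<Gamma>1 m M = {\<mu>. continuous_on (closure \<Gamma>1) \<mu> \<and>
     (\<forall>i\<in>{1..m}. poly_on 2 (closed_segment (M i) (M (i + 1))) \<mu>) \<and>
     \<mu> (M 1) = 0 \<and> \<mu> (M (m + 1)) = 0}"

definition Lam_inner ::
  "(real^2 \<Rightarrow> real) \<Rightarrow> nat \<Rightarrow> (nat \<Rightarrow> real^2) \<Rightarrow>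
   (real^2 \<Rightarrow> real) \<Rightarrow> (real^2 \<Rightarrow> real) \<Rightarrow> real" where
  "Lam_inner g m M \<eta> \<mu> = 1 / 6 * (\<Sum>i=1..m. dist (M i) (M (i + 1)) *
     (g (M i) * \<eta> (M i) * \<mu> (M i)
      + 4 * g (half_node M i) * \<eta> (half_node M i) * \<mu> (half_node M i)
      + g (M (i + 1)) * \<eta> (M (i + 1)) * \<mu> (M (i + 1))))"

definition Lam_norm ::
  "(real^2 \<Rightarrow> real) \<Rightarrow> nat \<Rightarrow> (nat \<Rightarrow> real^2) \<Rightarrow> (real^2 \<Rightarrow> real) \<Rightarrow> real" where
  "Lam_norm g m M \<mu> = sqrt (Lam_inner g m M \<mu> \<mu>)"

definition Lam_tilde ::
  "(real^2) set \<Rightarrow> (real^2) set set \<Rightarrow> nat \<Rightarrow> (nat \<Rightarrow> real^2) \<Rightarrow> (real^2 \<Rightarrow> real) set" where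
  "Lam_tilde \<Gamma>1 \<T> m M =
     {\<mu> \<in> Lam_space \<Gamma>1 m M. \<forall>x \<in> \<Gamma>1 \<inter> mesh_nodes \<T>. \<bar>\<mu> x\<bar> \<le> 1}"

text \<open>Orthogonal projection onto the closed convex set \<open>Lam_tilde\<close>, as the nearest point. It is
  a relation because multipliers are only determined on \<open>closure \<Gamma>1\<close>.\<close>

definition is_Lam_proj ::
  "(real^2) set \<Rightarrow> (real^2 \<Rightarrow> real) \<Rightarrow> (real^2) set set \<Rightarrow> nat \<Rightarrow> (nat \<Rightarrow> real^2) \<Rightarrow>
   (real^2 \<Rightarrow> real) \<Rightarrow> (real^2 \<Rightarrow> real) \<Rightarrow> bool" where
  "is_Lam_proj \<Gamma>1 g \<T> m M \<mu> \<eta> \<longleftrightarrow>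
     is_arg_min (\<lambda>\<xi>. Lam_norm g m M (\<lambda>x. \<mu> x - \<xi> x)) (\<lambda>\<xi>. \<xi> \<in> Lam_tilde \<Gamma>1 \<T> m M) \<eta>"

abbreviation normal_comp :: "real^2 \<Rightarrow> (real^2 \<Rightarrow> real^2) \<Rightarrow> real^2 \<Rightarrow> real" where
  "normal_comp n v \<equiv> (\<lambda>x. v x \<bullet> n)"


section \<open>The discrete problem and the Uzawa iteration\<close>

definition VE_solution ::
  "(real^2) set \<Rightarrow> (real^2) set \<Rightarrow> (real^2) set \<Rightarrow> real^2 \<Rightarrow>
   real \<Rightarrow> (real^2 \<Rightarrow> real^2) \<Rightarrow> (real^2 \<Rightarrow> real) \<Rightarrow>
   (real^2) set set \<Rightarrow> nat \<Rightarrow> (nat \<Rightarrow> real^2) \<Rightarrow>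
   (real^2 \<Rightarrow> real^2) \<Rightarrow> (real^2 \<Rightarrow> real) \<Rightarrow> (real^2 \<Rightarrow> real) \<Rightarrow> bool" where
  "VE_solution \<Omega> \<Gamma>0 \<Gamma>1 n \<nu> f g \<T> m M u p l \<longleftrightarrow>
     u \<in> V_tau_space \<Omega> \<Gamma>0 \<Gamma>1 n \<T> \<and> p \<in> Q_space \<Omega> \<T> \<and> l \<in> Lam_tilde \<Gamma>1 \<T> m M \<and>
     (\<forall>v \<in> V_tau_space \<Omega> \<Gamma>0 \<Gamma>1 n \<T>.
        a_form \<Omega> \<nu> u v + b_form \<Omega> v p + Lam_inner g m M (normal_comp n v) l = L2_inner \<Omega> f v) \<and>
     (\<forall>q \<in> Q_space \<Omega> \<T>. b_form \<Omega> u q = 0) \<and>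
     (\<forall>\<mu> \<in> Lam_tilde \<Gamma>1 \<T> m M. Lam_inner g m M (normal_comp n u) (\<lambda>x. \<mu> x - l x) \<le> 0)"

text \<open>Indices start at \<open>k = 1\<close>; the terms with index \<open>0\<close> are unconstrained and unused.\<close>

definition uzawa_iterates ::
  "(real^2) set \<Rightarrow> (real^2) set \<Rightarrow> (real^2) set \<Rightarrow> real^2 \<Rightarrow>
   real \<Rightarrow> (real^2 \<Rightarrow> real^2) \<Rightarrow> (real^2 \<Rightarrow> real) \<Rightarrow>
   (real^2) set set \<Rightarrow> nat \<Rightarrow> (nat \<Rightarrow> real^2) \<Rightarrow> real \<Rightarrow>
   (nat \<Rightarrow> real^2 \<Rightarrow> real^2) \<Rightarrow> (nat \<Rightarrow> real^2 \<Rightarrow> real) \<Rightarrow> (nat \<Rightarrow> real^2 \<Rightarrow> real) \<Rightarrow> bool" where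
  "uzawa_iterates \<Omega> \<Gamma>0 \<Gamma>1 n \<nu> f g \<T> m M \<rho> u p l \<longleftrightarrow>
     l 1 \<in> Lam_tilde \<Gamma>1 \<T> m M \<and>
     (\<forall>k\<ge>1.
        u k \<in> V_tau_space \<Omega> \<Gamma>0 \<Gamma>1 n \<T> \<and> p k \<in> Q_space \<Omega> \<T> \<and>
        (\<forall>v \<in> V_tau_space \<Omega> \<Gamma>0 \<Gamma>1 n \<T>.
           a_form \<Omega> \<nu> (u k) v + b_form \<Omega> v (p k) =
           L2_inner \<Omega> f v - Lam_inner g m M (normal_comp n v) (l k)) \<and>
        (\<forall>q \<in> Q_space \<Omega> \<T>. b_form \<Omega> (u k) q = 0) \<and>
        is_Lam_proj \<Gamma>1 g \<T> m M (\<lambda>x. l k x + \<rho> * normal_comp n (u k) x) (l (k + 1)))"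

end

theory Submission
  imports Defs "HOL-Library.Function_Algebras"
begin

text \<open>
  Eliminating velocity and pressure, the iteration is a projected gradient method for a convex
  quadratic energy of the multiplier. If \<open>C\<close> bounds the squared multiplier norm of \<open>v\<^sub>n\<close> by
  \<open>a(v, v)\<close>, the energy decreases for \<open>\<rho> < 2 / C\<close> and the increments of the multiplier are
  square summable; by compactness of the constraint set a subsequence converges to a saddle point,
  and since the distance of the multipliers to every saddle point does not increase, the whole
  sequence converges. Velocity and pressure follow from the multiplier because \<open>a\<close> is definite and the
  discrete gradient is injective.

  Korn's inequality is avoided in finding a \<open>C\<close> independent of the mesh. The derivative of \<open>v\<^sub>n\<close>
  in direction \<open>n\<close> is a component of the strain, so integrating along lines parallel to \<open>n\<close>
  that enter the domain through the side bounds the trace of \<open>v\<^sub>n\<close> by the strain, and Simpson's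
  rule for squares of quadratics passes from the trace to the multiplier norm. The same slicing
  shows that \<open>a\<close> is definite. For the injectivity, testing with the quadratic bubble of an
  interior side shows that the pressure is constant on every triangle with a vertex inside the
  domain, hence constant, and the normal bubble of a boundary side on \<open>\<Gamma>1\<close> then forces it
  to vanish.
\<close>

section \<open>Finite-dimensional subspaces\<close>

text \<open>The limit is only some solution because pressure and multiplier need not be unique: for
  zero load, u = 0 with a small constant pressure c and the multiplier with nodal values c/g on
  \<Gamma>1 is a solution, Simpson's rule being exact for quadratic normal components. So no
  contraction in the multiplier is available, and convergence of the whole sequence comes from
  monotone distances to an accumulation point. A second obstacle is that the derivatives in the
  statement are weak ones picked by \<open>SOME\<close>. Computations need the classical derivatives
  on the cells, so both existence (integration by parts via a Lipschitz extension by zero) and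
  uniqueness (test functions approximating indicators of boxes) are proved; identities then hold
  almost everywhere. The threshold is 2/C with C = 5/2 * G * (2 r) / (2 \<nu>) + 1: 5/2 is from
  Simpson's rule, G bounds g on the side, 2 r exceeds all distances in the closure of \<Omega>, and
  2 \<nu> is the factor of the form. Compactness and equivalence of norms have constants that depend
  on the mesh; they serve only to identify the limit and to pass between norms.\<close>

definition fin_dim :: "'a::real_vector set \<Rightarrow> bool" where
  "fin_dim E \<longleftrightarrow> subspace E \<and> (\<exists>W. finite W \<and> E \<subseteq> span W)"

text \<open>Relative to a set, because the norms of the statement behave as norms only on a
  finite-dimensional set of functions inside a much larger function type; definiteness is supplied
  separately where it is used.\<close>

definition seminorm_on :: "'a::real_vector set \<Rightarrow> ('a \<Rightarrow> real) \<Rightarrow> bool" where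
  "seminorm_on E N \<longleftrightarrow> (\<forall>x\<in>E. 0 \<le> N x) \<and> (\<forall>x\<in>E. \<forall>y\<in>E. N (x + y) \<le> N x + N y) \<and>
     (\<forall>x\<in>E. \<forall>r. N (r *\<^sub>R x) = \<bar>r\<bar> * N x)"

lemma fin_dim_basis:
  assumes "fin_dim E"
  obtains B where "finite B" "independent B" "B \<subseteq> E" "span B = E"
proof -
  obtain W where W: "finite W" "E \<subseteq> span W" and E: "subspace E"
    using assms unfolding fin_dim_def by blast
  obtain B where B: "B \<subseteq> E" "independent B" "E \<subseteq> span B"
    using maximal_independent_subset by blast
  have "finite B" using independent_span_bound[OF W(1) B(2)] B(1) W(2) by blast
  moreover have "span B = E" using B(1,3) E by (meson span_minimal subset_antisym)
  ultimately show ?thesis using that B by blast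
qed

text \<open>Bolzano-Weierstrass in coordinates, one coordinate at a time: each induction step
  extracts a further subsequence, along which the limits already found persist.\<close>

lemma bounded_coefficients_subseq:
  fixes c :: "nat \<Rightarrow> 'b \<Rightarrow> real"
  assumes "finite B" "\<And>k b. b \<in> B \<Longrightarrow> \<bar>c k b\<bar> \<le> R"
  shows "\<exists>r d. strict_mono r \<and> (\<forall>b\<in>B. (\<lambda>k. c (r k) b) \<longlonglongrightarrow> d b)"
  using assms
proof (induction B)
  case empty
  then show ?case by (auto intro: exI[of _ id] simp: strict_mono_id)
next
  case (insert a B)
  then obtain r d where r: "strict_mono r" "\<forall>b\<in>B. (\<lambda>k. c (r k) b) \<longlonglongrightarrow> d b" by auto
  have "bounded (range (\<lambda>k. c (r k) a))"
    using insert.prems by (auto simp: bounded_iff intro!: exI[of _ R])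
  then obtain l r' where r': "strict_mono r'" "((\<lambda>k. c (r k) a) \<circ> r') \<longlonglongrightarrow> l"
    using bounded_imp_convergent_subsequence by blast
  have "(\<lambda>k. c ((r \<circ> r') k) b) \<longlonglongrightarrow> (d(a := l)) b" if "b \<in> insert a B" for b
  proof (cases "b = a")
    case True
    then show ?thesis using r'(2) by (simp add: o_def)
  next
    case False
    with that have "(\<lambda>k. c (r k) b) \<longlonglongrightarrow> d b" using r(2) by auto
    from LIMSEQ_subseq_LIMSEQ[OF this r'(1)] show ?thesis using False by (simp add: o_def)
  qed
  moreover have "strict_mono (r \<circ> r')" using r(1) r'(1) by (rule strict_mono_o)
  ultimately show ?case by blast
qed

lemma seminorm_zero: "seminorm_on E N \<Longrightarrow> subspace E \<Longrightarrow> N 0 = 0"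
  unfolding seminorm_on_def using subspace_0 by (metis abs_zero mult_zero_left scaleR_zero_left)

lemma seminorm_sum:
  assumes "seminorm_on E N" "subspace E" "finite B" "B \<subseteq> E"
  shows "N (\<Sum>b\<in>B. c b *\<^sub>R b) \<le> (\<Sum>b\<in>B. \<bar>c b\<bar> * N b)"
  using assms(3,4)
proof (induction B)
  case empty
  then show ?case using seminorm_zero[OF assms(1,2)] by simp
next
  case (insert x B)
  have "x \<in> E" "(\<Sum>b\<in>B. c b *\<^sub>R b) \<in> E" using insert.prems assms(2)
    by (auto intro!: subspace_sum subspace_scale)
  then have "N (c x *\<^sub>R x + (\<Sum>b\<in>B. c b *\<^sub>R b)) \<le> \<bar>c x\<bar> * N x + N (\<Sum>b\<in>B. c b *\<^sub>R b)"
    using assms(1,2) subspace_scale unfolding seminorm_on_def by metis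
  then show ?case using insert by simp
qed

lemma seminorm_diff_commute:
  assumes "seminorm_on E N" "subspace E" "x \<in> E" "y \<in> E"
  shows "N (x - y) = N (y - x)"
proof -
  have "N ((-1) *\<^sub>R (x - y)) = \<bar>-1\<bar> * N (x - y)"
    using assms subspace_diff unfolding seminorm_on_def by blast
  then show ?thesis by simp
qed

lemma seminorm_triangle:
  assumes "seminorm_on E N" "subspace E" "x \<in> E" "y \<in> E"
  shows "N x \<le> N y + N (x - y)"
proof -
  have "N (y + (x - y)) \<le> N y + N (x - y)"
    using assms subspace_diff unfolding seminorm_on_def by blast
  then show ?thesis by simp
qed

lemma seminorm_limit_of_coefficients:
  assumes N: "seminorm_on E N" and E: "subspace E" and B: "finite B" "B \<subseteq> E"
    and x: "\<And>k. x k = (\<Sum>b\<in>B. c k b *\<^sub>R b)" and lim: "\<And>b. b \<in> B \<Longrightarrow> (\<lambda>k. c k b) \<longlonglongrightarrow> d b"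
  shows "(\<lambda>k. N (x k - (\<Sum>b\<in>B. d b *\<^sub>R b))) \<longlonglongrightarrow> 0"
proof (rule tendsto_sandwich[of "\<lambda>k. 0" _ _ "\<lambda>k. \<Sum>b\<in>B. \<bar>c k b - d b\<bar> * N b"])
  have *: "x k - (\<Sum>b\<in>B. d b *\<^sub>R b) = (\<Sum>b\<in>B. (c k b - d b) *\<^sub>R b)" for k
    unfolding x sum_subtractf[symmetric] by (simp add: scaleR_diff_left)
  have "(\<Sum>b\<in>B. (c k b - d b) *\<^sub>R b) \<in> E" for k
    using B E by (auto intro!: subspace_sum subspace_scale)
  then show "\<forall>\<^sub>F k in sequentially. 0 \<le> N (x k - (\<Sum>b\<in>B. d b *\<^sub>R b))"
    unfolding * using N unfolding seminorm_on_def by simp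
  show "\<forall>\<^sub>F k in sequentially. N (x k - (\<Sum>b\<in>B. d b *\<^sub>R b)) \<le> (\<Sum>b\<in>B. \<bar>c k b - d b\<bar> * N b)"
    unfolding * using seminorm_sum[OF N E B] by simp
  have "(\<lambda>k. \<Sum>b\<in>B. \<bar>c k b - d b\<bar> * N b) \<longlonglongrightarrow> (\<Sum>b\<in>B. \<bar>d b - d b\<bar> * N b)"
    by (intro tendsto_intros lim)
  then show "(\<lambda>k. \<Sum>b\<in>B. \<bar>c k b - d b\<bar> * N b) \<longlonglongrightarrow> 0" by simp
qed simp

text \<open>Compactness of the unit sphere in coefficient space. If no constant worked, there would
  be vectors with absolute coefficient sum 1 and \<open>N\<close> below 1/(k + 1); a subsequence of
  the coefficients converges, the limit vector has \<open>N\<close> equal to 0 and so vanishes, yet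
  its coefficients have absolute sum 1.\<close>

lemma representation_bounded_by_norm:
  assumes B: "finite B" "independent B" and N: "seminorm_on (span B) N"
    and definite: "\<And>x. x \<in> span B \<Longrightarrow> N x = 0 \<Longrightarrow> x = 0"
  shows "\<exists>C>0. \<forall>x\<in>span B. (\<Sum>b\<in>B. \<bar>representation B x b\<bar>) \<le> C * N x"
proof (rule ccontr)
  assume neg: "\<not> ?thesis"
  define S where "S x = (\<Sum>b\<in>B. \<bar>representation B x b\<bar>)" for x
  have "\<exists>x\<in>span B. S x = 1 \<and> N x < 1 / (real k + 1)" for k
  proof -
    have "real k + 1 > 0" by simp
    with neg obtain x where x: "x \<in> span B" "S x > (real k + 1) * N x"
      unfolding S_def by (metis linorder_not_le)
    have "N x \<ge> 0" using N x(1) unfolding seminorm_on_def by blast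
    then have "S x > 0" using x(2) by (smt (verit) mult_nonneg_nonneg of_nat_0_le_iff)
    have "S ((1 / S x) *\<^sub>R x) = \<bar>1 / S x\<bar> * S x"
      unfolding S_def sum_distrib_left
      by (intro sum.cong refl) (simp add: representation_scale[OF B(2) x(1)] abs_mult)
    then have 1: "S ((1 / S x) *\<^sub>R x) = 1" using \<open>S x > 0\<close> by simp
    have "N ((1 / S x) *\<^sub>R x) = 1 / S x * N x"
      using N x(1) \<open>S x > 0\<close> unfolding seminorm_on_def by simp
    also have "\<dots> < 1 / (real k + 1)" using x(2) \<open>S x > 0\<close> by (simp add: field_simps)
    finally show ?thesis using 1 x(1) span_scale by blast
  qed
  then obtain x where x: "\<And>k. x k \<in> span B" "\<And>k. S (x k) = 1" "\<And>k. N (x k) < 1 / (real k + 1)"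
    by metis
  define c where "c k b = representation B (x k) b" for k b
  have xc: "x k = (\<Sum>b\<in>B. c k b *\<^sub>R b)" for k
    unfolding c_def using sum_representation_eq[OF B(2) x(1) B(1)] by simp
  have "\<bar>c k b\<bar> \<le> 1" if "b \<in> B" for k b
    using x(2)[of k] member_le_sum[OF that, of "\<lambda>b. \<bar>c k b\<bar>"] B(1) unfolding S_def c_def by simp
  then obtain r d where r: "strict_mono r" "\<forall>b\<in>B. (\<lambda>k. c (r k) b) \<longlonglongrightarrow> d b"
    using bounded_coefficients_subseq[OF B(1)] by blast
  define y where "y = (\<Sum>b\<in>B. d b *\<^sub>R b)"
  have y: "y \<in> span B" unfolding y_def by (intro span_sum span_scale span_base)
  have lim: "(\<lambda>k. N (x (r k) - y)) \<longlonglongrightarrow> 0" unfolding y_def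
    by (rule seminorm_limit_of_coefficients[OF N subspace_span B(1) span_superset, of _ "\<lambda>k. c (r k)"])
       (use xc r(2) in auto)
  have "(\<lambda>k. 1 / (real (r k) + 1)) \<longlonglongrightarrow> 0"
    using LIMSEQ_subseq_LIMSEQ[OF LIMSEQ_inverse_real_of_nat r(1)]
    by (simp add: o_def inverse_eq_divide add.commute)
  from tendsto_add[OF this lim]
  have "(\<lambda>k. 1 / (real (r k) + 1) + N (x (r k) - y)) \<longlonglongrightarrow> 0" by simp
  moreover have "N y \<le> 1 / (real (r k) + 1) + N (x (r k) - y)" for k
  proof -
    have "N y \<le> N (x (r k)) + N (y - x (r k))"
      by (rule seminorm_triangle[OF N subspace_span y x(1)])
    then show ?thesis using x(3)[of "r k"] seminorm_diff_commute[OF N subspace_span y x(1)]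
      by (smt (verit))
  qed
  ultimately have "N y \<le> 0" using LIMSEQ_le_const by blast
  moreover have "N y \<ge> 0" using N y unfolding seminorm_on_def by blast
  ultimately have "y = 0" using definite[OF y] by simp
  then have d0: "d b = 0" if "b \<in> B" for b
    using B that unfolding y_def independent_explicit_finite_subsets by (auto simp: independent_if_scalars_zero)
  have "(\<lambda>k. \<Sum>b\<in>B. \<bar>c (r k) b\<bar>) \<longlonglongrightarrow> (\<Sum>b\<in>B. \<bar>d b\<bar>)"
    using r(2) by (intro tendsto_intros) auto
  moreover have "(\<Sum>b\<in>B. \<bar>c (r k) b\<bar>) = 1" for k using x(2)[of "r k"] unfolding S_def c_def .
  ultimately show False using d0 LIMSEQ_unique[OF tendsto_const] by fastforce
qed

text \<open>Half of the equivalence of norms, with \<open>N'\<close> allowed to be degenerate, so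
  that it covers absolute values of linear functionals as well as the norms of the
  statement.\<close>

lemma fin_dim_norm_dominates:
  assumes "fin_dim E" "seminorm_on E N" "\<And>x. x \<in> E \<Longrightarrow> N x = 0 \<Longrightarrow> x = 0" "seminorm_on E N'"
  shows "\<exists>C\<ge>0. \<forall>x\<in>E. N' x \<le> C * N x"
proof -
  obtain B where B: "finite B" "independent B" "B \<subseteq> E" "span B = E"
    using fin_dim_basis[OF assms(1)] by blast
  obtain C where C: "C > 0" "\<And>x. x \<in> E \<Longrightarrow> (\<Sum>b\<in>B. \<bar>representation B x b\<bar>) \<le> C * N x"
    using representation_bounded_by_norm[OF B(1,2), of N] assms B(4) by auto
  define D where "D = (\<Sum>b\<in>B. N' b)"
  have D: "N' b \<ge> 0" "N' b \<le> D" if "b \<in> B" for b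
    using that assms(4) B(3) member_le_sum[OF that, of N'] B(1) unfolding D_def seminorm_on_def by auto
  have "D \<ge> 0" unfolding D_def using D(1) by (rule sum_nonneg)
  have "N' x \<le> (D * C) * N x" if x: "x \<in> E" for x
  proof -
    have E: "subspace E" using assms(1) unfolding fin_dim_def by blast
    have "N' x = N' (\<Sum>b\<in>B. representation B x b *\<^sub>R b)"
      using sum_representation_eq[OF B(2) _ B(1)] x B(4) by simp
    also have "\<dots> \<le> (\<Sum>b\<in>B. \<bar>representation B x b\<bar> * N' b)"
      by (rule seminorm_sum[OF assms(4) E B(1,3)])
    also have "\<dots> \<le> (\<Sum>b\<in>B. \<bar>representation B x b\<bar> * D)"
      using D by (intro sum_mono mult_left_mono) auto
    also have "\<dots> = D * (\<Sum>b\<in>B. \<bar>representation B x b\<bar>)"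
      unfolding sum_distrib_right[symmetric] by simp
    also have "\<dots> \<le> D * (C * N x)" using C(2)[OF x] \<open>D \<ge> 0\<close> by (intro mult_left_mono)
    finally show ?thesis by simp
  qed
  moreover have "D * C \<ge> 0" using \<open>D \<ge> 0\<close> C by simp
  ultimately show ?thesis by blast
qed

text \<open>Bounds on the norm become bounds on the coefficients by
  \<open>representation_bounded_by_norm\<close>, and convergence of coefficients implies convergence
  in \<open>N\<close>.\<close>

lemma fin_dim_bounded_subseq:
  assumes "fin_dim E" "seminorm_on E N" "\<And>x. x \<in> E \<Longrightarrow> N x = 0 \<Longrightarrow> x = 0"
    and x: "\<And>k::nat. x k \<in> E" "\<And>k. N (x k) \<le> R"
  shows "\<exists>r y. strict_mono r \<and> y \<in> E \<and> (\<lambda>k. N (x (r k) - y)) \<longlonglongrightarrow> 0"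
proof -
  obtain B where B: "finite B" "independent B" "B \<subseteq> E" "span B = E"
    using fin_dim_basis[OF assms(1)] by blast
  obtain C where C: "C > 0" "\<And>x. x \<in> E \<Longrightarrow> (\<Sum>b\<in>B. \<bar>representation B x b\<bar>) \<le> C * N x"
    using representation_bounded_by_norm[OF B(1,2), of N] assms B(4) by auto
  define c where "c k b = representation B (x k) b" for k b
  have "\<bar>c k b\<bar> \<le> C * R" if "b \<in> B" for k b
  proof -
    have "\<bar>c k b\<bar> \<le> (\<Sum>b\<in>B. \<bar>c k b\<bar>)" using member_le_sum[OF that, of "\<lambda>b. \<bar>c k b\<bar>"] B(1) by simp
    also have "\<dots> \<le> C * N (x k)" unfolding c_def by (rule C(2)[OF x(1)])
    also have "\<dots> \<le> C * R" using x(2) C(1) by simp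
    finally show ?thesis .
  qed
  then obtain r d where r: "strict_mono r" "\<forall>b\<in>B. (\<lambda>k. c (r k) b) \<longlonglongrightarrow> d b"
    using bounded_coefficients_subseq[OF B(1)] by blast
  have xc: "x k = (\<Sum>b\<in>B. c k b *\<^sub>R b)" for k
    unfolding c_def using sum_representation_eq[OF B(2) _ B(1)] x(1) B(4) by simp
  have E: "subspace E" using assms(1) unfolding fin_dim_def by blast
  have "(\<lambda>k. N (x (r k) - (\<Sum>b\<in>B. d b *\<^sub>R b))) \<longlonglongrightarrow> 0"
    by (rule seminorm_limit_of_coefficients[OF assms(2) E B(1,3), of _ "\<lambda>k. c (r k)"])
       (use xc r(2) in auto)
  moreover have "(\<Sum>b\<in>B. d b *\<^sub>R b) \<in> E" using B(3) E by (auto intro!: subspace_sum subspace_scale)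
  ultimately show ?thesis using r(1) by blast
qed

lemma seminorm_on_abs_linear:
  assumes "\<And>x y. x \<in> E \<Longrightarrow> y \<in> E \<Longrightarrow> \<phi> (x + y) = \<phi> x + \<phi> y" "\<And>x r. x \<in> E \<Longrightarrow> \<phi> (r *\<^sub>R x) = r * \<phi> x"
  shows "seminorm_on E (\<lambda>x. \<bar>\<phi> x :: real\<bar>)"
  unfolding seminorm_on_def using assms by (auto simp: abs_mult)

text \<open>This turns convergence in one definite norm, the energy norm for velocities or the dual
  norm for pressures, into convergence of linear functionals and of the H1 and L2 norms.\<close>

lemma fin_dim_seminorm_tendsto:
  assumes "fin_dim E" "seminorm_on E N" "\<And>x. x \<in> E \<Longrightarrow> N x = 0 \<Longrightarrow> x = 0" "seminorm_on E N'"
    and x: "\<And>k::nat. x k \<in> E" and "(\<lambda>k. N (x k)) \<longlonglongrightarrow> 0"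
  shows "(\<lambda>k. N' (x k)) \<longlonglongrightarrow> 0"
proof -
  obtain C where C: "C \<ge> 0" "\<And>x. x \<in> E \<Longrightarrow> N' x \<le> C * N x"
    using fin_dim_norm_dominates[OF assms(1-4)] by blast
  have "(\<lambda>k. C * N (x k)) \<longlonglongrightarrow> 0" using tendsto_mult_right_zero[OF assms(6)] .
  then show ?thesis
  proof (rule tendsto_sandwich[OF _ _ tendsto_const, rotated 2])
    show "\<forall>\<^sub>F k in sequentially. 0 \<le> N' (x k)" using assms(4) x unfolding seminorm_on_def by simp
    show "\<forall>\<^sub>F k in sequentially. N' (x k) \<le> C * N (x k)" using C(2) x by simp
  qed
qed

section \<open>Semidefinite bilinear forms\<close>

definition bilinear_on :: "'a::real_vector set \<Rightarrow> 'b::real_vector set \<Rightarrow> ('a \<Rightarrow> 'b \<Rightarrow> real) \<Rightarrow> bool" where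
  "bilinear_on E F B \<longleftrightarrow>
     (\<forall>x\<in>E. \<forall>y\<in>E. \<forall>z\<in>F. B (x + y) z = B x z + B y z) \<and> (\<forall>x\<in>E. \<forall>z\<in>F. \<forall>r. B (r *\<^sub>R x) z = r * B x z) \<and>
     (\<forall>x\<in>E. \<forall>y\<in>F. \<forall>z\<in>F. B x (y + z) = B x y + B x z) \<and> (\<forall>x\<in>E. \<forall>z\<in>F. \<forall>r. B x (r *\<^sub>R z) = r * B x z)"

lemma bilinear_onD:
  assumes "bilinear_on E F B" "subspace E" "subspace F" "x \<in> E" "y \<in> E" "z \<in> F" "w \<in> F"
  shows "B (x + y) z = B x z + B y z" "B (x - y) z = B x z - B y z" "B (r *\<^sub>R x) z = r * B x z"
    "B x (z + w) = B x z + B x w" "B x (z - w) = B x z - B x w" "B x (r *\<^sub>R z) = r * B x z"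
proof -
  show 1: "B (x + y) z = B x z + B y z" "B x (z + w) = B x z + B x w"
    "B (r *\<^sub>R x) z = r * B x z" "B x (r *\<^sub>R z) = r * B x z"
    using assms unfolding bilinear_on_def by blast+
  have "B (x + (-1) *\<^sub>R y) z = B x z + B ((-1) *\<^sub>R y) z" "B ((-1) *\<^sub>R y) z = (-1) * B y z"
    using assms subspace_scale unfolding bilinear_on_def by blast+
  then show "B (x - y) z = B x z - B y z" by simp
  have "B x (z + (-1) *\<^sub>R w) = B x z + B x ((-1) *\<^sub>R w)" "B x ((-1) *\<^sub>R w) = (-1) * B x w"
    using assms subspace_scale unfolding bilinear_on_def by blast+
  then show "B x (z - w) = B x z - B x w" by simp
qed

text \<open>\<open>B\<close> is only assumed semidefinite, so in the case \<open>B y y = 0\<close>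
  there is no minimiser to insert into the nonnegative quadratic \<open>expand\<close>, and a
  separate choice of the parameter is made.\<close>

lemma bilinear_Cauchy_Schwarz:
  assumes B: "bilinear_on E E B" and E: "subspace E" and sym: "\<And>x y. x \<in> E \<Longrightarrow> y \<in> E \<Longrightarrow> B x y = B y x"
    and pos: "\<And>x. x \<in> E \<Longrightarrow> 0 \<le> B x x" and x: "x \<in> E" and y: "y \<in> E"
  shows "\<bar>B x y\<bar> \<le> sqrt (B x x) * sqrt (B y y)"
proof -
  have expand: "0 \<le> B x x + 2 * t * B x y + t\<^sup>2 * B y y" for t
  proof -
    have ty: "t *\<^sub>R y \<in> E" "x + t *\<^sub>R y \<in> E" using x y E by (auto intro: subspace_add subspace_scale)
    have "B (x + t *\<^sub>R y) (x + t *\<^sub>R y) = B x x + B x (t *\<^sub>R y) + (B (t *\<^sub>R y) x + B (t *\<^sub>R y) (t *\<^sub>R y))"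
      using bilinear_onD[OF B E E] x ty by simp
    also have "\<dots> = B x x + 2 * t * B x y + t\<^sup>2 * B y y"
      using bilinear_onD(3,6)[OF B E E] x y ty sym[OF x y] by (simp add: power2_eq_square)
    finally show ?thesis using pos[OF ty(2)] by simp
  qed
  have "(B x y)\<^sup>2 \<le> B x x * B y y"
  proof (cases "B y y = 0")
    case True
    have "B x y = 0"
    proof (rule ccontr)
      assume "B x y \<noteq> 0"
      \<comment> \<open>With this parameter the quadratic, here of degree one, takes the value
        -1.\<close>
      then show False using expand[of "- (B x x + 1) / (2 * B x y)"] True by (simp add: field_simps)
    qed
    then show ?thesis using True by simp
  next
    case False
    then have "B y y > 0" using pos[OF y] by simp
    then show ?thesis using expand[of "- B x y / B y y"]
      by (simp add: power2_eq_square field_simps)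
  qed
  then have "\<bar>B x y\<bar> \<le> sqrt (B x x * B y y)" by (simp add: real_le_rsqrt)
  then show ?thesis by (simp add: real_sqrt_mult)
qed

lemma seminorm_on_sqrt_bilinear:
  assumes B: "bilinear_on E E B" and E: "subspace E" and sym: "\<And>x y. x \<in> E \<Longrightarrow> y \<in> E \<Longrightarrow> B x y = B y x"
    and pos: "\<And>x. x \<in> E \<Longrightarrow> 0 \<le> B x x"
  shows "seminorm_on E (\<lambda>x. sqrt (B x x))"
  unfolding seminorm_on_def
proof (intro conjI ballI allI)
  fix x y assume x: "x \<in> E" and y: "y \<in> E"
  have "B (x + y) (x + y) = B x x + 2 * B x y + B y y"
    using bilinear_onD(1,4)[OF B E E] x y sym[OF x y] subspace_add[OF E] by simp
  also have "\<dots> \<le> (sqrt (B x x) + sqrt (B y y))\<^sup>2"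
    using bilinear_Cauchy_Schwarz[OF assms x y] pos[OF x] pos[OF y] by (simp add: power2_sum)
  finally show "sqrt (B (x + y) (x + y)) \<le> sqrt (B x x) + sqrt (B y y)"
    using pos x y by (intro real_le_lsqrt) auto
next
  fix x r assume x: "x \<in> E"
  have "B (r *\<^sub>R x) (r *\<^sub>R x) = r\<^sup>2 * B x x"
    using bilinear_onD(3,6)[OF B E E] x subspace_scale[OF E] by (simp add: power2_eq_square)
  then show "sqrt (B (r *\<^sub>R x) (r *\<^sub>R x)) = \<bar>r\<bar> * sqrt (B x x)" by (simp add: real_sqrt_mult)
qed (use pos in auto)

section \<open>The Uzawa iteration in finite dimension\<close>

lemma squeeze_to_0:
  fixes f g :: "nat \<Rightarrow> real"
  assumes "\<And>k. 0 \<le> f k" "\<And>k. f k \<le> g k" "g \<longlonglongrightarrow> 0"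
  shows "f \<longlonglongrightarrow> 0"
  by (rule tendsto_sandwich[OF _ _ tendsto_const assms(3)]) (simp_all add: assms)

text \<open>\<open>s\<close> is a semi-inner product on the whole type and definite only on
  \<open>L\<close>, so \<open>\<gamma>\<close> need not map into \<open>L\<close>.
  \<open>b_injective\<close> is the qualitative form of an inf-sup condition, which finite dimension
  makes quantitative. \<open>K_closed\<close> expresses closedness through \<open>s\<close>, as the
  types carry no topology.\<close>

locale uzawa_setting =
  fixes E :: "'u::real_vector set" and Q :: "'q::real_vector set"
    and L :: "'l::real_vector set" and K :: "'l set"
    and a :: "'u \<Rightarrow> 'u \<Rightarrow> real" and b :: "'u \<Rightarrow> 'q \<Rightarrow> real" and s :: "'l \<Rightarrow> 'l \<Rightarrow> real"
    and \<gamma> :: "'u \<Rightarrow> 'l" and load :: "'u \<Rightarrow> real" and C R :: real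
  assumes E: "fin_dim E" and Q: "fin_dim Q" and L: "fin_dim L"
    and a_bilinear: "bilinear_on E E a" and a_sym: "\<And>x y. x \<in> E \<Longrightarrow> y \<in> E \<Longrightarrow> a x y = a y x"
    and a_nonneg: "\<And>x. x \<in> E \<Longrightarrow> 0 \<le> a x x" and a_definite: "\<And>x. x \<in> E \<Longrightarrow> a x x = 0 \<Longrightarrow> x = 0"
    and b_bilinear: "bilinear_on E Q b"
    and b_injective: "\<And>q. q \<in> Q \<Longrightarrow> (\<And>v. v \<in> E \<Longrightarrow> b v q = 0) \<Longrightarrow> q = 0"
    and s_bilinear: "bilinear_on UNIV UNIV s" and s_sym: "\<And>x y. s x y = s y x"
    and s_nonneg: "\<And>x. 0 \<le> s x x" and s_definite: "\<And>x. x \<in> L \<Longrightarrow> s x x = 0 \<Longrightarrow> x = 0"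
    and gamma_add: "\<And>x y. x \<in> E \<Longrightarrow> y \<in> E \<Longrightarrow> \<gamma> (x + y) = \<gamma> x + \<gamma> y"
    and gamma_scale: "\<And>x r. x \<in> E \<Longrightarrow> \<gamma> (r *\<^sub>R x) = r *\<^sub>R \<gamma> x"
    and trace: "\<And>v. v \<in> E \<Longrightarrow> s (\<gamma> v) (\<gamma> v) \<le> C * a v v" and C_pos: "C > 0"
    and load_add: "\<And>x y. x \<in> E \<Longrightarrow> y \<in> E \<Longrightarrow> load (x + y) = load x + load y"
    and load_scale: "\<And>x r. x \<in> E \<Longrightarrow> load (r *\<^sub>R x) = r * load x"
    and K_subset: "K \<subseteq> L" and K_convex: "convex K" and K_bounded: "\<And>\<mu>. \<mu> \<in> K \<Longrightarrow> sqrt (s \<mu> \<mu>) \<le> R"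
    and K_closed: "\<And>x y. (\<And>k::nat. x k \<in> K) \<Longrightarrow> y \<in> L \<Longrightarrow> (\<lambda>k. sqrt (s (x k - y) (x k - y))) \<longlonglongrightarrow> 0 \<Longrightarrow> y \<in> K"
begin

definition saddle_point :: "'u \<Rightarrow> 'q \<Rightarrow> 'l \<Rightarrow> bool" where
  "saddle_point u p l \<longleftrightarrow> u \<in> E \<and> p \<in> Q \<and> l \<in> K \<and>
     (\<forall>v\<in>E. a u v + b v p + s (\<gamma> v) l = load v) \<and> (\<forall>q\<in>Q. b u q = 0) \<and>
     (\<forall>\<mu>\<in>K. s (\<gamma> u) (\<mu> - l) \<le> 0)"

lemma subspaces: "subspace E" "subspace Q" "subspace L"
  using E Q L unfolding fin_dim_def by auto

lemmas a_simps = bilinear_onD[OF a_bilinear subspaces(1,1)]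
lemmas b_simps = bilinear_onD[OF b_bilinear subspaces(1,2)]
lemmas s_simps = bilinear_onD[OF s_bilinear subspace_UNIV subspace_UNIV UNIV_I UNIV_I UNIV_I UNIV_I]

lemma gamma_diff: "x \<in> E \<Longrightarrow> y \<in> E \<Longrightarrow> \<gamma> (x - y) = \<gamma> x - \<gamma> y"
proof -
  assume "x \<in> E" "y \<in> E"
  then have "\<gamma> (x + (-1) *\<^sub>R y) = \<gamma> x + (-1) *\<^sub>R \<gamma> y"
    using gamma_add gamma_scale subspace_scale[OF subspaces(1)] by metis
  then show ?thesis by simp
qed

lemma seminorm_a: "seminorm_on E (\<lambda>x. sqrt (a x x))"
  using seminorm_on_sqrt_bilinear[OF a_bilinear subspaces(1) a_sym a_nonneg] .

lemma seminorm_s: "seminorm_on F (\<lambda>x. sqrt (s x x))"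
  using seminorm_on_sqrt_bilinear[OF s_bilinear subspace_UNIV s_sym s_nonneg]
  unfolding seminorm_on_def by auto

lemma s_Cauchy_Schwarz: "\<bar>s x y\<bar> \<le> sqrt (s x x) * sqrt (s y y)"
  using bilinear_Cauchy_Schwarz[OF s_bilinear subspace_UNIV s_sym s_nonneg UNIV_I UNIV_I] .

text \<open>Cauchy-Schwarz for \<open>s\<close> and the trace bound give a(d, d) \<le> sqrt (C a(d,
  d)) sqrt (s \<delta> \<delta>), and a factor sqrt (a(d, d)) cancels. It serves both for increments
  of the iteration and for errors against a saddle point; in both cases the pressure term has
  dropped out because the velocities are discretely divergence free.\<close>

lemma a_bounded_by_multiplier:
  assumes d: "d \<in> E" and eq: "a d d = - s (\<gamma> d) \<delta>"
  shows "a d d \<le> C * s \<delta> \<delta>"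
proof (cases "a d d = 0")
  case False
  then have pos: "a d d > 0" using a_nonneg[OF d] by simp
  have "a d d \<le> sqrt (s (\<gamma> d) (\<gamma> d)) * sqrt (s \<delta> \<delta>)"
    using s_Cauchy_Schwarz[of "\<gamma> d" \<delta>] eq by simp
  also have "\<dots> \<le> sqrt (C * a d d) * sqrt (s \<delta> \<delta>)"
    using trace[OF d] s_nonneg by (intro mult_right_mono) auto
  also have "\<dots> = sqrt (C * s \<delta> \<delta> * a d d)" by (simp add: real_sqrt_mult[symmetric] mult.commute mult.left_commute)
  finally have "(a d d)\<^sup>2 \<le> C * s \<delta> \<delta> * a d d"
    using pos by (metis order_less_imp_le real_sqrt_le_iff real_sqrt_abs abs_of_pos)
  then show ?thesis using pos by (simp add: power2_eq_square)
qed (use C_pos s_nonneg in simp)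

text \<open>A stand-in for the dual norm of the functional v \<mapsto> b(v, q): finitely many test
  vectors suffice, and each summand can be read off from the momentum equation. Injectivity of the
  discrete gradient is exactly its definiteness.\<close>

definition q_norm :: "'q \<Rightarrow> real" where
  "q_norm q = (\<Sum>v\<in>(SOME B. finite B \<and> independent B \<and> B \<subseteq> E \<and> span B = E). \<bar>b v q\<bar>)"

lemma q_norm_basis:
  obtains B where "finite B" "B \<subseteq> E" "span B = E" "\<And>q. q_norm q = (\<Sum>v\<in>B. \<bar>b v q\<bar>)"
proof -
  define B where "B = (SOME B. finite B \<and> independent B \<and> B \<subseteq> E \<and> span B = E)"
  have "\<exists>B. finite B \<and> independent B \<and> B \<subseteq> E \<and> span B = E"
    using fin_dim_basis[OF E] by metis
  then have "finite B \<and> independent B \<and> B \<subseteq> E \<and> span B = E" unfolding B_def by (rule someI_ex)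
  then show ?thesis using that[of B] unfolding q_norm_def B_def[symmetric] by blast
qed

lemma seminorm_q: "seminorm_on Q q_norm"
proof -
  obtain B where B: "finite B" "B \<subseteq> E" "\<And>q. q_norm q = (\<Sum>v\<in>B. \<bar>b v q\<bar>)"
    using q_norm_basis by metis
  show ?thesis
    unfolding seminorm_on_def B(3)
  proof (intro conjI ballI allI)
    fix p q assume "p \<in> Q" "q \<in> Q"
    then have "(\<Sum>v\<in>B. \<bar>b v (p + q)\<bar>) = (\<Sum>v\<in>B. \<bar>b v p + b v q\<bar>)"
      using B(2) b_simps(4) by (intro sum.cong refl) (metis subsetD)
    also have "\<dots> \<le> (\<Sum>v\<in>B. \<bar>b v p\<bar> + \<bar>b v q\<bar>)" by (intro sum_mono) simp
    finally show "(\<Sum>v\<in>B. \<bar>b v (p + q)\<bar>) \<le> (\<Sum>v\<in>B. \<bar>b v p\<bar>) + (\<Sum>v\<in>B. \<bar>b v q\<bar>)"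
      by (simp add: sum.distrib)
  next
    fix q r assume "q \<in> Q"
    then have "(\<Sum>v\<in>B. \<bar>b v (r *\<^sub>R q)\<bar>) = (\<Sum>v\<in>B. \<bar>r * b v q\<bar>)"
      using B(2) b_simps(6) by (intro sum.cong refl) (metis subsetD)
    then show "(\<Sum>v\<in>B. \<bar>b v (r *\<^sub>R q)\<bar>) = \<bar>r\<bar> * (\<Sum>v\<in>B. \<bar>b v q\<bar>)"
      by (simp add: abs_mult sum_distrib_left)
  qed (simp add: sum_nonneg)
qed

lemma q_norm_definite:
  assumes "q \<in> Q" "q_norm q = 0"
  shows "q = 0"
proof (rule b_injective[OF assms(1)])
  fix v assume v: "v \<in> E"
  obtain B where B: "finite B" "B \<subseteq> E" "span B = E" "\<And>q. q_norm q = (\<Sum>v\<in>B. \<bar>b v q\<bar>)"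
    using q_norm_basis by metis
  have base: "b w q = 0" if "w \<in> B" for w
    using assms(2) that B(1) unfolding B(4) by (simp add: sum_nonneg_eq_0_iff)
  have E0: "0 \<in> E" using subspaces(1) by (rule subspace_0)
  have "b (0 *\<^sub>R 0) q = 0" using b_simps(3)[OF E0 E0 assms(1) assms(1), of 0] by simp
  then have "subspace {x \<in> E. b x q = 0}"
    using subspaces(1) E0 b_simps(1,3)[OF _ _ assms(1,1)]
    by (auto simp: subspace_def)
  moreover have "B \<subseteq> {x \<in> E. b x q = 0}" using base B(2) by auto
  ultimately show "b v q = 0" using v B(3) span_minimal by blast
qed

section \<open>The iteration, indexed from 0, with the projection given by its variational
  inequality\<close>

context
  fixes u :: "nat \<Rightarrow> 'u" and p :: "nat \<Rightarrow> 'q" and l :: "nat \<Rightarrow> 'l" and \<rho> :: real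
  assumes u: "\<And>k. u k \<in> E" and p: "\<And>k. p k \<in> Q" and l: "\<And>k. l k \<in> K"
    and momentum: "\<And>k v. v \<in> E \<Longrightarrow> a (u k) v + b v (p k) = load v - s (\<gamma> v) (l k)"
    and incompressible: "\<And>k q. q \<in> Q \<Longrightarrow> b (u k) q = 0"
    and projection: "\<And>k \<mu>. \<mu> \<in> K \<Longrightarrow> s (l k + \<rho> *\<^sub>R \<gamma> (u k) - l (Suc k)) (\<mu> - l (Suc k)) \<le> 0"
    and \<rho>: "0 < \<rho>" "\<rho> < 2 / C"
begin

text \<open>The iteration is the projected gradient method for \<^term>\<open>\<lambda>k. a (u k) (u k) / 2\<close> as a function
  of the multiplier, so this energy decreases.\<close>

lemma energy_decrease:
  "a (u (Suc k)) (u (Suc k)) + (2 / \<rho> - C) * s (l (Suc k) - l k) (l (Suc k) - l k) \<le> a (u k) (u k)"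
proof -
  define d \<delta> where "d = u (Suc k) - u k" and "\<delta> = l (Suc k) - l k"
  have d: "d \<in> E" unfolding d_def using u subspaces(1) by (simp add: subspace_diff)
  have ad: "a d v + b v (p (Suc k)) - b v (p k) = - s (\<gamma> v) \<delta>" if "v \<in> E" for v
    using momentum[OF that, of k] momentum[OF that, of "Suc k"] a_simps(2)[OF u u that that]
    unfolding d_def \<delta>_def s_simps(5) by simp
  have bd: "b d q = 0" if "q \<in> Q" for q
    unfolding d_def using b_simps(2)[OF u u that that] incompressible[OF that] by simp
  have add: "a d d = - s (\<gamma> d) \<delta>" using ad[OF d] bd[OF p] by simp
  have adu: "a d (u k) = - s (\<gamma> (u k)) \<delta>" using ad[OF u, of k] incompressible[OF p] by simp
  \<comment> \<open>The projection inequality is tested with the old multiplier, which lies in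
    \<open>K\<close>; it yields s \<delta> \<delta> \<le> \<rho> s (\<gamma> (u k))
    \<delta>.\<close>
  have "s (l k + \<rho> *\<^sub>R \<gamma> (u k) - l (Suc k)) (l k - l (Suc k)) \<le> 0" using projection[OF l] .
  moreover have "l k + \<rho> *\<^sub>R \<gamma> (u k) - l (Suc k) = \<rho> *\<^sub>R \<gamma> (u k) - \<delta>" "l k - l (Suc k) = (-1) *\<^sub>R \<delta>"
    unfolding \<delta>_def by auto
  ultimately have "s (\<rho> *\<^sub>R \<gamma> (u k) - \<delta>) ((-1) *\<^sub>R \<delta>) \<le> 0" by (simp only:)
  then have "s \<delta> \<delta> \<le> \<rho> * s (\<gamma> (u k)) \<delta>" unfolding s_simps(6) s_simps(2) s_simps(3) by simp
  then have "s \<delta> \<delta> / \<rho> \<le> s (\<gamma> (u k)) \<delta>" using \<rho> by (simp add: pos_divide_le_eq mult.commute)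
  moreover have "a (u (Suc k)) (u (Suc k)) = a (u k) (u k) + 2 * a d (u k) + a d d"
  proof -
    have "u (Suc k) = u k + d" unfolding d_def by simp
    then show ?thesis using a_simps(1,4) u d a_sym[OF d u] subspace_add[OF subspaces(1)] by simp
  qed
  ultimately show ?thesis
    using adu a_bounded_by_multiplier[OF d add] unfolding \<delta>_def[symmetric]
    by (simp add: algebra_simps)
qed

lemma energy_bounded: "a (u k) (u k) \<le> a (u 0) (u 0)"
proof (induction k)
  case (Suc k)
  have "2 / \<rho> - C \<ge> 0" using \<rho> C_pos by (simp add: field_simps)
  then have "(2 / \<rho> - C) * s (l (Suc k) - l k) (l (Suc k) - l k) \<ge> 0" using s_nonneg by simp
  then show ?case using energy_decrease[of k] Suc by linarith
qed simp

lemma step_tendsto_0: "(\<lambda>k. sqrt (s (l (Suc k) - l k) (l (Suc k) - l k))) \<longlonglongrightarrow> 0"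
proof -
  define D where "D k = s (l (Suc k) - l k) (l (Suc k) - l k)" for k
  have c: "2 / \<rho> - C > 0" using \<rho> C_pos by (simp add: field_simps)
  have "a (u n) (u n) + (2 / \<rho> - C) * (\<Sum>k<n. D k) \<le> a (u 0) (u 0)" for n
  proof (induction n)
    case (Suc n)
    then show ?case using energy_decrease[of n] unfolding D_def by (simp add: distrib_left)
  qed simp
  then have "(2 / \<rho> - C) * (\<Sum>k<n. D k) \<le> a (u 0) (u 0)" for n
    using a_nonneg[OF u] by (smt (verit))
  then have "(\<Sum>k<n. D k) \<le> a (u 0) (u 0) / (2 / \<rho> - C)" for n
    using c by (simp add: pos_le_divide_eq mult.commute)
  then have "(\<Sum>k\<le>n. D k) \<le> a (u 0) (u 0) / (2 / \<rho> - C)" for n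
    unfolding lessThan_Suc_atMost[symmetric] .
  moreover have "0 \<le> D k" for k unfolding D_def by (rule s_nonneg)
  ultimately have "summable D" by (intro bounded_imp_summable)
  then have "D \<longlonglongrightarrow> 0" by (rule summable_LIMSEQ_zero)
  then have "(\<lambda>k. sqrt (D k)) \<longlonglongrightarrow> sqrt 0" by (intro tendsto_intros)
  then show ?thesis unfolding D_def by simp
qed

text \<open>Every linear functional is continuous for the energy norm by equivalence of norms, so no
  bound has to be computed separately for \<open>a\<close>, \<open>b\<close> and the trace.\<close>

lemma tendsto_linear_functional:
  assumes "x \<in> E" "\<And>k::nat. y k \<in> E" "(\<lambda>k. sqrt (a (y k - x) (y k - x))) \<longlonglongrightarrow> 0"
    "\<And>x y. x \<in> E \<Longrightarrow> y \<in> E \<Longrightarrow> \<phi> (x + y) = \<phi> x + \<phi> y" "\<And>x r. x \<in> E \<Longrightarrow> \<phi> (r *\<^sub>R x) = r * \<phi> x"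
  shows "(\<lambda>k. \<phi> (y k)) \<longlonglongrightarrow> (\<phi> x :: real)"
proof -
  have yx: "y k - x \<in> E" for k using assms subspaces(1) by (simp add: subspace_diff)
  have "(\<lambda>k. \<bar>\<phi> (y k - x)\<bar>) \<longlonglongrightarrow> 0"
    by (rule fin_dim_seminorm_tendsto[OF E seminorm_a _ seminorm_on_abs_linear yx assms(3)])
       (use assms a_definite in auto)
  then have "(\<lambda>k. \<phi> (y k - x)) \<longlonglongrightarrow> 0" by (simp add: tendsto_rabs_zero_iff)
  from tendsto_add[OF this tendsto_const[of "\<phi> x"]]
  have "(\<lambda>k. \<phi> (y k - x) + \<phi> x) \<longlonglongrightarrow> \<phi> x" by simp
  moreover have "\<phi> (y k - x) + \<phi> x = \<phi> (y k)" for k using assms(4)[OF yx assms(1)] by simp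
  ultimately show ?thesis by (simp only:)
qed

lemma tendsto_s:
  assumes "(\<lambda>k. sqrt (s (y k - x) (y k - x))) \<longlonglongrightarrow> 0"
  shows "(\<lambda>k::nat. s z (y k)) \<longlonglongrightarrow> s z x"
proof -
  have "(\<lambda>k. sqrt (s z z) * sqrt (s (y k - x) (y k - x))) \<longlonglongrightarrow> 0"
    using tendsto_mult_right_zero[OF assms] .
  then have "(\<lambda>k. s z (y k - x)) \<longlonglongrightarrow> 0"
    by (rule Lim_null_comparison[rotated]) (use s_Cauchy_Schwarz in \<open>simp add: always_eventually\<close>)
  then show ?thesis unfolding s_simps(5) by (simp add: LIM_zero_iff)
qed

text \<open>Three successive extractions: multipliers are bounded through \<open>K\<close>,
  velocities through the decreasing energy, and pressures because the momentum equation bounds each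
  \<open>b v (p k)\<close>. The equations pass to the limit by continuity. The projection inequality
  involves \<open>l (Suc (r k))\<close>, whose index leaves the subsequence; vanishing increments
  give it the same limit.\<close>

lemma subsequential_saddle_point:
  shows "\<exists>r u' p' l'. strict_mono r \<and> saddle_point u' p' l' \<and>
    (\<lambda>k. sqrt (s (l (r k) - l') (l (r k) - l'))) \<longlonglongrightarrow> 0"
proof -
  have lL: "l k \<in> L" for k using l K_subset by blast
  have N_l: "sqrt (s (l k) (l k)) \<le> R" for k using K_bounded[OF l] .
  have "\<exists>r y. strict_mono r \<and> y \<in> L \<and> (\<lambda>k. sqrt (s (l (r k) - y) (l (r k) - y))) \<longlonglongrightarrow> 0"
    by (rule fin_dim_bounded_subseq[OF L seminorm_s _ lL N_l]) (use s_definite in auto)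
  then obtain r1 l' where r1: "strict_mono r1" "l' \<in> L"
    "(\<lambda>k. sqrt (s (l (r1 k) - l') (l (r1 k) - l'))) \<longlonglongrightarrow> 0" by blast
  have N_u: "sqrt (a (u (r1 k)) (u (r1 k))) \<le> sqrt (a (u 0) (u 0))" for k
    using energy_bounded by simp
  have "\<exists>r y. strict_mono r \<and> y \<in> E \<and> (\<lambda>k. sqrt (a (u (r1 (r k)) - y) (u (r1 (r k)) - y))) \<longlonglongrightarrow> 0"
    by (rule fin_dim_bounded_subseq[OF E seminorm_a _ u N_u]) (use a_definite in auto)
  then obtain r2 u' where r2: "strict_mono r2" "u' \<in> E"
    "(\<lambda>k. sqrt (a (u (r1 (r2 k)) - u') (u (r1 (r2 k)) - u'))) \<longlonglongrightarrow> 0" by blast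
  obtain B where B: "finite B" "B \<subseteq> E" "\<And>q. q_norm q = (\<Sum>v\<in>B. \<bar>b v q\<bar>)"
    using q_norm_basis by metis
  \<comment> \<open>Every term of the momentum equation except the pressure term is already
    bounded.\<close>
  have N_p: "q_norm (p k) \<le> (\<Sum>v\<in>B. \<bar>load v\<bar> + sqrt (s (\<gamma> v) (\<gamma> v)) * R + sqrt (a v v) * sqrt (a (u 0) (u 0)))" for k
    unfolding B(3)
  proof (rule sum_mono)
    fix v assume "v \<in> B"
    then have v: "v \<in> E" using B(2) by blast
    have "\<bar>s (\<gamma> v) (l k)\<bar> \<le> sqrt (s (\<gamma> v) (\<gamma> v)) * R"
      using s_Cauchy_Schwarz[of "\<gamma> v" "l k"] N_l[of k] s_nonneg
      by (meson mult_left_mono order_trans real_sqrt_ge_zero)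
    moreover have "\<bar>a (u k) v\<bar> \<le> sqrt (a v v) * sqrt (a (u 0) (u 0))"
    proof -
      have "\<bar>a (u k) v\<bar> \<le> sqrt (a (u k) (u k)) * sqrt (a v v)"
        using bilinear_Cauchy_Schwarz[OF a_bilinear subspaces(1) a_sym a_nonneg u v] .
      also have "\<dots> \<le> sqrt (a (u 0) (u 0)) * sqrt (a v v)"
        using energy_bounded a_nonneg[OF v] by (intro mult_right_mono) auto
      finally show ?thesis by (simp add: mult.commute)
    qed
    ultimately show "\<bar>b v (p k)\<bar> \<le> \<bar>load v\<bar> + sqrt (s (\<gamma> v) (\<gamma> v)) * R + sqrt (a v v) * sqrt (a (u 0) (u 0))"
      using momentum[OF v, of k] by linarith
  qed
  have "\<exists>r y. strict_mono r \<and> y \<in> Q \<and> (\<lambda>k. q_norm (p (r1 (r2 (r k))) - y)) \<longlonglongrightarrow> 0"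
    by (rule fin_dim_bounded_subseq[OF Q seminorm_q _ p N_p]) (use q_norm_definite in auto)
  then obtain r3 p' where r3: "strict_mono r3" "p' \<in> Q"
    "(\<lambda>k. q_norm (p (r1 (r2 (r3 k))) - p')) \<longlonglongrightarrow> 0" by blast
  define r where "r = r1 \<circ> r2 \<circ> r3"
  have r: "strict_mono r" unfolding r_def using r1 r2 r3 by (intro strict_mono_o)
  have lim_l: "(\<lambda>k. sqrt (s (l (r k) - l') (l (r k) - l'))) \<longlonglongrightarrow> 0"
    using LIMSEQ_subseq_LIMSEQ[OF r1(3) strict_mono_o[OF r2(1) r3(1)]] by (simp add: r_def o_def)
  have lim_u: "(\<lambda>k. sqrt (a (u (r k) - u') (u (r k) - u'))) \<longlonglongrightarrow> 0"
    using LIMSEQ_subseq_LIMSEQ[OF r2(3) r3(1)] by (simp add: r_def o_def)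
  have lim_p: "(\<lambda>k. q_norm (p (r k) - p')) \<longlonglongrightarrow> 0" using r3(3) by (simp add: r_def)
  have l': "l' \<in> K" using K_closed[OF _ r1(2) r1(3)] l by blast
  have lim_b: "(\<lambda>k. b v (p (r k))) \<longlonglongrightarrow> b v p'" if v: "v \<in> E" for v
  proof -
    have pp: "p (r k) - p' \<in> Q" for k using p r3(2) subspaces(2) by (simp add: subspace_diff)
    have "(\<lambda>k. \<bar>b v (p (r k) - p')\<bar>) \<longlonglongrightarrow> 0"
      by (rule fin_dim_seminorm_tendsto[OF Q seminorm_q _ seminorm_on_abs_linear pp lim_p])
         (use q_norm_definite b_simps(4,6)[OF v v] in auto)
    moreover have "b v (p (r k) - p') = b v (p (r k)) - b v p'" for k
      using b_simps(5)[OF v v p r3(2)] .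
    ultimately show ?thesis by (simp add: tendsto_rabs_zero_iff LIM_zero_iff)
  qed
  have eq1: "a u' v + b v p' + s (\<gamma> v) l' = load v" if v: "v \<in> E" for v
  proof -
    have "(\<lambda>k. a (u (r k)) v) \<longlonglongrightarrow> a u' v"
      by (rule tendsto_linear_functional[OF r2(2) u lim_u]) (use a_simps(1,3) v in auto)
    from tendsto_add[OF tendsto_add[OF this lim_b[OF v]] tendsto_s[OF lim_l, of "\<gamma> v"]]
    have "(\<lambda>k. a (u (r k)) v + b v (p (r k)) + s (\<gamma> v) (l (r k))) \<longlonglongrightarrow> a u' v + b v p' + s (\<gamma> v) l'" .
    moreover have "a (u (r k)) v + b v (p (r k)) + s (\<gamma> v) (l (r k)) = load v" for k
      using momentum[OF v, of "r k"] by simp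
    ultimately show ?thesis using LIMSEQ_unique[OF tendsto_const] by fastforce
  qed
  have eq2: "b u' q = 0" if q: "q \<in> Q" for q
  proof -
    have "(\<lambda>k. b (u (r k)) q) \<longlonglongrightarrow> b u' q"
      by (rule tendsto_linear_functional[OF r2(2) u lim_u]) (use b_simps(1,3) q in auto)
    then show ?thesis using incompressible[OF q] LIMSEQ_unique[OF tendsto_const] by fastforce
  qed
  have eq3: "s (\<gamma> u') (\<mu> - l') \<le> 0" if \<mu>: "\<mu> \<in> K" for \<mu>
  proof -
    define \<delta> where "\<delta> k = l (Suc (r k)) - l (r k)" for k
    define X where "X = \<mu> - l'"
    have lim_\<delta>: "(\<lambda>k. sqrt (s (\<delta> k) (\<delta> k))) \<longlonglongrightarrow> 0"
      unfolding \<delta>_def using LIMSEQ_subseq_LIMSEQ[OF step_tendsto_0 r] by (simp add: o_def)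
    have lim_\<gamma>: "(\<lambda>k. s (\<gamma> (u (r k))) X) \<longlonglongrightarrow> s (\<gamma> u') X"
      by (rule tendsto_linear_functional[OF r2(2) u lim_u])
         (use gamma_add gamma_scale s_simps(1,3) in auto)
    define e where "e k = sqrt (s (l (r k) - l') (l (r k) - l')) + sqrt (s (\<delta> k) (\<delta> k))" for k
    have e: "e \<longlonglongrightarrow> 0" unfolding e_def using tendsto_add[OF lim_l lim_\<delta>] by simp
    define G where "G = sqrt C * sqrt (a (u 0) (u 0))"
    \<comment> \<open>The arguments of the projection inequality are replaced by \<rho> \<gamma> (u
      (r k)) and X = \<mu> - l'. The error is controlled by \<open>e k\<close>, which bounds the
      distance from \<open>l (Suc (r k))\<close> to l', and by \<open>G\<close>, which bounds the
      traces of all iterates.\<close>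
    have bound: "\<rho> * s (\<gamma> (u (r k))) X \<le>
        \<rho> * (G * e k) + sqrt (s (\<delta> k) (\<delta> k)) * (sqrt (s X X) + e k)" for k
    proof -
      define w where "w = X - (\<mu> - l (Suc (r k)))"
      have w: "w = (l (r k) - l') + \<delta> k" unfolding w_def X_def \<delta>_def by simp
      have nw: "sqrt (s w w) \<le> e k"
        unfolding w e_def using seminorm_s[of UNIV] unfolding seminorm_on_def by blast
      have "l (r k) + \<rho> *\<^sub>R \<gamma> (u (r k)) - l (Suc (r k)) = \<rho> *\<^sub>R \<gamma> (u (r k)) - \<delta> k"
        "\<mu> - l (Suc (r k)) = X - w" unfolding \<delta>_def w_def by simp_all
      then have "s (\<rho> *\<^sub>R \<gamma> (u (r k)) - \<delta> k) (X - w) \<le> 0"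
        using projection[OF \<mu>, of "r k"] by (simp only:)
      then have "\<rho> * s (\<gamma> (u (r k))) (X - w) \<le> s (\<delta> k) (X - w)"
        unfolding s_simps(2) s_simps(3) by linarith
      then have 1: "\<rho> * s (\<gamma> (u (r k))) X \<le> \<rho> * s (\<gamma> (u (r k))) w + s (\<delta> k) (X - w)"
        unfolding s_simps(5) by (simp add: algebra_simps)
      have "s (\<gamma> (u (r k))) w \<le> sqrt (s (\<gamma> (u (r k))) (\<gamma> (u (r k)))) * sqrt (s w w)"
        using s_Cauchy_Schwarz[of "\<gamma> (u (r k))" w] by linarith
      also have "\<dots> \<le> G * e k"
      proof (rule mult_mono[OF _ nw])
        have "s (\<gamma> (u (r k))) (\<gamma> (u (r k))) \<le> C * a (u 0) (u 0)"
          using trace[OF u[of "r k"]] mult_left_mono[OF energy_bounded[of "r k"] order_less_imp_le[OF C_pos]]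
          by linarith
        then show "sqrt (s (\<gamma> (u (r k))) (\<gamma> (u (r k)))) \<le> G" unfolding G_def real_sqrt_mult[symmetric] by simp
      qed (use C_pos s_nonneg a_nonneg[OF u] in \<open>auto simp: G_def\<close>)
      finally have 2: "\<rho> * s (\<gamma> (u (r k))) w \<le> \<rho> * (G * e k)" using \<rho> by simp
      have "s (\<delta> k) (X - w) \<le> sqrt (s (\<delta> k) (\<delta> k)) * sqrt (s (X - w) (X - w))"
        using s_Cauchy_Schwarz[of "\<delta> k" "X - w"] by linarith
      also have "\<dots> \<le> sqrt (s (\<delta> k) (\<delta> k)) * (sqrt (s X X) + e k)"
      proof (intro mult_left_mono)
        have "sqrt (s (X - w) (X - w)) \<le> sqrt (s X X) + sqrt (s w w)"
          using seminorm_triangle[OF seminorm_s[of UNIV], of "X - w" X]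
            seminorm_diff_commute[OF seminorm_s[of UNIV], of "X - w" X] by simp
        then show "sqrt (s (X - w) (X - w)) \<le> sqrt (s X X) + e k" using nw by simp
      qed (use s_nonneg in auto)
      finally show ?thesis using 1 2 by linarith
    qed
    have "(\<lambda>k. \<rho> * (G * e k) + sqrt (s (\<delta> k) (\<delta> k)) * (sqrt (s X X) + e k)) \<longlonglongrightarrow> \<rho> * (G * 0) + 0 * (sqrt (s X X) + 0)"
      by (intro tendsto_intros e lim_\<delta>)
    moreover have "(\<lambda>k. \<rho> * s (\<gamma> (u (r k))) X) \<longlonglongrightarrow> \<rho> * s (\<gamma> u') X" by (intro tendsto_intros lim_\<gamma>)
    ultimately have "\<rho> * s (\<gamma> u') X \<le> \<rho> * (G * 0) + 0 * (sqrt (s X X) + 0)"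
      using bound by (intro LIMSEQ_le[of "\<lambda>k. \<rho> * s (\<gamma> (u (r k))) X"]) auto
    then have "\<rho> * s (\<gamma> u') X \<le> 0" by simp
    then show ?thesis using \<rho> unfolding X_def by (simp add: mult_le_0_iff)
  qed
  have "saddle_point u' p' l'" unfolding saddle_point_def using r2(2) r3(2) l' eq1 eq2 eq3 by blast
  then show ?thesis using r lim_l by blast
qed

text \<open>Subtraction of the two momentum equations. With the velocity error itself as test vector
  the pressure error disappears, since both velocities satisfy the divergence constraint.\<close>

lemma saddle_point_error:
  assumes sp: "saddle_point u' p' l'"
  shows "v \<in> E \<Longrightarrow> a (u k - u') v + b v (p k - p') = - s (\<gamma> v) (l k - l')"
    and "a (u k - u') (u k - u') = - s (\<gamma> (u k - u')) (l k - l')"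
proof -
  have u': "u' \<in> E" "p' \<in> Q" using sp unfolding saddle_point_def by auto
  show *: "a (u k - u') v + b v (p k - p') = - s (\<gamma> v) (l k - l')" if v: "v \<in> E" for v
    using momentum[OF v, of k] sp v a_simps(2)[OF u u'(1) v v] b_simps(5)[OF v v p u'(2)] s_simps(5)
    unfolding saddle_point_def by (smt (verit))
  have d: "u k - u' \<in> E" using u u' subspaces(1) by (simp add: subspace_diff)
  have "p k - p' \<in> Q" using p u' subspaces(2) by (simp add: subspace_diff)
  then have "b (u k - u') (p k - p') = 0"
    using b_simps(2)[OF u u'(1)] incompressible sp unfolding saddle_point_def by simp
  with *[OF d] show "a (u k - u') (u k - u') = - s (\<gamma> (u k - u')) (l k - l')" by simp
qed

text \<open>A saddle multiplier is a fixed point of the projection step, and projections do not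
  expand distances; both facts are unrolled here from the two variational inequalities. In the
  unprojected step the cross term contributes -2 \<rho> a(d, d) and the quadratic term at most
  \<rho>^2 C a(d, d), which \<rho> < 2/C makes harmless.\<close>

lemma Fejer_monotone:
  assumes sp: "saddle_point u' p' l'"
  shows "s (l (Suc k) - l') (l (Suc k) - l') \<le> s (l k - l') (l k - l')"
proof -
  have u': "u' \<in> E" and l': "l' \<in> K" using sp unfolding saddle_point_def by auto
  define x y z where "x = l k - l'" and "y = \<gamma> (u k - u')" and "z = l (Suc k) - l'"
  have d: "u k - u' \<in> E" using u u' subspaces(1) by (simp add: subspace_diff)
  have "l k + \<rho> *\<^sub>R \<gamma> (u k) - l (Suc k) = x + \<rho> *\<^sub>R y - z + \<rho> *\<^sub>R \<gamma> u'"
    unfolding x_def y_def z_def gamma_diff[OF u u'] by (simp add: scaleR_diff_right)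
  moreover have "l' - l (Suc k) = (-1) *\<^sub>R z" unfolding z_def by simp
  ultimately have "s (x + \<rho> *\<^sub>R y - z + \<rho> *\<^sub>R \<gamma> u') ((-1) *\<^sub>R z) \<le> 0"
    using projection[OF l', of k] by simp
  then have 1: "s z z \<le> s (x + \<rho> *\<^sub>R y) z + \<rho> * s (\<gamma> u') z"
    unfolding s_simps(6) s_simps(1)[of _ "\<rho> *\<^sub>R \<gamma> u'"] s_simps(2) s_simps(3) by simp
  have "s (\<gamma> u') z \<le> 0" using sp l unfolding saddle_point_def z_def by blast
  then have "s z z \<le> s (x + \<rho> *\<^sub>R y) z" using 1 \<rho> by (smt (verit) mult_nonneg_nonpos)
  moreover have "2 * s (x + \<rho> *\<^sub>R y) z \<le> s (x + \<rho> *\<^sub>R y) (x + \<rho> *\<^sub>R y) + s z z"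
    using s_nonneg[of "x + \<rho> *\<^sub>R y - z"] s_sym[of z "x + \<rho> *\<^sub>R y"] unfolding s_simps(2,5) by simp
  ultimately have "s z z \<le> s (x + \<rho> *\<^sub>R y) (x + \<rho> *\<^sub>R y)" by simp
  also have "\<dots> = s x x + 2 * \<rho> * s y x + \<rho>\<^sup>2 * s y y"
    using s_sym[of x y] unfolding s_simps(1,3,4,6) by (simp add: power2_eq_square algebra_simps)
  also have "\<dots> \<le> s x x"
  proof -
    have ayx: "s y x = - a (u k - u') (u k - u')"
      unfolding x_def y_def using saddle_point_error(2)[OF sp, of k] by simp
    have "\<rho>\<^sup>2 * s y y \<le> \<rho>\<^sup>2 * (C * a (u k - u') (u k - u'))"
      unfolding y_def using trace[OF d] by (intro mult_left_mono) auto
    also have "\<dots> = \<rho> * (\<rho> * C) * a (u k - u') (u k - u')" by (simp add: power2_eq_square)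
    also have "\<dots> \<le> \<rho> * 2 * a (u k - u') (u k - u')"
      using \<rho> C_pos a_nonneg[OF d] by (intro mult_right_mono mult_left_mono) (auto simp: field_simps)
    finally show ?thesis using ayx by simp
  qed
  finally show ?thesis unfolding x_def z_def .
qed

text \<open>Distances to l' decrease and tend to 0 along a subsequence, hence tend to 0. The error
  equation then controls velocities by multipliers, and pressures by both. Quantification over all
  seminorms leaves the choice of norms to the application.\<close>

theorem uzawa_converges:
  "\<exists>u' p' l'. saddle_point u' p' l' \<and>
     (\<forall>N. seminorm_on E N \<longrightarrow> (\<lambda>k. N (u k - u')) \<longlonglongrightarrow> 0) \<and>
     (\<forall>N. seminorm_on Q N \<longrightarrow> (\<lambda>k. N (p k - p')) \<longlonglongrightarrow> 0) \<and>
     (\<lambda>k. sqrt (s (l k - l') (l k - l'))) \<longlonglongrightarrow> 0"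
proof -
  obtain r u' p' l' where r: "strict_mono r" "saddle_point u' p' l'"
    "(\<lambda>k. sqrt (s (l (r k) - l') (l (r k) - l'))) \<longlonglongrightarrow> 0"
    using subsequential_saddle_point by blast
  have u': "u' \<in> E" "p' \<in> Q" using r(2) unfolding saddle_point_def by auto
  define D where "D k = sqrt (s (l k - l') (l k - l'))" for k
  have "decseq D" unfolding D_def decseq_Suc_iff using Fejer_monotone[OF r(2)] by simp
  moreover have "0 \<le> D k" for k unfolding D_def using s_nonneg by simp
  ultimately obtain c where c: "D \<longlonglongrightarrow> c" using decseq_convergent[of D 0] by blast
  have "(D \<circ> r) \<longlonglongrightarrow> 0" using r(3) unfolding D_def o_def .
  then have lim_l: "D \<longlonglongrightarrow> 0" using LIMSEQ_subseq_LIMSEQ[OF c r(1)] c LIMSEQ_unique by blast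
  have d: "u k - u' \<in> E" "p k - p' \<in> Q" for k
    using u p u' subspaces(1,2) by (auto simp: subspace_diff)
  have bound_u: "sqrt (a (u k - u') (u k - u')) \<le> sqrt C * D k" for k
    using a_bounded_by_multiplier[OF d(1) saddle_point_error(2)[OF r(2)]]
    unfolding D_def real_sqrt_mult[symmetric] by simp
  have lim_u: "(\<lambda>k. sqrt (a (u k - u') (u k - u'))) \<longlonglongrightarrow> 0"
    by (rule squeeze_to_0[OF _ bound_u tendsto_mult_right_zero[OF lim_l]]) (simp add: a_nonneg[OF d(1)])
  obtain B where B: "finite B" "B \<subseteq> E" "\<And>q. q_norm q = (\<Sum>v\<in>B. \<bar>b v q\<bar>)"
    using q_norm_basis by metis
  have lim_p: "(\<lambda>k. q_norm (p k - p')) \<longlonglongrightarrow> 0"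
    unfolding B(3)
  proof (rule tendsto_null_sum)
    fix v assume "v \<in> B"
    then have v: "v \<in> E" using B(2) by blast
    have bound: "\<bar>b v (p k - p')\<bar> \<le> sqrt (s (\<gamma> v) (\<gamma> v)) * D k + sqrt (a (u k - u') (u k - u')) * sqrt (a v v)" for k
      using saddle_point_error(1)[OF r(2) v, of k] s_Cauchy_Schwarz[of "\<gamma> v" "l k - l'"]
        bilinear_Cauchy_Schwarz[OF a_bilinear subspaces(1) a_sym a_nonneg d(1) v, of k]
      unfolding D_def by linarith
    have "(\<lambda>k. sqrt (s (\<gamma> v) (\<gamma> v)) * D k + sqrt (a (u k - u') (u k - u')) * sqrt (a v v))
        \<longlonglongrightarrow> sqrt (s (\<gamma> v) (\<gamma> v)) * 0 + 0 * sqrt (a v v)"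
      by (intro tendsto_intros lim_l lim_u)
    then have "(\<lambda>k. sqrt (s (\<gamma> v) (\<gamma> v)) * D k + sqrt (a (u k - u') (u k - u')) * sqrt (a v v)) \<longlonglongrightarrow> 0"
      by (simp only: mult_zero_left mult_zero_right add_0_right)
    from squeeze_to_0[OF abs_ge_zero bound this] show "(\<lambda>k. \<bar>b v (p k - p')\<bar>) \<longlonglongrightarrow> 0" .
  qed
  have "(\<lambda>k. N (u k - u')) \<longlonglongrightarrow> 0" if "seminorm_on E N" for N
    using fin_dim_seminorm_tendsto[OF E seminorm_a _ that d(1) lim_u] a_definite by auto
  moreover have "(\<lambda>k. N (p k - p')) \<longlonglongrightarrow> 0" if "seminorm_on Q N" for N
    using fin_dim_seminorm_tendsto[OF Q seminorm_q _ that d(2) lim_p] q_norm_definite by auto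
  ultimately show ?thesis using r(2) lim_l unfolding D_def by blast
qed

end

end

text \<open>The nearest point is compared with points of the segment towards \<mu>, which convexity
  keeps in \<open>K\<close>; the squared distance along it is a quadratic polynomial in t.\<close>

lemma nearest_point_variational:
  assumes s: "bilinear_on UNIV UNIV s" and sym: "\<And>x y. s x y = s y x"
    and "convex K" "\<eta> \<in> K" "\<mu> \<in> K"
    and min: "\<And>\<xi>. \<xi> \<in> K \<Longrightarrow> s (w - \<eta>) (w - \<eta>) \<le> s (w - \<xi>) (w - \<xi>)"
  shows "s (w - \<eta>) (\<mu> - \<eta>) \<le> (0::real)"
proof (rule ccontr)
  note s_simps = bilinear_onD[OF s subspace_UNIV subspace_UNIV UNIV_I UNIV_I UNIV_I UNIV_I]
  define X Y where "X = w - \<eta>" and "Y = \<mu> - \<eta>"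
  assume "\<not> ?thesis"
  then have pos: "s X Y > 0" unfolding X_def Y_def by simp
  have *: "2 * t * s X Y \<le> t\<^sup>2 * s Y Y" if "0 \<le> t" "t \<le> 1" for t
  proof -
    have "\<eta> + t *\<^sub>R Y = (1 - t) *\<^sub>R \<eta> + t *\<^sub>R \<mu>" unfolding Y_def by (simp add: algebra_simps)
    then have "\<eta> + t *\<^sub>R Y \<in> K" using convexD_alt[OF assms(3-5) that] by simp
    from min[OF this] have "s X X \<le> s (X - t *\<^sub>R Y) (X - t *\<^sub>R Y)" unfolding X_def by (simp add: algebra_simps)
    also have "\<dots> = s X X - 2 * t * s X Y + t\<^sup>2 * s Y Y"
      using sym[of Y X] unfolding s_simps(2,3,5,6) by (simp add: power2_eq_square algebra_simps)
    finally show ?thesis by simp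
  qed
  have "2 * s X Y \<le> s Y Y" using *[of 1] by simp
  then have Ypos: "s Y Y > 0" using pos by simp
  \<comment> \<open>The minimiser of the quadratic; it does not exceed 1 by the comparison already
    made at t = 1.\<close>
  define t where "t = s X Y / s Y Y"
  have t: "0 < t" "t \<le> 1" unfolding t_def using pos Ypos \<open>2 * s X Y \<le> s Y Y\<close> by auto
  have "2 * t * s X Y \<le> t * (t * s Y Y)" using *[of t] t by (simp add: power2_eq_square)
  moreover have "t * s Y Y = s X Y" unfolding t_def using Ypos by simp
  ultimately have "t * s X Y \<le> 0" by simp
  then show False using t(1) pos by (simp add: mult_le_0_iff)
qed

section \<open>Weak derivatives are unique\<close>

text \<open>The factor \<open>1 / t ^ k\<close> makes this family closed under differentiation.\<close>

definition bump :: "nat \<Rightarrow> real \<Rightarrow> real" where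
  "bump k t = (if 0 < t then exp (- (1 / t)) / t ^ k else 0)"

text \<open>With y = 1/t this is y^k e^(-y) \<le> k^k, the k-th power of y/k \<le> exp
  (y/k).\<close>

lemma bump_le:
  assumes "0 < t" "0 < k"
  shows "bump k t \<le> real k ^ k"
proof -
  define y where "y = 1 / t"
  have y: "y > 0" "t = 1 / y" unfolding y_def using assms by auto
  have "(y / real k) ^ k \<le> exp (y / real k) ^ k"
    using y exp_ge_add_one_self[of "y / real k"] by (intro power_mono) (linarith, simp)
  also have "\<dots> = exp y" using assms by (simp add: exp_of_nat_mult[symmetric])
  finally have "y ^ k \<le> real k ^ k * exp y"
    using assms by (simp add: power_divide pos_divide_le_eq mult.commute)
  then have "y ^ k * exp (- y) \<le> real k ^ k" by (simp add: exp_minus field_simps)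
  moreover have "bump k t = y ^ k * exp (- y)"
    unfolding bump_def y(2) using y(1) by (simp add: power_divide field_simps)
  ultimately show ?thesis by simp
qed

text \<open>At the origin the difference quotient is h times \<open>bump (k + 2) h\<close> for
  positive h, and \<open>bump_le\<close> bounds the second factor; to the right of the origin the
  product rule applies.\<close>

lemma bump_has_derivative:
  "(bump k has_real_derivative bump (k + 2) t - real k * bump (k + 1) t) (at t)"
proof (cases t "0::real" rule: linorder_cases)
  case less
  have "eventually (\<lambda>s. s < 0) (nhds t)" using less eventually_nhds_in_open[of "{..<0}" t] by simp
  then have "eventually (\<lambda>s. bump k s = 0) (nhds t)" by eventually_elim (simp add: bump_def)
  then have "(bump k has_real_derivative 0) (at t) = ((\<lambda>s. 0) has_real_derivative 0) (at t)"
    by (intro DERIV_cong_ev refl)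
  then show ?thesis using less by (simp add: bump_def)
next
  case equal
  define C where "C = real (k + 2) ^ (k + 2)"
  then have C: "0 \<le> C" by simp
  have "((\<lambda>h. bump k h / h) \<longlongrightarrow> 0) (at 0)"
  proof (rule Lim_null_comparison)
    show "\<forall>\<^sub>F h in at 0. norm (bump k h / h) \<le> C * \<bar>h\<bar>"
    proof (rule always_eventually, rule allI)
      fix h :: real
      show "norm (bump k h / h) \<le> C * \<bar>h\<bar>"
      proof (cases "0 < h")
        case True
        have "bump k h / h = bump (k + 2) h * h" unfolding bump_def using True by (simp add: power_add field_simps power2_eq_square)
        moreover have "0 \<le> bump (k + 2) h" unfolding bump_def by simp
        ultimately show ?thesis using bump_le[OF True, of "k + 2"] True unfolding C_def
          by (simp add: abs_mult mult_right_mono)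
      qed (use C in \<open>simp add: bump_def mult_nonneg_nonpos\<close>)
    qed
    have "((\<lambda>h. C * \<bar>h\<bar>) \<longlongrightarrow> C * \<bar>0\<bar>) (at 0)" by (intro tendsto_intros)
    then show "((\<lambda>h. C * \<bar>h\<bar>) \<longlongrightarrow> 0) (at 0)" by simp
  qed
  then show ?thesis using equal by (simp add: has_field_derivative_iff bump_def)
next
  case greater
  have eq: "bump k s = exp (- inverse s) * inverse s ^ k" if "0 < s" for k s
    using that by (simp add: bump_def divide_inverse power_inverse)
  have D: "((\<lambda>s. exp (- inverse s) * inverse s ^ k) has_real_derivative bump (k + 2) t - real k * bump (k + 1) t) (at t)"
  proof -
    have "((\<lambda>s. exp (- inverse s) * inverse s ^ k) has_real_derivative
      exp (- inverse t) * (inverse t)\<^sup>2 * inverse t ^ k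
        - exp (- inverse t) * (real k * inverse t ^ (k - 1) * (inverse t)\<^sup>2)) (at t)"
      using greater by (auto intro!: derivative_eq_intros simp: power2_eq_square algebra_simps)
    moreover have "real k * inverse t ^ (k - 1) * (inverse t)\<^sup>2 = real k * inverse t ^ (k + 1)"
      by (cases k) (simp_all add: power2_eq_square)
    moreover have "(inverse t)\<^sup>2 * inverse t ^ k = inverse t ^ (k + 2)"
      by (simp add: power_add mult.commute power2_eq_square)
    moreover have "bump (k + 2) t - real k * bump (k + 1) t =
        exp (- inverse t) * inverse t ^ (k + 2) - exp (- inverse t) * (real k * inverse t ^ (k + 1))"
      unfolding eq[OF greater] by simp
    ultimately show ?thesis by (simp only: mult.assoc)
  qed
  have "eventually (\<lambda>s. 0 < s) (nhds t)" using greater eventually_nhds_in_open[of "{0<..}" t] by simp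
  then have "eventually (\<lambda>s. bump k s = exp (- inverse s) * inverse s ^ k) (nhds t)"
    by eventually_elim (rule eq)
  from DERIV_cong_ev[OF refl this refl] D show ?thesis by blast
qed

lemma partial_deriv_eq: "(\<phi> has_derivative D) (at x) \<Longrightarrow> partial_deriv j \<phi> x = D (axis j 1)"
  unfolding partial_deriv_def by (metis frechet_derivative_at)

text \<open>A syntactic class closed under partial derivatives, so that membership alone gives
  derivatives of all orders by induction on the order. It contains the polynomials as well as the
  test functions built from \<open>bump\<close>.\<close>

inductive_set elementary :: "(real^2 \<Rightarrow> real) set" where
  const: "(\<lambda>x. c) \<in> elementary"
| coord: "(\<lambda>x. x $ i) \<in> elementary"
| add: "\<phi> \<in> elementary \<Longrightarrow> \<psi> \<in> elementary \<Longrightarrow> (\<lambda>x. \<phi> x + \<psi> x) \<in> elementary"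
| mult: "\<phi> \<in> elementary \<Longrightarrow> \<psi> \<in> elementary \<Longrightarrow> (\<lambda>x. \<phi> x * \<psi> x) \<in> elementary"
| bump: "\<phi> \<in> elementary \<Longrightarrow> (\<lambda>x. bump k (\<phi> x)) \<in> elementary"

lemma differentiable_has_derivative:
  "\<phi> differentiable (at x) \<Longrightarrow> (\<phi> has_derivative frechet_derivative \<phi> (at x)) (at x)"
  by (simp add: frechet_derivative_works)

lemma elementary_differentiable:
  assumes "\<phi> \<in> elementary"
  shows "(\<forall>x. \<phi> differentiable (at x)) \<and> (\<forall>j. partial_deriv j \<phi> \<in> elementary)"
  using assms
proof induction
  case (const c)
  have "partial_deriv j (\<lambda>x. c) = (\<lambda>x. 0)" for j
    by (rule ext, subst partial_deriv_eq[OF has_derivative_const]) simp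
  then show ?case by (simp add: elementary.const)
next
  case (coord i)
  have D: "((\<lambda>x::real^2. x $ i) has_derivative (\<lambda>x. x $ i)) (at x)" for x
    by (rule bounded_linear_imp_has_derivative[OF bounded_linear_vec_nth])
  have "partial_deriv j (\<lambda>x. x $ i) = (\<lambda>x. axis j 1 $ i)" for j
    by (rule ext, subst partial_deriv_eq[OF D]) simp
  then show ?case using D by (auto simp: elementary.const differentiable_def)
next
  case (add \<phi> \<psi>)
  have D: "((\<lambda>x. \<phi> x + \<psi> x) has_derivative
     (\<lambda>h. frechet_derivative \<phi> (at x) h + frechet_derivative \<psi> (at x) h)) (at x)" for x
    using add by (intro has_derivative_add differentiable_has_derivative) auto
  have "partial_deriv j (\<lambda>x. \<phi> x + \<psi> x) = (\<lambda>x. partial_deriv j \<phi> x + partial_deriv j \<psi> x)" for j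
    by (rule ext, subst partial_deriv_eq[OF D]) (simp add: partial_deriv_def)
  then show ?case using D add by (auto simp: differentiable_def intro: elementary.add)
next
  case (mult \<phi> \<psi>)
  have D: "((\<lambda>x. \<phi> x * \<psi> x) has_derivative
     (\<lambda>h. \<phi> x * frechet_derivative \<psi> (at x) h + frechet_derivative \<phi> (at x) h * \<psi> x)) (at x)" for x
    using mult by (intro has_derivative_mult differentiable_has_derivative) auto
  have "partial_deriv j (\<lambda>x. \<phi> x * \<psi> x) = (\<lambda>x. \<phi> x * partial_deriv j \<psi> x + partial_deriv j \<phi> x * \<psi> x)" for j
    by (rule ext, subst partial_deriv_eq[OF D]) (simp add: partial_deriv_def)
  then show ?case using D mult by (auto simp: differentiable_def intro!: elementary.add elementary.mult)
next
  case (bump \<phi> k)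
  define b where "b t = bump (k + 2) t + (- real k) * bump (k + 1) t" for t
  have b: "(bump k has_derivative (\<lambda>h. b t * h)) (at t)" for t
    using bump_has_derivative[of k t] unfolding has_field_derivative_def b_def by simp
  have D: "((\<lambda>x. bump k (\<phi> x)) has_derivative (\<lambda>h. b (\<phi> x) * frechet_derivative \<phi> (at x) h)) (at x)" for x
    using bump by (intro has_derivative_compose[OF differentiable_has_derivative b]) auto
  have "partial_deriv j (\<lambda>x. bump k (\<phi> x)) = (\<lambda>x. b (\<phi> x) * partial_deriv j \<phi> x)" for j
    by (rule ext, subst partial_deriv_eq[OF D]) (simp add: partial_deriv_def)
  moreover have "(\<lambda>x. b (\<phi> x)) \<in> elementary"
    unfolding b_def using bump by (intro elementary.intros) auto
  ultimately show ?case using D bump by (auto simp: differentiable_def intro!: elementary.mult)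
qed

lemma elementary_C_diff: "\<phi> \<in> elementary \<Longrightarrow> C_diff k \<phi>"
proof (induction k arbitrary: \<phi>)
  case 0
  then show ?case using elementary_differentiable
    by (auto intro!: continuous_at_imp_continuous_on differentiable_imp_continuous_within)
qed (use elementary_differentiable in auto)

text \<open>Each factor is exp (-1/(k s)) where s, the product of the signed distances to two
  opposite faces, is positive, and 0 elsewhere. As k grows the exponent tends to 0, so the functions
  converge to the indicator of the open box while staying between 0 and 1.\<close>

definition box_bump :: "real^2 \<Rightarrow> real^2 \<Rightarrow> nat \<Rightarrow> real^2 \<Rightarrow> real" where
  "box_bump a b k x = bump 0 (real k * ((x $ 1 - a $ 1) * (b $ 1 - x $ 1))) *
     bump 0 (real k * ((x $ 2 - a $ 2) * (b $ 2 - x $ 2)))"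

lemma box_bump_elementary: "box_bump a b k \<in> elementary"
proof -
  have "(\<lambda>x. bump 0 (real k * ((x $ i + (- a $ i)) * (b $ i + (- 1) * x $ i)))) \<in> elementary" for i
    by (intro elementary.intros)
  from elementary.mult[OF this[of 1] this[of 2]] show ?thesis
    unfolding box_bump_def[abs_def] by simp
qed

lemma product_pos_iff:
  fixes a b t :: real
  assumes "a < b"
  shows "0 < (t - a) * (b - t) \<longleftrightarrow> a < t \<and> t < b"
  using assms by (auto simp: zero_less_mult_iff)

lemma mem_box_2: "x \<in> box a b \<longleftrightarrow> a $ 1 < x $ 1 \<and> x $ 1 < b $ 1 \<and> a $ 2 < x $ 2 \<and> x $ 2 < (b::real^2) $ 2"
  by (auto simp: mem_box_cart forall_2)

lemma bump_0_bounds: "0 \<le> bump 0 t" "bump 0 t \<le> 1"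
  unfolding bump_def by auto

lemma box_bump_bounds: "0 \<le> box_bump a b k x" "box_bump a b k x \<le> 1"
  unfolding box_bump_def using bump_0_bounds by (auto intro: mult_le_one)

lemma box_bump_outside:
  assumes "a $ 1 < b $ 1" "a $ 2 < b $ 2" "x \<notin> box a b"
  shows "box_bump a b k x = 0"
proof -
  have zero: "bump 0 (real k * s) = 0" if "\<not> 0 < s" for s
    using that unfolding bump_def by (simp add: zero_less_mult_iff)
  have "\<not> 0 < (x $ 1 - a $ 1) * (b $ 1 - x $ 1) \<or> \<not> 0 < (x $ 2 - a $ 2) * (b $ 2 - x $ 2)"
    using assms(3) unfolding mem_box_2 product_pos_iff[OF assms(1)] product_pos_iff[OF assms(2)] by blast
  then show ?thesis unfolding box_bump_def by (metis zero mult_zero_left mult_zero_right)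
qed

lemma bump_tendsto_1:
  assumes "0 < s"
  shows "(\<lambda>k. bump 0 (real k * s)) \<longlonglongrightarrow> 1"
proof -
  have "(\<lambda>k. exp (- (inverse (real (Suc k)) * (1 / s)))) \<longlonglongrightarrow> exp (- (0 * (1 / s)))"
    by (intro tendsto_intros LIMSEQ_inverse_real_of_nat)
  moreover have "bump 0 (real (Suc k) * s) = exp (- (inverse (real (Suc k)) * (1 / s)))" for k
  proof -
    have "0 < real (Suc k) * s" using assms by (intro mult_pos_pos) auto
    then show ?thesis unfolding bump_def by (simp add: inverse_eq_divide del: of_nat_Suc)
  qed
  ultimately have "(\<lambda>k. bump 0 (real (Suc k) * s)) \<longlonglongrightarrow> 1" by simp
  then show ?thesis by (rule LIMSEQ_imp_Suc)
qed

lemma box_bump_tendsto: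
  assumes "a $ 1 < b $ 1" "a $ 2 < b $ 2"
  shows "(\<lambda>k. box_bump a b k x) \<longlonglongrightarrow> indicator (box a b) x"
proof (cases "x \<in> box a b")
  case True
  then have "0 < (x $ 1 - a $ 1) * (b $ 1 - x $ 1)" "0 < (x $ 2 - a $ 2) * (b $ 2 - x $ 2)"
    unfolding mem_box_2 by auto
  from tendsto_mult[OF this[THEN bump_tendsto_1]] show ?thesis using True unfolding box_bump_def by simp
qed (use box_bump_outside[OF assms] in simp)

lemma box_bump_test_function:
  assumes "a $ 1 < b $ 1" "a $ 2 < b $ 2" "cbox a b \<subseteq> \<Omega>"
  shows "test_function \<Omega> (box_bump a b k)"
proof -
  have "{x. box_bump a b k x \<noteq> 0} \<subseteq> box a b" using box_bump_outside[OF assms(1,2)] by blast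
  then have "closure {x. box_bump a b k x \<noteq> 0} \<subseteq> cbox a b"
    using box_subset_cbox by (intro closure_minimal closed_cbox) blast
  moreover from this have "compact (closure {x. box_bump a b k x \<noteq> 0})"
    using bounded_subset[OF bounded_cbox] by (simp add: compact_eq_bounded_closed)
  ultimately show ?thesis
    unfolding test_function_def using elementary_C_diff[OF box_bump_elementary] assms(3) by blast
qed

section \<open>From vanishing against test functions to vanishing almost everywhere\<close>

lemma integral_lebesgue_on:
  fixes f :: "'a::euclidean_space \<Rightarrow> real"
  assumes "open \<Omega>"
  shows "(LINT x|lebesgue_on \<Omega>. f x) = (LINT x|lebesgue. indicator \<Omega> x * f x)"
    and "integrable (lebesgue_on \<Omega>) f \<longleftrightarrow> integrable lebesgue (\<lambda>x. indicator \<Omega> x * f x)"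
  using assms by (simp_all add: integral_restrict_space integrable_restrict_space)

text \<open>Dominated convergence along \<open>box_bump\<close>, whose limit is the indicator of the
  open box; the faces of the box have measure zero.\<close>

lemma integral_cbox_zero_of_test_functions:
  assumes \<Omega>: "open \<Omega>" and g: "g absolutely_integrable_on cbox a b" and sub: "cbox a b \<subseteq> \<Omega>"
    and ab: "a $ 1 < b $ 1" "a $ 2 < b $ 2"
    and test: "\<And>\<phi>. test_function \<Omega> \<phi> \<Longrightarrow> (LINT x|lebesgue_on \<Omega>. g x * \<phi> x) = 0"
  shows "integral (cbox a b) g = 0"
proof -
  define G where "G x = indicator (cbox a b) x * g x" for x
  have G: "integrable lebesgue G" using g unfolding set_integrable_def G_def by simp
  have meas: "box_bump a b k \<in> borel_measurable lebesgue" for k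
  proof -
    have "continuous_on UNIV (box_bump a b k)"
      using elementary_C_diff[OF box_bump_elementary, of 0] by simp
    then have "box_bump a b k \<in> borel_measurable lborel"
      by (simp add: borel_measurable_continuous_onI)
    then show ?thesis by (rule measurable_completion)
  qed
  have "(LINT x|lebesgue. G x * box_bump a b k x) = 0" for k
  proof -
    have "(LINT x|lebesgue. G x * box_bump a b k x) = (LINT x|lebesgue_on \<Omega>. g x * box_bump a b k x)"
      unfolding integral_lebesgue_on[OF \<Omega>]
    proof (rule Bochner_Integration.integral_cong[OF refl])
      fix x
      show "G x * box_bump a b k x = indicator \<Omega> x * (g x * box_bump a b k x)"
        using box_bump_outside[OF ab, of x k] sub box_subset_cbox[of a b]
        unfolding G_def by (cases "x \<in> box a b") (auto simp: indicator_def)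
    qed
    then show ?thesis using test[OF box_bump_test_function[OF ab sub]] by simp
  qed
  moreover have "(\<lambda>k. LINT x|lebesgue. G x * box_bump a b k x) \<longlonglongrightarrow> (LINT x|lebesgue. G x * indicator (box a b) x)"
  proof (rule integral_dominated_convergence[where w = "\<lambda>x. \<bar>G x\<bar>"])
    show "(\<lambda>x. G x * indicator (box a b) x) \<in> borel_measurable lebesgue"
      using G by (intro borel_measurable_times borel_measurable_indicator) (auto simp: borel_measurable_integrable)
    show "(\<lambda>x. G x * box_bump a b k x) \<in> borel_measurable lebesgue" for k
      using G meas by (intro borel_measurable_times) (auto simp: borel_measurable_integrable)
    show "integrable lebesgue (\<lambda>x. \<bar>G x\<bar>)" using G by simp
    show "AE x in lebesgue. (\<lambda>k. G x * box_bump a b k x) \<longlonglongrightarrow> G x * indicator (box a b) x"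
      by (intro always_eventually allI tendsto_mult_left box_bump_tendsto ab)
    show "AE x in lebesgue. norm (G x * box_bump a b k x) \<le> \<bar>G x\<bar>" for k
      using box_bump_bounds[of a b k] by (intro always_eventually allI) (simp add: abs_mult mult_left_le)
  qed
  ultimately have "(LINT x|lebesgue. G x * indicator (box a b) x) = 0"
    using LIMSEQ_unique[OF tendsto_const] by fastforce
  moreover have "G x * indicator (box a b) x = indicator (box a b) x *\<^sub>R g x" for x
    unfolding G_def using box_subset_cbox[of a b] by (auto simp: indicator_def)
  ultimately have "(LINT x:box a b|lebesgue. g x) = 0" by (simp add: set_lebesgue_integral_def)
  moreover have "g absolutely_integrable_on box a b"
    by (rule set_integrable_subset[OF g _ box_subset_cbox]) simp
  ultimately have "integral (box a b) g = 0" by (simp only: set_lebesgue_integral_eq_integral(2))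
  then show ?thesis by (simp add: integral_open_interval)
qed

text \<open>The fundamental lemma of the calculus of variations. Integrals over all boxes inside the
  domain vanish, and Lebesgue differentiation recovers the value of g at almost every point from
  averages over cubes with that point as lower corner. Countably many boxes cover the
  domain.\<close>

lemma AE_zero_of_test_functions:
  assumes \<Omega>: "open \<Omega>" and g: "\<And>C. compact C \<Longrightarrow> C \<subseteq> \<Omega> \<Longrightarrow> g absolutely_integrable_on C"
    and test: "\<And>\<phi>. test_function \<Omega> \<phi> \<Longrightarrow> (LINT x|lebesgue_on \<Omega>. g x * \<phi> x) = 0"
  shows "AE x in lebesgue_on \<Omega>. g x = 0"
proof -
  have local: "negligible {x \<in> cbox a b. g x \<noteq> 0}" if sub: "cbox a b \<subseteq> \<Omega>" for a b
  proof -
    define F where "F = (\<lambda>x. if x \<in> cbox a b then g x else 0)"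
    have "F integrable_on cbox c d" for c d
    proof -
      have "F integrable_on UNIV"
        unfolding F_def
        by (subst integrable_restrict_UNIV) (rule set_lebesgue_integral_eq_integral(1)[OF g[OF compact_cbox sub]])
      then show ?thesis by (rule integrable_on_subcbox) simp
    qed
    then obtain N where N: "negligible N" "\<And>x e. x \<notin> N \<Longrightarrow> 0 < e \<Longrightarrow>
        \<exists>d>0. \<forall>h. 0 < h \<and> h < d \<longrightarrow> norm (integral (cbox x (x + h *\<^sub>R One)) F /\<^sub>R h ^ DIM(real^2) - F x) < e"
      using integrable_ccontinuous_explicit by blast
    have "g x = 0" if x: "x \<in> box a b" "x \<notin> N" for x
    proof (rule ccontr)
      assume "g x \<noteq> 0"
      then have Fx: "norm (F x) > 0" using x(1) box_subset_cbox unfolding F_def by auto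
      obtain d where d: "d > 0" "\<And>h. 0 < h \<Longrightarrow> h < d \<Longrightarrow>
          norm (integral (cbox x (x + h *\<^sub>R One)) F /\<^sub>R h ^ DIM(real^2) - F x) < norm (F x)"
        using N(2)[OF x(2) Fx] by blast
      \<comment> \<open>Below d for the differentiation theorem, and small enough for the cube to
        stay inside \<open>cbox a b\<close>.\<close>
      define h where "h = min (d / 2) (min (b $ 1 - x $ 1) (b $ 2 - x $ 2) / 2)"
      have h: "0 < h" "h < d" "h < b $ 1 - x $ 1" "h < b $ 2 - x $ 2"
        using d x(1) unfolding mem_box_2 h_def by (auto simp: min_def)
      have One: "(One :: real^2) $ i = 1" for i
      proof -
        have "axis i 1 \<in> (Basis :: (real^2) set)" by simp
        from inner_sum_left_Basis[OF this, of "\<lambda>_. 1"] show ?thesis by (simp add: cart_eq_inner_axis)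
      qed
      then have corner: "(x + h *\<^sub>R One) $ i = x $ i + h" for i
        by (simp only: vector_add_component vector_scaleR_component real_scaleR_def mult_1_right)
      have small: "cbox x (x + h *\<^sub>R One) \<subseteq> cbox a b"
      proof
        fix y assume "y \<in> cbox x (x + h *\<^sub>R One)"
        then have "\<forall>i. x $ i \<le> y $ i \<and> y $ i \<le> x $ i + h"
          unfolding mem_box_cart corner .
        then have "x $ 1 \<le> y $ 1" "x $ 2 \<le> y $ 2" "y $ 1 \<le> x $ 1 + h" "y $ 2 \<le> x $ 2 + h"
          by auto
        moreover have "a $ 1 < x $ 1" "a $ 2 < x $ 2" using x(1) unfolding mem_box_2 by auto
        ultimately show "y \<in> cbox a b"
          using h(3,4) unfolding mem_box_cart forall_2 by linarith
      qed
      then have sub': "cbox x (x + h *\<^sub>R One) \<subseteq> \<Omega>" using sub by blast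
      have "integral (cbox x (x + h *\<^sub>R One)) g = 0"
        by (rule integral_cbox_zero_of_test_functions[OF \<Omega> g[OF compact_cbox sub'] sub' _ _ test])
           (simp_all only: corner less_add_same_cancel1 h(1))
      moreover have "integral (cbox x (x + h *\<^sub>R One)) F = integral (cbox x (x + h *\<^sub>R One)) g"
      proof (rule Henstock_Kurzweil_Integration.integral_cong)
        fix y assume "y \<in> cbox x (x + h *\<^sub>R One)"
        then have "y \<in> cbox a b" using small by blast
        then show "F y = g y" unfolding F_def by (rule if_P)
      qed
      ultimately have "integral (cbox x (x + h *\<^sub>R One)) F = 0" by (simp only:)
      with d(2)[OF h(1,2)] have "norm (0 /\<^sub>R h ^ DIM(real^2) - F x) < norm (F x)" by (simp only:)
      then show False by simp
    qed
    then have "{x \<in> cbox a b. g x \<noteq> 0} \<subseteq> N \<union> (cbox a b - box a b)" by blast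
    then show ?thesis using negligible_subset[OF negligible_Un[OF N(1) negligible_frontier_interval]] by blast
  qed
  obtain \<D> where \<D>: "countable \<D>" "\<D> \<subseteq> Pow \<Omega>" "\<And>X. X \<in> \<D> \<Longrightarrow> \<exists>a b. X = cbox a b" "\<Union>\<D> = \<Omega>"
    using open_countable_Union_open_cbox[OF \<Omega>] by (metis (no_types, lifting))
  have "{x \<in> \<Omega>. g x \<noteq> 0} = (\<Union>X\<in>\<D>. {x \<in> X. g x \<noteq> 0})" using \<D>(4) by blast
  moreover have "negligible (\<Union>X\<in>\<D>. {x \<in> X. g x \<noteq> 0})"
  proof (rule negligible_countable_Union)
    fix Y assume "Y \<in> (\<lambda>X. {x \<in> X. g x \<noteq> 0}) ` \<D>"
    then obtain X where X: "X \<in> \<D>" "Y = {x \<in> X. g x \<noteq> 0}" by blast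
    obtain a b where ab: "X = cbox a b" using \<D>(3)[OF X(1)] by auto
    have "X \<subseteq> \<Omega>" using X(1) \<D>(2) by auto
    then show "negligible Y" unfolding X(2) ab by (rule local)
  qed (use \<D>(1) in simp)
  ultimately have "negligible {x \<in> \<Omega>. g x \<noteq> 0}" by simp
  then have null: "{x \<in> \<Omega>. g x \<noteq> 0} \<in> null_sets lebesgue" by (simp only: negligible_iff_null_sets)
  have "AE x in lebesgue. x \<in> \<Omega> \<longrightarrow> g x = 0" by (rule AE_I'[OF null]) blast
  then show ?thesis using \<Omega> by (simp add: AE_restrict_space_iff)
qed

section \<open>Bounded measurable functions\<close>

text \<open>Closed under sums and products and, on a bounded open set, contained in the integrable
  functions, so products in the forms need no separate integrability argument. The bound is required
  almost everywhere only, since a weak derivative chosen by \<open>SOME\<close> is arbitrary on null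
  sets.\<close>

definition bounded_meas :: "(real^2) set \<Rightarrow> (real^2 \<Rightarrow> real) \<Rightarrow> bool" where
  "bounded_meas \<Omega> f \<longleftrightarrow> f \<in> borel_measurable (lebesgue_on \<Omega>) \<and> (\<exists>M. AE x in lebesgue_on \<Omega>. \<bar>f x\<bar> \<le> M)"

lemma bounded_meas_const: "bounded_meas \<Omega> (\<lambda>x. c)"
  unfolding bounded_meas_def by auto

lemma bounded_meas_add:
  assumes "bounded_meas \<Omega> f" "bounded_meas \<Omega> g"
  shows "bounded_meas \<Omega> (\<lambda>x. f x + g x)"
proof -
  obtain M M' where "AE x in lebesgue_on \<Omega>. \<bar>f x\<bar> \<le> M" "AE x in lebesgue_on \<Omega>. \<bar>g x\<bar> \<le> M'"
    using assms unfolding bounded_meas_def by blast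
  then have "AE x in lebesgue_on \<Omega>. \<bar>f x + g x\<bar> \<le> M + M'" by eventually_elim linarith
  then show ?thesis using assms unfolding bounded_meas_def by auto
qed

lemma bounded_meas_mult:
  assumes "bounded_meas \<Omega> f" "bounded_meas \<Omega> g"
  shows "bounded_meas \<Omega> (\<lambda>x. f x * g x)"
proof -
  obtain M M' where "AE x in lebesgue_on \<Omega>. \<bar>f x\<bar> \<le> M" "AE x in lebesgue_on \<Omega>. \<bar>g x\<bar> \<le> M'"
    using assms unfolding bounded_meas_def by blast
  then have "AE x in lebesgue_on \<Omega>. \<bar>f x * g x\<bar> \<le> \<bar>M\<bar> * \<bar>M'\<bar>"
    by eventually_elim (auto simp: abs_mult intro!: mult_mono)
  then show ?thesis using assms unfolding bounded_meas_def by auto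
qed

lemma bounded_meas_cmult: "bounded_meas \<Omega> f \<Longrightarrow> bounded_meas \<Omega> (\<lambda>x. c * f x)"
  by (intro bounded_meas_mult bounded_meas_const)

lemma bounded_meas_sum: "(\<And>i. i \<in> I \<Longrightarrow> bounded_meas \<Omega> (f i)) \<Longrightarrow> bounded_meas \<Omega> (\<lambda>x. \<Sum>i\<in>I. f i x)"
proof (induction I rule: infinite_finite_induct)
  case (insert i I)
  then show ?case using bounded_meas_add[of \<Omega> "f i" "\<lambda>x. \<Sum>i\<in>I. f i x"] by simp
qed (auto intro: bounded_meas_const)

lemma lebesgue_on_borel_measurable_iff:
  fixes f :: "'a::euclidean_space \<Rightarrow> real"
  assumes "open \<Omega>"
  shows "f \<in> borel_measurable (lebesgue_on \<Omega>) \<longleftrightarrow> (\<lambda>x. indicator \<Omega> x * f x) \<in> borel_measurable lebesgue"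
  using assms borel_measurable_restrict_space_iff[of \<Omega> lebesgue f] by simp

lemma bounded_meas_AE:
  assumes \<Omega>: "open \<Omega>" and f: "bounded_meas \<Omega> f" and eq: "AE x in lebesgue_on \<Omega>. f x = g x"
  shows "bounded_meas \<Omega> g"
proof -
  have "AE x in lebesgue. x \<in> \<Omega> \<longrightarrow> f x = g x" using eq \<Omega> by (simp add: AE_restrict_space_iff)
  then have "AE x in lebesgue. indicator \<Omega> x * f x = indicator \<Omega> x * g x"
    by eventually_elim (auto simp: indicator_def)
  moreover have "(\<lambda>x. indicator \<Omega> x * f x) \<in> borel_measurable lebesgue"
    using f unfolding bounded_meas_def lebesgue_on_borel_measurable_iff[OF \<Omega>] by (rule conjunct1)
  ultimately have "(\<lambda>x. indicator \<Omega> x * g x) \<in> borel_measurable lebesgue"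
    by (rule borel_measurable_AE[rotated])
  then have "g \<in> borel_measurable (lebesgue_on \<Omega>)"
    unfolding lebesgue_on_borel_measurable_iff[OF \<Omega>] .
  moreover obtain M where "AE x in lebesgue_on \<Omega>. \<bar>f x\<bar> \<le> M" using f unfolding bounded_meas_def by blast
  with eq have "AE x in lebesgue_on \<Omega>. \<bar>g x\<bar> \<le> M" by eventually_elim simp
  ultimately show ?thesis unfolding bounded_meas_def by blast
qed

lemma finite_measure_lebesgue_on:
  assumes "open \<Omega>" "bounded (\<Omega> :: (real^2) set)"
  shows "finite_measure (lebesgue_on \<Omega>)"
proof
  have "\<Omega> \<in> lmeasurable" using assms lmeasurable_open by blast
  then show "emeasure (lebesgue_on \<Omega>) (space (lebesgue_on \<Omega>)) \<noteq> \<infinity>"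
    using assms(1) by (simp add: emeasure_restrict_space space_restrict_space fmeasurable_def)
qed

lemma bounded_meas_integrable:
  assumes "open \<Omega>" "bounded \<Omega>" "bounded_meas \<Omega> f"
  shows "integrable (lebesgue_on \<Omega>) f"
proof -
  obtain M where "AE x in lebesgue_on \<Omega>. norm (f x) \<le> M"
    using assms(3) unfolding bounded_meas_def by auto
  then show ?thesis
    using finite_measure.integrable_const_bound[OF finite_measure_lebesgue_on[OF assms(1,2)]] assms(3)
    unfolding bounded_meas_def by blast
qed

lemma bounded_meas_continuous:
  assumes "open \<Omega>" "bounded \<Omega>" "continuous_on (closure \<Omega>) f"
  shows "bounded_meas \<Omega> f"
proof -
  have "continuous_on \<Omega> f" using assms(3) closure_subset continuous_on_subset by blast
  then have "(\<lambda>x. indicator \<Omega> x * f x) \<in> borel_measurable borel"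
    using borel_measurable_continuous_on_indicator[of \<Omega> f] assms(1) by simp
  then have "f \<in> borel_measurable (lebesgue_on \<Omega>)"
    unfolding lebesgue_on_borel_measurable_iff[OF assms(1)]
    by (simp add: measurable_completion)
  moreover have "compact (f ` closure \<Omega>)" using assms by (intro compact_continuous_image) auto
  then obtain M where "\<And>x. x \<in> closure \<Omega> \<Longrightarrow> \<bar>f x\<bar> \<le> M"
    using compact_imp_bounded bounded_iff by (metis imageI real_norm_def)
  then have "AE x in lebesgue_on \<Omega>. \<bar>f x\<bar> \<le> M"
    using closure_subset by (intro AE_I2) (auto simp: space_restrict_space)
  ultimately show ?thesis unfolding bounded_meas_def by blast
qed

lemma bounded_meas_on_subset:
  assumes \<Omega>: "open \<Omega>" "bounded \<Omega>" and "bounded_meas \<Omega> f" "compact C" "C \<subseteq> \<Omega>"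
  shows "f absolutely_integrable_on C"
proof -
  have "integrable (lebesgue_on \<Omega>) f" using bounded_meas_integrable assms by blast
  then have "f absolutely_integrable_on \<Omega>"
    using \<Omega> unfolding set_integrable_def by (simp add: integrable_restrict_space)
  then show ?thesis by (rule set_integrable_subset) (use assms in \<open>auto simp: lmeasurable_compact fmeasurableD\<close>)
qed

section \<open>Piecewise smooth functions on a mesh\<close>

definition directional :: "real^2 \<Rightarrow> (real^2 \<Rightarrow> real) \<Rightarrow> real^2 \<Rightarrow> real" where
  "directional d w x = (\<Sum>j\<in>UNIV. d $ j * partial_deriv j w x)"

lemma frechet_derivative_directional:
  assumes "w differentiable (at x)"
  shows "frechet_derivative w (at x) d = directional d w x"
proof -
  have lin: "linear (frechet_derivative w (at x))"
    using assms linear_frechet_derivative by blast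
  have "frechet_derivative w (at x) d = frechet_derivative w (at x) (\<Sum>j\<in>UNIV. d $ j *\<^sub>R axis j 1)"
    using basis_expansion[of d] by (simp add: scalar_mult_eq_scaleR)
  also have "\<dots> = (\<Sum>j\<in>UNIV. d $ j * frechet_derivative w (at x) (axis j 1))"
    using lin by (simp add: linear_sum linear_cmul)
  finally show ?thesis unfolding directional_def partial_deriv_def .
qed

lemma has_derivative_directional:
  "w differentiable (at x) \<Longrightarrow> (w has_derivative (\<lambda>d. directional d w x)) (at x)"
  using differentiable_has_derivative[of w x] frechet_derivative_directional[of w x]
  by (metis (no_types, lifting) ext)

lemma directional_eq: "(w has_derivative D) (at x) \<Longrightarrow> directional d w x = D d"
  by (metis differentiable_def frechet_derivative_at frechet_derivative_directional)

lemma line_has_derivative: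
  assumes "w differentiable (at (x + t *\<^sub>R d))"
  shows "((\<lambda>t. w (x + t *\<^sub>R d)) has_real_derivative directional d w (x + t *\<^sub>R d)) (at t)"
proof -
  have "((\<lambda>t. x + t *\<^sub>R d) has_derivative (\<lambda>h. h *\<^sub>R d)) (at t)" by (auto intro!: derivative_eq_intros)
  from has_derivative_compose[OF this has_derivative_directional[OF assms]]
  have "((\<lambda>t. w (x + t *\<^sub>R d)) has_derivative (\<lambda>h. directional (h *\<^sub>R d) w (x + t *\<^sub>R d))) (at t)" .
  moreover have "directional (h *\<^sub>R d) w y = directional d w y * h" for h y
    unfolding directional_def by (simp add: sum_distrib_right sum_distrib_left mult.commute mult.left_commute)
  ultimately show ?thesis unfolding has_field_derivative_def by simp
qed

text \<open>Partial derivatives are bounded on the compact set, and convexity supplies the segment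
  for the mean value inequality.\<close>

lemma C_diff_1_lipschitz:
  assumes "C_diff 1 P" "compact T" "convex T"
  shows "\<exists>L\<ge>0. \<forall>x\<in>T. \<forall>y\<in>T. \<bar>P x - P y\<bar> \<le> L * norm (x - y)"
proof -
  have diff: "\<And>x. P differentiable (at x)" and cont: "\<And>j. continuous_on UNIV (partial_deriv j P)"
    using assms(1) by auto
  have "\<exists>M. \<forall>x\<in>T. \<bar>partial_deriv j P x\<bar> \<le> M" for j
  proof -
    have "compact (partial_deriv j P ` T)"
      using assms(2) cont continuous_on_subset by (intro compact_continuous_image) blast+
    then obtain M where "\<forall>y\<in>partial_deriv j P ` T. norm y \<le> M" using compact_imp_bounded bounded_iff by blast
    then show ?thesis by auto
  qed
  then obtain M where M: "\<And>j x. x \<in> T \<Longrightarrow> \<bar>partial_deriv j P x\<bar> \<le> M j" by metis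
  define L where "L = (\<Sum>j\<in>UNIV. \<bar>M j\<bar>)"
  have "norm (P x - P y) \<le> L * norm (x - y)" if "x \<in> T" "y \<in> T" for x y
  proof (rule differentiable_bound[OF assms(3) _ _ that])
    show "(P has_derivative (\<lambda>d. directional d P x)) (at x within T)" for x
      using has_derivative_directional[OF diff] has_derivative_at_withinI by blast
    show "onorm (\<lambda>d. directional d P x) \<le> L" if "x \<in> T" for x
    proof (rule onorm_le)
      fix d :: "real^2"
      have "\<bar>directional d P x\<bar> \<le> (\<Sum>j\<in>UNIV. \<bar>d $ j * partial_deriv j P x\<bar>)"
        unfolding directional_def by (rule sum_abs)
      also have "\<dots> \<le> (\<Sum>j\<in>UNIV. norm d * \<bar>M j\<bar>)"
        unfolding abs_mult using M[OF that] component_le_norm_cart[of d]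
        by (intro sum_mono mult_mono) (auto intro: order_trans[OF _ abs_ge_self])
      finally show "norm (directional d P x) \<le> L * norm d"
        unfolding L_def by (simp add: sum_distrib_left mult.commute)
    qed
  qed
  moreover have "L \<ge> 0" unfolding L_def by (simp add: sum_nonneg)
  ultimately show ?thesis by auto
qed

text \<open>By translation invariance every difference quotient of \<open>F\<close> has integral \<open>0\<close>.\<close>

lemma integral_derivative_zero:
  fixes F D :: "real^2 \<Rightarrow> real"
  assumes lip: "\<And>x y. \<bar>F x - F y\<bar> \<le> L * norm (x - y)" and supp: "\<And>x. norm x > R \<Longrightarrow> F x = 0"
    and D: "D \<in> borel_measurable lebesgue"
    and deriv: "AE x in lebesgue. ((\<lambda>t. F (x + t *\<^sub>R d)) has_real_derivative D x) (at 0)"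
  shows "integral\<^sup>L lebesgue D = 0"
proof -
  define t where "t k = inverse (real (Suc k))" for k
  have t: "0 < t k" "t k \<le> 1" for k unfolding t_def by (auto simp: inverse_le_1_iff)
  define Q where "Q k x = (F (t k *\<^sub>R d + x) - F x) / t k" for k x
  have L: "L * norm d \<ge> 0" using lip[of d 0] abs_ge_zero order_trans by (metis diff_zero)
  have "continuous_on UNIV F"
  proof (rule lipschitz_on_continuous_on)
    show "(\<bar>L\<bar>)-lipschitz_on UNIV F"
    proof (rule lipschitz_onI)
      fix x y :: "real^2"
      have "L * norm (x - y) \<le> \<bar>L\<bar> * norm (x - y)" by (rule mult_right_mono) auto
      with lip[of x y] show "dist (F x) (F y) \<le> \<bar>L\<bar> * dist x y" by (simp add: dist_norm)
    qed simp
  qed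
  then have meas: "F \<in> borel_measurable borel" by (rule borel_measurable_continuous_onI)
  have F_bound: "norm (F x) \<le> (SUP x\<in>cball 0 R. \<bar>F x\<bar>) * indicator (cball 0 R) x" for x
  proof (cases "norm x \<le> R")
    case True
    have "compact ((\<lambda>x. \<bar>F x\<bar>) ` cball 0 R)"
      using \<open>continuous_on UNIV F\<close> continuous_on_subset
      by (intro compact_continuous_image continuous_intros compact_cball) blast
    then have "bdd_above ((\<lambda>x. \<bar>F x\<bar>) ` cball 0 R)" by (intro bounded_imp_bdd_above compact_imp_bounded)
    then have "\<bar>F x\<bar> \<le> (SUP x\<in>cball 0 R. \<bar>F x\<bar>)" using True by (intro cSUP_upper) auto
    then show ?thesis using True by (simp add: indicator_def)
  qed (use supp in \<open>simp add: indicator_def\<close>)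
  have ball_int: "integrable lborel (indicator (cball (0::real^2) S) :: _ \<Rightarrow> real)" for S
    using emeasure_bounded_finite[OF bounded_cball, of 0 S] by (intro integrable_real_indicator) auto
  have int_F: "integrable lborel F"
  proof (rule Bochner_Integration.integrable_bound)
    show "integrable lborel (\<lambda>x::real^2. (SUP x\<in>cball 0 R. \<bar>F x\<bar>) * indicator (cball 0 R) x)"
      by (rule integrable_mult_right) (rule ball_int)
    show "AE x in lborel. norm (F x) \<le> norm ((SUP x\<in>cball 0 R. \<bar>F x\<bar>) * indicat_real (cball 0 R) x)"
      using order_trans[OF F_bound abs_ge_self] by (intro AE_I2) simp
  qed (use meas in simp)
  have Q0: "integral\<^sup>L lebesgue (Q k) = 0" for k
  proof -
    have "(\<integral>x. F (t k *\<^sub>R d + x) \<partial>lborel) = (\<integral>x. F x \<partial>(distr lborel borel ((+) (t k *\<^sub>R d))))"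
      by (rule integral_distr[symmetric]) (use meas in auto)
    then have 1: "(\<integral>x. F (t k *\<^sub>R d + x) \<partial>lborel) = integral\<^sup>L lborel F" by (simp add: lborel_distr_plus)
    have "integrable (distr lborel borel ((+) (t k *\<^sub>R d))) F" using int_F by (simp add: lborel_distr_plus)
    then have 2: "integrable lborel (\<lambda>x. F (t k *\<^sub>R d + x))"
      by (subst (asm) integrable_distr_eq) (use meas in auto)
    have "integral\<^sup>L lborel (Q k) = ((\<integral>x. F (t k *\<^sub>R d + x) \<partial>lborel) - integral\<^sup>L lborel F) / t k"
      unfolding Q_def using 2 int_F by simp
    moreover have "Q k \<in> borel_measurable borel" unfolding Q_def using meas by measurable
    ultimately show ?thesis using 1 by (simp add: integral_completion)
  qed
  have "(\<lambda>k. integral\<^sup>L lebesgue (Q k)) \<longlonglongrightarrow> integral\<^sup>L lebesgue D"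
  \<comment> \<open>Difference quotients are at most L times the norm of d, and since the steps do
    not exceed 1 they vanish outside the ball enlarged by the norm of d.\<close>
  proof (rule integral_dominated_convergence[where w = "\<lambda>x. (L * norm d) * indicator (cball 0 (R + norm d)) x"])
    show "Q k \<in> borel_measurable lebesgue" for k
    proof -
      have "Q k \<in> borel_measurable borel" unfolding Q_def using meas by measurable
      then show ?thesis by (simp add: measurable_completion)
    qed
    show "integrable lebesgue (\<lambda>x::real^2. L * norm d * indicat_real (cball 0 (R + norm d)) x)"
      using ball_int by (intro integrable_mult_right) (simp add: integrable_completion)
    show "AE x in lebesgue. (\<lambda>k. Q k x) \<longlonglongrightarrow> D x"
      using deriv
    proof eventually_elim
      case (elim x)
      then have "((\<lambda>s. (F (x + s *\<^sub>R d) - F x) / s) \<longlongrightarrow> D x) (at 0)"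
        unfolding has_field_derivative_iff by simp
      moreover have "filterlim t (at 0) sequentially"
        using LIMSEQ_inverse_real_of_nat t(1) unfolding t_def filterlim_at
        by (auto intro!: always_eventually)
      ultimately show ?case
        unfolding Q_def using filterlim_compose[of "\<lambda>s. (F (x + s *\<^sub>R d) - F x) / s"] by (simp add: add.commute)
    qed
    show "AE x in lebesgue. norm (Q k x) \<le> L * norm d * indicator (cball 0 (R + norm d)) x" for k
    proof (rule always_eventually, rule allI)
      fix x
      show "norm (Q k x) \<le> L * norm d * indicator (cball 0 (R + norm d)) x"
      proof (cases "norm x \<le> R + norm d")
        case True
        have "\<bar>F (t k *\<^sub>R d + x) - F x\<bar> \<le> L * (t k * norm d)"
          using lip[of "t k *\<^sub>R d + x" x] t(1)[of k] by simp
        then have "\<bar>Q k x\<bar> \<le> L * norm d"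
          unfolding Q_def using t(1)[of k] by (simp add: abs_divide pos_divide_le_eq mult.commute mult.left_commute)
        then show ?thesis using True by (simp add: indicator_def)
      next
        case False
        have "norm (t k *\<^sub>R d) \<le> norm d" using t[of k] mult_right_mono[of "t k" 1 "norm d"] by simp
        then have "norm (t k *\<^sub>R d + x) > R" using False norm_diff_ineq[of x "t k *\<^sub>R d"] by (simp add: add.commute)
        moreover have "norm x > R" using False norm_ge_zero[of d] by linarith
        ultimately show ?thesis using False supp unfolding Q_def by simp
      qed
    qed
  qed (rule D)
  then show ?thesis using Q0 LIMSEQ_unique[OF tendsto_const] by fastforce
qed

lemma C_diff_1_has_derivative: "C_diff 1 P \<Longrightarrow> (P has_derivative (\<lambda>d. directional d P x)) (at x)"
  using has_derivative_directional by simp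

lemma C_diff_1_const: "C_diff 1 (\<lambda>x. c)"
  using elementary_C_diff[OF elementary.const] .

lemma C_diff_1_add:
  assumes "C_diff 1 P" "C_diff 1 Q"
  shows "C_diff 1 (\<lambda>x. P x + Q x)"
proof -
  note D = has_derivative_add[OF assms[THEN C_diff_1_has_derivative]]
  have "partial_deriv j (\<lambda>x. P x + Q x) = (\<lambda>x. directional (axis j 1) P x + directional (axis j 1) Q x)" for j
    by (rule ext, rule partial_deriv_eq[OF D])
  moreover have "continuous_on UNIV (directional d P)" "continuous_on UNIV (directional d Q)" for d
    unfolding directional_def[abs_def] using assms by (auto intro!: continuous_intros)
  ultimately show ?thesis using differentiableI[OF D] by (auto intro!: continuous_intros)
qed

lemma C_diff_1_mult:
  assumes "C_diff 1 P" "C_diff 1 Q"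
  shows "C_diff 1 (\<lambda>x. P x * Q x)"
proof -
  note D = has_derivative_mult[OF assms[THEN C_diff_1_has_derivative]]
  have "partial_deriv j (\<lambda>x. P x * Q x) =
      (\<lambda>x. P x * directional (axis j 1) Q x + directional (axis j 1) P x * Q x)" for j
    by (rule ext, rule partial_deriv_eq[OF D])
  moreover have "continuous_on UNIV (directional d P)" "continuous_on UNIV (directional d Q)" for d
    unfolding directional_def[abs_def] using assms by (auto intro!: continuous_intros)
  moreover have "continuous_on UNIV P" "continuous_on UNIV Q"
    using assms by (auto intro!: continuous_at_imp_continuous_on differentiable_imp_continuous_within)
  ultimately show ?thesis using differentiableI[OF D] by (auto intro!: continuous_intros)
qed

text \<open>\<open>interior_closure\<close> says that \<Omega> has no slits. It puts the interior of
  every cell, and later any open set contained in the closure, inside \<Omega>.\<close>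

locale mesh_domain =
  fixes \<Omega> :: "(real^2) set" and \<T> :: "(real^2) set set"
  assumes open_domain: "open \<Omega>" and bounded_domain: "bounded \<Omega>"
    and interior_closure: "interior (closure \<Omega>) = \<Omega>"
    and finite_mesh: "finite \<T>" and compact_cell: "\<And>T. T \<in> \<T> \<Longrightarrow> compact T"
    and convex_cell: "\<And>T. T \<in> \<T> \<Longrightarrow> convex T" and Union_mesh: "\<Union>\<T> = closure \<Omega>"
begin

text \<open>An open set whose complement in the closed domain is negligible, and on which piecewise
  smooth functions are classically differentiable.\<close>

definition core :: "(real^2) set" where "core = (\<Union>T\<in>\<T>. interior T)"

text \<open>The pieces agree with w on the closed cells, so continuity across common sides is built
  in; they are continuously differentiable on the whole plane, so their derivatives are bounded on
  each compact cell.\<close>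

definition pc1 :: "(real^2 \<Rightarrow> real) \<Rightarrow> bool" where
  "pc1 w \<longleftrightarrow> (\<forall>T\<in>\<T>. \<exists>P. C_diff 1 P \<and> (\<forall>x\<in>T. w x = P x))"

definition zero_ext :: "(real^2 \<Rightarrow> real) \<Rightarrow> real^2 \<Rightarrow> real" where
  "zero_ext w x = (if x \<in> closure \<Omega> then w x else 0)"

lemma open_core: "open core" unfolding core_def by auto

lemma core_subset: "core \<subseteq> \<Omega>"
proof -
  have "interior T \<subseteq> interior (closure \<Omega>)" if "T \<in> \<T>" for T
    using that Union_mesh by (intro interior_mono) blast
  then show ?thesis unfolding core_def interior_closure by blast
qed

lemma negligible_core: "negligible (closure \<Omega> - core)"
proof (rule negligible_subset)
  show "negligible (\<Union>T\<in>\<T>. frontier T)"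
    using finite_mesh convex_cell by (intro negligible_Union) (auto intro: negligible_convex_frontier)
  show "closure \<Omega> - core \<subseteq> (\<Union>T\<in>\<T>. frontier T)"
    unfolding core_def Union_mesh[symmetric] frontier_def using closure_subset by blast
qed

lemma AE_core: "AE x in lebesgue. x \<in> core \<or> x \<notin> closure \<Omega>"
  by (rule AE_I'[OF negligible_core[unfolded negligible_iff_null_sets]]) blast

lemma AE_core_on: "AE x in lebesgue_on \<Omega>. x \<in> core"
  using AE_core open_domain closure_subset by (auto simp: AE_restrict_space_iff elim!: eventually_mono)

lemma pc1_C_diff: "C_diff 1 w \<Longrightarrow> pc1 w"
  unfolding pc1_def by blast

lemma pc1_const: "pc1 (\<lambda>x. c)"
  using pc1_C_diff[OF C_diff_1_const] .

lemma pc1_add: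
  assumes "pc1 v" "pc1 w"
  shows "pc1 (\<lambda>x. v x + w x)"
  unfolding pc1_def
proof
  fix T assume "T \<in> \<T>"
  then obtain P Q where "C_diff 1 P" "\<forall>x\<in>T. v x = P x" "C_diff 1 Q" "\<forall>x\<in>T. w x = Q x"
    using assms unfolding pc1_def by blast
  then show "\<exists>P. C_diff 1 P \<and> (\<forall>x\<in>T. v x + w x = P x)"
    by (intro exI[of _ "\<lambda>x. P x + Q x"] conjI C_diff_1_add) auto
qed

lemma pc1_mult:
  assumes "pc1 v" "pc1 w"
  shows "pc1 (\<lambda>x. v x * w x)"
  unfolding pc1_def
proof
  fix T assume "T \<in> \<T>"
  then obtain P Q where "C_diff 1 P" "\<forall>x\<in>T. v x = P x" "C_diff 1 Q" "\<forall>x\<in>T. w x = Q x"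
    using assms unfolding pc1_def by blast
  then show "\<exists>P. C_diff 1 P \<and> (\<forall>x\<in>T. v x * w x = P x)"
    by (intro exI[of _ "\<lambda>x. P x * Q x"] conjI C_diff_1_mult) auto
qed

lemma pc1_cmult: "pc1 w \<Longrightarrow> pc1 (\<lambda>x. c * w x)"
  by (intro pc1_mult pc1_const)

lemma pc1_has_derivative:
  assumes "C_diff 1 P" "\<forall>x\<in>T. w x = P x" "x \<in> interior T"
  shows "(w has_derivative (\<lambda>d. directional d P x)) (at x)"
  by (rule has_derivative_transform_within_open[OF C_diff_1_has_derivative[OF assms(1)] open_interior assms(3)])
     (use assms(2) interior_subset in force)

lemma pc1_differentiable:
  assumes "pc1 w" "x \<in> core"
  shows "w differentiable (at x)"
  using assms pc1_has_derivative unfolding pc1_def core_def differentiable_def by blast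

lemma pc1_deriv_on_cell:
  assumes "pc1 w" "T \<in> \<T>"
  obtains P where "C_diff 1 P" "\<And>x. x \<in> T \<Longrightarrow> w x = P x"
    "\<And>x j. x \<in> interior T \<Longrightarrow> partial_deriv j w x = partial_deriv j P x"
proof -
  obtain P where P: "C_diff 1 P" "\<forall>x\<in>T. w x = P x" using assms unfolding pc1_def by blast
  have "partial_deriv j w x = partial_deriv j P x" if "x \<in> interior T" for x j
    using partial_deriv_eq[OF pc1_has_derivative[OF P that]] partial_deriv_eq[OF C_diff_1_has_derivative[OF P(1)]]
    by metis
  then show ?thesis using that P by blast
qed

lemma pc1_deriv_continuous:
  assumes "pc1 w"
  shows "continuous_on core (partial_deriv j w)"
  unfolding core_def
proof (rule continuous_on_open_UN)
  fix T assume T: "T \<in> \<T>"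
  obtain P where P: "C_diff 1 P" "\<And>x j. x \<in> interior T \<Longrightarrow> partial_deriv j w x = partial_deriv j P x"
    using pc1_deriv_on_cell[OF assms T] by metis
  have "continuous_on (interior T) (partial_deriv j P)"
    by (rule continuous_on_subset[OF _ subset_UNIV]) (use P(1) in simp)
  then show "continuous_on (interior T) (partial_deriv j w)"
    using P(2) by (simp cong: continuous_on_cong)
qed simp

lemma pc1_continuous:
  assumes "pc1 w"
  shows "continuous_on (closure \<Omega>) w"
proof -
  have "continuous_on (\<Union>T\<in>\<T>. T) w"
  proof (rule continuous_on_closed_Union[OF finite_mesh])
    fix T assume T: "T \<in> \<T>"
    then show "closed T" using compact_cell compact_imp_closed by blast
    obtain P where P: "C_diff 1 P" "\<forall>x\<in>T. w x = P x" using assms T unfolding pc1_def by blast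
    have "continuous_on T P"
      using P(1) by (auto intro!: continuous_at_imp_continuous_on differentiable_imp_continuous_within)
    then show "continuous_on T w" using P(2) by (simp cong: continuous_on_cong)
  qed
  then show ?thesis using Union_mesh by simp
qed

text \<open>The estimate is for two points of one cell: \<Omega> need not be convex, so the segment
  between points of different cells may leave it.\<close>

lemma pc1_lipschitz:
  assumes "pc1 w"
  shows "\<exists>L\<ge>0. \<forall>T\<in>\<T>. \<forall>x\<in>T. \<forall>y\<in>T. \<bar>w x - w y\<bar> \<le> L * norm (x - y)"
proof -
  have "\<exists>L\<ge>0. \<forall>x\<in>T. \<forall>y\<in>T. \<bar>w x - w y\<bar> \<le> L * norm (x - y)" if T: "T \<in> \<T>" for T
  proof -
    obtain P where P: "C_diff 1 P" "\<forall>x\<in>T. w x = P x" using assms T unfolding pc1_def by blast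
    show ?thesis using C_diff_1_lipschitz[OF P(1) compact_cell[OF T] convex_cell[OF T]] P(2) by auto
  qed
  then obtain L where L: "\<And>T. T \<in> \<T> \<Longrightarrow> L T \<ge> 0"
    "\<And>T x y. T \<in> \<T> \<Longrightarrow> x \<in> T \<Longrightarrow> y \<in> T \<Longrightarrow> \<bar>w x - w y\<bar> \<le> L T * norm (x - y)" by metis
  have "\<bar>w x - w y\<bar> \<le> (\<Sum>T\<in>\<T>. L T) * norm (x - y)" if T: "T \<in> \<T>" "x \<in> T" "y \<in> T" for T x y
  proof -
    have "L T \<le> (\<Sum>T\<in>\<T>. L T)" using finite_mesh L(1) T(1) by (intro member_le_sum) auto
    then show ?thesis using L(2)[OF T] by (meson mult_right_mono norm_ge_zero order_trans)
  qed
  moreover have "(\<Sum>T\<in>\<T>. L T) \<ge> 0" using L(1) by (simp add: sum_nonneg)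
  ultimately show ?thesis by blast
qed

lemma pc1_deriv_bounded:
  assumes "pc1 w"
  shows "\<exists>M. \<forall>x\<in>core. \<bar>partial_deriv j w x\<bar> \<le> M"
proof -
  have "\<exists>M. \<forall>x\<in>interior T. \<bar>partial_deriv j w x\<bar> \<le> M" if T: "T \<in> \<T>" for T
  proof -
    obtain P where P: "C_diff 1 P" "\<And>x j. x \<in> interior T \<Longrightarrow> partial_deriv j w x = partial_deriv j P x"
      using pc1_deriv_on_cell[OF assms T] by metis
    have "continuous_on T (partial_deriv j P)"
      by (rule continuous_on_subset[OF _ subset_UNIV]) (use P(1) in simp)
    then have "compact (partial_deriv j P ` T)" using compact_cell[OF T] by (rule compact_continuous_image)
    then obtain M where "\<forall>y\<in>partial_deriv j P ` T. norm y \<le> M" using compact_imp_bounded bounded_iff by blast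
    then show ?thesis using P(2) interior_subset by (intro exI[of _ M]) force
  qed
  then obtain M where M: "\<And>T x. T \<in> \<T> \<Longrightarrow> x \<in> interior T \<Longrightarrow> \<bar>partial_deriv j w x\<bar> \<le> M T" by metis
  have "\<bar>partial_deriv j w x\<bar> \<le> (\<Sum>T\<in>\<T>. \<bar>M T\<bar>)" if x: "x \<in> core" for x
  proof -
    obtain T where T: "T \<in> \<T>" "x \<in> interior T" using x unfolding core_def by blast
    have "\<bar>M T\<bar> \<le> (\<Sum>T\<in>\<T>. \<bar>M T\<bar>)" using finite_mesh T(1) by (intro member_le_sum) auto
    then show ?thesis using M[OF T] by linarith
  qed
  then show ?thesis by blast
qed

text \<open>Where w is not differentiable its classical partial derivative is an arbitrary value, so
  measurability is shown for the restriction to \<open>core\<close> and carried over almost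
  everywhere.\<close>

lemma bounded_meas_deriv:
  assumes "pc1 w"
  shows "bounded_meas \<Omega> (partial_deriv j w)"
proof -
  obtain M where M: "\<And>x. x \<in> core \<Longrightarrow> \<bar>partial_deriv j w x\<bar> \<le> M" using pc1_deriv_bounded[OF assms] by blast
  have "(\<lambda>x. indicator core x * partial_deriv j w x) \<in> borel_measurable borel"
    using borel_measurable_continuous_on_indicator[of core "partial_deriv j w"] open_core pc1_deriv_continuous[OF assms]
    by simp
  then have "(\<lambda>x. indicator core x * partial_deriv j w x) \<in> borel_measurable (lebesgue_on \<Omega>)"
    by (intro measurable_restrict_space1 measurable_completion) simp
  moreover have "\<bar>indicator core x * partial_deriv j w x\<bar> \<le> \<bar>M\<bar>" for x
    using M by (cases "x \<in> core") (auto intro: order_trans[OF _ abs_ge_self])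
  ultimately have "bounded_meas \<Omega> (\<lambda>x. indicator core x * partial_deriv j w x)"
    unfolding bounded_meas_def by blast
  then show ?thesis
    by (rule bounded_meas_AE[OF open_domain]) (use AE_core_on in eventually_elim, simp)
qed

lemma bounded_meas_pc1: "pc1 w \<Longrightarrow> bounded_meas \<Omega> w"
  using bounded_meas_continuous[OF open_domain bounded_domain pc1_continuous] .

lemma bounded_meas_directional: "pc1 w \<Longrightarrow> bounded_meas \<Omega> (directional d w)"
  unfolding directional_def[abs_def] by (intro bounded_meas_sum bounded_meas_cmult bounded_meas_deriv)

text \<open>An interval covered by finitely many closed sets, on each of which a function is
  Lipschitz with constant C, inherits that constant. The sets are the slices of the cells and one
  further set \<open>Z\<close>, indexed by \<open>None\<close>, where the extension by zero
  vanishes. With C = 0 the same statement propagates constancy.\<close>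

lemma line_lipschitz:
  assumes "\<And>T. T \<in> \<T> \<Longrightarrow> C-lipschitz_on {t. x + t *\<^sub>R d \<in> T} (\<lambda>t. w (x + t *\<^sub>R d))"
    and Z: "closed Z" "\<And>t. t \<in> Z \<Longrightarrow> zero_ext w (x + t *\<^sub>R d) = 0"
    and cover: "{a..b} \<subseteq> {t. x + t *\<^sub>R d \<in> closure \<Omega>} \<union> Z" and "C \<ge> 0"
  shows "C-lipschitz_on {a..b} (\<lambda>t. zero_ext w (x + t *\<^sub>R d))"
proof (rule lipschitz_on_closed_Union[where I = "insert None (Some ` \<T>)"
      and U = "\<lambda>i. case i of None \<Rightarrow> Z | Some T \<Rightarrow> {t. x + t *\<^sub>R d \<in> T}"])
  fix i assume "i \<in> insert None (Some ` \<T>)"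
  then consider "i = None" | T where "i = Some T" "T \<in> \<T>" by blast
  then show "C-lipschitz_on (case i of None \<Rightarrow> Z | Some T \<Rightarrow> {t. x + t *\<^sub>R d \<in> T}) (\<lambda>t. zero_ext w (x + t *\<^sub>R d))"
  proof cases
    case 1
    then show ?thesis using Z(2) \<open>C \<ge> 0\<close> by (auto intro!: lipschitz_onI)
  next
    case 2
    have "zero_ext w (x + t *\<^sub>R d) = w (x + t *\<^sub>R d)" if "x + t *\<^sub>R d \<in> T" for t
      using that 2(2) Union_mesh unfolding zero_ext_def by auto
    then show ?thesis using assms(1)[OF 2(2)] 2(1) unfolding lipschitz_on_def by auto
  qed
next
  fix i assume "i \<in> insert None (Some ` \<T>)"
  moreover have "closed {t. x + t *\<^sub>R d \<in> T}" if "T \<in> \<T>" for T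
    using continuous_closed_vimage[of T "\<lambda>t. x + t *\<^sub>R d"] compact_cell[OF that] compact_imp_closed
    by (auto simp: vimage_def intro!: continuous_intros)
  ultimately show "closed (case i of None \<Rightarrow> Z | Some T \<Rightarrow> {t. x + t *\<^sub>R d \<in> T})" using Z(1) by auto
next
  show "{a..b} \<subseteq> (\<Union>i\<in>insert None (Some ` \<T>). case i of None \<Rightarrow> Z | Some T \<Rightarrow> {t. x + t *\<^sub>R d \<in> T})"
    using cover unfolding Union_mesh[symmetric] by auto
qed (use finite_mesh \<open>C \<ge> 0\<close> in auto)

lemma closed_line_complement: "closed {t. x + t *\<^sub>R d \<notin> \<Omega>}"
  using continuous_closed_vimage[of "- \<Omega>" "\<lambda>t. x + t *\<^sub>R d"] open_domain
  by (auto simp: vimage_def intro!: continuous_intros)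

lemma cell_line_lipschitz:
  assumes "\<And>x y. x \<in> T \<Longrightarrow> y \<in> T \<Longrightarrow> \<bar>w x - w y\<bar> \<le> L * norm (x - y)" "L \<ge> 0"
  shows "(L * norm d)-lipschitz_on {t. x + t *\<^sub>R d \<in> T} (\<lambda>t. w (x + t *\<^sub>R d))"
proof (rule lipschitz_onI)
  fix s t assume "s \<in> {t. x + t *\<^sub>R d \<in> T}" "t \<in> {t. x + t *\<^sub>R d \<in> T}"
  then have "\<bar>w (x + s *\<^sub>R d) - w (x + t *\<^sub>R d)\<bar> \<le> L * norm ((x + s *\<^sub>R d) - (x + t *\<^sub>R d))"
    using assms(1) by blast
  also have "(x + s *\<^sub>R d) - (x + t *\<^sub>R d) = (s - t) *\<^sub>R d" by (simp add: algebra_simps)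
  finally show "dist (w (x + s *\<^sub>R d)) (w (x + t *\<^sub>R d)) \<le> L * norm d * dist s t"
    by (simp add: dist_real_def mult.commute mult.left_commute)
qed (use assms(2) in simp)

section \<open>Integration by parts and identification of weak derivatives\<close>

lemma zero_ext_outside:
  assumes "\<And>x. x \<in> frontier \<Omega> \<Longrightarrow> w x = 0" "x \<notin> \<Omega>"
  shows "zero_ext w x = 0"
  using assms open_domain unfolding zero_ext_def frontier_def by (auto simp: interior_open)

text \<open>The segment from x to y may leave the domain and enter it again; off \<Omega> the
  extension is 0, on the frontier by hypothesis, so the closed complement of \<Omega> serves as
  \<open>Z\<close>.\<close>

lemma zero_ext_lipschitz:
  assumes "pc1 w" and zero: "\<And>x. x \<in> frontier \<Omega> \<Longrightarrow> w x = 0"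
  shows "\<exists>L. \<forall>x y. \<bar>zero_ext w x - zero_ext w y\<bar> \<le> L * norm (x - y)"
proof -
  obtain L where L: "L \<ge> 0" "\<And>T x y. T \<in> \<T> \<Longrightarrow> x \<in> T \<Longrightarrow> y \<in> T \<Longrightarrow> \<bar>w x - w y\<bar> \<le> L * norm (x - y)"
    using pc1_lipschitz[OF assms(1)] by blast
  have "\<bar>zero_ext w x - zero_ext w y\<bar> \<le> L * norm (x - y)" for x y
  proof -
    have "(L * norm (y - x))-lipschitz_on {0..1} (\<lambda>t. zero_ext w (x + t *\<^sub>R (y - x)))"
      by (rule line_lipschitz[OF cell_line_lipschitz[OF L(2,1)] closed_line_complement zero_ext_outside[OF zero]])
         (use L(1) closure_subset in auto)
    from lipschitz_onD[OF this, of 0 1] show ?thesis by (simp add: dist_real_def norm_minus_commute)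
  qed
  then show ?thesis by blast
qed

lemma zero_ext_has_derivative:
  assumes w: "pc1 w" and x: "x \<in> core \<or> x \<notin> closure \<Omega>"
  shows "((\<lambda>t. zero_ext w (x + t *\<^sub>R d)) has_real_derivative indicator core x * directional d w x) (at 0)"
proof -
  have line: "((\<lambda>t. x + t *\<^sub>R d) \<longlongrightarrow> x) (at 0)"
    by (rule tendsto_eq_intros refl | simp)+
  consider "x \<in> core" | "x \<notin> closure \<Omega>" using x by blast
  then show ?thesis
  proof cases
    case 1
    have "eventually (\<lambda>t. x + t *\<^sub>R d \<in> core) (nhds 0)"
      using topological_tendstoD[OF line open_core 1] 1 by (simp add: eventually_nhds_conv_at)
    then have "eventually (\<lambda>t. zero_ext w (x + t *\<^sub>R d) = w (x + t *\<^sub>R d)) (nhds 0)"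
    proof eventually_elim
      case (elim t)
      then show ?case using core_subset closure_subset unfolding zero_ext_def by auto
    qed
    from DERIV_cong_ev[OF refl this refl] line_has_derivative[of w x 0 d] pc1_differentiable[OF w 1]
    show ?thesis using 1 by simp
  next
    case 2
    have "eventually (\<lambda>t. x + t *\<^sub>R d \<in> - closure \<Omega>) (nhds 0)"
      using topological_tendstoD[OF line, of "- closure \<Omega>"] 2 by (simp add: eventually_nhds_conv_at open_Compl)
    then have "eventually (\<lambda>t. zero_ext w (x + t *\<^sub>R d) = 0) (nhds 0)"
      by eventually_elim (simp add: zero_ext_def)
    from DERIV_cong_ev[OF refl this refl] have "((\<lambda>t. zero_ext w (x + t *\<^sub>R d)) has_real_derivative 0) (at 0)"
      by simp
    moreover have "x \<notin> core" using 2 core_subset closure_subset by blast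
    ultimately show ?thesis by simp
  qed
qed

lemma indicator_core_AE: "AE x in lebesgue. indicator \<Omega> x * f x = indicator core x * (f x :: real)"
  using AE_core by eventually_elim (use core_subset closure_subset in \<open>auto simp: indicator_def\<close>)

text \<open>The divergence theorem for zero boundary values, without any integrals over sides of
  cells: the extension by zero is Lipschitz on the plane with bounded support, so its derivative
  integrates to 0.\<close>

lemma integral_directional_zero:
  assumes w: "pc1 w" and zero: "\<And>x. x \<in> frontier \<Omega> \<Longrightarrow> w x = 0"
  shows "(LINT x|lebesgue_on \<Omega>. directional d w x) = 0"
proof -
  obtain L where L: "\<And>x y. \<bar>zero_ext w x - zero_ext w y\<bar> \<le> L * norm (x - y)"
    using zero_ext_lipschitz[OF assms] by blast
  obtain R where R: "\<And>x. x \<in> closure \<Omega> \<Longrightarrow> norm x \<le> R"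
    using bounded_closure[OF bounded_domain] bounded_iff by metis
  have "bounded_meas \<Omega> (directional d w)" using bounded_meas_directional[OF w] .
  then have meas': "(\<lambda>x. indicator \<Omega> x * directional d w x) \<in> borel_measurable lebesgue"
    unfolding bounded_meas_def lebesgue_on_borel_measurable_iff[OF open_domain] by (rule conjunct1)
  from borel_measurable_AE[OF meas' indicator_core_AE]
  have meas: "(\<lambda>x. indicator core x * directional d w x) \<in> borel_measurable lebesgue" .
  have "integral\<^sup>L lebesgue (\<lambda>x. indicator core x * directional d w x) = 0"
  proof (rule integral_derivative_zero[OF L _ meas])
    show "zero_ext w x = 0" if "norm x > R" for x using that R unfolding zero_ext_def by force
    show "AE x in lebesgue. ((\<lambda>t. zero_ext w (x + t *\<^sub>R d)) has_real_derivative
        indicator core x * directional d w x) (at 0)"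
      using AE_core by eventually_elim (rule zero_ext_has_derivative[OF w])
  qed
  moreover have "integral\<^sup>L lebesgue (\<lambda>x. indicator core x * directional d w x) =
      integral\<^sup>L lebesgue (\<lambda>x. indicator \<Omega> x * directional d w x)"
    by (rule integral_cong_AE[OF meas' meas indicator_core_AE, symmetric])
  ultimately show ?thesis unfolding integral_lebesgue_on[OF open_domain] by simp
qed

lemma directional_axis: "directional (axis j 1) w x = partial_deriv j w x"
  unfolding directional_def axis_def by (simp add: if_distrib if_distribR sum.If_cases cong: if_cong)

lemma partial_deriv_mult:
  assumes "v differentiable (at x)" "w differentiable (at x)"
  shows "partial_deriv j (\<lambda>x. v x * w x) x = v x * partial_deriv j w x + partial_deriv j v x * w x"
  using partial_deriv_eq[OF has_derivative_mult[OF assms[THEN has_derivative_directional]]]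
  unfolding directional_axis .

text \<open>Only the product has to vanish on the frontier, so either factor may carry the boundary
  condition: the test function in the definition of weak derivatives, the bubble against the
  pressure.\<close>

lemma integral_by_parts:
  assumes v: "pc1 v" and w: "pc1 w" and zero: "\<And>x. x \<in> frontier \<Omega> \<Longrightarrow> v x * w x = 0"
  shows "(LINT x|lebesgue_on \<Omega>. v x * partial_deriv j w x) = - (LINT x|lebesgue_on \<Omega>. partial_deriv j v x * w x)"
proof -
  note bm = bounded_meas_pc1[OF v] bounded_meas_pc1[OF w] bounded_meas_deriv[OF v, of j] bounded_meas_deriv[OF w, of j]
  note int = bounded_meas_integrable[OF open_domain bounded_domain bounded_meas_mult]
  have "(LINT x|lebesgue_on \<Omega>. partial_deriv j (\<lambda>x. v x * w x) x) = 0"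
    using integral_directional_zero[OF pc1_mult[OF v w] zero, of "axis j 1"] unfolding directional_axis .
  moreover have "(LINT x|lebesgue_on \<Omega>. partial_deriv j (\<lambda>x. v x * w x) x) =
      (LINT x|lebesgue_on \<Omega>. v x * partial_deriv j w x + partial_deriv j v x * w x)"
  proof (rule integral_cong_AE)
    show "partial_deriv j (\<lambda>x. v x * w x) \<in> borel_measurable (lebesgue_on \<Omega>)"
      using bounded_meas_deriv[OF pc1_mult[OF v w]] unfolding bounded_meas_def by blast
    show "(\<lambda>x. v x * partial_deriv j w x + partial_deriv j v x * w x) \<in> borel_measurable (lebesgue_on \<Omega>)"
      using bm unfolding bounded_meas_def by auto
    show "AE x in lebesgue_on \<Omega>. partial_deriv j (\<lambda>x. v x * w x) x = v x * partial_deriv j w x + partial_deriv j v x * w x"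
      using AE_core_on by eventually_elim (intro partial_deriv_mult pc1_differentiable v w)
  qed
  moreover have "\<dots> = (LINT x|lebesgue_on \<Omega>. v x * partial_deriv j w x) + (LINT x|lebesgue_on \<Omega>. partial_deriv j v x * w x)"
    by (rule Bochner_Integration.integral_add) (intro int bm)+
  ultimately show ?thesis by simp
qed

lemma test_function_pc1:
  assumes "test_function \<Omega> \<phi>"
  shows "pc1 \<phi>" "x \<in> frontier \<Omega> \<Longrightarrow> \<phi> x = 0"
proof -
  show "pc1 \<phi>" using assms pc1_C_diff unfolding test_function_def by blast
  assume "x \<in> frontier \<Omega>"
  then have "x \<notin> \<Omega>" using open_domain by (simp add: frontier_def interior_open)
  moreover have "closure {x. \<phi> x \<noteq> 0} \<subseteq> \<Omega>" using assms unfolding test_function_def by simp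
  ultimately have "x \<notin> {x. \<phi> x \<noteq> 0}" using closure_subset[of "{x. \<phi> x \<noteq> 0}"] by blast
  then show "\<phi> x = 0" by simp
qed

lemma pc1_has_weak_deriv:
  assumes w: "pc1 w"
  shows "has_weak_deriv \<Omega> j w (partial_deriv j w)"
  unfolding has_weak_deriv_def
proof (intro conjI allI impI)
  fix C assume C: "compact C \<and> C \<subseteq> \<Omega>"
  show "w absolutely_integrable_on C" "partial_deriv j w absolutely_integrable_on C"
    using C bounded_meas_on_subset[OF open_domain bounded_domain] bounded_meas_pc1[OF w] bounded_meas_deriv[OF w] by auto
next
  fix \<phi> assume \<phi>: "test_function \<Omega> \<phi>"
  show "(LINT x|lebesgue_on \<Omega>. w x * partial_deriv j \<phi> x) = - (LINT x|lebesgue_on \<Omega>. partial_deriv j w x * \<phi> x)"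
    by (rule integral_by_parts[OF w test_function_pc1(1)[OF \<phi>]]) (simp add: test_function_pc1(2)[OF \<phi>])
qed

text \<open>The classical derivative is one weak derivative, so the choice made by
  \<open>weak_deriv\<close> is another; their difference integrates to 0 against all test
  functions.\<close>

lemma weak_deriv_pc1:
  assumes w: "pc1 w"
  shows "AE x in lebesgue_on \<Omega>. weak_deriv \<Omega> j w x = partial_deriv j w x"
proof -
  have weak: "has_weak_deriv \<Omega> j w (weak_deriv \<Omega> j w)"
    unfolding weak_deriv_def using pc1_has_weak_deriv[OF w] by (rule someI[where P = "has_weak_deriv \<Omega> j w"])
  note weak' = pc1_has_weak_deriv[OF w, of j]
  have "AE x in lebesgue_on \<Omega>. weak_deriv \<Omega> j w x - partial_deriv j w x = 0"
  proof (rule AE_zero_of_test_functions[OF open_domain])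
    fix C assume "compact C" "C \<subseteq> \<Omega>"
    then show "(\<lambda>x. weak_deriv \<Omega> j w x - partial_deriv j w x) absolutely_integrable_on C"
      using weak weak' unfolding has_weak_deriv_def by (intro set_integral_diff(1)) auto
  next
    fix \<phi> assume \<phi>: "test_function \<Omega> \<phi>"
    \<comment> \<open>Weak derivatives are only locally integrable; the compact support of \<phi>
      makes the product integrable on \<Omega>.\<close>
    have int: "integrable (lebesgue_on \<Omega>) (\<lambda>x. v x * \<phi> x)"
      if v: "\<And>C. compact C \<Longrightarrow> C \<subseteq> \<Omega> \<Longrightarrow> v absolutely_integrable_on C" for v
    proof -
      define C where "C = closure {x. \<phi> x \<noteq> 0}"
      have C: "compact C" "C \<subseteq> \<Omega>" using \<phi> unfolding test_function_def C_def by auto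
      have "C_diff 0 \<phi>" using \<phi> unfolding test_function_def by blast
      then have cont: "continuous_on UNIV \<phi>" by simp
      have "compact (\<phi> ` C)" using cont C(1) continuous_on_subset by (intro compact_continuous_image) blast+
      then obtain M where M: "\<And>x. x \<in> C \<Longrightarrow> \<bar>\<phi> x\<bar> \<le> M"
        using compact_imp_bounded bounded_iff by (metis imageI real_norm_def)
      have out: "\<phi> x = 0" if "x \<notin> C" for x
      proof -
        have "x \<notin> {x. \<phi> x \<noteq> 0}" using that closure_subset[of "{x. \<phi> x \<noteq> 0}"] unfolding C_def by blast
        then show ?thesis by simp
      qed
      have v_int: "integrable lebesgue (\<lambda>x. indicator C x * v x)"
        using v[OF C] unfolding set_integrable_def by simp
      have "\<phi> \<in> borel_measurable lebesgue"
        using borel_measurable_continuous_onI[OF cont] by (simp add: measurable_completion)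
      then have "integrable lebesgue (\<lambda>x. (indicator C x * v x) * \<phi> x)"
      proof (intro Bochner_Integration.integrable_bound[OF integrable_mult_right[OF v_int, of "\<bar>M\<bar>"]])
        show "AE x in lebesgue. norm (indicator C x * v x * \<phi> x) \<le> norm (\<bar>M\<bar> * (indicator C x * v x))"
        proof (rule AE_I2)
          fix x
          show "norm (indicator C x * v x * \<phi> x) \<le> norm (\<bar>M\<bar> * (indicator C x * v x))"
            using M[of x] by (cases "x \<in> C") (auto simp: abs_mult mult.commute intro!: mult_right_mono)
        qed
      qed (use v_int in \<open>auto simp: borel_measurable_integrable\<close>)
      moreover have "(indicator C x * v x) * \<phi> x = indicator \<Omega> x * (v x * \<phi> x)" for x
        using out[of x] C(2) by (cases "x \<in> C") (auto simp: indicator_def)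
      ultimately show ?thesis unfolding integral_lebesgue_on(2)[OF open_domain] by simp
    qed
    have "(LINT x|lebesgue_on \<Omega>. weak_deriv \<Omega> j w x * \<phi> x) = (LINT x|lebesgue_on \<Omega>. partial_deriv j w x * \<phi> x)"
      using weak weak' \<phi> unfolding has_weak_deriv_def by fastforce
    moreover have "integrable (lebesgue_on \<Omega>) (\<lambda>x. weak_deriv \<Omega> j w x * \<phi> x)"
      "integrable (lebesgue_on \<Omega>) (\<lambda>x. partial_deriv j w x * \<phi> x)"
      using weak weak' unfolding has_weak_deriv_def by (auto intro!: int)
    ultimately show "(LINT x|lebesgue_on \<Omega>. (weak_deriv \<Omega> j w x - partial_deriv j w x) * \<phi> x) = 0"
      by (simp add: left_diff_distrib)
  qed
  then show ?thesis by eventually_elim simp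
qed

end

section \<open>Slicing and the trace inequality\<close>

text \<open>The segment may run along the boundary of \<open>T\<close>, where nothing is known about
  the derivative. It is shrunk towards an interior point c, which keeps its direction and moves it
  into the interior, and continuity gives the limit.\<close>

lemma (in mesh_domain) line_constant_on_cell:
  assumes w: "pc1 w" and d0: "\<And>x. x \<in> core \<Longrightarrow> directional d w x = 0"
    and T: "T \<in> \<T>" "interior T \<noteq> {}" and y: "y \<in> T" "y + s *\<^sub>R d \<in> T"
  shows "w (y + s *\<^sub>R d) = w y"
proof -
  obtain c where c: "c \<in> interior T" using T(2) by blast
  have conv: "convex T" using convex_cell[OF T(1)] .
  define Y where "Y k = y - inverse (real (Suc k)) *\<^sub>R (y - c)" for k
  define Z where "Z k = (y + s *\<^sub>R d) - inverse (real (Suc k)) *\<^sub>R (y + s *\<^sub>R d - c)" for k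
  have e: "0 < inverse (real (Suc k))" "inverse (real (Suc k)) \<le> 1" for k
    by (auto simp: inverse_le_1_iff)
  have YZ: "Y k \<in> interior T" "Z k \<in> interior T" for k
    unfolding Y_def Z_def using mem_interior_convex_shrink[OF conv c] y e by blast+
  have eq: "w (Z k) = w (Y k)" for k
  proof -
    define q where "q = (1 - inverse (real (Suc k))) * s"
    have Zq: "Z k = Y k + q *\<^sub>R d" unfolding Z_def Y_def q_def by (simp add: algebra_simps)
    have seg: "Y k + t *\<^sub>R (q *\<^sub>R d) \<in> interior T" if "t \<in> {0..1}" for t
    proof -
      have "(1 - t) *\<^sub>R Y k + t *\<^sub>R Z k \<in> interior T"
        using convexD_alt[OF convex_interior[OF conv] YZ(1) YZ(2)] that by simp
      then show ?thesis unfolding Zq by (simp add: algebra_simps)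
    qed
    have deriv: "((\<lambda>t. w (Y k + t *\<^sub>R (q *\<^sub>R d))) has_real_derivative 0) (at t within {0..1})" if "t \<in> {0..1}" for t
    proof -
      have core: "Y k + t *\<^sub>R (q *\<^sub>R d) \<in> core" using seg[OF that] T(1) unfolding core_def by blast
      have "directional (q *\<^sub>R d) w x = q * directional d w x" for x
        unfolding directional_def by (simp add: sum_distrib_left mult.assoc)
      then have "directional (q *\<^sub>R d) w (Y k + t *\<^sub>R (q *\<^sub>R d)) = 0" using d0[OF core] by simp
      then show ?thesis
        using line_has_derivative[OF pc1_differentiable[OF w core]] has_field_derivative_at_within by metis
    qed
    have "\<exists>c. \<forall>t\<in>{0..1}. w (Y k + t *\<^sub>R (q *\<^sub>R d)) = c"
      by (rule has_field_derivative_zero_constant[OF _ deriv]) simp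
    then obtain c where c: "\<And>t. t \<in> {0..1} \<Longrightarrow> w (Y k + t *\<^sub>R (q *\<^sub>R d)) = c" by blast
    have "w (Y k + 1 *\<^sub>R (q *\<^sub>R d)) = w (Y k + 0 *\<^sub>R (q *\<^sub>R d))"
      by (rule trans[OF c c[symmetric]]) simp_all
    then show ?thesis unfolding Zq by simp
  qed
  have cont: "continuous_on T w" using pc1_continuous[OF w] T(1) Union_mesh continuous_on_subset by blast
  have lims: "Y \<longlonglongrightarrow> y" "Z \<longlonglongrightarrow> y + s *\<^sub>R d"
  proof -
    have "Y \<longlonglongrightarrow> y - 0 *\<^sub>R (y - c)" unfolding Y_def by (intro tendsto_intros LIMSEQ_inverse_real_of_nat)
    then show "Y \<longlonglongrightarrow> y" by simp
    have "Z \<longlonglongrightarrow> (y + s *\<^sub>R d) - 0 *\<^sub>R (y + s *\<^sub>R d - c)" unfolding Z_def by (intro tendsto_intros LIMSEQ_inverse_real_of_nat)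
    then show "Z \<longlonglongrightarrow> y + s *\<^sub>R d" by simp
  qed
  have "Y k \<in> T" "Z k \<in> T" for k using YZ interior_subset[of T] by blast+
  then have "(\<lambda>k. w (Y k)) \<longlonglongrightarrow> w y" "(\<lambda>k. w (Z k)) \<longlonglongrightarrow> w (y + s *\<^sub>R d)"
    using continuous_on_tendsto_compose[OF cont lims(1) y(1)] continuous_on_tendsto_compose[OF cont lims(2) y(2)] by simp_all
  then show ?thesis unfolding eq using LIMSEQ_unique by blast
qed

text \<open>Along the ray the extension by zero is constant: on cells because the directional
  derivative vanishes, off \<Omega> because it is 0 there. This is \<open>line_lipschitz\<close>
  with constant 0, and the ray ends outside the bounded domain.\<close>

lemma (in mesh_domain) zero_along_ray:
  assumes w: "pc1 w" and d0: "\<And>x. x \<in> core \<Longrightarrow> directional d w x = 0"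
    and int: "\<And>T. T \<in> \<T> \<Longrightarrow> interior T \<noteq> {}" and "d \<noteq> 0" and x: "x \<in> \<Omega>"
    and exit: "\<And>t. 0 \<le> t \<Longrightarrow> x + t *\<^sub>R d \<in> frontier \<Omega> \<Longrightarrow> w (x + t *\<^sub>R d) = 0"
  shows "w x = 0"
proof -
  obtain R0 where R0: "\<And>y. y \<in> closure \<Omega> \<Longrightarrow> norm y \<le> R0"
    using bounded_closure[OF bounded_domain] bounded_iff by metis
  \<comment> \<open>Long enough for \<open>x + R *\<^sub>R d\<close> to have norm at least R0 +
    1.\<close>
  define R where "R = (R0 + norm x + 1) / norm d"
  have xc: "x \<in> closure \<Omega>" using x closure_subset by blast
  then have "R0 \<ge> 0" using R0 norm_ge_zero order_trans by metis
  then have R: "R \<ge> 0" unfolding R_def by simp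
  have out: "x + R *\<^sub>R d \<notin> closure \<Omega>"
  proof
    assume "x + R *\<^sub>R d \<in> closure \<Omega>"
    then have "norm (x + R *\<^sub>R d) \<le> R0" by (rule R0)
    moreover have "norm (R *\<^sub>R d) = R0 + norm x + 1" using \<open>d \<noteq> 0\<close> \<open>R0 \<ge> 0\<close> unfolding R_def by simp
    ultimately show False using norm_diff_ineq[of "R *\<^sub>R d" x] by (simp add: add.commute)
  qed
  have "0-lipschitz_on {0..R} (\<lambda>t. zero_ext w (x + t *\<^sub>R d))"
  proof (rule line_lipschitz)
    fix T assume T: "T \<in> \<T>"
    show "0-lipschitz_on {t. x + t *\<^sub>R d \<in> T} (\<lambda>t. w (x + t *\<^sub>R d))"
    proof (rule lipschitz_onI)
      fix s t assume "s \<in> {t. x + t *\<^sub>R d \<in> T}" "t \<in> {t. x + t *\<^sub>R d \<in> T}"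
      then have st: "x + s *\<^sub>R d \<in> T" "x + t *\<^sub>R d \<in> T" by auto
      have *: "x + s *\<^sub>R d + (t - s) *\<^sub>R d = x + t *\<^sub>R d" by (simp add: algebra_simps)
      have "w (x + s *\<^sub>R d + (t - s) *\<^sub>R d) = w (x + s *\<^sub>R d)"
        by (rule line_constant_on_cell[OF w d0 T int[OF T] st(1)]) (simp_all only: * st(2))
      then show "dist (w (x + s *\<^sub>R d)) (w (x + t *\<^sub>R d)) \<le> 0 * dist s t" unfolding * by simp
    qed simp
  next
    show "closed ({t. x + t *\<^sub>R d \<notin> \<Omega>} \<inter> {0..})" by (intro closed_Int closed_line_complement closed_atLeast)
    fix t assume t: "t \<in> {t. x + t *\<^sub>R d \<notin> \<Omega>} \<inter> {0..}"
    show "zero_ext w (x + t *\<^sub>R d) = 0"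
      using t exit[of t] open_domain unfolding zero_ext_def frontier_def by (auto simp: interior_open)
  qed (use closure_subset in auto)
  from lipschitz_onD[OF this, of 0 R] R have "zero_ext w x = zero_ext w (x + R *\<^sub>R d)" by simp
  then show ?thesis using out xc unfolding zero_ext_def by simp
qed

text \<open>The fundamental theorem with finitely many exceptional points gives f 0 as minus the
  integral of g; Cauchy-Schwarz follows from the nonnegative integral of the squared deviation of g
  from its mean. The extended nonnegative form is what Tonelli integration over the slices
  needs.\<close>

lemma square_le_integral_derivative_square:
  fixes f g :: "real \<Rightarrow> real"
  assumes S: "finite S" and R: "0 < R" and cont: "continuous_on {0..R} f"
    and deriv: "\<And>t. t \<in> {0<..<R} - S \<Longrightarrow> (f has_real_derivative g t) (at t)"
    and fR: "f R = 0" and g: "g \<in> borel_measurable borel" "\<And>t. \<bar>g t\<bar> \<le> M"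
  shows "ennreal ((f 0)\<^sup>2) \<le> ennreal R * (\<integral>\<^sup>+t. ennreal ((g t)\<^sup>2) * indicator {0..R} t \<partial>lborel)"
proof -
  have "(g has_integral (f R - f 0)) {0..R}"
    using fundamental_theorem_of_calculus_interior_strong[OF S order_less_imp_le[OF R] _ cont] deriv
    by (auto simp: has_real_derivative_iff_has_vector_derivative)
  then have I: "integral {0..R} g = - f 0" using fR by (simp add: integral_unique)
  define \<mu> where "\<mu> = (\<lambda>h::real \<Rightarrow> real. LINT t:{0..R}|lborel. h t)"
  have int: "set_integrable lborel {0..R} h" if "h \<in> borel_measurable borel" "\<And>t. \<bar>h t\<bar> \<le> B" for h :: "real \<Rightarrow> real" and B
    unfolding set_integrable_def
  proof (rule Bochner_Integration.integrable_bound[where f = "\<lambda>t. B * indicator {0..R} t"])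
    show "AE t in lborel. norm (indicat_real {0..R} t *\<^sub>R h t) \<le> norm (B * indicat_real {0..R} t)"
      using that(2) by (intro AE_I2) (auto simp: indicator_def intro: order_trans[OF _ abs_ge_self])
  qed (use that R in \<open>auto intro!: integrable_mult_right integrable_real_indicator simp: emeasure_lborel_Icc_eq\<close>)
  have g1: "set_integrable lborel {0..R} g" using int[OF g] .
  have g2: "set_integrable lborel {0..R} (\<lambda>t. (g t)\<^sup>2)"
  proof (rule int[where B = "M\<^sup>2"])
    show "\<bar>(g t)\<^sup>2\<bar> \<le> M\<^sup>2" for t using g(2)[of t] abs_le_square_iff[of "g t" M] by auto
  qed (use g in measurable)
  define I J where "I = \<mu> g" and "J = \<mu> (\<lambda>t. (g t)\<^sup>2)"
  have If: "I = - f 0" unfolding I_def \<mu>_def using I set_borel_integral_eq_integral(2)[OF g1] by simp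
  have c: "\<mu> (\<lambda>t. c) = c * R" "set_integrable lborel {0..R} (\<lambda>t. c)" for c :: real
    unfolding \<mu>_def using R int[of "\<lambda>_. c" "\<bar>c\<bar>"] by (simp_all add: set_lebesgue_integral_def)
  have "0 \<le> \<mu> (\<lambda>t. (g t - I / R)\<^sup>2)" unfolding \<mu>_def set_lebesgue_integral_def by (intro integral_nonneg_AE AE_I2) simp
  also have "\<mu> (\<lambda>t. (g t - I / R)\<^sup>2) = \<mu> (\<lambda>t. ((g t)\<^sup>2 - (2 * I / R) * g t) + (I / R)\<^sup>2)"
    by (simp add: power2_diff algebra_simps)
  also have "\<dots> = (J - (2 * I / R) * I) + (I / R)\<^sup>2 * R"
    unfolding I_def J_def c(1)[symmetric] unfolding \<mu>_def using g1 g2 c(2)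
    by (simp add: set_integral_add set_integral_diff)
  also have "\<dots> = J - I\<^sup>2 / R" using R by (simp add: power2_eq_square field_simps)
  finally have IJ: "(f 0)\<^sup>2 \<le> R * J" using R If by (simp add: pos_divide_le_eq mult.commute)
  have "(\<integral>\<^sup>+t. ennreal ((g t)\<^sup>2) * indicator {0..R} t \<partial>lborel) = (\<integral>\<^sup>+t. ennreal (indicator {0..R} t * (g t)\<^sup>2) \<partial>lborel)"
    by (intro nn_integral_cong) (auto simp: indicator_def)
  also have "\<dots> = ennreal J"
    unfolding J_def \<mu>_def set_lebesgue_integral_def using g2 unfolding set_integrable_def
    by (subst nn_integral_eq_integral) auto
  finally have eq: "(\<integral>\<^sup>+t. ennreal ((g t)\<^sup>2) * indicator {0..R} t \<partial>lborel) = ennreal J" .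
  show ?thesis unfolding eq using ennreal_leI[OF IJ] R by (simp add: ennreal_mult')
qed

text \<open>If the line meets the interior of \<open>T\<close>, then of three frontier points on it
  the middle one would be interior, so there are at most two. If it misses the interior, the whole
  segment between two frontier points belongs to the frontier and has positive length.\<close>

lemma negligible_slice_finite:
  fixes T :: "(real^2) set"
  assumes conv: "convex T" and closed: "closed T" and "d \<noteq> 0"
    and null: "emeasure lborel {t. x + t *\<^sub>R d \<in> frontier T} = 0"
  shows "finite {t. x + t *\<^sub>R d \<in> frontier T}"
proof (rule ccontr)
  define J where "J = {t. x + t *\<^sub>R d \<in> frontier T}"
  assume "\<not> ?thesis"
  then have "infinite J" unfolding J_def by simp
  then obtain B where B: "finite B" "card B = 3" "B \<subseteq> J" using infinite_arbitrarily_large by blast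
  then have ne: "B \<noteq> {}" by auto
  define t1 t3 where "t1 = Min B" and "t3 = Max B"
  have "card {t1, t3} < card B" using B(2) card_insert_le_m1[of 2 "{t3}" t1] by simp
  then obtain t2 where t2: "t2 \<in> B" "t2 \<noteq> t1" "t2 \<noteq> t3"
    using card_mono[of "{t1, t3}" B] by (auto simp: not_le[symmetric])
  have order: "t1 < t2" "t2 < t3" using t2 B(1) unfolding t1_def t3_def
    by (metis Min_le order_le_neq_trans, metis Max_ge order_le_neq_trans)
  have inT: "x + t *\<^sub>R d \<in> T \<and> x + t *\<^sub>R d \<notin> interior T" if "t \<in> J" for t
    using that closed unfolding J_def frontier_def by simp
  have J: "t1 \<in> J" "t2 \<in> J" "t3 \<in> J"
    using subsetD[OF B(3) Min_in[OF B(1) ne]] subsetD[OF B(3) Max_in[OF B(1) ne]] subsetD[OF B(3) t2(1)]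
    unfolding t1_def t3_def by blast+
  have between: "x + b *\<^sub>R d \<in> open_segment (x + a *\<^sub>R d) (x + c *\<^sub>R d)" if "a < b \<and> b < c \<or> c < b \<and> b < a" for a b c
  proof -
    define u where "u = (b - a) / (c - a)"
    have "c \<noteq> a" using that by auto
    then have "0 < u" "u < 1" "u * (c - a) = b - a" using that unfolding u_def by (auto simp: field_simps divide_less_eq zero_less_divide_iff)
    moreover have "(1 - u) *\<^sub>R (x + a *\<^sub>R d) + u *\<^sub>R (x + c *\<^sub>R d) = x + (a + u * (c - a)) *\<^sub>R d"
      by (simp add: algebra_simps)
    ultimately show ?thesis using \<open>c \<noteq> a\<close> \<open>d \<noteq> 0\<close> unfolding in_segment by (intro conjI exI[of _ u]) auto
  qed
  show False
  proof (cases "\<exists>t0. x + t0 *\<^sub>R d \<in> interior T")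
    case True
    then obtain t0 where t0: "x + t0 *\<^sub>R d \<in> interior T" by blast
    then have "t0 \<noteq> t2" using inT[OF J(2)] by blast
    then obtain c where "c \<in> {t1, t3}" "t0 < t2 \<and> t2 < c \<or> c < t2 \<and> t2 < t0"
      using order by (cases "t0 < t2") auto
    moreover from this have "x + c *\<^sub>R d \<in> closure T" using inT J closure_subset by blast
    ultimately have "x + t2 *\<^sub>R d \<in> interior T"
      using between in_interior_closure_convex_segment[OF conv t0] by blast
    then show False using inT[OF J(2)] by blast
  next
    case False
    have "{t1..t3} \<subseteq> J"
    proof
      fix t assume t: "t \<in> {t1..t3}"
      have "x + t *\<^sub>R d \<in> T"
      proof (cases "t = t1 \<or> t = t3")
        case False
        then have "x + t *\<^sub>R d \<in> open_segment (x + t1 *\<^sub>R d) (x + t3 *\<^sub>R d)" using t by (intro between) auto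
        then show ?thesis using conv inT[OF J(1)] inT[OF J(3)] unfolding convex_contains_open_segment by blast
      qed (use inT J in auto)
      then show "t \<in> J" using False closed unfolding J_def frontier_def by simp
    qed
    have "J \<in> sets borel"
    proof -
      have "closed J" unfolding J_def using continuous_closed_vimage[of "frontier T" "\<lambda>t. x + t *\<^sub>R d"]
        by (auto simp: vimage_def intro!: continuous_intros)
      then show ?thesis by simp
    qed
    then have "emeasure lborel {t1..t3} \<le> emeasure lborel J" using \<open>{t1..t3} \<subseteq> J\<close> by (intro emeasure_mono) auto
    then show False using null order unfolding J_def[symmetric] by (simp add: ennreal_eq_0_iff)
  qed
qed

section \<open>Measure preserving coordinates in the plane\<close>

lemma distr_vector: "distr (lborel :: (real \<times> real) measure) borel (\<lambda>(s, t). vector [s, t] :: real^2) = lborel"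
proof (rule lborel_eqI[symmetric])
  have meas: "(\<lambda>(s, t). vector [s, t] :: real^2) \<in> borel_measurable borel"
  proof -
    have eq: "(\<lambda>(s, t). vector [s, t] :: real^2) = (\<lambda>p. fst p *\<^sub>R axis 1 1 + snd p *\<^sub>R axis 2 1)"
      by (auto simp: vec_eq_iff forall_2 axis_def)
    show ?thesis unfolding eq by (intro borel_measurable_continuous_onI continuous_intros)
  qed
  fix l u :: "real^2" assume lu: "\<And>b. b \<in> Basis \<Longrightarrow> l \<bullet> b \<le> u \<bullet> b"
  then have lu2: "l $ i \<le> u $ i" for i using lu[of "axis i 1"] by (simp add: cart_eq_inner_axis)
  have "(\<lambda>(s, t). vector [s, t] :: real^2) -` box l u = {l $ 1<..<u $ 1} \<times> {l $ 2<..<u $ 2}"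
    by (auto simp: mem_box_2)
  then have "emeasure (distr lborel borel (\<lambda>(s, t). vector [s, t] :: real^2)) (box l u) =
      emeasure (lborel \<Otimes>\<^sub>M lborel) ({l $ 1<..<u $ 1} \<times> {l $ 2<..<u $ 2})"
    using meas by (subst emeasure_distr) (auto simp: lborel_prod)
  also have "\<dots> = ennreal ((u $ 1 - l $ 1) * (u $ 2 - l $ 2))"
    using lu2 by (subst lborel.emeasure_pair_measure_Times) (auto simp: ennreal_mult)
  also have "(u $ 1 - l $ 1) * (u $ 2 - l $ 2) = (\<Prod>b\<in>Basis. (u - l) \<bullet> b)"
  proof -
    have 1: "(Basis :: (real^2) set) = (\<lambda>i. axis i 1) ` UNIV" by (auto simp: Basis_vec_def)
    have 2: "inj (\<lambda>i::2. axis i (1::real))" by (auto simp: inj_on_def axis_eq_axis)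
    show ?thesis unfolding 1 prod.reindex[OF 2] by (simp add: UNIV_2 inner_axis)
  qed
  finally show "emeasure (distr lborel borel (\<lambda>(s, t). vector [s, t] :: real^2)) (box l u) = ennreal (\<Prod>b\<in>Basis. (u - l) \<bullet> b)" .
qed simp

text \<open>Covers the orthogonal maps used for slicing and the linear part of the triangle
  involution used later, whose determinant is -1.\<close>

lemma distr_unimodular:
  fixes U V :: "real^2 \<Rightarrow> real^2"
  assumes U: "linear U" and V: "linear V" and inv: "\<And>x. V (U x) = x" "\<And>x. U (V x) = x" and det: "\<bar>det (matrix V)\<bar> = 1"
  shows "distr lborel borel U = lborel"
proof (rule lborel_eqI[symmetric])
  have meas: "U \<in> borel_measurable borel"
    using U by (intro borel_measurable_continuous_onI linear_continuous_on) (simp add: linear_conv_bounded_linear[symmetric])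
  fix l u :: "real^2" assume lu: "\<And>b. b \<in> Basis \<Longrightarrow> l \<bullet> b \<le> u \<bullet> b"
  have vim: "U -` box l u = V ` box l u"
  proof
    show "U -` box l u \<subseteq> V ` box l u" using inv(1) by (metis image_eqI subsetI vimage_eq)
    show "V ` box l u \<subseteq> U -` box l u" using inv(2) by auto
  qed
  have lm: "V ` box l u \<in> lmeasurable" by (rule measurable_linear_image[OF V]) simp
  have "emeasure (distr lborel borel U) (box l u) = emeasure lborel (U -` box l u)"
    using meas by (subst emeasure_distr) auto
  also have "\<dots> = emeasure lebesgue (V ` box l u)"
  proof -
    have "U -` box l u \<in> sets borel" using measurable_sets[OF meas, of "box l u"] by simp
    then show ?thesis unfolding vim by (simp add: main_part_sets)
  qed
  also have "\<dots> = ennreal (measure lebesgue (V ` box l u))"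
    using fmeasurableD2[OF lm] by (intro emeasure_eq_ennreal_measure) simp
  also have "\<dots> = ennreal (measure lebesgue (box l u))"
    using det by (subst measure_linear_image[OF V]) auto
  also have "\<dots> = ennreal (\<Prod>b\<in>Basis. (u - l) \<bullet> b)"
    using lu by (simp add: measure_lborel_box_eq inner_diff_left)
  finally show "emeasure (distr lborel borel U) (box l u) = ennreal (\<Prod>b\<in>Basis. (u - l) \<bullet> b)" .
qed simp

lemma distr_orthogonal:
  fixes U :: "real^2 \<Rightarrow> real^2"
  assumes U: "orthogonal_transformation U"
  shows "distr lborel borel U = lborel"
proof (rule distr_unimodular)
  have inv: "orthogonal_transformation (inv U)" using U by (rule orthogonal_transformation_inv)
  then show "linear U" "linear (inv U)" using U by (simp_all add: orthogonal_transformation_linear)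
  have "bij U" using U by (simp add: orthogonal_transformation_bij)
  then show "inv U (U x) = x" "U (inv U x) = x" for x
    by (simp_all add: bij_is_inj bij_is_surj surj_f_inv_f)
  have "orthogonal_matrix (matrix (inv U))" using inv by (simp add: orthogonal_transformation_matrix)
  then show "\<bar>det (matrix (inv U))\<bar> = 1" using det_orthogonal_matrix by fastforce
qed

lemma orthogonal_frame:
  fixes \<tau> d :: "real^2"
  assumes "norm \<tau> = 1" "norm d = 1" "\<tau> \<bullet> d = 0"
  shows "orthogonal_transformation (\<lambda>x::real^2. x $ 1 *\<^sub>R \<tau> + x $ 2 *\<^sub>R d)"
  unfolding orthogonal_transformation_def
proof
  show "linear (\<lambda>x::real^2. x $ 1 *\<^sub>R \<tau> + x $ 2 *\<^sub>R d)"
    by (intro linearI) (simp_all add: algebra_simps)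
  have *: "\<tau> \<bullet> \<tau> = 1" "d \<bullet> d = 1" "d \<bullet> \<tau> = 0" using assms by (simp_all add: norm_eq_1 inner_commute)
  show "\<forall>v w :: real^2. (v $ 1 *\<^sub>R \<tau> + v $ 2 *\<^sub>R d) \<bullet> (w $ 1 *\<^sub>R \<tau> + w $ 2 *\<^sub>R d) = v \<bullet> w"
  proof (intro allI)
    fix v w :: "real^2"
    have "(v $ 1 *\<^sub>R \<tau> + v $ 2 *\<^sub>R d) \<bullet> (w $ 1 *\<^sub>R \<tau> + w $ 2 *\<^sub>R d) = v $ 1 * w $ 1 + v $ 2 * w $ 2"
      by (simp add: inner_add_left inner_add_right * assms(3))
    then show "(v $ 1 *\<^sub>R \<tau> + v $ 2 *\<^sub>R d) \<bullet> (w $ 1 *\<^sub>R \<tau> + w $ 2 *\<^sub>R d) = v \<bullet> w"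
      by (simp only: inner_vec_def sum_2 inner_real_def)
  qed
qed

text \<open>Tonelli's theorem is available on pairs (s, t). Their composition with an orthogonal
  frame and a translation preserves the measure and makes t run along the lines on which the trace
  estimate integrates.\<close>

lemma distr_frame:
  fixes A \<tau> d :: "real^2"
  assumes "norm \<tau> = 1" "norm d = 1" "\<tau> \<bullet> d = 0"
  shows "distr (lborel \<Otimes>\<^sub>M lborel) borel (\<lambda>(s, t). A + s *\<^sub>R \<tau> + t *\<^sub>R d) = lborel"
    and "(\<lambda>(s, t). A + s *\<^sub>R \<tau> + t *\<^sub>R d) \<in> borel_measurable (lborel \<Otimes>\<^sub>M lborel)"
proof -
  define U where "U x = x $ 1 *\<^sub>R \<tau> + x $ 2 *\<^sub>R d" for x :: "real^2"
  define V where "V = (\<lambda>(s, t). vector [s, t] :: real^2)"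
  have eq: "(\<lambda>(s, t). A + s *\<^sub>R \<tau> + t *\<^sub>R d) = (+) A \<circ> (U \<circ> V)"
    unfolding U_def V_def by (auto simp: add.assoc)
  have V: "V = (\<lambda>p. fst p *\<^sub>R axis 1 1 + snd p *\<^sub>R axis 2 1)"
    unfolding V_def by (auto simp: vec_eq_iff forall_2 axis_def)
  have mV: "V \<in> borel_measurable borel" unfolding V by (intro borel_measurable_continuous_onI continuous_intros)
  have mU: "U \<in> borel_measurable borel" unfolding U_def by (intro borel_measurable_continuous_onI continuous_intros)
  have mA: "(+) A \<in> borel_measurable borel" by measurable
  have mUV: "U \<circ> V \<in> borel_measurable borel" using mU mV by (rule measurable_comp[rotated])
  have "distr lborel borel ((+) A \<circ> (U \<circ> V)) = distr (distr (distr lborel borel V) borel U) borel ((+) A)"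
    using mV mU mA mUV by (simp add: distr_distr)
  also have "\<dots> = lborel"
    using distr_vector distr_orthogonal[OF orthogonal_frame[OF assms]] lborel_distr_plus[of A]
    unfolding V_def[symmetric] U_def[abs_def, symmetric] by simp
  finally show "distr (lborel \<Otimes>\<^sub>M lborel) borel (\<lambda>(s, t). A + s *\<^sub>R \<tau> + t *\<^sub>R d) = lborel"
    unfolding eq lborel_prod .
  have "(+) A \<circ> (U \<circ> V) \<in> borel_measurable borel" using mA mUV by (rule measurable_comp[rotated])
  then show "(\<lambda>(s, t). A + s *\<^sub>R \<tau> + t *\<^sub>R d) \<in> borel_measurable (lborel \<Otimes>\<^sub>M lborel)"
    unfolding eq lborel_prod by simp
qed

section \<open>The trace estimate by integration along parallel lines\<close>

context mesh_domain
begin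

definition skeleton :: "(real^2) set" where "skeleton = (\<Union>T\<in>\<T>. frontier T)"

lemma negligible_skeleton: "negligible skeleton"
  unfolding skeleton_def using finite_mesh convex_cell
  by (intro negligible_Union) (auto intro: negligible_convex_frontier)

lemma closed_skeleton: "closed skeleton"
  unfolding skeleton_def using finite_mesh by (intro closed_UN) auto

lemma core_or_outside: "x \<notin> skeleton \<Longrightarrow> x \<in> core \<or> x \<notin> closure \<Omega>"
  unfolding skeleton_def core_def Union_mesh[symmetric] frontier_def using closure_subset by blast

text \<open>Upgrades null slices to finite ones, because the form of the fundamental theorem used on
  slices allows only finitely many points without a derivative.\<close>

lemma slice_skeleton_finite:
  assumes "d \<noteq> 0" "AE t in lborel. x + t *\<^sub>R d \<notin> skeleton"
  shows "finite {t. x + t *\<^sub>R d \<in> skeleton}"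
proof -
  have "finite {t. x + t *\<^sub>R d \<in> frontier T}" if T: "T \<in> \<T>" for T
  proof (rule negligible_slice_finite[OF convex_cell[OF T] compact_imp_closed[OF compact_cell[OF T]] assms(1)])
    have "closed {t. x + t *\<^sub>R d \<in> frontier T}"
      using continuous_closed_vimage[of "frontier T" "\<lambda>t. x + t *\<^sub>R d"]
      by (auto simp: vimage_def intro!: continuous_intros)
    then have "{t. x + t *\<^sub>R d \<in> frontier T} \<in> sets lborel" by simp
    moreover have "AE t in lborel. x + t *\<^sub>R d \<notin> frontier T"
      using assms(2) by eventually_elim (use T in \<open>auto simp: skeleton_def\<close>)
    ultimately show "emeasure lborel {t. x + t *\<^sub>R d \<in> frontier T} = 0"
      using AE_iff_measurable[of "{t. x + t *\<^sub>R d \<in> frontier T}" lborel "\<lambda>t. x + t *\<^sub>R d \<notin> frontier T"] by simp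
  qed
  moreover have "{t. x + t *\<^sub>R d \<in> skeleton} = (\<Union>T\<in>\<T>. {t. x + t *\<^sub>R d \<in> frontier T})"
    unfolding skeleton_def by blast
  ultimately show ?thesis using finite_mesh by simp
qed

text \<open>The start x may lie on the frontier and carry a nonzero value of w. \<open>entry\<close>
  keeps the ray inside \<Omega> for a while, so the vanishing of the extension off \<Omega> is only
  used from \<epsilon> on, and the extension is Lipschitz up to t = 0. R exceeds all distances in
  the closed domain, so the ray has left it at t = R.\<close>

lemma slice_inequality:
  assumes w: "pc1 w" and fin: "finite {t. x + t *\<^sub>R d \<in> skeleton}" and x: "x \<in> closure \<Omega>" and d: "norm d = 1"
    and R: "\<And>y z. y \<in> closure \<Omega> \<Longrightarrow> z \<in> closure \<Omega> \<Longrightarrow> norm (y - z) < R"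
    and entry: "\<epsilon> > 0" "\<And>t. 0 < t \<Longrightarrow> t < \<epsilon> \<Longrightarrow> x + t *\<^sub>R d \<in> \<Omega>"
    and exit: "\<And>t. 0 < t \<Longrightarrow> x + t *\<^sub>R d \<in> frontier \<Omega> \<Longrightarrow> w (x + t *\<^sub>R d) = 0"
  shows "ennreal ((w x)\<^sup>2) \<le> ennreal R *
    (\<integral>\<^sup>+t. ennreal (indicator core (x + t *\<^sub>R d) * (directional d w (x + t *\<^sub>R d))\<^sup>2) \<partial>lborel)"
proof -
  define f where "f t = zero_ext w (x + t *\<^sub>R d)" for t
  define g where "g t = indicator core (x + t *\<^sub>R d) * directional d w (x + t *\<^sub>R d)" for t
  have "R > 0" using R[OF x x] by simp
  obtain L where L: "L \<ge> 0" "\<And>T x y. T \<in> \<T> \<Longrightarrow> x \<in> T \<Longrightarrow> y \<in> T \<Longrightarrow> \<bar>w x - w y\<bar> \<le> L * norm (x - y)"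
    using pc1_lipschitz[OF w] by blast
  have outside: "zero_ext w (x + t *\<^sub>R d) = 0" if "0 < t" "x + t *\<^sub>R d \<notin> \<Omega>" for t
    using that exit[of t] open_domain unfolding zero_ext_def frontier_def by (auto simp: interior_open)
  have "(L * norm d)-lipschitz_on {0..R} f"
    unfolding f_def
  proof (rule line_lipschitz[OF cell_line_lipschitz[OF L(2,1)]])
    show "closed ({t. x + t *\<^sub>R d \<notin> \<Omega>} \<inter> {\<epsilon>..})" by (intro closed_Int closed_line_complement closed_atLeast)
    show "zero_ext w (x + t *\<^sub>R d) = 0" if "t \<in> {t. x + t *\<^sub>R d \<notin> \<Omega>} \<inter> {\<epsilon>..}" for t
      using that entry(1) by (intro outside) auto
    show "{0..R} \<subseteq> {t. x + t *\<^sub>R d \<in> closure \<Omega>} \<union> ({t. x + t *\<^sub>R d \<notin> \<Omega>} \<inter> {\<epsilon>..})"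
    proof
      fix t assume "t \<in> {0..R}"
      moreover have "x + t *\<^sub>R d \<in> closure \<Omega>" if "t = 0" using x that by simp
      moreover have "x + t *\<^sub>R d \<in> closure \<Omega>" if "0 < t" "t < \<epsilon>" using entry(2)[OF that] closure_subset by blast
      ultimately show "t \<in> {t. x + t *\<^sub>R d \<in> closure \<Omega>} \<union> ({t. x + t *\<^sub>R d \<notin> \<Omega>} \<inter> {\<epsilon>..})"
        using closure_subset by (cases "t = 0"; cases "t < \<epsilon>") auto
    qed
  qed (use L(1) in auto)
  then have cont: "continuous_on {0..R} f" by (rule lipschitz_on_continuous_on)
  have deriv: "(f has_real_derivative g t) (at t)" if "x + t *\<^sub>R d \<notin> skeleton" for t
  proof -
    have "((\<lambda>s. zero_ext w ((x + t *\<^sub>R d) + s *\<^sub>R d)) has_real_derivative g t) (at 0)"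
      unfolding g_def by (rule zero_ext_has_derivative[OF w core_or_outside[OF that]])
    moreover have "zero_ext w ((x + t *\<^sub>R d) + s *\<^sub>R d) = f (s + t)" for s
      unfolding f_def by (simp add: algebra_simps)
    ultimately have "((\<lambda>s. f (s + t)) has_real_derivative g t) (at 0)" by simp
    then show ?thesis using DERIV_shift[of f "g t" 0 t] by simp
  qed
  have fR: "f R = 0"
  proof -
    have "norm ((x + R *\<^sub>R d) - x) = R" using d \<open>R > 0\<close> by simp
    then have "x + R *\<^sub>R d \<notin> closure \<Omega>" using R[of "x + R *\<^sub>R d" x] x by auto
    then show ?thesis unfolding f_def zero_ext_def by simp
  qed
  have G: "(\<lambda>y. indicator core y * directional d w y) \<in> borel_measurable borel"
    using borel_measurable_continuous_on_indicator[of core "directional d w"] open_core pc1_deriv_continuous[OF w]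
    unfolding directional_def[abs_def] by (simp add: continuous_on_sum continuous_on_mult)
  have "(\<lambda>t. x + t *\<^sub>R d) \<in> borel_measurable borel" by (intro borel_measurable_continuous_onI continuous_intros)
  from measurable_compose[OF this G] have meas: "g \<in> borel_measurable borel" unfolding g_def .
  obtain M where M: "\<And>j x. x \<in> core \<Longrightarrow> \<bar>partial_deriv j w x\<bar> \<le> M j" using pc1_deriv_bounded[OF w] by metis
  have bound: "\<bar>g t\<bar> \<le> (\<Sum>j\<in>UNIV. \<bar>d $ j\<bar> * \<bar>M j\<bar>)" for t
  proof (cases "x + t *\<^sub>R d \<in> core")
    case True
    then have "\<bar>g t\<bar> \<le> (\<Sum>j\<in>UNIV. \<bar>d $ j * partial_deriv j w (x + t *\<^sub>R d)\<bar>)"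
      unfolding g_def directional_def by (simp add: sum_abs)
    also have "\<dots> \<le> (\<Sum>j\<in>UNIV. \<bar>d $ j\<bar> * \<bar>M j\<bar>)"
      using M[OF True] unfolding abs_mult by (intro sum_mono mult_left_mono) (auto intro: order_trans[OF _ abs_ge_self])
    finally show ?thesis .
  qed (simp add: g_def sum_nonneg)
  have "ennreal ((f 0)\<^sup>2) \<le> ennreal R * (\<integral>\<^sup>+t. ennreal ((g t)\<^sup>2) * indicator {0..R} t \<partial>lborel)"
    by (rule square_le_integral_derivative_square[OF fin \<open>R > 0\<close> cont _ fR meas bound]) (use deriv in auto)
  also have "\<dots> \<le> ennreal R * (\<integral>\<^sup>+t. ennreal (indicator core (x + t *\<^sub>R d) * (directional d w (x + t *\<^sub>R d))\<^sup>2) \<partial>lborel)"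
    by (intro mult_left_mono nn_integral_mono) (auto simp: g_def indicator_def)
  finally show ?thesis using x unfolding f_def zero_ext_def by simp
qed

text \<open>Almost every ray meets the skeleton in a finite set, so \<open>slice_inequality\<close>
  applies to almost every s, and Tonelli in the frame coordinates collects the ray integrals into
  one integral over the domain. The factor R is the length of the slices.\<close>

theorem trace_inequality:
  assumes w: "pc1 w" and frame: "norm \<tau> = 1" "norm d = 1" "\<tau> \<bullet> d = 0"
    and R: "0 \<le> R" "\<And>y z. y \<in> closure \<Omega> \<Longrightarrow> z \<in> closure \<Omega> \<Longrightarrow> norm (y - z) < R"
    and side: "\<And>s. s \<in> {0..b} \<Longrightarrow> A + s *\<^sub>R \<tau> \<in> closure \<Omega>"
    and entry: "\<And>s. s \<in> {0<..<b} \<Longrightarrow> \<exists>\<epsilon>>0. \<forall>t. 0 < t \<and> t < \<epsilon> \<longrightarrow> A + s *\<^sub>R \<tau> + t *\<^sub>R d \<in> \<Omega>"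
    and exit: "\<And>s t. s \<in> {0<..<b} \<Longrightarrow> 0 < t \<Longrightarrow> A + s *\<^sub>R \<tau> + t *\<^sub>R d \<in> frontier \<Omega> \<Longrightarrow> w (A + s *\<^sub>R \<tau> + t *\<^sub>R d) = 0"
  shows "integral {0..b} (\<lambda>s. (w (A + s *\<^sub>R \<tau>))\<^sup>2) \<le> R * (LINT x|lebesgue_on \<Omega>. (directional d w x)\<^sup>2)"
proof -
  define \<Phi> where "\<Phi> = (\<lambda>(s, t). A + s *\<^sub>R \<tau> + t *\<^sub>R d)"
  define h where "h x = indicator core x * (directional d w x)\<^sup>2" for x
  define J where "J = (LINT x|lebesgue_on \<Omega>. (directional d w x)\<^sup>2)"
  have \<Phi>: "distr (lborel \<Otimes>\<^sub>M lborel) borel \<Phi> = lborel" "\<Phi> \<in> borel_measurable (lborel \<Otimes>\<^sub>M lborel)"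
    unfolding \<Phi>_def using distr_frame[OF frame] by auto
  have h: "h \<in> borel_measurable borel"
  proof -
    have "continuous_on core (\<lambda>x. (directional d w x)\<^sup>2)"
      unfolding directional_def using pc1_deriv_continuous[OF w] by (intro continuous_intros)
    from borel_measurable_continuous_on_indicator[OF _ this] show ?thesis
      unfolding h_def using open_core by simp
  qed
  have "AE x in lborel. x \<notin> skeleton"
  proof -
    have "skeleton \<in> null_sets lborel"
      using negligible_skeleton closed_skeleton by (simp add: negligible_iff_null_sets null_sets_completion_iff)
    then show ?thesis by (rule AE_not_in)
  qed
  then have "AE x in distr (lborel \<Otimes>\<^sub>M lborel) borel \<Phi>. x \<notin> skeleton" unfolding \<Phi>(1) .
  from AE_distrD[OF \<Phi>(2) this] have "AE p in lborel \<Otimes>\<^sub>M lborel. \<Phi> p \<notin> skeleton" .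
  from lborel_pair.AE_pair[OF this] have AE: "AE s in lborel. AE t in lborel. \<Phi> (s, t) \<notin> skeleton" .
  have J: "(\<integral>\<^sup>+x. ennreal (h x) \<partial>lborel) = ennreal J"
  proof -
    have bm: "bounded_meas \<Omega> (\<lambda>x. (directional d w x)\<^sup>2)"
      unfolding power2_eq_square by (intro bounded_meas_mult bounded_meas_directional w)
    have int: "integrable lebesgue (\<lambda>x. indicator \<Omega> x * (directional d w x)\<^sup>2)"
      using bounded_meas_integrable[OF open_domain bounded_domain bm] unfolding integral_lebesgue_on(2)[OF open_domain] .
    have "(\<integral>\<^sup>+x. ennreal (h x) \<partial>lborel) = (\<integral>\<^sup>+x. ennreal (h x) \<partial>lebesgue)"
      using h by (simp add: nn_integral_completion)
    also have "\<dots> = (\<integral>\<^sup>+x. ennreal (indicator \<Omega> x * (directional d w x)\<^sup>2) \<partial>lebesgue)"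
      by (rule nn_integral_cong_AE)
         (use indicator_core_AE[of "\<lambda>x. (directional d w x)\<^sup>2"] in eventually_elim, simp only: h_def)
    also have "\<dots> = ennreal J"
      unfolding J_def integral_lebesgue_on(1)[OF open_domain] using int by (intro nn_integral_eq_integral) auto
    finally show ?thesis .
  qed
  define F where "F s = (w (A + s *\<^sub>R \<tau>))\<^sup>2" for s
  have "continuous_on {0..b} (\<lambda>s. w (A + s *\<^sub>R \<tau>))"
    by (rule continuous_on_compose2[OF pc1_continuous[OF w]]) (use side in \<open>auto intro!: continuous_intros\<close>)
  then have "continuous_on {0..b} F" unfolding F_def by (intro continuous_intros)
  then have "(F has_integral integral {0..b} F) {0..b}" by (intro integrable_integral integrable_continuous_real)
  from nn_integral_has_integral_lebesgue[OF _ this]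
  have "ennreal (integral {0..b} F) = (\<integral>\<^sup>+s. ennreal (indicator {0..b} s * F s) \<partial>lborel)"
    by (simp add: F_def)
  also have "\<dots> \<le> (\<integral>\<^sup>+s. ennreal R * (\<integral>\<^sup>+t. ennreal (h (\<Phi> (s, t))) \<partial>lborel) \<partial>lborel)"
  proof (rule nn_integral_mono_AE)
    \<comment> \<open>At the two ends of the side neither \<open>entry\<close> nor
      \<open>exit\<close> is available.\<close>
    have "AE s in lborel. s \<notin> {0, b}" by (intro AE_not_in finite_imp_null_set_lborel) simp
    with AE show "AE s in lborel. ennreal (indicator {0..b} s * F s) \<le> ennreal R * (\<integral>\<^sup>+t. ennreal (h (\<Phi> (s, t))) \<partial>lborel)"
    proof eventually_elim
      case (elim s)
      show ?case
      proof (cases "s \<in> {0..b}")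
        case True
        then have s: "s \<in> {0<..<b}" using elim(2) by auto
        obtain \<epsilon> where e: "\<epsilon> > 0" "\<And>t. 0 < t \<Longrightarrow> t < \<epsilon> \<Longrightarrow> A + s *\<^sub>R \<tau> + t *\<^sub>R d \<in> \<Omega>" using entry[OF s] by blast
        have "finite {t. A + s *\<^sub>R \<tau> + t *\<^sub>R d \<in> skeleton}"
          using elim(1) frame(2) by (intro slice_skeleton_finite) (auto simp: \<Phi>_def)
        from slice_inequality[OF w this side[OF True] frame(2) R(2) e exit[OF s]]
        show ?thesis using True unfolding F_def h_def \<Phi>_def by simp
      qed simp
    qed
  qed
  also have "\<dots> = ennreal R * (\<integral>\<^sup>+s. (\<integral>\<^sup>+t. ennreal (h (\<Phi> (s, t))) \<partial>lborel) \<partial>lborel)"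
  proof (rule nn_integral_cmult)
    show "(\<lambda>s. \<integral>\<^sup>+t. ennreal (h (\<Phi> (s, t))) \<partial>lborel) \<in> borel_measurable lborel"
      using measurable_compose[OF measurable_compose[OF \<Phi>(2) h] measurable_ennreal]
      by (intro lborel.borel_measurable_nn_integral) (simp add: case_prod_unfold)
  qed
  also have "(\<integral>\<^sup>+s. (\<integral>\<^sup>+t. ennreal (h (\<Phi> (s, t))) \<partial>lborel) \<partial>lborel) = (\<integral>\<^sup>+p. ennreal (h (\<Phi> p)) \<partial>(lborel \<Otimes>\<^sub>M lborel))"
    using measurable_compose[OF measurable_compose[OF \<Phi>(2) h] measurable_ennreal]
    by (intro lborel.nn_integral_fst)
  also have "\<dots> = (\<integral>\<^sup>+x. ennreal (h x) \<partial>(distr (lborel \<Otimes>\<^sub>M lborel) borel \<Phi>))"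
    using \<Phi>(2) h by (subst nn_integral_distr) auto
  also have "\<dots> = ennreal J" unfolding \<Phi>(1) J ..
  finally have "ennreal (integral {0..b} F) \<le> ennreal (R * J)" using R(1) by (simp add: ennreal_mult')
  moreover have "0 \<le> J" unfolding J_def by (intro integral_nonneg_AE AE_I2) simp
  ultimately show ?thesis using R(1) unfolding F_def J_def by (simp add: ennreal_le_iff)
qed

end

section \<open>Polygons\<close>

context
  fixes vs :: "(real^2) list"
  assumes poly: "simple_polygon vs"
begin

lemma polygon_length: "3 \<le> length vs" and polygon_distinct: "distinct vs"
  using poly unfolding simple_polygon_def by auto

lemma polygon_length_pos: "0 < length vs" "1 < length vs"
  using polygon_length by linarith+

lemma polygon_vertex_inj: "i < length vs \<Longrightarrow> j < length vs \<Longrightarrow> vs ! i = vs ! j \<longleftrightarrow> i = j"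
  using polygon_distinct nth_eq_iff_index_eq by blast

lemma polygon_sides_inter:
  assumes "i < length vs" "j < length vs" "i \<noteq> j"
  shows "polygon_side vs i \<inter> polygon_side vs j =
    {vs ! i, vs ! (Suc i mod length vs)} \<inter> {vs ! j, vs ! (Suc j mod length vs)}"
  using poly assms unfolding simple_polygon_def by blast

text \<open>Adding one side at a time keeps an arc: by simplicity of the polygon the new side meets
  the earlier ones at most in its starting vertex. The last side is left out, since it closes the
  curve.\<close>

lemma polygon_arc:
  assumes "1 \<le> k" "k < length vs"
  shows "\<exists>g. arc g \<and> pathstart g = vs ! 0 \<and> pathfinish g = vs ! k \<and> path_image g = (\<Union>i<k. polygon_side vs i)"
  using assms
proof (induction k rule: dec_induct)
  case base
  have "vs ! 0 \<noteq> vs ! 1" using polygon_vertex_inj[OF polygon_length_pos] by simp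
  then show ?case using polygon_length
    by (intro exI[of _ "linepath (vs ! 0) (vs ! 1)"]) (auto simp: polygon_side_def lessThan_Suc)
next
  case (step k)
  then obtain g where g: "arc g" "pathstart g = vs ! 0" "pathfinish g = vs ! k"
    "path_image g = (\<Union>i<k. polygon_side vs i)" by auto
  let ?l = "linepath (vs ! k) (vs ! Suc k)"
  have k: "polygon_side vs k = closed_segment (vs ! k) (vs ! Suc k)" using step by (simp add: polygon_side_def)
  have "polygon_side vs i \<inter> polygon_side vs k \<subseteq> {vs ! k}" if "i < k" for i
    using polygon_sides_inter[of i k] that step polygon_vertex_inj[of i "Suc k"] polygon_vertex_inj[of "Suc i" "Suc k"]
    by auto
  then have "path_image g \<inter> path_image ?l \<subseteq> {vs ! k}" unfolding g(4) using k by auto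
  moreover have "arc ?l" using polygon_vertex_inj[of k "Suc k"] step by simp
  ultimately have "arc (g +++ ?l)" using g(1,3) by (intro arc_join) auto
  moreover have "path_image (g +++ ?l) = (\<Union>i<Suc k. polygon_side vs i)"
    using g(3,4) k by (subst path_image_join) (auto simp: lessThan_Suc)
  ultimately show ?case using g(2) by (intro exI[of _ "g +++ ?l"]) simp
qed

text \<open>In this form the Jordan-Brouwer theorems apply to the polygon.\<close>

lemma polygon_homeomorphic_circle: "\<Union>(polygon_sides vs) homeomorphic sphere (0::real^2) 1"
proof -
  define N where "N = length vs - 1"
  have N: "1 \<le> N" "N < length vs" "Suc N = length vs" using polygon_length unfolding N_def by auto
  obtain g where g: "arc g" "pathstart g = vs ! 0" "pathfinish g = vs ! N"
    "path_image g = (\<Union>i<N. polygon_side vs i)" using polygon_arc[OF N(1,2)] by blast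
  let ?l = "linepath (vs ! N) (vs ! 0)"
  have side: "polygon_side vs N = path_image ?l" unfolding polygon_side_def N(3) by simp
  have "polygon_side vs i \<inter> polygon_side vs N \<subseteq> {vs ! N, vs ! 0}" if "i < N" for i
    using polygon_sides_inter[of i N] that N by auto
  then have "path_image g \<inter> path_image ?l \<subseteq> {pathstart g, pathstart ?l}" unfolding g side[symmetric] by auto
  moreover have "arc ?l" using polygon_vertex_inj[OF N(2) polygon_length_pos(1)] N(1) by simp
  ultimately have "simple_path (g +++ ?l)" using g by (intro simple_path_join_loop) auto
  then have "path_image (g +++ ?l) homeomorphic sphere (0::complex) 1"
    using g by (intro homeomorphic_simple_path_image_circle) auto
  moreover have "path_image (g +++ ?l) = \<Union>(polygon_sides vs)"
    using g side by (subst path_image_join) (auto simp: polygon_sides_def N(3)[symmetric] lessThan_Suc)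
  moreover have "sphere (0::complex) 1 homeomorphic sphere (0::real^2) 1"
    by (rule homeomorphic_spheres_gen) auto
  ultimately show ?thesis using homeomorphic_trans by metis
qed

lemma polygon_side_neighbour:
  assumes ij: "i < length vs" "j < length vs" "i \<noteq> j" and p: "p \<in> {vs ! j, vs ! (Suc j mod length vs)}"
  shows "p \<in> closure (polygon_side vs j - polygon_side vs i)"
proof -
  have "Suc j mod length vs \<noteq> j" using polygon_length ij(2) by (cases "Suc j = length vs") auto
  then have ne: "vs ! j \<noteq> vs ! (Suc j mod length vs)"
    using polygon_vertex_inj[OF ij(2), of "Suc j mod length vs"] mod_less_divisor[OF polygon_length_pos(1)] by auto
  have "open_segment (vs ! j) (vs ! (Suc j mod length vs)) \<subseteq> polygon_side vs j - polygon_side vs i"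
    using polygon_sides_inter[OF ij] unfolding open_segment_def polygon_side_def by blast
  from closure_mono[OF this] show ?thesis using ne p by auto
qed

text \<open>An end point of a side also belongs to a neighbouring side and is approached along the
  relative interior of that one. This later puts the corners at the ends of \<Gamma>1 into the
  closure of \<Gamma>0.\<close>

lemma polygon_side_endpoints:
  assumes "closed_segment A B \<in> polygon_sides vs" "p \<in> {A, B}"
  shows "p \<in> closure (\<Union>(polygon_sides vs) - closed_segment A B)"
proof -
  let ?n = "length vs"
  obtain i where i: "i < ?n" "closed_segment A B = polygon_side vs i"
    using assms(1) unfolding polygon_sides_def by auto
  then have "{A, B} = {vs ! i, vs ! (Suc i mod ?n)}" unfolding polygon_side_def by simp
  then consider "p = vs ! i" | "p = vs ! (Suc i mod ?n)" using assms(2) by blast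
  then obtain j where j: "j < ?n" "j \<noteq> i" "p \<in> {vs ! j, vs ! (Suc j mod ?n)}"
  proof cases
    case 1
    show ?thesis
    proof (cases i)
      case 0
      \<comment> \<open>Indices are cyclic: the side ending in the first vertex is the last
        one.\<close>
      have "?n - 1 < ?n" "Suc (?n - 1) = ?n" "?n - 1 \<noteq> 0" using polygon_length by linarith+
      then show ?thesis using that[of "?n - 1"] 1 0 by auto
    next
      case (Suc k)
      then show ?thesis using that[of k] 1 i by auto
    qed
  next
    case 2
    have "Suc i mod ?n \<noteq> i" using polygon_length i(1) by (cases "Suc i = ?n") auto
    then show ?thesis using that[of "Suc i mod ?n"] 2 mod_less_divisor[OF polygon_length_pos(1)] by auto
  qed
  have "polygon_side vs j - polygon_side vs i \<subseteq> \<Union>(polygon_sides vs) - closed_segment A B"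
    using j(1) i unfolding polygon_sides_def by auto
  then show ?thesis using polygon_side_neighbour[OF i(1) j(1) j(2)[symmetric] j(3)] closure_mono by blast
qed

end

text \<open>By the Jordan curve theorem a connected domain lies on one side of each boundary polygon.\<close>

lemma polygonal_domain_interior_closure:
  assumes "polygonal_domain \<Omega> \<P>"
  shows "interior (closure \<Omega>) = \<Omega>"
proof
  have \<Omega>: "open \<Omega>" "connected \<Omega>" "\<Omega> \<noteq> {}" "\<And>vs. vs \<in> \<P> \<Longrightarrow> simple_polygon vs"
    and fr: "frontier \<Omega> = (\<Union>vs\<in>\<P>. \<Union>(polygon_sides vs))"
    using assms unfolding polygonal_domain_def by auto
  show "\<Omega> \<subseteq> interior (closure \<Omega>)" using \<Omega>(1) closure_subset interior_maximal by blast
  show "interior (closure \<Omega>) \<subseteq> \<Omega>"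
  proof
    fix z assume z: "z \<in> interior (closure \<Omega>)"
    show "z \<in> \<Omega>"
    proof (rule ccontr)
      assume "z \<notin> \<Omega>"
      then have "z \<in> frontier \<Omega>" using z interior_subset \<Omega>(1) by (auto simp: frontier_def interior_open)
      then obtain vs where vs: "vs \<in> \<P>" "z \<in> \<Union>(polygon_sides vs)" using fr by blast
      define C where "C = \<Union>(polygon_sides vs)"
      have C: "C homeomorphic sphere (0::real^2) 1"
        unfolding C_def by (rule polygon_homeomorphic_circle[OF \<Omega>(4)[OF vs(1)]])
      have "C \<subseteq> frontier \<Omega>" unfolding C_def fr using vs(1) by blast
      then have sub: "\<Omega> \<subseteq> - C" using \<Omega>(1) by (auto simp: frontier_def interior_open)
      have ncon: "\<not> connected (- C)" by (rule Jordan_Brouwer_separation[OF C]) simp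
      obtain x0 where x0: "x0 \<in> \<Omega>" using \<Omega>(3) by blast
      define D where "D = connected_component_set (- C) x0"
      have D: "D \<in> components (- C)" unfolding D_def using x0 sub by (intro componentsI) blast
      have \<Omega>D: "\<Omega> \<subseteq> D" unfolding D_def by (rule connected_component_maximal[OF x0 \<Omega>(2) sub])
      have "D \<noteq> - C" using ncon D in_components_connected by blast
      then obtain x1 where x1: "x1 \<in> - C" "x1 \<notin> D" using in_components_subset[OF D] by blast
      define D' where "D' = connected_component_set (- C) x1"
      have D': "D' \<in> components (- C)" unfolding D'_def using x1 by (intro componentsI)
      have "x1 \<in> D'" unfolding D'_def using x1 by simp
      then have "D \<noteq> D'" using x1(2) by blast
      then have disj: "D \<inter> D' = {}" using components_nonoverlap[OF D D'] by blast
      have "closed C" using C compact_imp_closed homeomorphic_compactness compact_sphere by blast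
      then have "open D'" using D' open_components by blast
      \<comment> \<open>Every component of the complement has the whole curve as its frontier, so
        D', which avoids \<Omega>, comes arbitrarily close to z.\<close>
      have "frontier D' = C" by (rule Jordan_Brouwer_frontier[OF C D']) simp
      then have "z \<in> closure D'" using vs(2) unfolding C_def frontier_def by blast
      then have "interior (closure \<Omega>) \<inter> D' \<noteq> {}"
        using z open_Int_closure_eq_empty[OF open_interior, of "closure \<Omega>" D'] by blast
      then have "closure \<Omega> \<inter> D' \<noteq> {}" using interior_subset by blast
      then have "\<Omega> \<inter> D' \<noteq> {}" using open_Int_closure_eq_empty[OF \<open>open D'\<close>, of \<Omega>] by blast
      then show False using \<Omega>D disj by blast
    qed
  qed
qed

section \<open>Triangles\<close>

lemma triangle_vertices:
  assumes "2 simplex (T :: (real^2) set)"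
  obtains a b c where "a \<noteq> b" "a \<noteq> c" "b \<noteq> c" "\<not> affine_dependent {a, b, c}" "\<not> collinear {a, b, c}"
    "T = convex hull {a, b, c}" "vertices_of T = {a, b, c}"
proof -
  obtain C where C: "\<not> affine_dependent C" "int (card C) = 2 + 1" "T = convex hull C"
    using assms unfolding simplex_def by blast
  then have "card C = 3" by simp
  then obtain a b c where abc: "C = {a, b, c}" "a \<noteq> b" "a \<noteq> c" "b \<noteq> c" by (auto simp: card_3_iff)
  have "vertices_of T = C"
    unfolding vertices_of_def C(3) extreme_point_of_convex_hull_affine_independent[OF C(1)] by simp
  moreover have "\<not> collinear {a, b, c}" using C(1) abc by (simp add: collinear_3_eq_affine_dependent)
  ultimately show ?thesis using that[of a b c] abc C by simp
qed

lemma triangle_interior_nonempty: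
  assumes "2 simplex (T :: (real^2) set)"
  shows "interior T \<noteq> {}"
proof -
  obtain a b c where "\<not> collinear {a, b, c}" "T = convex hull {a, b, c}" using triangle_vertices[OF assms] by metis
  then have "interior T = {v. \<exists>x y z. 0 < x \<and> 0 < y \<and> 0 < z \<and> x + y + z = 1 \<and> x *\<^sub>R a + y *\<^sub>R b + z *\<^sub>R c = v}"
    using interior_convex_hull_3_minimal[of a b c] by simp
  then have "(1/3) *\<^sub>R a + (1/3) *\<^sub>R b + (1/3) *\<^sub>R c \<in> interior T"
    by (auto intro!: exI[of _ "1/3::real"])
  then show ?thesis by blast
qed

text \<open>A point with three positive barycentric coordinates is interior, so one coordinate is 0
  and the point lies on the opposite side.\<close>

lemma triangle_frontier_side:
  assumes "2 simplex (T :: (real^2) set)" "y \<in> T" "y \<notin> interior T"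
  shows "\<exists>a\<in>vertices_of T. \<exists>b\<in>vertices_of T. a \<noteq> b \<and> y \<in> closed_segment a b"
proof -
  obtain a b c where abc: "a \<noteq> b" "a \<noteq> c" "b \<noteq> c" "\<not> collinear {a, b, c}" "T = convex hull {a, b, c}"
    "vertices_of T = {a, b, c}" using triangle_vertices[OF assms(1)] by metis
  have int: "interior T = {v. \<exists>x y z. 0 < x \<and> 0 < y \<and> 0 < z \<and> x + y + z = 1 \<and> x *\<^sub>R a + y *\<^sub>R b + z *\<^sub>R c = v}"
    using interior_convex_hull_3_minimal[of a b c] abc by simp
  obtain u v w where uvw: "y = u *\<^sub>R a + v *\<^sub>R b + w *\<^sub>R c" "0 \<le> u" "0 \<le> v" "0 \<le> w" "u + v + w = 1"
    using assms(2) unfolding abc(5) convex_hull_3 by blast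
  have "\<not> (0 < u \<and> 0 < v \<and> 0 < w)" using assms(3) uvw unfolding int by blast
  then consider "u = 0" | "v = 0" | "w = 0" using uvw by linarith
  then show ?thesis
  proof cases
    case 1
    then have "v = 1 - w" "0 \<le> w" "w \<le> 1" using uvw by auto
    then have "y \<in> closed_segment b c" using uvw(1) 1 unfolding in_segment by (intro exI[of _ w]) simp
    then show ?thesis using abc by blast
  next
    case 2
    then have "u = 1 - w" "0 \<le> w" "w \<le> 1" using uvw by auto
    then have "y \<in> closed_segment a c" using uvw(1) 2 unfolding in_segment by (intro exI[of _ w]) simp
    then show ?thesis using abc by blast
  next
    case 3
    then have "u = 1 - v" "0 \<le> v" "v \<le> 1" using uvw by auto
    then have "y \<in> closed_segment a b" using uvw(1) 3 unfolding in_segment by (intro exI[of _ v]) simp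
    then show ?thesis using abc by blast
  qed
qed

text \<open>Subtracting one point turns affine into linear independence, and the extended linear
  functional is represented by an inner product. This yields the nodal basis functions of degree
  1.\<close>

lemma affine_interpolation:
  fixes C :: "(real^2) set" and y :: "real^2 \<Rightarrow> real"
  assumes "\<not> affine_dependent C" "C \<noteq> {}"
  shows "\<exists>\<alpha> \<beta>. \<forall>v\<in>C. \<alpha> + \<beta> \<bullet> v = y v"
proof -
  obtain c where c: "c \<in> C" using assms(2) by blast
  define D where "D = (\<lambda>v. v - c) ` (C - {c})"
  have "D = (\<lambda>x. - c + x) ` (C - {c})" unfolding D_def by (intro image_cong) auto
  then have "independent D" using assms(1) affine_dependent_iff_dependent2[OF c] by (simp only:) blast
  define f where "f d = y (d + c) - y c" for d
  obtain g where g: "linear g" "\<And>d. d \<in> D \<Longrightarrow> g d = f d"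
    using linear_independent_extend[OF \<open>independent D\<close>, of f] by blast
  obtain \<beta> where \<beta>: "\<And>x. g x = \<beta> \<bullet> x"
  proof -
    have "g x = adjoint g 1 \<bullet> x" for x using adjoint_works[OF g(1), of x 1] by (simp add: inner_commute)
    then show ?thesis using that by blast
  qed
  have "y c - \<beta> \<bullet> c + \<beta> \<bullet> v = y v" if "v \<in> C" for v
  proof (cases "v = c")
    case False
    then have "v - c \<in> D" using that unfolding D_def by blast
    then have "\<beta> \<bullet> (v - c) = y v - y c" using g(2) \<beta> unfolding f_def by simp
    then show ?thesis by (simp add: inner_diff_right)
  qed simp
  then show ?thesis by blast
qed

section \<open>Polynomials on triangles and segments\<close>

lemma elementary_power: "\<phi> \<in> elementary \<Longrightarrow> (\<lambda>x. \<phi> x ^ k) \<in> elementary"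
  by (induction k) (auto intro: elementary.const elementary.mult)

lemma elementary_sum:
  assumes "\<And>i. i \<in> I \<Longrightarrow> \<phi> i \<in> elementary"
  shows "(\<lambda>x. \<Sum>i\<in>I. \<phi> i x) \<in> elementary"
  using assms
proof (induction I rule: infinite_finite_induct)
  case (insert i I)
  then show ?case using elementary.add[of "\<phi> i" "\<lambda>x. \<Sum>i\<in>I. \<phi> i x"] by simp
qed (auto intro: elementary.const)

lemma poly_on_elementary:
  assumes "poly_on k S w"
  shows "\<exists>P\<in>elementary. \<forall>x\<in>S. w x = P x"
proof -
  obtain c where c: "\<forall>x\<in>S. w x = (\<Sum>i\<le>k. \<Sum>j\<le>k - i. c i j * (x $ 1) ^ i * (x $ 2) ^ j)"
    using assms unfolding poly_on_def by blast
  define P where "P = (\<lambda>x::real^2. \<Sum>i\<le>k. \<Sum>j\<le>k - i. c i j * (x $ 1) ^ i * (x $ 2) ^ j)"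
  have "P \<in> elementary" unfolding P_def
    by (intro elementary_sum elementary.mult elementary_power elementary.const elementary.coord)
  moreover have "\<forall>x\<in>S. w x = P x" using c by (simp add: P_def)
  ultimately show ?thesis by blast
qed

lemma poly_on_add:
  assumes "poly_on k S v" "poly_on k S w"
  shows "poly_on k S (\<lambda>x. v x + w x)"
proof -
  obtain c c' where "\<forall>x\<in>S. v x = (\<Sum>i\<le>k. \<Sum>j\<le>k - i. c i j * (x $ 1) ^ i * (x $ 2) ^ j)"
    "\<forall>x\<in>S. w x = (\<Sum>i\<le>k. \<Sum>j\<le>k - i. c' i j * (x $ 1) ^ i * (x $ 2) ^ j)"
    using assms unfolding poly_on_def by blast
  then show ?thesis unfolding poly_on_def
    by (intro exI[of _ "\<lambda>i j. c i j + c' i j"]) (simp add: distrib_right sum.distrib)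
qed

lemma poly_on_cmult:
  assumes "poly_on k S w"
  shows "poly_on k S (\<lambda>x. r * w x)"
proof -
  obtain c where "\<forall>x\<in>S. w x = (\<Sum>i\<le>k. \<Sum>j\<le>k - i. c i j * (x $ 1) ^ i * (x $ 2) ^ j)"
    using assms unfolding poly_on_def by blast
  then show ?thesis unfolding poly_on_def
    by (intro exI[of _ "\<lambda>i j. r * c i j"]) (simp add: sum_distrib_left mult.assoc)
qed

lemma poly_on_zero: "poly_on k S (\<lambda>x. 0)"
  unfolding poly_on_def by (intro exI[of _ "\<lambda>i j. 0"]) simp

lemma poly_on_cong: "(\<And>x. x \<in> S \<Longrightarrow> v x = w x) \<Longrightarrow> poly_on k S v \<longleftrightarrow> poly_on k S w"
  unfolding poly_on_def by auto

lemma atMost_2: "{..2::nat} = {0, 1, 2}" "{..1::nat} = {0, 1}" by auto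

lemma poly_on_1_affine:
  assumes "poly_on 1 S w"
  shows "\<exists>\<alpha> \<beta>. \<forall>x\<in>S. w x = \<alpha> + \<beta> \<bullet> x"
proof -
  obtain c where c: "\<forall>x\<in>S. w x = (\<Sum>i\<le>1. \<Sum>j\<le>1 - i. c i j * (x $ 1) ^ i * (x $ 2) ^ j)"
    using assms unfolding poly_on_def by blast
  have "w x = c 0 0 + (vector [c 1 0, c 0 1] :: real^2) \<bullet> x" if "x \<in> S" for x
    using c that by (simp add: atMost_2 inner_vec_def sum_2)
  then show ?thesis by blast
qed

lemma affine_poly_on_1:
  assumes "\<And>x. x \<in> S \<Longrightarrow> w x = \<alpha> + \<beta> \<bullet> x"
  shows "poly_on 1 S w"
  unfolding poly_on_def
  by (rule exI[of _ "\<lambda>i j. if i = 0 \<and> j = 0 then \<alpha> else if i = 0 then \<beta> $ 2 else \<beta> $ 1"])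
     (simp add: assms atMost_2 inner_vec_def sum_2)

lemma affine_product_poly_on_2:
  assumes "\<And>x. x \<in> S \<Longrightarrow> v x = \<alpha> + \<beta> \<bullet> x" "\<And>x. x \<in> S \<Longrightarrow> w x = \<gamma> + \<delta> \<bullet> x"
  shows "poly_on 2 S (\<lambda>x. v x * w x)"
  unfolding poly_on_def
  by (rule exI[of _ "\<lambda>i j. if i = 0 then (if j = 0 then \<alpha> * \<gamma> else if j = 1 then \<alpha> * \<delta> $ 2 + \<beta> $ 2 * \<gamma> else \<beta> $ 2 * \<delta> $ 2)
      else if i = 1 then (if j = 0 then \<alpha> * \<delta> $ 1 + \<beta> $ 1 * \<gamma> else \<beta> $ 1 * \<delta> $ 2 + \<beta> $ 2 * \<delta> $ 1) else \<beta> $ 1 * \<delta> $ 1"])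
     (simp add: assms atMost_2 inner_vec_def sum_2 power2_eq_square algebra_simps)

lemma poly_on_2_segment:
  assumes "poly_on 2 S w" "closed_segment a b \<subseteq> S"
  shows "\<exists>\<alpha> \<beta> \<gamma>. \<forall>t\<in>{0..1}. w (a + t *\<^sub>R (b - a)) = \<alpha> + \<beta> * t + \<gamma> * t\<^sup>2"
proof -
  obtain c where c: "\<forall>x\<in>S. w x = (\<Sum>i\<le>2. \<Sum>j\<le>2 - i. c i j * (x $ 1) ^ i * (x $ 2) ^ j)"
    using assms(1) unfolding poly_on_def by blast
  define p q r s where "p = a $ 1" and "q = b $ 1 - a $ 1" and "r = a $ 2" and "s = b $ 2 - a $ 2"
  have "w (a + t *\<^sub>R (b - a)) =
      (c 0 0 + c 0 1 * r + c 0 2 * r\<^sup>2 + c 1 0 * p + c 1 1 * p * r + c 2 0 * p\<^sup>2)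
    + (c 0 1 * s + 2 * c 0 2 * r * s + c 1 0 * q + c 1 1 * (p * s + q * r) + 2 * c 2 0 * p * q) * t
    + (c 0 2 * s\<^sup>2 + c 1 1 * q * s + c 2 0 * q\<^sup>2) * t\<^sup>2" if "t \<in> {0..1}" for t
  proof -
    have "a + t *\<^sub>R (b - a) \<in> closed_segment a b"
      using that unfolding in_segment by (intro exI[of _ t]) (auto simp: algebra_simps)
    then have "w (a + t *\<^sub>R (b - a)) = (\<Sum>i\<le>2. \<Sum>j\<le>2 - i. c i j * (p + t * q) ^ i * (r + t * s) ^ j)"
      using c assms(2) unfolding p_def q_def r_def s_def by auto
    then show ?thesis by (simp add: atMost_2 power2_eq_square algebra_simps)
  qed
  then show ?thesis by blast
qed

lemma quadratic_on_segment_zero: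
  assumes w: "poly_on 2 S w" "closed_segment a b \<subseteq> S" and zero: "w a = 0" "w b = 0" "w (midpoint a b) = 0"
    and x: "x \<in> closed_segment a b"
  shows "w x = 0"
proof -
  obtain \<alpha> \<beta> \<gamma> where q: "\<And>t. t \<in> {0..1} \<Longrightarrow> w (a + t *\<^sub>R (b - a)) = \<alpha> + \<beta> * t + \<gamma> * t\<^sup>2"
    using poly_on_2_segment[OF w] by blast
  have "a + (1/2) *\<^sub>R (b - a) = midpoint a b" by (simp add: midpoint_def vec_eq_iff field_simps)
  then have "\<alpha> = 0" "\<alpha> + \<beta> + \<gamma> = 0" "\<alpha> + \<beta> / 2 + \<gamma> / 4 = 0"
    using q[of 0] q[of 1] q[of "1/2"] zero by (auto simp: power2_eq_square)
  then have z: "\<alpha> = 0" "\<beta> = 0" "\<gamma> = 0" by auto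
  obtain t where "t \<in> {0..1}" "x = a + t *\<^sub>R (b - a)" using x unfolding in_segment by (auto simp: algebra_simps)
  then show ?thesis using q z by simp
qed

text \<open>The constant \<open>5/2\<close> is not optimal; it makes the difference of the two sides a sum of squares.\<close>

lemma simpson_square_bound:
  fixes \<alpha> \<beta> \<gamma> L :: real
  assumes "0 \<le> L" and q: "\<And>t. t \<in> {0..1} \<Longrightarrow> q t = \<alpha> + \<beta> * t + \<gamma> * t\<^sup>2"
  shows "L / 6 * ((q 0)\<^sup>2 + 4 * (q (1/2))\<^sup>2 + (q 1)\<^sup>2) \<le> 5 / 2 * (L * integral {0..1} (\<lambda>t. (q t)\<^sup>2))"
proof -
  have "((\<lambda>t. (\<alpha> + \<beta> * t + \<gamma> * t\<^sup>2)\<^sup>2) has_integral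
      ((\<lambda>t. \<alpha>\<^sup>2 * t + \<alpha> * \<beta> * t^2 + (\<beta>\<^sup>2 + 2 * \<alpha> * \<gamma>) * t^3 / 3 + \<beta> * \<gamma> * t^4 / 2 + \<gamma>\<^sup>2 * t^5 / 5) 1
      - (\<lambda>t. \<alpha>\<^sup>2 * t + \<alpha> * \<beta> * t^2 + (\<beta>\<^sup>2 + 2 * \<alpha> * \<gamma>) * t^3 / 3 + \<beta> * \<gamma> * t^4 / 2 + \<gamma>\<^sup>2 * t^5 / 5) 0)) {0..1}"
    by (intro fundamental_theorem_of_calculus)
       (auto intro!: derivative_eq_intros simp: has_real_derivative_iff_has_vector_derivative[symmetric]
         power2_eq_square power3_eq_cube power4_eq_xxxx algebra_simps)
  then have "integral {0..1} (\<lambda>t. (\<alpha> + \<beta> * t + \<gamma> * t\<^sup>2)\<^sup>2) = \<alpha>\<^sup>2 + \<alpha> * \<beta> + (\<beta>\<^sup>2 + 2 * \<alpha> * \<gamma>) / 3 + \<beta> * \<gamma> / 2 + \<gamma>\<^sup>2 / 5"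
    by (simp add: integral_unique)
  moreover have "integral {0..1} (\<lambda>t. (q t)\<^sup>2) = integral {0..1} (\<lambda>t. (\<alpha> + \<beta> * t + \<gamma> * t\<^sup>2)\<^sup>2)"
    by (rule Henstock_Kurzweil_Integration.integral_cong) (simp add: q)
  ultimately have I: "integral {0..1} (\<lambda>t. (q t)\<^sup>2) = \<alpha>\<^sup>2 + \<alpha> * \<beta> + (\<beta>\<^sup>2 + 2 * \<alpha> * \<gamma>) / 3 + \<beta> * \<gamma> / 2 + \<gamma>\<^sup>2 / 5"
    by simp
  \<comment> \<open>In the nodal values the integral is the quadratic form of the mass matrix of
    quadratic elements on the unit interval; the factor 30 clears its denominators.\<close>
  define x y z where "x = \<alpha>" and "y = \<alpha> + \<beta> / 2 + \<gamma> / 4" and "z = \<alpha> + \<beta> + \<gamma>"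
  have xyz: "q 0 = x" "q (1/2) = y" "q 1 = z" using q unfolding x_def y_def z_def by (auto simp: power2_eq_square)
  have I': "30 * integral {0..1} (\<lambda>t. (q t)\<^sup>2) = 4 * x\<^sup>2 + 16 * y\<^sup>2 + 4 * z\<^sup>2 + 4 * x * y + 4 * y * z - 2 * x * z"
    unfolding I x_def y_def z_def by (simp add: power2_eq_square algebra_simps)
  have "2 * (x\<^sup>2 + 4 * y\<^sup>2 + z\<^sup>2) \<le> 30 * integral {0..1} (\<lambda>t. (q t)\<^sup>2)"
  proof -
    have "0 \<le> (x + z + 4 * y)\<^sup>2 + 3 * (x - z)\<^sup>2" by simp
    also have "\<dots> = 2 * (30 * integral {0..1} (\<lambda>t. (q t)\<^sup>2) - 2 * (x\<^sup>2 + 4 * y\<^sup>2 + z\<^sup>2))"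
      unfolding I' by (simp add: power2_eq_square algebra_simps)
    finally have "0 \<le> 30 * integral {0..1} (\<lambda>t. (q t)\<^sup>2) - 2 * (x\<^sup>2 + 4 * y\<^sup>2 + z\<^sup>2)"
      by (simp only: zero_le_mult_iff) simp
    then show ?thesis by (simp only: diff_ge_0_iff_ge)
  qed
  then have "1 / 6 * (x\<^sup>2 + 4 * y\<^sup>2 + z\<^sup>2) \<le> 5 / 2 * integral {0..1} (\<lambda>t. (q t)\<^sup>2)" by simp
  from mult_left_mono[OF this assms(1)] show ?thesis unfolding xyz by (simp add: mult.commute mult.left_commute)
qed

section \<open>Geometry of the mesh near the boundary\<close>

text \<open>One fixed mesh of the family. Bounds that must not depend on h, for g and for the
  diameter of \<Omega>, are supplied from outside.\<close>

locale fe_mesh =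
  fixes \<Omega> \<Gamma>0 \<Gamma>1 :: "(real^2) set" and \<P> :: "(real^2) list set" and A B n :: "real^2"
    and \<T> :: "(real^2) set set" and m :: nat and M :: "nat \<Rightarrow> real^2"
  assumes domain: "polygonal_domain \<Omega> \<P>"
    and parts_open: "openin (top_of_set (frontier \<Omega>)) \<Gamma>0" "openin (top_of_set (frontier \<Omega>)) \<Gamma>1"
    and \<Gamma>1_nonempty: "\<Gamma>1 \<noteq> {}" and parts_disjoint: "\<Gamma>0 \<inter> \<Gamma>1 = {}"
    and parts_cover: "frontier \<Omega> = closure \<Gamma>0 \<union> closure \<Gamma>1"
    and whole_side: "closed_segment A B \<in> (\<Union>vs\<in>\<P>. polygon_sides vs)"
      "closure \<Gamma>1 = closed_segment A B" "\<Gamma>1 = open_segment A B"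
    and normal: "outer_unit_normal \<Omega> \<Gamma>1 n"
    and triangulation_mesh: "triangulation \<T>" and triangle: "\<And>T. T \<in> \<T> \<Longrightarrow> 2 simplex T"
    and Union_cells: "\<Union>\<T> = closure \<Omega>"
    and free_vertex: "\<And>T. T \<in> \<T> \<Longrightarrow> \<exists>v\<in>vertices_of T. v \<notin> frontier \<Omega>"
    and vertices: "boundary_vertices A B \<T> m M"
begin

sublocale mesh_domain \<Omega> \<T>
  using domain polygonal_domain_interior_closure[OF domain] triangulation_mesh triangle Union_cells
  by unfold_locales (auto simp: polygonal_domain_def triangulation_def intro: compact_simplex convex_simplex)

lemma connected_domain: "connected \<Omega>" and nonempty_domain: "\<Omega> \<noteq> {}"
  using domain unfolding polygonal_domain_def by auto

lemma cell_subset: "T \<in> \<T> \<Longrightarrow> T \<subseteq> closure \<Omega>"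
  using Union_cells by blast

lemma domain_or_frontier: "x \<in> closure \<Omega> \<Longrightarrow> x \<in> \<Omega> \<or> x \<in> frontier \<Omega>"
  using open_domain by (simp add: frontier_def interior_open)

lemma frontier_not_domain: "x \<in> frontier \<Omega> \<Longrightarrow> x \<notin> \<Omega>"
  using open_domain by (simp add: frontier_def interior_open)

lemma interior_cell_subset: "T \<in> \<T> \<Longrightarrow> interior T \<subseteq> \<Omega>"
  using core_subset unfolding core_def by blast

lemma interior_cell_nonempty: "T \<in> \<T> \<Longrightarrow> interior T \<noteq> {}"
  using triangle_interior_nonempty triangle by blast

lemma vertices_subset: "vertices_of T \<subseteq> T"
  unfolding vertices_of_def extreme_point_of_def by blast

lemma inter_face: "T \<in> \<T> \<Longrightarrow> T' \<in> \<T> \<Longrightarrow> (T \<inter> T') face_of T"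
  using triangulation_mesh unfolding triangulation_def by blast

text \<open>Cells intersect in common faces, and extreme points of a face are extreme points of the
  cell; so there are no hanging nodes.\<close>

lemma mesh_vertex_in_cell:
  assumes "p \<in> mesh_vertices \<T>" "T \<in> \<T>" "p \<in> T"
  shows "p \<in> vertices_of T"
proof -
  obtain T' where T': "T' \<in> \<T>" "p extreme_point_of T'" using assms(1) unfolding mesh_vertices_def vertices_of_def by blast
  have "p \<in> T'" using T'(2) unfolding extreme_point_of_def by blast
  then have "p extreme_point_of (T' \<inter> T)"
    using extreme_point_of_face[OF inter_face[OF T'(1) assms(2)]] T'(2) assms(3) by blast
  then have "p extreme_point_of (T \<inter> T')" by (simp add: Int_commute)
  then show ?thesis using extreme_point_of_face[OF inter_face[OF assms(2) T'(1)]] unfolding vertices_of_def by blast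
qed

lemma vertex_not_in_open_segment:
  assumes "T \<in> \<T>" "a \<in> T" "b \<in> T" "p \<in> mesh_vertices \<T>"
  shows "p \<notin> open_segment a b"
proof
  assume p: "p \<in> open_segment a b"
  then have "p \<in> T" using assms convex_cell[OF assms(1)] unfolding convex_contains_open_segment by blast
  then have "p extreme_point_of T" using mesh_vertex_in_cell[OF assms(4,1)] unfolding vertices_of_def by blast
  then show False using p assms unfolding extreme_point_of_def by blast
qed

text \<open>The intersection of two cells is a face, and a face containing a point strictly between
  a and b contains both of them.\<close>

lemma side_in_cell:
  assumes "T \<in> \<T>" "a \<in> vertices_of T" "b \<in> vertices_of T" "z \<in> open_segment a b" "T' \<in> \<T>" "z \<in> T'"
  shows "a \<in> T'" "b \<in> T'" "a \<in> vertices_of T'" "b \<in> vertices_of T'"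
proof -
  have ab: "a \<in> T" "b \<in> T" using assms vertices_subset by blast+
  then have "z \<in> T" using assms(4) convex_cell[OF assms(1)] unfolding convex_contains_open_segment by blast
  then have "a \<in> T \<inter> T' \<and> b \<in> T \<inter> T'"
    using face_ofD[OF inter_face[OF assms(1,5)] assms(4) ab] assms(6) by blast
  then show "a \<in> T'" "b \<in> T'" by auto
  moreover have "a \<in> mesh_vertices \<T>" "b \<in> mesh_vertices \<T>"
    using assms unfolding mesh_vertices_def by blast+
  ultimately show "a \<in> vertices_of T'" "b \<in> vertices_of T'" using mesh_vertex_in_cell[OF _ assms(5)] by auto
qed

text \<open>A homothety centred at an end point of the side maps all cells containing the side into themselves.\<close>

lemma side_domain_homothety:
  assumes T: "T \<in> \<T>" "a \<in> vertices_of T" "b \<in> vertices_of T" and z: "z \<in> open_segment a b" "z \<in> \<Omega>"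
    and r: "0 < r" "r \<le> 1"
  shows "a + r *\<^sub>R (z - a) \<in> \<Omega>"
proof -
  \<comment> \<open>A neighbourhood of z that meets only cells containing z, hence only cells
    containing the whole side.\<close>
  define N where "N = \<Omega> - \<Union>{T' \<in> \<T>. z \<notin> T'}"
  have "closed (\<Union>{T' \<in> \<T>. z \<notin> T'})"
    using finite_mesh compact_cell by (intro closed_Union) (auto intro: compact_imp_closed)
  then have N: "open N" "z \<in> N" unfolding N_def using open_domain z(2) by auto
  have "(\<lambda>x. (a - r *\<^sub>R a) + r *\<^sub>R x) ` N \<subseteq> closure \<Omega>"
  proof
    fix y assume "y \<in> (\<lambda>x. (a - r *\<^sub>R a) + r *\<^sub>R x) ` N"
    then obtain x where x: "x \<in> N" "y = (a - r *\<^sub>R a) + r *\<^sub>R x" by blast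
    then have "x \<in> closure \<Omega>" unfolding N_def using closure_subset by blast
    then obtain T' where T': "T' \<in> \<T>" "x \<in> T'" using Union_cells by blast
    then have "z \<in> T'" using x(1) unfolding N_def by blast
    then have "a \<in> T'" using side_in_cell(1)[OF T z(1) T'(1)] by blast
    then have "(1 - r) *\<^sub>R a + r *\<^sub>R x \<in> T'" using convexD_alt[OF convex_cell[OF T'(1)] _ T'(2)] r by simp
    then show "y \<in> closure \<Omega>" unfolding x(2) using cell_subset[OF T'(1)] by (auto simp: algebra_simps)
  qed
  moreover have "open ((\<lambda>x. (a - r *\<^sub>R a) + r *\<^sub>R x) ` N)" using N(1) r by (intro open_affinity) auto
  ultimately have "(\<lambda>x. (a - r *\<^sub>R a) + r *\<^sub>R x) ` N \<subseteq> \<Omega>" using interior_maximal interior_closure by blast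
  moreover have "a + r *\<^sub>R (z - a) = (a - r *\<^sub>R a) + r *\<^sub>R z" by (simp add: algebra_simps)
  ultimately show ?thesis using N(2) by blast
qed

text \<open>One point z of the open side in \<Omega> is enough: homotheties centred at a reach the
  points between a and z, those centred at b the remaining ones.\<close>

lemma side_dichotomy:
  assumes T: "T \<in> \<T>" "a \<in> vertices_of T" "b \<in> vertices_of T" "a \<noteq> b"
  shows "open_segment a b \<subseteq> \<Omega> \<or> closed_segment a b \<subseteq> frontier \<Omega>"
proof (cases "open_segment a b \<inter> \<Omega> = {}")
  case True
  have "open_segment a b \<subseteq> frontier \<Omega>"
  proof
    fix y assume y: "y \<in> open_segment a b"
    then have "y \<in> T" using T vertices_subset convex_cell[OF T(1)] unfolding convex_contains_open_segment by blast
    then show "y \<in> frontier \<Omega>" using domain_or_frontier cell_subset[OF T(1)] y True by blast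
  qed
  then have "closure (open_segment a b) \<subseteq> frontier \<Omega>" by (intro closure_minimal) auto
  then show ?thesis using T(4) by simp
next
  case False
  then obtain z where z: "z \<in> open_segment a b" "z \<in> \<Omega>" by blast
  then obtain s where s: "0 < s" "s < 1" "z = (1 - s) *\<^sub>R a + s *\<^sub>R b" unfolding in_segment by blast
  have "y \<in> \<Omega>" if "y \<in> open_segment a b" for y
  proof -
    obtain t where t: "0 < t" "t < 1" "y = (1 - t) *\<^sub>R a + t *\<^sub>R b" using \<open>y \<in> open_segment a b\<close> unfolding in_segment by blast
    show ?thesis
    proof (cases "t \<le> s")
      case True
      have "y = a + (t / s) *\<^sub>R (z - a)" unfolding t(3) s(3) using s(1) by (simp add: algebra_simps)
      then show ?thesis using side_domain_homothety[OF T(1-3) z, of "t / s"] t s True by simp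
    next
      case False
      have z': "z \<in> open_segment b a" using z(1) by (simp add: open_segment_commute)
      define r where "r = (1 - t) / (1 - s)"
      have r: "0 < r" "r \<le> 1" "r * (1 - s) = 1 - t" unfolding r_def using t s False by auto
      have "z - b = (1 - s) *\<^sub>R (a - b)" unfolding s(3) by (simp add: algebra_simps)
      then have "b + r *\<^sub>R (z - b) = b + (1 - t) *\<^sub>R (a - b)" using r(3) by simp
      also have "\<dots> = y" unfolding t(3) by (simp add: algebra_simps)
      finally show ?thesis using side_domain_homothety[OF T(1,3,2) z' z(2) r(1,2)] by simp
    qed
  qed
  then show ?thesis by blast
qed

text \<open>Interiors of cells lie in \<Omega>, so a frontier point is on a side of some cell; if it
  is not an end point, the dichotomy puts the entire side into the frontier.\<close>

lemma frontier_cases: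
  assumes "y \<in> frontier \<Omega>"
  shows "y \<in> mesh_vertices \<T> \<or> (\<exists>T\<in>\<T>. \<exists>a\<in>vertices_of T. \<exists>b\<in>vertices_of T.
    a \<noteq> b \<and> y \<in> open_segment a b \<and> closed_segment a b \<subseteq> frontier \<Omega>)"
proof -
  have "y \<in> closure \<Omega>" using assms unfolding frontier_def by blast
  then obtain T where T: "T \<in> \<T>" "y \<in> T" using Union_cells by blast
  have "y \<notin> interior T" using interior_cell_subset[OF T(1)] frontier_not_domain[OF assms] by blast
  then obtain a b where ab: "a \<in> vertices_of T" "b \<in> vertices_of T" "a \<noteq> b" "y \<in> closed_segment a b"
    using triangle_frontier_side[OF triangle[OF T(1)] T(2)] by blast
  show ?thesis
  proof (cases "y \<in> open_segment a b")
    case True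
    then show ?thesis using side_dichotomy[OF T(1) ab(1-3)] frontier_not_domain[OF assms] T(1) ab by blast
  next
    case False
    then have "y \<in> {a, b}" using ab(4) by (auto simp: open_segment_def)
    then show ?thesis using ab T(1) unfolding mesh_vertices_def by blast
  qed
qed

section \<open>The two parts of the boundary and the boundary values of discrete velocities\<close>

lemma AB_distinct: "A \<noteq> B" using \<Gamma>1_nonempty whole_side(3) by auto

lemma AB_vertices: "A \<in> mesh_vertices \<T>" "B \<in> mesh_vertices \<T>"
proof -
  have "M 1 \<in> M ` {1..m + 1}" "M (m + 1) \<in> M ` {1..m + 1}" by auto
  then show "A \<in> mesh_vertices \<T>" "B \<in> mesh_vertices \<T>" using vertices unfolding boundary_vertices_def by auto
qed

lemma \<Gamma>1_frontier: "\<Gamma>1 \<subseteq> frontier \<Omega>" "closed_segment A B \<subseteq> frontier \<Omega>"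
  using parts_open(2) openin_imp_subset parts_cover whole_side(2) by blast+

text \<open>Relative openness separates \<Gamma>1 from \<Gamma>0 by an open set, which then misses
  the closure as well.\<close>

lemma \<Gamma>1_not_\<Gamma>0: "\<Gamma>1 \<inter> closure \<Gamma>0 = {}"
proof -
  obtain U where U: "open U" "\<Gamma>1 = frontier \<Omega> \<inter> U" using parts_open(2) openin_open by blast
  have "\<Gamma>0 \<subseteq> frontier \<Omega>" using parts_open(1) openin_imp_subset by blast
  then have "U \<inter> \<Gamma>0 = {}" using U(2) parts_disjoint by blast
  then have "U \<inter> closure \<Gamma>0 = {}" using open_Int_closure_eq_empty[OF U(1)] by blast
  then show ?thesis using U(2) by blast
qed

text \<open>Off the closed side from A to B the boundary belongs to the closure of \<Gamma>0, and
  the corners are limits of such points along the neighbouring sides. Hence discrete velocities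
  vanish at both ends of \<Gamma>1.\<close>

lemma AB_closure_\<Gamma>0: "A \<in> closure \<Gamma>0" "B \<in> closure \<Gamma>0"
proof -
  obtain vs where vs: "vs \<in> \<P>" "closed_segment A B \<in> polygon_sides vs" using whole_side(1) by blast
  have "simple_polygon vs" "\<Union>(polygon_sides vs) \<subseteq> frontier \<Omega>"
    using domain vs(1) unfolding polygonal_domain_def by auto
  moreover have "frontier \<Omega> - closed_segment A B \<subseteq> closure \<Gamma>0" using parts_cover whole_side(2) by blast
  ultimately have "closure (\<Union>(polygon_sides vs) - closed_segment A B) \<subseteq> closure \<Gamma>0"
    by (intro closure_minimal) auto
  then show "A \<in> closure \<Gamma>0" "B \<in> closure \<Gamma>0"
    using polygon_side_endpoints[OF \<open>simple_polygon vs\<close> vs(2)] by blast+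
qed

lemma frontier_parts: "y \<in> frontier \<Omega> \<Longrightarrow> y \<in> closure \<Gamma>0 \<or> y \<in> \<Gamma>1"
  using parts_cover whole_side(2,3) AB_closure_\<Gamma>0 by (auto simp: open_segment_def)

text \<open>A and B are mesh vertices, so they are not inside a side of a cell, and on the open side
  \<Gamma>1 coincides with the closed segment from A to B. It is therefore both open and closed in
  the connected open side.\<close>

lemma side_boundary:
  assumes T: "T \<in> \<T>" "a \<in> vertices_of T" "b \<in> vertices_of T" "a \<noteq> b" and fr: "closed_segment a b \<subseteq> frontier \<Omega>"
  shows "open_segment a b \<subseteq> \<Gamma>1 \<or> closed_segment a b \<subseteq> closure \<Gamma>0"
proof (cases "open_segment a b \<inter> \<Gamma>1 = {}")
  case True
  then have "open_segment a b \<subseteq> closure \<Gamma>0" using fr frontier_parts segment_open_subset_closed by blast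
  then have "closure (open_segment a b) \<subseteq> closure \<Gamma>0" by (intro closure_minimal) auto
  then show ?thesis using T(4) by simp
next
  case False
  have no_AB: "A \<notin> open_segment a b" "B \<notin> open_segment a b"
    using vertex_not_in_open_segment[OF T(1)] T vertices_subset AB_vertices by blast+
  obtain U where U: "open U" "\<Gamma>1 = frontier \<Omega> \<inter> U" using parts_open(2) openin_open by blast
  have fr': "open_segment a b \<subseteq> frontier \<Omega>" using fr segment_open_subset_closed by blast
  have 1: "openin (top_of_set (open_segment a b)) (open_segment a b \<inter> \<Gamma>1)"
    unfolding openin_open using U fr' by blast
  have "open_segment a b \<inter> \<Gamma>1 = open_segment a b \<inter> closed_segment A B"
    using no_AB whole_side(3) by (auto simp: open_segment_def)
  then have 2: "closedin (top_of_set (open_segment a b)) (open_segment a b \<inter> \<Gamma>1)"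
    unfolding closedin_closed using closed_segment by blast
  have "connected (open_segment a b)" by (rule convex_connected[OF convex_open_segment])
  then have "open_segment a b \<inter> \<Gamma>1 = open_segment a b" using 1 2 False unfolding connected_clopen by blast
  then show ?thesis by blast
qed

lemma midpoint_in_open_segment: "a \<noteq> b \<Longrightarrow> midpoint a b \<in> open_segment a (b::real^2)"
  by simp

lemma vertex_node: "p \<in> mesh_vertices \<T> \<Longrightarrow> p \<in> mesh_nodes \<T>"
  unfolding mesh_nodes_def by blast

lemma midpoint_node:
  assumes "T \<in> \<T>" "a \<in> vertices_of T" "b \<in> vertices_of T" "a \<noteq> b"
  shows "midpoint a b \<in> mesh_nodes \<T>"
  using assms unfolding mesh_nodes_def by blast

lemma poly_on_inner:
  fixes v :: "real^2 \<Rightarrow> real^2"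
  assumes "\<And>i. poly_on k S (\<lambda>x. v x $ i)"
  shows "poly_on k S (\<lambda>x. v x \<bullet> d)"
proof -
  have "poly_on k S (\<lambda>x. d $ 1 * v x $ 1 + d $ 2 * v x $ 2)" using assms by (intro poly_on_add poly_on_cmult)
  then show ?thesis by (simp add: inner_vec_def sum_2 mult.commute)
qed

lemma V_space_poly: "v \<in> V_space \<Omega> \<T> \<Longrightarrow> T \<in> \<T> \<Longrightarrow> poly_on 2 T (\<lambda>x. v x \<bullet> d)"
  unfolding V_space_def by (intro poly_on_inner) auto

lemma tangent_frame: "norm n = 1" "n \<bullet> n = 1" "tangent n \<bullet> n = 0" "tangent n \<bullet> tangent n = 1" "norm (tangent n) = 1"
proof -
  show 1: "norm n = 1" using normal unfolding outer_unit_normal_def by blast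
  then show "n \<bullet> n = 1" by (simp add: norm_eq_1)
  then show "tangent n \<bullet> tangent n = 1" "tangent n \<bullet> n = 0"
    by (simp_all add: tangent_def inner_vec_def sum_2)
  then show "norm (tangent n) = 1" by (simp add: norm_eq_1)
qed

lemma zero_by_components:
  assumes "v \<bullet> n = 0" "v \<bullet> tangent n = 0"
  shows "v = 0"
proof -
  have e: "v $ 1 * n $ 1 + v $ 2 * n $ 2 = 0" "v $ 1 * n $ 2 - v $ 2 * n $ 1 = 0" "n $ 1 * n $ 1 + n $ 2 * n $ 2 = 1"
    using assms tangent_frame(2) by (simp_all add: tangent_def inner_vec_def sum_2)
  have "v $ 1 = v $ 1 * (n $ 1 * n $ 1 + n $ 2 * n $ 2)" using e by simp
  also have "\<dots> = (v $ 1 * n $ 1 + v $ 2 * n $ 2) * n $ 1 + (v $ 1 * n $ 2 - v $ 2 * n $ 1) * n $ 2" by (simp add: algebra_simps)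
  finally have 1: "v $ 1 = 0" unfolding e by simp
  have "v $ 2 = v $ 2 * (n $ 1 * n $ 1 + n $ 2 * n $ 2)" using e by simp
  also have "\<dots> = (v $ 1 * n $ 1 + v $ 2 * n $ 2) * n $ 2 - (v $ 1 * n $ 2 - v $ 2 * n $ 1) * n $ 1" by (simp add: algebra_simps)
  finally have "v $ 2 = 0" unfolding e by simp
  then show ?thesis using 1 by (simp add: vec_eq_iff forall_2)
qed

text \<open>The nodal conditions hold at both ends and at the midpoint of every boundary side, and
  these three values determine a quadratic on it, so the conditions hold along the whole boundary.
  The tangential component vanishes at the nodes of both parts, which is why the second conclusion
  makes no distinction.\<close>

lemma V_tau_boundary:
  assumes v: "v \<in> V_tau_space \<Omega> \<Gamma>0 \<Gamma>1 n \<T>" and y: "y \<in> frontier \<Omega>"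
  shows "y \<in> closure \<Gamma>0 \<Longrightarrow> v y = 0" and "v y \<bullet> tangent n = 0"
proof -
  have V: "v \<in> V_space \<Omega> \<T>" and nodes0: "\<And>x. x \<in> closure \<Gamma>0 \<Longrightarrow> x \<in> mesh_nodes \<T> \<Longrightarrow> v x = 0"
    and nodes1: "\<And>x. x \<in> \<Gamma>1 \<Longrightarrow> x \<in> mesh_nodes \<T> \<Longrightarrow> v x \<bullet> tangent n = 0"
    using v unfolding V_tau_space_def by auto
  have nodes: "v x \<bullet> tangent n = 0" if "x \<in> mesh_nodes \<T>" "x \<in> frontier \<Omega>" for x
    using frontier_parts[OF that(2)] nodes0 nodes1 that(1) by auto
  have "(y \<in> closure \<Gamma>0 \<longrightarrow> v y = 0) \<and> v y \<bullet> tangent n = 0"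
    using frontier_cases[OF y]
  proof
    assume "y \<in> mesh_vertices \<T>"
    then show ?thesis using nodes0 nodes vertex_node y by blast
  next
    assume "\<exists>T\<in>\<T>. \<exists>a\<in>vertices_of T. \<exists>b\<in>vertices_of T. a \<noteq> b \<and> y \<in> open_segment a b \<and> closed_segment a b \<subseteq> frontier \<Omega>"
    then obtain T a b where T: "T \<in> \<T>" "a \<in> vertices_of T" "b \<in> vertices_of T" "a \<noteq> b"
      and yo: "y \<in> open_segment a b" and fr: "closed_segment a b \<subseteq> frontier \<Omega>" by blast
    have yc: "y \<in> closed_segment a b" using yo segment_open_subset_closed by blast
    have ab: "a \<in> T" "b \<in> T" using T vertices_subset by blast+
    have sub: "closed_segment a b \<subseteq> T" using ab convex_cell[OF T(1)] by (simp add: closed_segment_subset)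
    have mid: "midpoint a b \<in> closed_segment a b" by simp
    have nd: "a \<in> mesh_nodes \<T>" "b \<in> mesh_nodes \<T>" "midpoint a b \<in> mesh_nodes \<T>"
      using T midpoint_node vertex_node unfolding mesh_vertices_def by blast+
    have *: "v y \<bullet> d = 0" if "v a \<bullet> d = 0" "v b \<bullet> d = 0" "v (midpoint a b) \<bullet> d = 0" for d
      by (rule quadratic_on_segment_zero[OF V_space_poly[OF V T(1)] sub that yc])
    have "a \<in> frontier \<Omega>" "b \<in> frontier \<Omega>" "midpoint a b \<in> frontier \<Omega>" using fr mid by auto
    then have "v y \<bullet> tangent n = 0" using nodes nd by (intro *) blast+
    moreover have "v y = 0" if "y \<in> closure \<Gamma>0"
    proof -
      have "\<not> open_segment a b \<subseteq> \<Gamma>1" using that yo \<Gamma>1_not_\<Gamma>0 by blast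
      then have "closed_segment a b \<subseteq> closure \<Gamma>0" using side_boundary[OF T fr] by blast
      then have "a \<in> closure \<Gamma>0" "b \<in> closure \<Gamma>0" "midpoint a b \<in> closure \<Gamma>0" using mid ends_in_segment by blast+
      then have "v a = 0" "v b = 0" "v (midpoint a b) = 0" using nodes0 nd by blast+
      then have "v y \<bullet> d = 0" for d by (intro *) auto
      then show ?thesis by (metis inner_eq_zero_iff)
    qed
    ultimately show ?thesis by blast
  qed
  then show "y \<in> closure \<Gamma>0 \<Longrightarrow> v y = 0" "v y \<bullet> tangent n = 0" by auto
qed

lemma pc1_V_space: "v \<in> V_space \<Omega> \<T> \<Longrightarrow> pc1 (\<lambda>x. v x \<bullet> d)"
  unfolding pc1_def using poly_on_elementary[OF V_space_poly] elementary_C_diff by metis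

lemma pc1_component: "v \<in> V_space \<Omega> \<T> \<Longrightarrow> pc1 (\<lambda>x. v x $ i)"
  using pc1_V_space[of v "axis i 1"] by (simp add: inner_axis)

lemma pc1_Q_space: "q \<in> Q_space \<Omega> \<T> \<Longrightarrow> pc1 q"
  unfolding pc1_def Q_space_def using poly_on_elementary elementary_C_diff by (metis (mono_tags, lifting) mem_Collect_eq)

lemma V_tau_V: "v \<in> V_tau_space \<Omega> \<Gamma>0 \<Gamma>1 n \<T> \<Longrightarrow> v \<in> V_space \<Omega> \<T>"
  unfolding V_tau_space_def by blast

section \<open>Parametrisation of the side by the distance from A\<close>

definition \<sigma> :: "real^2" where "\<sigma> = (B - A) /\<^sub>R dist A B"

text \<open>\<open>\<sigma>\<close> is \<open>tangent n\<close> up to sign, oriented from A to B.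
  Orthogonality to n is read off two points of the open segment, as the normal is specified on
  \<Gamma>1 only.\<close>

lemma side_direction: "norm \<sigma> = 1" "\<sigma> \<bullet> n = 0" "dist A B > 0" "B = A + dist A B *\<^sub>R \<sigma>"
proof -
  show d: "dist A B > 0" using AB_distinct by simp
  then show "norm \<sigma> = 1" unfolding \<sigma>_def by (simp add: dist_norm norm_minus_commute)
  show "B = A + dist A B *\<^sub>R \<sigma>" unfolding \<sigma>_def using d by simp
  define x where "x u = (1 - u) *\<^sub>R A + u *\<^sub>R B" for u
  have "x u \<in> \<Gamma>1" if "0 < u" "u < 1" for u
    unfolding x_def whole_side(3) in_segment using AB_distinct that by blast
  then have "(x (2/3) - x (1/3)) \<bullet> n = 0" using normal unfolding outer_unit_normal_def by simp
  moreover have "x (2/3) - x (1/3) = (1/3) *\<^sub>R (B - A)" unfolding x_def by (simp add: vec_eq_iff field_simps)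
  ultimately show "\<sigma> \<bullet> n = 0" unfolding \<sigma>_def by simp
qed

lemma side_param:
  "x \<in> closed_segment A B \<longleftrightarrow> (\<exists>s\<in>{0..dist A B}. x = A + s *\<^sub>R \<sigma>)"
  "A + s *\<^sub>R \<sigma> \<in> closed_segment A B \<longleftrightarrow> s \<in> {0..dist A B}"
  "A + s *\<^sub>R \<sigma> \<in> \<Gamma>1 \<longleftrightarrow> s \<in> {0<..<dist A B}"
proof -
  let ?d = "dist A B"
  have d: "?d > 0" using side_direction(3) .
  have inj: "s = t" if "A + s *\<^sub>R \<sigma> = A + t *\<^sub>R \<sigma>" for s t using that side_direction(1) by auto
  have B: "(1 - u) *\<^sub>R A + u *\<^sub>R B = A + (u * ?d) *\<^sub>R \<sigma>" for u
    by (subst side_direction(4)) (simp add: algebra_simps)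
  have c: "x \<in> closed_segment A B \<longleftrightarrow> (\<exists>u. 0 \<le> u \<and> u \<le> 1 \<and> x = A + (u * ?d) *\<^sub>R \<sigma>)" for x
    unfolding in_segment B by blast
  show 1: "x \<in> closed_segment A B \<longleftrightarrow> (\<exists>s\<in>{0..?d}. x = A + s *\<^sub>R \<sigma>)" for x
  proof
    assume "\<exists>s\<in>{0..?d}. x = A + s *\<^sub>R \<sigma>"
    then obtain s where "s \<in> {0..?d}" "x = A + s *\<^sub>R \<sigma>" by blast
    then show "x \<in> closed_segment A B" unfolding c using d by (intro exI[of _ "s / ?d"]) auto
  next
    assume "x \<in> closed_segment A B"
    then obtain u where "0 \<le> u" "u \<le> 1" "x = A + (u * ?d) *\<^sub>R \<sigma>" unfolding c by blast
    then show "\<exists>s\<in>{0..?d}. x = A + s *\<^sub>R \<sigma>" using d by (intro bexI[of _ "u * ?d"]) (auto simp: mult_left_le_one_le)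
  qed
  show 2: "A + s *\<^sub>R \<sigma> \<in> closed_segment A B \<longleftrightarrow> s \<in> {0..?d}" for s
    unfolding 1 using inj by blast
  have "A + s *\<^sub>R \<sigma> = A \<longleftrightarrow> s = 0" "A + s *\<^sub>R \<sigma> = B \<longleftrightarrow> s = ?d" for s
    using inj[of s 0] inj[of s ?d] side_direction(4) by auto
  then show "A + s *\<^sub>R \<sigma> \<in> \<Gamma>1 \<longleftrightarrow> s \<in> {0<..<?d}"
    unfolding whole_side(3) open_segment_def using 2[of s] by auto
qed

lemma off_side:
  assumes "t \<noteq> 0"
  shows "A + s *\<^sub>R \<sigma> + t *\<^sub>R n \<notin> closed_segment A B"
proof
  assume "A + s *\<^sub>R \<sigma> + t *\<^sub>R n \<in> closed_segment A B"
  then obtain s' where "A + s *\<^sub>R \<sigma> + t *\<^sub>R n = A + s' *\<^sub>R \<sigma>" unfolding side_param(1) by blast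
  then have "(A + s *\<^sub>R \<sigma> + t *\<^sub>R n) \<bullet> n = (A + s' *\<^sub>R \<sigma>) \<bullet> n" by (simp only:)
  then show False using assms side_direction(2) tangent_frame(2) by (simp add: inner_add_left)
qed

definition abscissa :: "nat \<Rightarrow> real" where "abscissa i = dist A (M i)"

lemma vertices_param:
  assumes "i \<in> {1..m + 1}"
  shows "M i = A + abscissa i *\<^sub>R \<sigma>" "abscissa i \<in> {0..dist A B}" "M i \<in> mesh_vertices \<T>"
proof -
  have "M i \<in> mesh_vertices \<T> \<inter> closed_segment A B"
    using vertices assms unfolding boundary_vertices_def by blast
  then show "M i \<in> mesh_vertices \<T>" by blast
  obtain s where s: "s \<in> {0..dist A B}" "M i = A + s *\<^sub>R \<sigma>"
    using \<open>M i \<in> mesh_vertices \<T> \<inter> closed_segment A B\<close> side_param(1)[of "M i"] by blast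
  then have "abscissa i = s" unfolding abscissa_def using side_direction(1) by (simp add: dist_norm)
  then show "M i = A + abscissa i *\<^sub>R \<sigma>" "abscissa i \<in> {0..dist A B}" using s by auto
qed

lemma abscissa_less: "i \<in> {1..m + 1} \<Longrightarrow> j \<in> {1..m + 1} \<Longrightarrow> i < j \<Longrightarrow> abscissa i < abscissa j"
  using vertices unfolding boundary_vertices_def abscissa_def strict_mono_on_def by blast

lemma abscissa_less_iff:
  assumes "i \<in> {1..m + 1}" "j \<in> {1..m + 1}"
  shows "abscissa i < abscissa j \<longleftrightarrow> i < j"
  using abscissa_less[OF assms] abscissa_less[OF assms(2,1)] by (metis less_irrefl linorder_neqE_nat less_asym)

lemma abscissa_ends: "abscissa 1 = 0" "abscissa (m + 1) = dist A B" "m \<ge> 1"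
proof -
  have M: "M 1 = A" "M (m + 1) = B" using vertices unfolding boundary_vertices_def by auto
  then show "abscissa 1 = 0" "abscissa (m + 1) = dist A B" unfolding abscissa_def by auto
  show "m \<ge> 1" using M AB_distinct by (cases m) auto
qed

lemma segment_param:
  assumes "s < t"
  shows "A + r *\<^sub>R \<sigma> \<in> open_segment (A + s *\<^sub>R \<sigma>) (A + t *\<^sub>R \<sigma>) \<longleftrightarrow> r \<in> {s<..<t}"
proof -
  have inj: "p = q" if "A + p *\<^sub>R \<sigma> = A + q *\<^sub>R \<sigma>" for p q using that side_direction(1) by auto
  have conv: "(1 - u) *\<^sub>R (A + s *\<^sub>R \<sigma>) + u *\<^sub>R (A + t *\<^sub>R \<sigma>) = A + (s + u * (t - s)) *\<^sub>R \<sigma>" for u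
    by (simp add: algebra_simps)
  have "A + r *\<^sub>R \<sigma> \<in> open_segment (A + s *\<^sub>R \<sigma>) (A + t *\<^sub>R \<sigma>) \<longleftrightarrow> (\<exists>u. 0 < u \<and> u < 1 \<and> r = s + u * (t - s))"
    unfolding in_segment conv using inj assms by blast
  also have "\<dots> \<longleftrightarrow> r \<in> {s<..<t}"
  proof
    assume "\<exists>u. 0 < u \<and> u < 1 \<and> r = s + u * (t - s)"
    then obtain u where u: "0 < u" "u < 1" "r = s + u * (t - s)" by blast
    define x where "x = u * (t - s)"
    have "x < 1 * (t - s)" "0 < x"
      using u assms unfolding x_def by (intro mult_strict_right_mono mult_pos_pos; simp)+
    then show "r \<in> {s<..<t}" unfolding u(3) x_def[symmetric] by simp
  next
    assume "r \<in> {s<..<t}"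
    then show "\<exists>u. 0 < u \<and> u < 1 \<and> r = s + u * (t - s)" using assms by (intro exI[of _ "(r - s) / (t - s)"]) auto
  qed
  finally show ?thesis .
qed

lemma half_node_param:
  assumes "i \<in> {1..m}"
  shows "half_node M i = A + ((abscissa i + abscissa (i + 1)) / 2) *\<^sub>R \<sigma>" "half_node M i \<in> \<Gamma>1"
proof -
  have i: "i \<in> {1..m + 1}" "i + 1 \<in> {1..m + 1}" using assms by auto
  show 1: "half_node M i = A + ((abscissa i + abscissa (i + 1)) / 2) *\<^sub>R \<sigma>"
  proof -
    have "half_node M i = midpoint (A + abscissa i *\<^sub>R \<sigma>) (A + abscissa (i + 1) *\<^sub>R \<sigma>)"
      using vertices_param(1)[OF i(1)] vertices_param(1)[OF i(2)] by metis
    then show ?thesis by (simp add: midpoint_def vec_eq_iff field_simps)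
  qed
  show "half_node M i \<in> \<Gamma>1"
    unfolding 1 side_param(3) using abscissa_less[OF i] vertices_param(2)[OF i(1)] vertices_param(2)[OF i(2)] by auto
qed

text \<open>The midpoint lies inside a frontier side of some cell, whose ends are again among the M
  j. No mesh vertex lies inside that side, and strict monotonicity of the abscissas leaves only
  consecutive indices.\<close>

lemma boundary_edge:
  assumes i: "i \<in> {1..m}"
  shows "\<exists>T\<in>\<T>. M i \<in> vertices_of T \<and> M (i + 1) \<in> vertices_of T"
proof -
  have i': "i \<in> {1..m + 1}" "i + 1 \<in> {1..m + 1}" using i by auto
  note lt = abscissa_less[OF i']
  define \<eta> where "\<eta> = (abscissa i + abscissa (i + 1)) / 2"
  have \<eta>: "abscissa i < \<eta>" "\<eta> < abscissa (i + 1)" unfolding \<eta>_def using lt by auto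
  define y where "y = half_node M i"
  have y: "y = A + \<eta> *\<^sub>R \<sigma>" "y \<in> \<Gamma>1" unfolding y_def \<eta>_def using half_node_param[OF i] by auto
  have vertex: "\<exists>j\<in>{1..m + 1}. p = M j" if "p \<in> mesh_vertices \<T>" "p \<in> closed_segment A B" for p
    using vertices that unfolding boundary_vertices_def by blast
  have "y \<notin> mesh_vertices \<T>"
  proof
    assume "y \<in> mesh_vertices \<T>"
    then obtain j where j: "j \<in> {1..m + 1}" "y = M j" using vertex y(2) whole_side(3) segment_open_subset_closed by blast
    then have "A + abscissa j *\<^sub>R \<sigma> = A + \<eta> *\<^sub>R \<sigma>" using y(1) j(2) vertices_param(1)[OF j(1)] by (simp only:)
    moreover have "\<sigma> \<noteq> 0" using side_direction(1) by auto
    ultimately have "abscissa j = \<eta>" by (metis add_left_cancel scaleR_right_imp_eq)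
    then have "i < j" "j < i + 1" using \<eta> abscissa_less_iff[OF i'(1) j(1)] abscissa_less_iff[OF j(1) i'(2)] by auto
    then show False by simp
  qed
  then obtain T a b where T: "T \<in> \<T>" "a \<in> vertices_of T" "b \<in> vertices_of T" "a \<noteq> b"
    and ab: "y \<in> open_segment a b" "closed_segment a b \<subseteq> frontier \<Omega>"
    using frontier_cases[of y] y(2) \<Gamma>1_frontier(1) by blast
  have abT: "a \<in> T" "b \<in> T" using T vertices_subset by blast+
  have "\<not> closed_segment a b \<subseteq> closure \<Gamma>0"
    using ab(1) y(2) \<Gamma>1_not_\<Gamma>0 segment_open_subset_closed by blast
  then have "open_segment a b \<subseteq> \<Gamma>1" using side_boundary[OF T ab(2)] by blast
  from closure_mono[OF this] have "closed_segment a b \<subseteq> closed_segment A B" using T(4) whole_side(2) by simp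
  then have "a \<in> closed_segment A B" "b \<in> closed_segment A B" by auto
  moreover have "a \<in> mesh_vertices \<T>" "b \<in> mesh_vertices \<T>" using T unfolding mesh_vertices_def by blast+
  ultimately obtain j k where jk: "j \<in> {1..m + 1}" "a = M j" "k \<in> {1..m + 1}" "b = M k" using vertex by metis
  have no: "M l \<notin> open_segment a b" if "l \<in> {1..m + 1}" for l
    using vertex_not_in_open_segment[OF T(1) abT vertices_param(3)[OF that]] .
  have key: "j' = i \<and> k' = i + 1"
    if j': "j' \<in> {1..m + 1}" "k' \<in> {1..m + 1}" "j' < k'" and seg: "open_segment a b = open_segment (M j') (M k')" for j' k'
  proof -
    have seg': "A + r *\<^sub>R \<sigma> \<in> open_segment a b \<longleftrightarrow> r \<in> {abscissa j'<..<abscissa k'}" for r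
      unfolding seg using segment_param[OF abscissa_less[OF j']] vertices_param(1)[OF j'(1)] vertices_param(1)[OF j'(2)] by metis
    have "\<eta> \<in> {abscissa j'<..<abscissa k'}" using ab(1) y(1) seg' by metis
    then have "j' < i + 1" "i < k'"
      using \<eta> abscissa_less_iff[OF j'(1) i'(2)] abscissa_less_iff[OF i'(1) j'(2)] by auto
    moreover have "\<not> (j' < i \<and> i < k')"
      using no[OF i'(1)] seg'[of "abscissa i"] vertices_param(1)[OF i'(1)] abscissa_less_iff[OF j'(1) i'(1)] abscissa_less_iff[OF i'(1) j'(2)]
      by auto
    moreover have "\<not> (j' < i + 1 \<and> i + 1 < k')"
      using no[OF i'(2)] seg'[of "abscissa (i + 1)"] vertices_param(1)[OF i'(2)] abscissa_less_iff[OF j'(1) i'(2)] abscissa_less_iff[OF i'(2) j'(2)]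
      by auto
    ultimately show ?thesis by linarith
  qed
  have "j \<noteq> k" using jk T(4) by auto
  then consider "j < k" | "k < j" by linarith
  then show ?thesis
  proof cases
    case 1
    then have "j = i" "k = i + 1" using key[OF jk(1,3) 1] jk by auto
    then show ?thesis using T jk by blast
  next
    case 2
    then have "k = i" "j = i + 1" using key[OF jk(3,1) 2] jk by (auto simp: open_segment_commute)
    then show ?thesis using T jk by blast
  qed
qed

end

section \<open>Functions as a vector space, and finite dimension of piecewise polynomials\<close>

instantiation "fun" :: (type, real_vector) real_vector
begin

definition "scaleR r f = (\<lambda>x. r *\<^sub>R f x)"

instance
  by standard (simp_all add: scaleR_fun_def fun_eq_iff scaleR_add_right scaleR_add_left)

end

lemma scaleR_fun_apply [simp]: "(r *\<^sub>R f) x = r *\<^sub>R f x"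
  by (simp add: scaleR_fun_def)

lemma sum_fun_apply: "(\<Sum>i\<in>I. f i) x = (\<Sum>i\<in>I. f i x)"
  by (induction I rule: infinite_finite_induct) auto

text \<open>The spanning set consists of monomials cut off to disjoint parts of the cells. Cells
  overlap along common sides, so each point is assigned to one chosen cell; elements of
  \<open>F\<close> are zero outside the cells, hence the sum reproduces them everywhere.\<close>

lemma fin_dim_piecewise_poly:
  fixes F :: "(real^2 \<Rightarrow> 'b::euclidean_space) set"
  assumes F: "subspace F" and fin: "finite \<C>"
    and outside: "\<And>f x. f \<in> F \<Longrightarrow> x \<notin> \<Union>\<C> \<Longrightarrow> f x = 0"
    and poly: "\<And>f T b. f \<in> F \<Longrightarrow> T \<in> \<C> \<Longrightarrow> b \<in> Basis \<Longrightarrow> poly_on k T (\<lambda>x. f x \<bullet> b)"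
  shows "fin_dim F"
proof -
  define cell where "cell x = (SOME T. T \<in> \<C> \<and> x \<in> T)" for x
  have cell: "cell x \<in> \<C> \<and> x \<in> cell x" if "x \<in> \<Union>\<C>" for x
    unfolding cell_def using that by (intro someI_ex[of "\<lambda>T. T \<in> \<C> \<and> x \<in> T"]) blast
  define w :: "(real^2) set \<Rightarrow> 'b \<Rightarrow> nat \<Rightarrow> nat \<Rightarrow> real^2 \<Rightarrow> 'b" where
    "w T b i j = (\<lambda>x. if x \<in> \<Union>\<C> \<and> cell x = T then (x $ 1 ^ i * x $ 2 ^ j) *\<^sub>R b else 0)" for T b i j
  define W where "W = (\<Union>T\<in>\<C>. \<Union>b\<in>Basis. \<Union>i\<in>{..k}. \<Union>j\<in>{..k}. {w T b i j})"
  have "finite W" unfolding W_def using fin by auto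
  moreover have "F \<subseteq> span W"
  proof
    fix f assume f: "f \<in> F"
    define c where "c T b = (SOME c. \<forall>x\<in>T. f x \<bullet> b = (\<Sum>i\<le>k. \<Sum>j\<le>k - i. c i j * (x $ 1) ^ i * (x $ 2) ^ j))" for T b
    have c: "f x \<bullet> b = (\<Sum>i\<le>k. \<Sum>j\<le>k - i. c T b i j * (x $ 1) ^ i * (x $ 2) ^ j)"
      if "T \<in> \<C>" "b \<in> Basis" "x \<in> T" for T b x
      using someI_ex[OF poly[OF f that(1,2), unfolded poly_on_def], folded c_def] that(3) by blast
    have "f = (\<Sum>T\<in>\<C>. \<Sum>b\<in>Basis. \<Sum>i\<le>k. \<Sum>j\<le>k - i. c T b i j *\<^sub>R w T b i j)"
    proof
      fix x
      have eq: "(\<Sum>T\<in>\<C>. \<Sum>b\<in>Basis. \<Sum>i\<le>k. \<Sum>j\<le>k - i. c T b i j *\<^sub>R w T b i j) x =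
          (\<Sum>T\<in>\<C>. if x \<in> \<Union>\<C> \<and> cell x = T then f x else 0)"
        unfolding sum_fun_apply
      proof (rule sum.cong[OF refl])
        fix T assume T: "T \<in> \<C>"
        show "(\<Sum>b\<in>Basis. \<Sum>i\<le>k. \<Sum>j\<le>k - i. (c T b i j *\<^sub>R w T b i j) x) = (if x \<in> \<Union>\<C> \<and> cell x = T then f x else 0)"
        proof (cases "x \<in> \<Union>\<C> \<and> cell x = T")
          case True
          then have "x \<in> T" using cell by blast
          have "(\<Sum>b\<in>Basis. \<Sum>i\<le>k. \<Sum>j\<le>k - i. (c T b i j *\<^sub>R w T b i j) x) =
              (\<Sum>b\<in>Basis. (\<Sum>i\<le>k. \<Sum>j\<le>k - i. c T b i j * (x $ 1) ^ i * (x $ 2) ^ j) *\<^sub>R b)"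
            using True by (simp add: w_def scaleR_sum_left mult.assoc)
          also have "\<dots> = (\<Sum>b\<in>Basis. (f x \<bullet> b) *\<^sub>R b)"
            using c[OF T _ \<open>x \<in> T\<close>] by (intro sum.cong refl) simp
          finally show ?thesis using True by (simp add: euclidean_representation)
        next
          case False
          then have "w T b i j x = 0" for b i j unfolding w_def by (rule if_not_P)
          then show ?thesis unfolding if_not_P[OF False] by simp
        qed
      qed
      show "f x = (\<Sum>T\<in>\<C>. \<Sum>b\<in>Basis. \<Sum>i\<le>k. \<Sum>j\<le>k - i. c T b i j *\<^sub>R w T b i j) x"
        unfolding eq using fin cell outside[OF f] by (cases "x \<in> \<Union>\<C>") auto
    qed
    moreover have "w T b i j \<in> W" if "T \<in> \<C>" "b \<in> Basis" "i \<le> k" "j \<le> k - i" for T b i j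
      using that unfolding W_def by (intro UN_I[of T] UN_I[of b] UN_I[of i] UN_I[of j]) auto
    then have "(\<Sum>T\<in>\<C>. \<Sum>b\<in>Basis. \<Sum>i\<le>k. \<Sum>j\<le>k - i. c T b i j *\<^sub>R w T b i j) \<in> span W"
      by (intro span_sum span_scale span_base) auto
    ultimately show "f \<in> span W" by simp
  qed
  ultimately show ?thesis using F unfolding fin_dim_def by blast
qed

lemma LINT_cong_bounded_meas:
  assumes "open \<Omega>" "bounded_meas \<Omega> f" "AE x in lebesgue_on \<Omega>. g x = f x"
  shows "(LINT x|lebesgue_on \<Omega>. g x) = (LINT x|lebesgue_on \<Omega>. f x)" "bounded_meas \<Omega> g"
proof -
  have eq: "AE x in lebesgue_on \<Omega>. f x = g x" using assms(3) by eventually_elim simp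
  show g: "bounded_meas \<Omega> g" by (rule bounded_meas_AE[OF assms(1,2) eq])
  show "(LINT x|lebesgue_on \<Omega>. g x) = (LINT x|lebesgue_on \<Omega>. f x)"
    using assms(2,3) g unfolding bounded_meas_def by (intro integral_cong_AE) auto
qed

section \<open>Linearity of weak derivatives and integrals up to null sets\<close>

context mesh_domain
begin

lemma weak_deriv_linear:
  assumes v: "pc1 v" and w: "pc1 w"
  shows "AE x in lebesgue_on \<Omega>. weak_deriv \<Omega> j (\<lambda>x. v x + w x) x = weak_deriv \<Omega> j v x + weak_deriv \<Omega> j w x"
    and "AE x in lebesgue_on \<Omega>. weak_deriv \<Omega> j (\<lambda>x. r * w x) x = r * weak_deriv \<Omega> j w x"
proof -
  have add: "partial_deriv j (\<lambda>x. v x + w x) x = partial_deriv j v x + partial_deriv j w x" if "x \<in> core" for x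
    using partial_deriv_eq[OF has_derivative_add[OF
        has_derivative_directional[OF pc1_differentiable[OF v that]] has_derivative_directional[OF pc1_differentiable[OF w that]]]]
    unfolding directional_axis .
  have mult: "partial_deriv j (\<lambda>x. r * w x) x = r * partial_deriv j w x" if "x \<in> core" for x
    using partial_deriv_eq[OF has_derivative_mult_right[OF has_derivative_directional[OF pc1_differentiable[OF w that]]]]
    unfolding directional_axis .
  show "AE x in lebesgue_on \<Omega>. weak_deriv \<Omega> j (\<lambda>x. v x + w x) x = weak_deriv \<Omega> j v x + weak_deriv \<Omega> j w x"
    using weak_deriv_pc1[OF v, of j] weak_deriv_pc1[OF w, of j] weak_deriv_pc1[OF pc1_add[OF v w], of j] AE_core_on
    by eventually_elim (simp add: add)
  show "AE x in lebesgue_on \<Omega>. weak_deriv \<Omega> j (\<lambda>x. r * w x) x = r * weak_deriv \<Omega> j w x"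
    using weak_deriv_pc1[OF w, of j] weak_deriv_pc1[OF pc1_cmult[OF w, of r], of j] AE_core_on
    by eventually_elim (simp add: mult)
qed

lemma bounded_meas_weak_deriv: "pc1 w \<Longrightarrow> bounded_meas \<Omega> (weak_deriv \<Omega> j w)"
  using LINT_cong_bounded_meas(2)[OF open_domain bounded_meas_deriv weak_deriv_pc1] .

lemma LINT_product_linear:
  assumes "bounded_meas \<Omega> f" "bounded_meas \<Omega> f'" "bounded_meas \<Omega> g" "AE x in lebesgue_on \<Omega>. h x = r * f x + f' x"
  shows "(LINT x|lebesgue_on \<Omega>. h x * g x) = r * (LINT x|lebesgue_on \<Omega>. f x * g x) + (LINT x|lebesgue_on \<Omega>. f' x * g x)"
proof -
  have bm: "bounded_meas \<Omega> (\<lambda>x. f x * g x)" "bounded_meas \<Omega> (\<lambda>x. f' x * g x)"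
    using assms by (auto intro: bounded_meas_mult)
  have "AE x in lebesgue_on \<Omega>. h x * g x = r * (f x * g x) + f' x * g x"
    using assms(4) by eventually_elim (simp add: algebra_simps)
  then have "(LINT x|lebesgue_on \<Omega>. h x * g x) = (LINT x|lebesgue_on \<Omega>. r * (f x * g x) + f' x * g x)"
    using bm by (intro LINT_cong_bounded_meas(1)[OF open_domain] bounded_meas_add bounded_meas_cmult)
  also have "\<dots> = r * (LINT x|lebesgue_on \<Omega>. f x * g x) + (LINT x|lebesgue_on \<Omega>. f' x * g x)"
    using bounded_meas_integrable[OF open_domain bounded_domain bm(1)] bounded_meas_integrable[OF open_domain bounded_domain bm(2)]
    by simp
  finally show ?thesis .
qed

text \<open>A nonzero value would persist on a nonempty open set, which is not negligible. This
  turns the almost everywhere information from vanishing integrals into pointwise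
  information.\<close>

lemma open_AE_zero:
  assumes "continuous_on U f" "open U" "U \<subseteq> \<Omega>" "AE x in lebesgue_on \<Omega>. x \<in> U \<longrightarrow> f x = (0::real)" "x \<in> U"
  shows "f x = 0"
proof (rule ccontr)
  assume nz: "f x \<noteq> 0"
  define W where "W = {y \<in> U. f y \<noteq> 0}"
  have "open W" unfolding W_def using continuous_open_preimage[OF assms(1,2), of "- {0}"]
    by (auto simp: vimage_def Int_def)
  moreover have "W \<noteq> {}" using nz assms(5) unfolding W_def by blast
  ultimately have "\<not> negligible W" by (rule open_not_negligible)
  moreover have "AE y in lebesgue. y \<notin> W"
    using assms(4) open_domain assms(3) unfolding W_def
    by (auto simp: AE_restrict_space_iff elim!: eventually_mono)
  then have "W \<in> null_sets lebesgue" using AE_iff_null_sets[of W lebesgue] \<open>open W\<close> by simp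
  ultimately show False by (simp add: negligible_iff_null_sets)
qed

lemma LINT_square_zero:
  assumes "bounded_meas \<Omega> f" "(LINT x|lebesgue_on \<Omega>. f x * f x) = 0"
  shows "AE x in lebesgue_on \<Omega>. f x = 0"
proof -
  have "integrable (lebesgue_on \<Omega>) (\<lambda>x. f x * f x)"
    using assms(1) by (intro bounded_meas_integrable[OF open_domain bounded_domain] bounded_meas_mult)
  then have "AE x in lebesgue_on \<Omega>. f x * f x = 0"
    using integral_nonneg_eq_0_iff_AE[of "lebesgue_on \<Omega>" "\<lambda>x. f x * f x"] assms(2) by simp
  then show ?thesis by eventually_elim simp
qed

end

section \<open>The bilinear forms on the finite element spaces\<close>

context fe_mesh
begin

abbreviation V where "V \<equiv> V_space \<Omega> \<T>"
abbreviation V\<tau> where "V\<tau> \<equiv> V_tau_space \<Omega> \<Gamma>0 \<Gamma>1 n \<T>"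

text \<open>The strain with classical derivatives, meaningful at every point of \<open>core\<close>,
  whereas \<open>strain\<close> is known only up to a null set.\<close>

definition strain_cl :: "2 \<Rightarrow> 2 \<Rightarrow> (real^2 \<Rightarrow> real^2) \<Rightarrow> real^2 \<Rightarrow> real" where
  "strain_cl i j v x = (partial_deriv j (\<lambda>y. v y $ i) x + partial_deriv i (\<lambda>y. v y $ j) x) / 2"

lemma strain_AE:
  assumes "v \<in> V"
  shows "AE x in lebesgue_on \<Omega>. strain \<Omega> i j v x = strain_cl i j v x"
  using weak_deriv_pc1[OF pc1_component[OF assms, of i], of j] weak_deriv_pc1[OF pc1_component[OF assms, of j], of i]
  by eventually_elim (simp add: strain_def strain_cl_def)

lemma bounded_meas_strain: "v \<in> V \<Longrightarrow> bounded_meas \<Omega> (strain \<Omega> i j v)"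
  unfolding strain_def[abs_def] divide_inverse mult.commute[of _ "inverse 2"]
  by (intro bounded_meas_cmult bounded_meas_add bounded_meas_weak_deriv pc1_component)

lemma bounded_meas_divergence: "v \<in> V \<Longrightarrow> bounded_meas \<Omega> (divergence \<Omega> v)"
  unfolding divergence_def[abs_def] by (intro bounded_meas_sum bounded_meas_weak_deriv pc1_component)

lemma weak_deriv_comp_linear:
  assumes "u \<in> V" "v \<in> V"
  shows "AE x in lebesgue_on \<Omega>. weak_deriv_comp \<Omega> i j (r *\<^sub>R u + v) x = r * weak_deriv_comp \<Omega> i j u x + weak_deriv_comp \<Omega> i j v x"
proof -
  have eq: "(\<lambda>y. (r *\<^sub>R u + v) y $ i) = (\<lambda>y. r * u y $ i + v y $ i)" by simp
  show ?thesis unfolding eq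
    using weak_deriv_linear(1)[OF pc1_cmult[OF pc1_component[OF assms(1), of i], of r] pc1_component[OF assms(2), of i], where j = j]
      weak_deriv_linear(2)[OF pc1_component[OF assms(1), of i] pc1_component[OF assms(1), of i], where j = j and r = r]
    by eventually_elim simp
qed

lemma strain_linear:
  assumes "u \<in> V" "v \<in> V"
  shows "AE x in lebesgue_on \<Omega>. strain \<Omega> i j (r *\<^sub>R u + v) x = r * strain \<Omega> i j u x + strain \<Omega> i j v x"
  using weak_deriv_comp_linear[OF assms, where i = i and j = j and r = r]
    weak_deriv_comp_linear[OF assms, where i = j and j = i and r = r]
  by eventually_elim (simp add: strain_def field_simps)

lemma divergence_linear:
  assumes "u \<in> V" "v \<in> V"
  shows "AE x in lebesgue_on \<Omega>. divergence \<Omega> (r *\<^sub>R u + v) x = r * divergence \<Omega> u x + divergence \<Omega> v x"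
  using weak_deriv_comp_linear[OF assms, where i = 1 and j = 1 and r = r]
    weak_deriv_comp_linear[OF assms, where i = 2 and j = 2 and r = r]
  by eventually_elim (simp add: divergence_def sum_2 algebra_simps)

lemma a_form_sym: "a_form \<Omega> \<nu> u v = a_form \<Omega> \<nu> v u"
  unfolding a_form_def by (simp add: mult.commute)

lemma a_form_linear:
  assumes "u \<in> V" "v \<in> V" "w \<in> V"
  shows "a_form \<Omega> \<nu> (r *\<^sub>R u + v) w = r * a_form \<Omega> \<nu> u w + a_form \<Omega> \<nu> v w"
proof -
  have "(LINT x|lebesgue_on \<Omega>. strain \<Omega> i j (r *\<^sub>R u + v) x * strain \<Omega> i j w x) =
      r * (LINT x|lebesgue_on \<Omega>. strain \<Omega> i j u x * strain \<Omega> i j w x) + (LINT x|lebesgue_on \<Omega>. strain \<Omega> i j v x * strain \<Omega> i j w x)" for i j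
    by (intro LINT_product_linear bounded_meas_strain strain_linear assms)
  then show ?thesis unfolding a_form_def by (simp add: sum.distrib sum_distrib_left algebra_simps)
qed

lemma b_form_linear:
  assumes "u \<in> V" "v \<in> V" "bounded_meas \<Omega> q"
  shows "b_form \<Omega> (r *\<^sub>R u + v) q = r * b_form \<Omega> u q + b_form \<Omega> v q"
  unfolding b_form_def
  using LINT_product_linear[OF bounded_meas_divergence[OF assms(1)] bounded_meas_divergence[OF assms(2)] assms(3)
      divergence_linear[OF assms(1,2), of r]] by simp

lemma b_form_linear_right:
  assumes "v \<in> V" "bounded_meas \<Omega> p" "bounded_meas \<Omega> q"
  shows "b_form \<Omega> v (r *\<^sub>R p + q) = r * b_form \<Omega> v p + b_form \<Omega> v q"
  unfolding b_form_def
  using LINT_product_linear[OF assms(2,3) bounded_meas_divergence[OF assms(1)], of "r *\<^sub>R p + q" r]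
  by (simp add: mult.commute)

lemma a_form_nonneg: "0 \<le> \<nu> \<Longrightarrow> 0 \<le> a_form \<Omega> \<nu> v v"
proof -
  assume "0 \<le> \<nu>"
  moreover have "0 \<le> (LINT x|lebesgue_on \<Omega>. strain \<Omega> i j v x * strain \<Omega> i j v x)" for i j
    by (rule Bochner_Integration.integral_nonneg) simp
  ultimately show ?thesis unfolding a_form_def by (simp add: sum_nonneg)
qed

text \<open>The quadratic form of the gradient matrix at d sees only the symmetric part of that
  matrix.\<close>

lemma directional_strain:
  assumes v: "v \<in> V" and x: "x \<in> core"
  shows "directional d (\<lambda>y. v y \<bullet> d) x = (\<Sum>i\<in>UNIV. \<Sum>j\<in>UNIV. d $ i * d $ j * strain_cl i j v x)"
proof -
  have D: "((\<lambda>y. v y $ i) has_derivative (\<lambda>h. directional h (\<lambda>y. v y $ i) x)) (at x)" for i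
    by (rule has_derivative_directional[OF pc1_differentiable[OF pc1_component[OF v] x]])
  have "((\<lambda>y. d $ 1 * v y $ 1 + d $ 2 * v y $ 2) has_derivative
      (\<lambda>h. d $ 1 * directional h (\<lambda>y. v y $ 1) x + d $ 2 * directional h (\<lambda>y. v y $ 2) x)) (at x)"
    by (intro has_derivative_add has_derivative_mult_right D)
  from directional_eq[OF this, of d] show ?thesis
    by (simp add: directional_def strain_cl_def inner_vec_def sum_2 algebra_simps add_divide_distrib)
qed

text \<open>Cauchy-Schwarz for matrices: the products of the components of d form a matrix of
  Frobenius norm 1.\<close>

lemma strain_normal_bound:
  assumes "d $ 1 * d $ 1 + d $ 2 * d $ 2 = (1::real)"
  shows "(\<Sum>i\<in>UNIV. \<Sum>j\<in>UNIV. (d::real^2) $ i * d $ j * e i j)\<^sup>2 \<le> (\<Sum>i\<in>UNIV. \<Sum>j\<in>UNIV. e i j * e (i::2) (j::2))"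
proof -
  define x where "x = (\<lambda>p::2 \<times> 2. d $ fst p * d $ snd p)"
  define y where "y = (\<lambda>p. e (fst p) (snd p))"
  have "(\<Sum>p\<in>UNIV. x p * y p)\<^sup>2 \<le> (\<Sum>p\<in>UNIV. (x p)\<^sup>2) * (\<Sum>p\<in>UNIV. (y p)\<^sup>2)"
    by (rule Cauchy_Schwarz_ineq_sum)
  moreover have pairs: "(\<Sum>p\<in>UNIV. f p) = (\<Sum>i\<in>UNIV. \<Sum>j\<in>UNIV. f (i, j))" for f :: "2 \<times> 2 \<Rightarrow> real"
    by (simp add: sum.cartesian_product)
  moreover have "(\<Sum>i\<in>UNIV. \<Sum>j\<in>UNIV. (x (i, j))\<^sup>2) = 1"
  proof -
    have "(\<Sum>i\<in>UNIV. \<Sum>j\<in>UNIV. (x (i, j))\<^sup>2) = (d $ 1 * d $ 1 + d $ 2 * d $ 2)\<^sup>2"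
      by (simp add: x_def sum_2 power2_eq_square algebra_simps)
    then show ?thesis using assms by simp
  qed
  ultimately show ?thesis unfolding pairs by (simp add: x_def y_def power2_eq_square)
qed

lemma a_form_controls_normal_derivative:
  assumes v: "v \<in> V" and "0 \<le> \<nu>"
  shows "2 * \<nu> * (LINT x|lebesgue_on \<Omega>. (directional n (normal_comp n v) x)\<^sup>2) \<le> a_form \<Omega> \<nu> v v"
proof -
  have n1: "n $ 1 * n $ 1 + n $ 2 * n $ 2 = 1" using tangent_frame(2) by (simp add: inner_vec_def sum_2)
  have bm: "bounded_meas \<Omega> (\<lambda>x. strain \<Omega> i j v x * strain \<Omega> i j v x)" for i j
    using v by (intro bounded_meas_mult bounded_meas_strain)
  have "AE x in lebesgue_on \<Omega>. \<forall>i j. strain \<Omega> i j v x = strain_cl i j v x"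
    unfolding AE_all_countable using strain_AE[OF v] by blast
  with AE_core_on have "AE x in lebesgue_on \<Omega>. (directional n (normal_comp n v) x)\<^sup>2 \<le> (\<Sum>i\<in>UNIV. \<Sum>j\<in>UNIV. strain \<Omega> i j v x * strain \<Omega> i j v x)"
  proof eventually_elim
    case (elim x)
    then show ?case using strain_normal_bound[OF n1, of "\<lambda>i j. strain_cl i j v x"]
      unfolding directional_strain[OF v elim(1)] by simp
  qed
  then have "(LINT x|lebesgue_on \<Omega>. (directional n (normal_comp n v) x)\<^sup>2) \<le>
      (LINT x|lebesgue_on \<Omega>. (\<Sum>i\<in>UNIV. \<Sum>j\<in>UNIV. strain \<Omega> i j v x * strain \<Omega> i j v x))"
    by (intro integral_mono_AE bounded_meas_integrable[OF open_domain bounded_domain] bounded_meas_sum bm)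
       (simp add: power2_eq_square, intro bounded_meas_mult bounded_meas_directional pc1_V_space v)
  also have "\<dots> = (\<Sum>i\<in>UNIV. \<Sum>j\<in>UNIV. LINT x|lebesgue_on \<Omega>. strain \<Omega> i j v x * strain \<Omega> i j v x)"
    using bounded_meas_integrable[OF open_domain bounded_domain bm] by (simp add: Bochner_Integration.integral_sum)
  finally show ?thesis unfolding a_form_def using assms(2) by (intro mult_left_mono) auto
qed

text \<open>Zero strain makes v \<bullet> d constant along lines of direction d inside the domain.
  For the tangential component every exit point has the value 0. For the normal component an exit
  through \<Gamma>1 must be avoided, and of the two opposite normal rays at most one meets the
  side.\<close>

theorem a_form_definite:
  assumes v: "v \<in> V\<tau>" and "\<nu> > 0" and zero: "a_form \<Omega> \<nu> v v = 0" and x: "x \<in> closure \<Omega>"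
  shows "v x = 0"
proof -
  have vV: "v \<in> V" using v by (rule V_tau_V)
  have nonneg: "0 \<le> (LINT x|lebesgue_on \<Omega>. strain \<Omega> i j v x * strain \<Omega> i j v x)" for i j
    by (rule Bochner_Integration.integral_nonneg) simp
  have "(\<Sum>i\<in>UNIV. \<Sum>j\<in>UNIV. LINT x|lebesgue_on \<Omega>. strain \<Omega> i j v x * strain \<Omega> i j v x) = 0"
    using zero \<open>\<nu> > 0\<close> unfolding a_form_def by simp
  then have "(LINT x|lebesgue_on \<Omega>. strain \<Omega> i j v x * strain \<Omega> i j v x) = 0" for i j
    using nonneg by (simp add: sum_nonneg_eq_0_iff sum_nonneg)
  then have AE0: "AE x in lebesgue_on \<Omega>. strain \<Omega> i j v x = 0" for i j
    by (intro LINT_square_zero bounded_meas_strain vV)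
  \<comment> \<open>Continuity on the open set \<open>core\<close> removes the exceptional null
    set.\<close>
  have strain0: "strain_cl i j v y = 0" if "y \<in> core" for i j y
  proof (rule open_AE_zero[OF _ open_core core_subset _ that])
    show "continuous_on core (strain_cl i j v)"
      unfolding strain_cl_def[abs_def] using pc1_deriv_continuous[OF pc1_component[OF vV]]
      by (intro continuous_intros) auto
    show "AE x in lebesgue_on \<Omega>. x \<in> core \<longrightarrow> strain_cl i j v x = 0"
      using AE0[of i j] strain_AE[OF vV, of i j] by eventually_elim simp
  qed
  have dir0: "directional d (\<lambda>y. v y \<bullet> d) y = 0" if "y \<in> core" for d y
    unfolding directional_strain[OF vV that] using strain0[OF that] by simp
  have inside: "v z = 0" if z: "z \<in> \<Omega>" for z
  proof (rule zero_by_components)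
    show "v z \<bullet> tangent n = 0"
    proof (rule zero_along_ray[OF pc1_V_space[OF vV] dir0 interior_cell_nonempty _ z])
      show "tangent n \<noteq> 0" using tangent_frame(5) by auto
    qed (use V_tau_boundary(2)[OF v] in auto)
    \<comment> \<open>If both normal rays met the side, comparing components along n would put z
      itself on it.\<close>
    have "\<exists>s\<in>{1, - 1}. \<forall>t\<ge>0. z + t *\<^sub>R (s *\<^sub>R n) \<notin> closed_segment A B"
    proof (rule ccontr)
      assume "\<not> ?thesis"
      then obtain t1 t2 where t: "t1 \<ge> 0" "z + t1 *\<^sub>R n \<in> closed_segment A B" "t2 \<ge> 0" "z + t2 *\<^sub>R (- n) \<in> closed_segment A B"
        by auto
      then obtain s1 s2 where s: "z + t1 *\<^sub>R n = A + s1 *\<^sub>R \<sigma>" "z + t2 *\<^sub>R (- n) = A + s2 *\<^sub>R \<sigma>"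
        unfolding side_param(1) by blast
      have "z \<bullet> n + t1 = A \<bullet> n" "z \<bullet> n - t2 = A \<bullet> n"
        using arg_cong[OF s(1), of "\<lambda>y. y \<bullet> n"] arg_cong[OF s(2), of "\<lambda>y. y \<bullet> n"] side_direction(2) tangent_frame(2)
        by (simp_all add: inner_add_left inner_diff_left)
      then have "t1 = 0" using t by linarith
      then have "z \<in> frontier \<Omega>" using t(2) \<Gamma>1_frontier(2) by auto
      then show False using frontier_not_domain z by blast
    qed
    then obtain s where s: "s \<in> {1, - 1}" "\<And>t. 0 \<le> t \<Longrightarrow> z + t *\<^sub>R (s *\<^sub>R n) \<notin> closed_segment A B" by blast
    show "v z \<bullet> n = 0"
    proof (rule zero_along_ray[OF pc1_V_space[OF vV] _ interior_cell_nonempty _ z])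
      show "s *\<^sub>R n \<noteq> 0" using s(1) tangent_frame(1) by auto
      show "directional (s *\<^sub>R n) (\<lambda>y. v y \<bullet> n) y = 0" if "y \<in> core" for y
        using dir0[OF that, of n] unfolding directional_def by (simp add: sum_distrib_left[symmetric] mult.assoc)
      show "v (z + t *\<^sub>R s *\<^sub>R n) \<bullet> n = 0" if "0 \<le> t" "z + t *\<^sub>R s *\<^sub>R n \<in> frontier \<Omega>" for t
      proof -
        have "z + t *\<^sub>R s *\<^sub>R n \<in> closure \<Gamma>0"
          using frontier_parts[OF that(2)] s(2)[OF that(1)] whole_side(3) segment_open_subset_closed by blast
        then show ?thesis using V_tau_boundary(1)[OF v that(2)] by simp
      qed
    qed
  qed
  have "continuous_on (closure \<Omega>) v" using vV unfolding V_space_def by blast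
  then show ?thesis using continuous_constant_on_closure[of \<Omega> v 0 x] inside x by blast
qed

lemma covering:
  assumes "s \<in> {0..dist A B}"
  shows "\<exists>i\<in>{1..m}. s \<in> {abscissa i..abscissa (i + 1)}"
proof -
  define P where "P j \<longleftrightarrow> 1 \<le> j \<and> s \<le> abscissa (j + 1)" for j
  have "P m" unfolding P_def using abscissa_ends assms by auto
  define j where "j = (LEAST j. P j)"
  have j: "P j" "j \<le> m" unfolding j_def using LeastI[of P m] Least_le[of P m] \<open>P m\<close> by auto
  have "abscissa j \<le> s"
  proof (cases "j = 1")
    case True
    then show ?thesis using abscissa_ends(1) assms by simp
  next
    case False
    have "1 \<le> j" using j(1) unfolding P_def by simp
    then have "\<not> P (j - 1)" using not_less_Least[of "j - 1" P, folded j_def] by simp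
    then show ?thesis using False j unfolding P_def by auto
  qed
  then show ?thesis using j unfolding P_def by auto
qed

lemma edge_param:
  assumes "i \<in> {1..m}" "t \<in> {0..1}"
  shows "M i + t *\<^sub>R (M (i + 1) - M i) = A + (abscissa i + t * (abscissa (i + 1) - abscissa i)) *\<^sub>R \<sigma>"
    "M i + t *\<^sub>R (M (i + 1) - M i) \<in> closed_segment (M i) (M (i + 1))"
    "dist (M i) (M (i + 1)) = abscissa (i + 1) - abscissa i"
proof -
  have i: "i \<in> {1..m + 1}" "i + 1 \<in> {1..m + 1}" using assms by auto
  define a b where "a = abscissa i" and "b = abscissa (i + 1)"
  have e: "M i = A + a *\<^sub>R \<sigma>" "M (i + 1) = A + b *\<^sub>R \<sigma>" "a < b"
    unfolding a_def b_def using vertices_param(1)[OF i(1)] vertices_param(1)[OF i(2)] abscissa_less[OF i] by auto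
  show "M i + t *\<^sub>R (M (i + 1) - M i) = A + (abscissa i + t * (abscissa (i + 1) - abscissa i)) *\<^sub>R \<sigma>"
    unfolding a_def[symmetric] b_def[symmetric] e by (simp add: algebra_simps)
  have "dist (M i) (M (i + 1)) = norm ((b - a) *\<^sub>R \<sigma>)" unfolding e dist_norm by (simp add: algebra_simps norm_minus_commute)
  then show "dist (M i) (M (i + 1)) = abscissa (i + 1) - abscissa i"
    using e(3) side_direction(1) unfolding a_def b_def by simp
  show "M i + t *\<^sub>R (M (i + 1) - M i) \<in> closed_segment (M i) (M (i + 1))"
    unfolding in_segment using assms(2) by (intro exI[of _ t]) (auto simp: algebra_simps)
qed

lemma closure_\<Gamma>1_edges: "closure \<Gamma>1 = (\<Union>i\<in>{1..m}. closed_segment (M i) (M (i + 1)))"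
proof
  show "closure \<Gamma>1 \<subseteq> (\<Union>i\<in>{1..m}. closed_segment (M i) (M (i + 1)))"
  proof
    fix x assume "x \<in> closure \<Gamma>1"
    then obtain s where s: "s \<in> {0..dist A B}" "x = A + s *\<^sub>R \<sigma>" unfolding whole_side(2) side_param(1) by blast
    obtain i where i: "i \<in> {1..m}" "abscissa i \<le> s" "s \<le> abscissa (i + 1)" using covering[OF s(1)] by auto
    have i': "i \<in> {1..m + 1}" "i + 1 \<in> {1..m + 1}" using i(1) by auto
    have lt: "abscissa i < abscissa (i + 1)" using abscissa_less[OF i'] by simp
    define t where "t = (s - abscissa i) / (abscissa (i + 1) - abscissa i)"
    have t: "t \<in> {0..1}" "abscissa i + t * (abscissa (i + 1) - abscissa i) = s"
      unfolding t_def using lt i(2,3) by (auto simp: divide_le_eq)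
    have "x = M i + t *\<^sub>R (M (i + 1) - M i)" unfolding edge_param(1)[OF i(1) t(1)] t(2) s(2) ..
    then show "x \<in> (\<Union>i\<in>{1..m}. closed_segment (M i) (M (i + 1)))" using edge_param(2)[OF i(1) t(1)] i(1) by auto
  qed
  have "closed_segment (M i) (M (i + 1)) \<subseteq> closed_segment A B" if "i \<in> {1..m}" for i
  proof -
    have "M i \<in> closed_segment A B" "M (i + 1) \<in> closed_segment A B"
      using vertices that unfolding boundary_vertices_def by force+
    then show ?thesis by (simp add: closed_segment_subset)
  qed
  then show "(\<Union>i\<in>{1..m}. closed_segment (M i) (M (i + 1))) \<subseteq> closure \<Gamma>1" unfolding whole_side(2) by blast
qed

lemma integral_affine_interval:
  fixes f :: "real \<Rightarrow> real"
  assumes "a < b" "continuous_on {a..b} f"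
  shows "(b - a) * integral {0..1} (\<lambda>t. f (a + t * (b - a))) = integral {a..b} f"
proof -
  have "(f has_integral integral {a..b} f) (cbox a b)"
    using assms(2) by (simp add: integrable_continuous_real integrable_integral)
  from has_integral_affinity[OF this, of "b - a" a] assms(1)
  have "((\<lambda>x. f ((b - a) * x + a)) has_integral (integral {a..b} f / (b - a))) ((\<lambda>x. (1 / (b - a)) *\<^sub>R x + - ((1 / (b - a)) *\<^sub>R a)) ` cbox a b)"
    by (simp add: divide_inverse mult.commute)
  moreover have "(\<lambda>x. (1 / (b - a)) *\<^sub>R x + - ((1 / (b - a)) *\<^sub>R a)) ` cbox a b = {0..1}"
    using assms(1) image_affinity_cbox[of "1 / (b - a)" "- ((1 / (b - a)) *\<^sub>R a)" a b]
    by (simp add: field_simps diff_divide_distrib[symmetric])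
  ultimately have "((\<lambda>x. f ((b - a) * x + a)) has_integral (integral {a..b} f / (b - a))) {0..1}" by simp
  then have "integral {0..1} (\<lambda>t. f (a + t * (b - a))) = integral {a..b} f / (b - a)"
    by (simp add: integral_unique add.commute mult.commute)
  then show ?thesis using assms(1) by simp
qed

text \<open>The normal component is quadratic on the edge because the edge is a side of some cell,
  by \<open>boundary_edge\<close>; \<open>simpson_square_bound\<close> is then rescaled from the
  unit interval.\<close>

lemma simpson_edge:
  assumes v: "v \<in> V" and i: "i \<in> {1..m}"
  defines "w \<equiv> normal_comp n v"
  shows "dist (M i) (M (i + 1)) / 6 * ((w (M i))\<^sup>2 + 4 * (w (half_node M i))\<^sup>2 + (w (M (i + 1)))\<^sup>2)
    \<le> 5 / 2 * integral {abscissa i..abscissa (i + 1)} (\<lambda>s. (w (A + s *\<^sub>R \<sigma>))\<^sup>2)"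
proof -
  have i': "i \<in> {1..m + 1}" "i + 1 \<in> {1..m + 1}" using i by auto
  have lt: "abscissa i < abscissa (i + 1)" using abscissa_less[OF i'] by simp
  obtain T where T: "T \<in> \<T>" "M i \<in> vertices_of T" "M (i + 1) \<in> vertices_of T" using boundary_edge[OF i] by blast
  have sub: "closed_segment (M i) (M (i + 1)) \<subseteq> T"
    using T vertices_subset convex_cell[OF T(1)] by (intro closed_segment_subset) blast+
  obtain \<alpha> \<beta> \<gamma> where q: "\<And>t. t \<in> {0..1} \<Longrightarrow> w (M i + t *\<^sub>R (M (i + 1) - M i)) = \<alpha> + \<beta> * t + \<gamma> * t\<^sup>2"
    using poly_on_2_segment[OF V_space_poly[OF v T(1)] sub] unfolding w_def by blast
  define q where "q t = w (M i + t *\<^sub>R (M (i + 1) - M i))" for t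
  have ends: "q 0 = w (M i)" "q 1 = w (M (i + 1))" "q (1/2) = w (half_node M i)"
  proof -
    have "M i + (1/2) *\<^sub>R (M (i + 1) - M i) = half_node M i" by (simp add: midpoint_def vec_eq_iff field_simps)
    then show "q (1/2) = w (half_node M i)" unfolding q_def by (simp only:)
  qed (simp_all add: q_def)
  have cont: "continuous_on {abscissa i..abscissa (i + 1)} (\<lambda>s. (w (A + s *\<^sub>R \<sigma>))\<^sup>2)"
  proof -
    have cw: "continuous_on (closure \<Omega>) w" unfolding w_def by (rule pc1_continuous[OF pc1_V_space[OF v]])
    have "(\<lambda>s. A + s *\<^sub>R \<sigma>) ` {abscissa i..abscissa (i + 1)} \<subseteq> closure \<Omega>"
    proof clarify
      fix s assume "s \<in> {abscissa i..abscissa (i + 1)}"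
      then have "A + s *\<^sub>R \<sigma> \<in> closed_segment A B"
        unfolding side_param(2) using vertices_param(2)[OF i'(1)] vertices_param(2)[OF i'(2)] by auto
      then show "A + s *\<^sub>R \<sigma> \<in> closure \<Omega>" using \<Gamma>1_frontier(2) by (auto simp: frontier_def)
    qed
    then have "continuous_on {abscissa i..abscissa (i + 1)} (\<lambda>s. w (A + s *\<^sub>R \<sigma>))"
      by (intro continuous_on_compose2[OF cw] continuous_intros)
    then show ?thesis by (intro continuous_intros)
  qed
  have "dist (M i) (M (i + 1)) * integral {0..1} (\<lambda>t. (q t)\<^sup>2) = integral {abscissa i..abscissa (i + 1)} (\<lambda>s. (w (A + s *\<^sub>R \<sigma>))\<^sup>2)"
  proof -
    have "integral {0..1} (\<lambda>t. (q t)\<^sup>2) = integral {0..1} (\<lambda>t. (w (A + (abscissa i + t * (abscissa (i + 1) - abscissa i)) *\<^sub>R \<sigma>))\<^sup>2)"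
      unfolding q_def by (intro Henstock_Kurzweil_Integration.integral_cong) (simp only: edge_param(1)[OF i])
    moreover have "dist (M i) (M (i + 1)) = abscissa (i + 1) - abscissa i" by (rule edge_param(3)[OF i, of 0]) simp
    ultimately show ?thesis using integral_affine_interval[OF lt cont] by simp
  qed
  moreover have "dist (M i) (M (i + 1)) / 6 * ((q 0)\<^sup>2 + 4 * (q (1/2))\<^sup>2 + (q 1)\<^sup>2) \<le> 5 / 2 * (dist (M i) (M (i + 1)) * integral {0..1} (\<lambda>t. (q t)\<^sup>2))"
    unfolding q_def by (rule simpson_square_bound[OF zero_le_dist q])
  ultimately show ?thesis unfolding ends by simp
qed

text \<open>The constant collects 5/2 from Simpson's rule, G from the weights g, R from the slices
  and 2 \<nu> from \<open>a_form\<close>. The edge integrals add up to the integral over the whole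
  side, so the number and the lengths of the edges disappear.\<close>

theorem Lam_trace:
  assumes v: "v \<in> V\<tau>" and \<nu>: "\<nu> > 0" and G: "0 \<le> G" "\<And>x. x \<in> closed_segment A B \<Longrightarrow> g x \<le> G"
    and R: "0 \<le> R" "\<And>y z. y \<in> closure \<Omega> \<Longrightarrow> z \<in> closure \<Omega> \<Longrightarrow> norm (y - z) < R"
  shows "Lam_inner g m M (normal_comp n v) (normal_comp n v) \<le> (5 / 2 * G * R / (2 * \<nu>)) * a_form \<Omega> \<nu> v v"
proof -
  have vV: "v \<in> V" using v by (rule V_tau_V)
  define w where "w = normal_comp n v"
  have w: "pc1 w" unfolding w_def by (rule pc1_V_space[OF vV])
  define F where "F s = (w (A + s *\<^sub>R \<sigma>))\<^sup>2" for s
  have side: "A + s *\<^sub>R \<sigma> \<in> closure \<Omega>" if "s \<in> {0..dist A B}" for s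
    using that \<Gamma>1_frontier(2) side_param(2) by (auto simp: frontier_def)
  have cont: "continuous_on {0..dist A B} F" unfolding F_def
    by (intro continuous_intros continuous_on_compose2[OF pc1_continuous[OF w]]) (use side in auto)
  have "(\<Sum>i=1..k. integral {abscissa i..abscissa (i + 1)} F) = integral {0..abscissa (k + 1)} F" if "k \<le> m" for k
    using that
  proof (induction k)
    case 0
    then show ?case using abscissa_ends(1) by simp
  next
    case (Suc k)
    have k: "Suc k \<in> {1..m + 1}" "Suc k + 1 \<in> {1..m + 1}" using Suc by auto
    have le: "0 \<le> abscissa (Suc k)" "abscissa (Suc k) \<le> abscissa (Suc k + 1)" "abscissa (Suc k + 1) \<le> dist A B"
      using vertices_param(2)[OF k(1)] vertices_param(2)[OF k(2)] abscissa_less[OF k] by auto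
    have "F integrable_on {0..abscissa (Suc k + 1)}"
      by (intro integrable_continuous_real continuous_on_subset[OF cont]) (use le in auto)
    from Henstock_Kurzweil_Integration.integral_combine[OF le(1,2) this] Suc show ?case by simp
  qed
  from this[of m] have sum: "(\<Sum>i=1..m. integral {abscissa i..abscissa (i + 1)} F) = integral {0..dist A B} F"
    using abscissa_ends(2) by simp
  have edge_term: "dist (M i) (M (i + 1)) * (g (M i) * w (M i) * w (M i) + 4 * g (half_node M i) * w (half_node M i) * w (half_node M i)
      + g (M (i + 1)) * w (M (i + 1)) * w (M (i + 1))) \<le> 6 * (G * (5 / 2 * integral {abscissa i..abscissa (i + 1)} F))" if i: "i \<in> {1..m}" for i
  proof -
    have "closed_segment (M i) (M (i + 1)) \<subseteq> closed_segment A B" using closure_\<Gamma>1_edges i whole_side(2) by blast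
    then have "M i \<in> closed_segment A B" "M (i + 1) \<in> closed_segment A B" "half_node M i \<in> closed_segment A B"
      using midpoint_in_closed_segment ends_in_segment by blast+
    then have gG: "g (M i) \<le> G" "g (M (i + 1)) \<le> G" "g (half_node M i) \<le> G" using G(2) by auto
    have "g (M i) * w (M i) * w (M i) + 4 * g (half_node M i) * w (half_node M i) * w (half_node M i)
      + g (M (i + 1)) * w (M (i + 1)) * w (M (i + 1)) \<le> G * ((w (M i))\<^sup>2 + 4 * (w (half_node M i))\<^sup>2 + (w (M (i + 1)))\<^sup>2)"
      using mult_right_mono[OF gG(1), of "(w (M i))\<^sup>2"] mult_right_mono[OF gG(2), of "(w (M (i + 1)))\<^sup>2"]
        mult_right_mono[OF gG(3), of "(w (half_node M i))\<^sup>2"]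
      by (simp add: power2_eq_square algebra_simps)
    then have "dist (M i) (M (i + 1)) * (g (M i) * w (M i) * w (M i) + 4 * g (half_node M i) * w (half_node M i) * w (half_node M i)
      + g (M (i + 1)) * w (M (i + 1)) * w (M (i + 1))) \<le> dist (M i) (M (i + 1)) * (G * ((w (M i))\<^sup>2 + 4 * (w (half_node M i))\<^sup>2 + (w (M (i + 1)))\<^sup>2))"
      by (rule mult_left_mono) simp
    also have "\<dots> = 6 * (G * (dist (M i) (M (i + 1)) / 6 * ((w (M i))\<^sup>2 + 4 * (w (half_node M i))\<^sup>2 + (w (M (i + 1)))\<^sup>2)))" by simp
    also have "\<dots> \<le> 6 * (G * (5 / 2 * integral {abscissa i..abscissa (i + 1)} F))"
      using simpson_edge[OF vV i] G(1) unfolding F_def w_def by (intro mult_left_mono) auto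
    finally show ?thesis .
  qed
  have "Lam_inner g m M w w \<le> 1 / 6 * (\<Sum>i=1..m. 6 * (G * (5 / 2 * integral {abscissa i..abscissa (i + 1)} F)))"
    unfolding Lam_inner_def by (intro mult_left_mono sum_mono edge_term) auto
  also have "\<dots> = 5 / 2 * G * integral {0..dist A B} F"
    unfolding sum[symmetric] by (simp add: sum_distrib_left mult.assoc)
  finally have 1: "Lam_inner g m M w w \<le> 5 / 2 * G * integral {0..dist A B} F" .
  \<comment> \<open>Slices enter the domain in direction -n; once off the side they can meet the
    frontier only in the closure of \<Gamma>0, where v vanishes.\<close>
  have "integral {0..dist A B} F \<le> R * (LINT x|lebesgue_on \<Omega>. (directional (- n) w x)\<^sup>2)"
    unfolding F_def
  proof (rule trace_inequality[OF w])
    show "norm \<sigma> = 1" "norm (- n) = 1" "\<sigma> \<bullet> - n = 0" using side_direction tangent_frame by auto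
    fix s assume s: "s \<in> {0<..<dist A B}"
    then have "A + s *\<^sub>R \<sigma> \<in> \<Gamma>1" by (simp only: side_param(3))
    then obtain \<epsilon> where "\<epsilon> > 0" "\<And>t. 0 < t \<Longrightarrow> t < \<epsilon> \<Longrightarrow> A + s *\<^sub>R \<sigma> - t *\<^sub>R n \<in> \<Omega>"
      using normal unfolding outer_unit_normal_def by blast
    then show "\<exists>\<epsilon>>0. \<forall>t. 0 < t \<and> t < \<epsilon> \<longrightarrow> A + s *\<^sub>R \<sigma> + t *\<^sub>R - n \<in> \<Omega>" by auto
    fix t :: real assume t: "0 < t" and fr: "A + s *\<^sub>R \<sigma> + t *\<^sub>R - n \<in> frontier \<Omega>"
    have "A + s *\<^sub>R \<sigma> + (- t) *\<^sub>R n \<notin> closed_segment A B" using t by (intro off_side) simp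
    then have "A + s *\<^sub>R \<sigma> + t *\<^sub>R - n \<notin> \<Gamma>1" using whole_side(3) segment_open_subset_closed by auto
    then have "A + s *\<^sub>R \<sigma> + t *\<^sub>R - n \<in> closure \<Gamma>0" using frontier_parts[OF fr] by blast
    then show "w (A + s *\<^sub>R \<sigma> + t *\<^sub>R - n) = 0" unfolding w_def using V_tau_boundary(1)[OF v fr] by simp
  qed (use R side in auto)
  also have "(LINT x|lebesgue_on \<Omega>. (directional (- n) w x)\<^sup>2) = (LINT x|lebesgue_on \<Omega>. (directional n w x)\<^sup>2)"
    unfolding directional_def by (simp add: sum_negf)
  finally have 2: "integral {0..dist A B} F \<le> R * (LINT x|lebesgue_on \<Omega>. (directional n w x)\<^sup>2)" .
  have 3: "(LINT x|lebesgue_on \<Omega>. (directional n w x)\<^sup>2) \<le> a_form \<Omega> \<nu> v v / (2 * \<nu>)"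
    using a_form_controls_normal_derivative[OF vV, of \<nu>] \<nu> unfolding w_def by (simp add: pos_le_divide_eq mult.commute)
  have "5 / 2 * G * integral {0..dist A B} F \<le> 5 / 2 * G * (R * (a_form \<Omega> \<nu> v v / (2 * \<nu>)))"
    using order_trans[OF 2 mult_left_mono[OF 3 R(1)]] G(1) by (intro mult_left_mono) auto
  with 1 have "Lam_inner g m M w w \<le> 5 / 2 * G * (R * (a_form \<Omega> \<nu> v v / (2 * \<nu>)))" by linarith
  then show ?thesis unfolding w_def by simp
qed

end

section \<open>Injectivity of the discrete gradient\<close>

lemma affine_on_hull:
  fixes \<beta> :: "real^2"
  assumes "\<And>v. v \<in> S \<Longrightarrow> 0 \<le> \<alpha> + \<beta> \<bullet> v" "x \<in> convex hull S"
  shows "0 \<le> \<alpha> + \<beta> \<bullet> x"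
proof -
  have "convex {x. - \<alpha> \<le> \<beta> \<bullet> x}" using convex_halfspace_ge[of "- \<alpha>" \<beta>] by simp
  moreover have "S \<subseteq> {x. - \<alpha> \<le> \<beta> \<bullet> x}" using assms(1) by force
  ultimately have "convex hull S \<subseteq> {x. - \<alpha> \<le> \<beta> \<bullet> x}" by (rule hull_minimal[rotated])
  then show ?thesis using assms(2) by force
qed

lemma affine_zero_on_hull:
  fixes \<beta> :: "real^2"
  assumes "\<And>v. v \<in> S \<Longrightarrow> \<alpha> + \<beta> \<bullet> v = 0" "x \<in> convex hull S"
  shows "\<alpha> + \<beta> \<bullet> x = 0"
  using affine_on_hull[of S \<alpha> \<beta> x] affine_on_hull[of S "- \<alpha>" "- \<beta>" x] assms by fastforce

lemma orthonormal_zero: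
  fixes v n d :: "real^2"
  assumes "n \<bullet> n = 1" "d \<bullet> d = 1" "n \<bullet> d = 0" "v \<bullet> n = 0" "v \<bullet> d = 0"
  shows "v = 0"
proof -
  \<comment> \<open>The determinant of the frame; Cramer's rule gives both components of v.\<close>
  define D where "D = n $ 1 * d $ 2 - n $ 2 * d $ 1"
  have e: "n $ 1 * n $ 1 + n $ 2 * n $ 2 = 1" "d $ 1 * d $ 1 + d $ 2 * d $ 2 = 1" "n $ 1 * d $ 1 + n $ 2 * d $ 2 = 0"
    "v $ 1 * n $ 1 + v $ 2 * n $ 2 = 0" "v $ 1 * d $ 1 + v $ 2 * d $ 2 = 0"
    using assms by (simp_all add: inner_vec_def sum_2)
  have "D * D = (n $ 1 * n $ 1 + n $ 2 * n $ 2) * (d $ 1 * d $ 1 + d $ 2 * d $ 2) - (n $ 1 * d $ 1 + n $ 2 * d $ 2) * (n $ 1 * d $ 1 + n $ 2 * d $ 2)"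
    unfolding D_def by (simp add: algebra_simps)
  then have "D * D = 1" unfolding e by simp
  then have "D \<noteq> 0" by auto
  have "v $ 1 * D = (v $ 1 * n $ 1 + v $ 2 * n $ 2) * d $ 2 - (v $ 1 * d $ 1 + v $ 2 * d $ 2) * n $ 2"
    "v $ 2 * D = n $ 1 * (v $ 1 * d $ 1 + v $ 2 * d $ 2) - d $ 1 * (v $ 1 * n $ 1 + v $ 2 * n $ 2)"
    unfolding D_def by (simp_all add: algebra_simps)
  then have "v $ 1 * D = 0" "v $ 2 * D = 0" unfolding e by simp_all
  then show ?thesis using \<open>D \<noteq> 0\<close> by (simp add: vec_eq_iff forall_2)
qed

text \<open>The affine involution of a triangle that exchanges two of its vertices preserves the measure.\<close>

lemma integral_barycentric_swap:
  fixes a b c \<beta>a \<beta>b :: "real^2" and \<alpha>a \<alpha>b :: real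
  defines "la \<equiv> \<lambda>x. \<alpha>a + \<beta>a \<bullet> x" and "lb \<equiv> \<lambda>x. \<alpha>b + \<beta>b \<bullet> x"
  assumes la: "la a = 1" "la b = 0" "la c = 0" and lb: "lb a = 0" "lb b = 1" "lb c = 0"
  defines "T \<equiv> convex hull {a, b, c}"
  shows "(LINT x|lborel. indicator T x * la x) = (LINT x|lborel. indicator T x * lb x)"
proof -
  define e where "e = b - a"
  define \<beta> where "\<beta> = \<beta>a - \<beta>b"
  \<comment> \<open>\<open>R\<close> exchanges the first two barycentric coordinates;
    \<open>L\<close> is its linear part, the identity plus a term of rank one.\<close>
  define L where "L x = x + (\<beta> \<bullet> x) *\<^sub>R e" for x :: "real^2"
  define R where "R x = x + (la x - lb x) *\<^sub>R e" for x
  have be: "\<beta>a \<bullet> e = - 1" "\<beta>b \<bullet> e = 1" "\<beta> \<bullet> e = - 2"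
    using la lb unfolding e_def \<beta>_def la_def lb_def by (simp_all add: inner_diff_left inner_diff_right)
  have lin: "linear L" unfolding L_def by (intro linearI) (simp_all add: inner_add_right algebra_simps)
  have LL: "L (L x) = x" for x
    unfolding L_def using be(3) by (simp add: inner_add_right algebra_simps)
  have RL: "R x = (\<alpha>a - \<alpha>b) *\<^sub>R e + L x" for x
    unfolding R_def L_def la_def lb_def \<beta>_def by (simp add: inner_diff_left algebra_simps)
  have laR: "la (R x) = lb x" and lbR: "lb (R x) = la x" for x
    unfolding R_def la_def lb_def using be by (simp_all add: inner_add_right algebra_simps)
  have RR: "R (R x) = x" for x
  proof -
    have "R (R x) = R x + (lb x - la x) *\<^sub>R e" by (subst R_def) (simp add: laR lbR)
    then show ?thesis unfolding R_def by (simp add: algebra_simps)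
  qed
  have RT: "R ` T = T"
  proof -
    have img: "R ` S = (+) ((\<alpha>a - \<alpha>b) *\<^sub>R e) ` (L ` S)" for S by (auto simp: RL)
    then have "R ` T = (+) ((\<alpha>a - \<alpha>b) *\<^sub>R e) ` (L ` T)" .
    also have "\<dots> = convex hull (R ` {a, b, c})"
      unfolding T_def img by (simp only: convex_hull_linear_image[OF lin] convex_hull_translation)
    also have "R ` {a, b, c} = {a, b, c}"
    proof -
      have "R a = b" "R b = a" "R c = c" unfolding R_def using la lb by (simp_all add: e_def)
      then show ?thesis by auto
    qed
    finally show ?thesis unfolding T_def .
  qed
  have indR: "indicator T (R x) = (indicator T x :: real)" for x
    using RT RR by (metis (no_types, lifting) image_eqI indicator_simps)
  \<comment> \<open>For the identity plus a rank one term the determinant is 1 + \<beta> \<bullet>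
    e, here -1.\<close>
  have det: "\<bar>det (matrix L)\<bar> = 1"
  proof -
    have "matrix L $ i $ j = (if i = j then 1 else 0) + \<beta> $ j * e $ i" for i j
      unfolding matrix_def L_def by (simp add: inner_axis) (simp add: axis_def)
    then have "det (matrix L) = 1 + \<beta> \<bullet> e" by (simp add: det_2 inner_vec_def sum_2 algebra_simps)
    then show ?thesis using be by simp
  qed
  have mL: "L \<in> borel_measurable borel"
    using lin by (intro borel_measurable_continuous_onI linear_continuous_on) (simp add: linear_conv_bounded_linear[symmetric])
  have mR: "R \<in> borel_measurable borel" unfolding RL[abs_def] using mL by measurable
  have distr: "distr lborel borel R = lborel"
  proof -
    have "distr lborel borel R = distr (distr lborel borel L) borel ((+) ((\<alpha>a - \<alpha>b) *\<^sub>R e))"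
      using mL by (subst distr_distr) (simp_all add: o_def RL[abs_def])
    then show ?thesis using distr_unimodular[OF lin lin LL LL det] by (simp add: lborel_distr_plus)
  qed
  have "closed T" unfolding T_def by (intro compact_imp_closed finite_imp_compact_convex_hull) simp
  then have "T \<in> sets borel" by simp
  moreover have "la \<in> borel_measurable borel" unfolding la_def by measurable
  ultimately have m: "(\<lambda>x. indicator T x * la x) \<in> borel_measurable borel" by measurable
  have "(LINT x|lborel. indicator T x * la x) = (LINT x|distr lborel borel R. indicator T x * la x)" unfolding distr ..
  also have "\<dots> = (LINT x|lborel. indicator T (R x) * la (R x))" using mR m by (intro integral_distr) auto
  finally show ?thesis unfolding indR laR .
qed

section \<open>Nodal hat functions and side bubbles\<close>

context fe_mesh
begin

lemma cell_hull: "T \<in> \<T> \<Longrightarrow> T = convex hull vertices_of T"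
  using triangle_vertices[OF triangle] by metis

text \<open>The intersection is a common face, so its extreme points are the common vertices, and
  Krein-Milman recovers it from them.\<close>

lemma inter_hull:
  assumes T: "T \<in> \<T>" "T' \<in> \<T>"
  shows "T \<inter> T' = convex hull (vertices_of T \<inter> vertices_of T')"
proof -
  have face: "(T \<inter> T') face_of T" "(T \<inter> T') face_of T'"
    using inter_face[OF T] inter_face[OF T(2,1)] by (simp_all add: Int_commute)
  have "{v. v extreme_point_of (T \<inter> T')} = vertices_of T \<inter> vertices_of T'"
    using extreme_point_of_face[OF face(1)] extreme_point_of_face[OF face(2)] vertices_subset[of T] vertices_subset[of T']
    unfolding vertices_of_def by blast
  then show ?thesis
    using Krein_Milman_Minkowski[of "T \<inter> T'"] T compact_cell convex_cell by (simp add: compact_Int convex_Int)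
qed

text \<open>A face that meets the interior of a convex set is the whole set; applied in both
  directions, this makes the two cells equal.\<close>

lemma interior_cell_unique:
  assumes "T \<in> \<T>" "T' \<in> \<T>" "x \<in> interior T" "x \<in> T'"
  shows "T' = T"
proof -
  have x: "x \<in> T" using assms(3) interior_subset by blast
  have "T \<inter> T' = T" using face_of_disjoint_interior[OF inter_face[OF assms(1,2)]] assms(3,4) x by blast
  then have sub: "T \<subseteq> T'" by blast
  then have "x \<in> interior T'" using assms(3) interior_mono by blast
  then have "T' \<inter> T = T'" using face_of_disjoint_interior[OF inter_face[OF assms(2,1)]] assms(4) x by blast
  then show ?thesis using sub by blast
qed

text \<open>The continuous piecewise affine nodal basis function of a, as a predicate because values
  off the closed domain are free.\<close>

definition hat :: "real^2 \<Rightarrow> (real^2 \<Rightarrow> real) \<Rightarrow> bool" where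
  "hat a \<psi> \<longleftrightarrow> (\<forall>T\<in>\<T>. \<exists>\<alpha> \<beta>. \<forall>x\<in>T. \<psi> x = \<alpha> + \<beta> \<bullet> x) \<and>
     (\<forall>v\<in>mesh_vertices \<T>. \<psi> v = (if v = a then 1 else 0))"

text \<open>The affine interpolants of two cells agree on their intersection, since this is the hull
  of the common vertices; hence the cell chosen for a point does not matter.\<close>

lemma hat_exists: "\<exists>\<psi>. hat a \<psi>"
proof -
  have "\<exists>\<alpha> \<beta>. \<forall>v\<in>vertices_of T. \<alpha> + \<beta> \<bullet> v = (if v = a then 1 else 0)" if T: "T \<in> \<T>" for T
  proof -
    obtain p q r where "\<not> affine_dependent {p, q, r}" "vertices_of T = {p, q, r}"
      using triangle_vertices[OF triangle[OF T]] by metis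
    then show ?thesis using affine_interpolation[of "{p, q, r}" "\<lambda>v. if v = a then 1 else 0"] by auto
  qed
  then obtain \<alpha> \<beta> where int: "\<And>T v. T \<in> \<T> \<Longrightarrow> v \<in> vertices_of T \<Longrightarrow> \<alpha> T + \<beta> T \<bullet> v = (if v = a then 1 else 0)"
    by metis
  define \<psi> where "\<psi> x = (let T = (SOME T. T \<in> \<T> \<and> x \<in> T) in \<alpha> T + \<beta> T \<bullet> x)" for x
  have \<psi>: "\<psi> x = \<alpha> T + \<beta> T \<bullet> x" if T: "T \<in> \<T>" "x \<in> T" for x T
  proof -
    define T' where "T' = (SOME T. T \<in> \<T> \<and> x \<in> T)"
    have T': "T' \<in> \<T> \<and> x \<in> T'" unfolding T'_def using T by (intro someI[of "\<lambda>T. T \<in> \<T> \<and> x \<in> T" T]) simp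
    have x: "x \<in> convex hull (vertices_of T \<inter> vertices_of T')" using T T' inter_hull by blast
    have "(\<alpha> T' - \<alpha> T) + (\<beta> T' - \<beta> T) \<bullet> v = 0" if "v \<in> vertices_of T \<inter> vertices_of T'" for v
      using int[OF T(1), of v] int[of T' v] T' that by (auto simp: inner_diff_left)
    from affine_zero_on_hull[OF this x] have "(\<alpha> T' - \<alpha> T) + (\<beta> T' - \<beta> T) \<bullet> x = 0" .
    then show ?thesis unfolding \<psi>_def Let_def T'_def[symmetric] by (simp add: inner_diff_left)
  qed
  have "\<psi> v = (if v = a then 1 else 0)" if v: "v \<in> mesh_vertices \<T>" for v
  proof -
    obtain T where "T \<in> \<T>" "v \<in> vertices_of T" using v unfolding mesh_vertices_def by blast
    moreover from this have "v \<in> T" using vertices_subset by blast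
    ultimately show ?thesis using \<psi>[of T v] int[of T v] by simp
  qed
  then show ?thesis unfolding hat_def using \<psi> by blast
qed

lemma hat_cell:
  assumes "hat a \<psi>" "T \<in> \<T>"
  obtains \<alpha> \<beta> where "\<And>x. x \<in> T \<Longrightarrow> \<psi> x = \<alpha> + \<beta> \<bullet> x"
    "\<And>v. v \<in> vertices_of T \<Longrightarrow> \<alpha> + \<beta> \<bullet> v = (if v = a then 1 else 0)"
proof -
  obtain \<alpha> \<beta> where ab: "\<And>x. x \<in> T \<Longrightarrow> \<psi> x = \<alpha> + \<beta> \<bullet> x" using assms unfolding hat_def by blast
  have "\<alpha> + \<beta> \<bullet> v = (if v = a then 1 else 0)" if "v \<in> vertices_of T" for v
  proof -
    have "v \<in> T" "v \<in> mesh_vertices \<T>" using that assms(2) vertices_subset unfolding mesh_vertices_def by blast+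
    then show ?thesis using assms(1) ab[of v] unfolding hat_def by auto
  qed
  then show ?thesis using that ab by blast
qed

lemma hat_nonneg:
  assumes \<psi>: "hat a \<psi>" and "x \<in> closure \<Omega>"
  shows "0 \<le> \<psi> x"
proof -
  obtain T where T: "T \<in> \<T>" "x \<in> T" using assms(2) Union_cells by blast
  obtain \<alpha> \<beta> where ab: "\<And>x. x \<in> T \<Longrightarrow> \<psi> x = \<alpha> + \<beta> \<bullet> x"
    "\<And>v. v \<in> vertices_of T \<Longrightarrow> \<alpha> + \<beta> \<bullet> v = (if v = a then 1 else 0)" using hat_cell[OF \<psi> T(1)] by metis
  have "0 \<le> \<alpha> + \<beta> \<bullet> v" if "v \<in> vertices_of T" for v using ab(2)[OF that] by simp
  moreover have "x \<in> convex hull vertices_of T" using T(2) cell_hull[OF T(1)] by simp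
  ultimately have "0 \<le> \<alpha> + \<beta> \<bullet> x" by (rule affine_on_hull)
  then show ?thesis using ab(1) T by simp
qed

lemma hat_zero_hull:
  assumes \<psi>: "hat a \<psi>" and T: "T \<in> \<T>" and S: "S \<subseteq> vertices_of T" "a \<notin> S" and x: "x \<in> convex hull S"
  shows "\<psi> x = 0"
proof -
  obtain \<alpha> \<beta> where ab: "\<And>x. x \<in> T \<Longrightarrow> \<psi> x = \<alpha> + \<beta> \<bullet> x"
    "\<And>v. v \<in> vertices_of T \<Longrightarrow> \<alpha> + \<beta> \<bullet> v = (if v = a then 1 else 0)" using hat_cell[OF \<psi> T] by metis
  have "\<alpha> + \<beta> \<bullet> v = 0" if "v \<in> S" for v using ab(2)[of v] S that by auto
  from affine_zero_on_hull[OF this x] have "\<alpha> + \<beta> \<bullet> x = 0" .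
  moreover have "x \<in> T" using hull_mono[OF S(1), of convex] x cell_hull[OF T] by blast
  ultimately show ?thesis using ab(1) by simp
qed

lemma pc1_affine: "\<forall>T\<in>\<T>. \<exists>\<alpha> \<beta>. \<forall>x\<in>T. w x = \<alpha> + \<beta> \<bullet> x \<Longrightarrow> pc1 w"
  unfolding pc1_def
proof
  fix T assume "\<forall>T\<in>\<T>. \<exists>\<alpha> \<beta>. \<forall>x\<in>T. w x = \<alpha> + \<beta> \<bullet> x" "T \<in> \<T>"
  then obtain \<alpha> \<beta> where "\<And>x. x \<in> T \<Longrightarrow> w x = \<alpha> + \<beta> \<bullet> x" by blast
  then have "poly_on 1 T w" by (rule affine_poly_on_1)
  then show "\<exists>P. C_diff 1 P \<and> (\<forall>x\<in>T. w x = P x)" using poly_on_elementary elementary_C_diff by blast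
qed

lemma pc1_hat: "hat a \<psi> \<Longrightarrow> pc1 \<psi>"
  unfolding hat_def using pc1_affine by blast

lemma directional_affine:
  assumes "\<And>x. x \<in> T \<Longrightarrow> w x = \<alpha> + \<beta> \<bullet> x" "x \<in> interior T"
  shows "(w has_derivative (\<lambda>h. \<beta> \<bullet> h)) (at x)" "directional d w x = \<beta> \<bullet> d"
proof -
  have "((\<lambda>x. \<alpha> + \<beta> \<bullet> x) has_derivative (\<lambda>h. \<beta> \<bullet> h)) (at x)"
    by (auto intro!: derivative_eq_intros)
  then show *: "(w has_derivative (\<lambda>h. \<beta> \<bullet> h)) (at x)"
    by (rule has_derivative_transform_within_open[OF _ open_interior assms(2)]) (use assms(1) interior_subset in force)
  show "directional d w x = \<beta> \<bullet> d" by (rule directional_eq[OF *])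
qed

context
  fixes a b :: "real^2" and T0 :: "(real^2) set" and \<psi>a \<psi>b :: "real^2 \<Rightarrow> real"
  assumes T0: "T0 \<in> \<T>" "a \<in> vertices_of T0" "b \<in> vertices_of T0" "a \<noteq> b"
    and hats: "hat a \<psi>a" "hat b \<psi>b"
begin

text \<open>The quadratic bubble of the side from a to b: it vanishes at every mesh node other than
  the midpoint of the side, and on every cell without that side.\<close>

definition bubble :: "real^2 \<Rightarrow> real" where "bubble x = \<psi>a x * \<psi>b x"

lemma pc1_bubble: "pc1 bubble"
  unfolding bubble_def[abs_def] by (intro pc1_mult pc1_hat[OF hats(1)] pc1_hat[OF hats(2)])

lemma bubble_nonneg: "x \<in> closure \<Omega> \<Longrightarrow> 0 \<le> bubble x"
  unfolding bubble_def using hat_nonneg hats by simp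

lemma bubble_outside: "T \<in> \<T> \<Longrightarrow> x \<in> T \<Longrightarrow> \<not> (a \<in> vertices_of T \<and> b \<in> vertices_of T) \<Longrightarrow> bubble x = 0"
  unfolding bubble_def using hat_zero_hull[OF hats(1), of T "vertices_of T" x] hat_zero_hull[OF hats(2), of T "vertices_of T" x] cell_hull[of T]
  by auto

lemma bubble_vertex: "v \<in> mesh_vertices \<T> \<Longrightarrow> bubble v = 0"
  unfolding bubble_def using hats T0(4) unfolding hat_def by auto

lemma bubble_other_side:
  assumes "T \<in> \<T>" "p \<in> vertices_of T" "q \<in> vertices_of T" "{p, q} \<noteq> {a, b}" "p \<noteq> q" "x \<in> closed_segment p q"
  shows "bubble x = 0"
proof -
  have "a \<notin> {p, q} \<or> b \<notin> {p, q}" using assms(4,5) T0(4) by auto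
  then show ?thesis
    unfolding bubble_def using hat_zero_hull[OF hats(1) assms(1), of "{p, q}" x] hat_zero_hull[OF hats(2) assms(1), of "{p, q}" x] assms
    by (auto simp: segment_convex_hull)
qed

lemma bubble_node:
  assumes "x \<in> mesh_nodes \<T>" "x \<noteq> midpoint a b"
  shows "bubble x = 0"
proof -
  consider "x \<in> mesh_vertices \<T>" | p q T where "T \<in> \<T>" "p \<in> vertices_of T" "q \<in> vertices_of T" "p \<noteq> q" "x = midpoint p q"
    using assms(1) unfolding mesh_nodes_def by blast
  then show ?thesis
  proof cases
    case 1
    then show ?thesis by (rule bubble_vertex)
  next
    case 2
    then have "{p, q} \<noteq> {a, b}" using assms(2) by (auto simp: doubleton_eq_iff midpoint_sym)
    then show ?thesis using bubble_other_side[OF 2(1-3) _ 2(4)] 2(5) by auto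
  qed
qed

lemma bubble_frontier:
  assumes "y \<in> frontier \<Omega>" "bubble y \<noteq> 0"
  shows "y \<in> open_segment a b"
proof -
  have "y \<notin> mesh_vertices \<T>" using bubble_vertex assms(2) by blast
  then obtain T p q where T: "T \<in> \<T>" "p \<in> vertices_of T" "q \<in> vertices_of T" "p \<noteq> q" "y \<in> open_segment p q"
    using frontier_cases[OF assms(1)] by blast
  then have "{p, q} = {a, b}" using bubble_other_side[OF T(1-3) _ T(4)] assms(2) segment_open_subset_closed by blast
  then show ?thesis using T(5) by (auto simp: doubleton_eq_iff open_segment_commute)
qed

text \<open>At the barycentre of a cell containing the side both hat functions equal 1/3.\<close>

lemma bubble_positive: "\<exists>x\<in>interior T0. 0 < bubble x"
proof -
  obtain p q r where pqr: "\<not> collinear {p, q, r}" "T0 = convex hull {p, q, r}" "vertices_of T0 = {p, q, r}"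
    "p \<noteq> q" "p \<noteq> r" "q \<noteq> r"
    using triangle_vertices[OF triangle[OF T0(1)]] by metis
  define x where "x = (1/3) *\<^sub>R p + (1/3) *\<^sub>R q + (1/3) *\<^sub>R r"
  have x: "x \<in> interior T0"
    unfolding pqr(2) x_def using interior_convex_hull_3_minimal[OF pqr(1)] by (auto intro!: exI[of _ "1/3::real"])
  then have xT: "x \<in> T0" using interior_subset by blast
  have pos: "0 < \<psi> x" if \<psi>: "hat v \<psi>" and v: "v \<in> vertices_of T0" for \<psi> v
  proof -
    obtain \<alpha> \<beta> where ab: "\<And>x. x \<in> T0 \<Longrightarrow> \<psi> x = \<alpha> + \<beta> \<bullet> x"
      "\<And>u. u \<in> vertices_of T0 \<Longrightarrow> \<alpha> + \<beta> \<bullet> u = (if u = v then 1 else 0)" using hat_cell[OF \<psi> T0(1)] by metis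
    have "\<psi> x = ((\<alpha> + \<beta> \<bullet> p) + (\<alpha> + \<beta> \<bullet> q) + (\<alpha> + \<beta> \<bullet> r)) / 3"
      unfolding ab(1)[OF xT] unfolding x_def by (simp add: inner_add_right field_simps)
    also have "\<dots> = 1/3" using ab(2) pqr v by auto
    finally show ?thesis by simp
  qed
  then show ?thesis using x T0 hats unfolding bubble_def by (intro bexI[of _ x]) auto
qed

lemma integral_bubble_pos: "0 < (LINT x|lebesgue_on \<Omega>. bubble x)"
proof -
  have nonneg: "AE x in lebesgue_on \<Omega>. 0 \<le> bubble x"
    using bubble_nonneg closure_subset by (intro AE_I2) (auto simp: space_restrict_space)
  have int: "integrable (lebesgue_on \<Omega>) bubble"
    by (rule bounded_meas_integrable[OF open_domain bounded_domain bounded_meas_pc1[OF pc1_bubble]])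
  have "(LINT x|lebesgue_on \<Omega>. bubble x) \<noteq> 0"
  proof
    assume "(LINT x|lebesgue_on \<Omega>. bubble x) = 0"
    then have "AE x in lebesgue_on \<Omega>. bubble x = 0" using integral_nonneg_eq_0_iff_AE[OF int nonneg] by simp
    then have "AE x in lebesgue_on \<Omega>. x \<in> core \<longrightarrow> bubble x = 0" by eventually_elim simp
    moreover have "continuous_on core bubble"
      using pc1_continuous[OF pc1_bubble] core_subset closure_subset continuous_on_subset by blast
    moreover obtain x where x: "x \<in> interior T0" "0 < bubble x" using bubble_positive by blast
    moreover have "x \<in> core" using x(1) T0(1) unfolding core_def by blast
    ultimately have "bubble x = 0" using open_AE_zero[OF _ open_core core_subset] by blast
    then show False using x(2) by simp
  qed
  moreover have "0 \<le> (LINT x|lebesgue_on \<Omega>. bubble x)" using nonneg by (rule integral_nonneg_AE)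
  ultimately show ?thesis by simp
qed

text \<open>All nodal conditions except the one at the midpoint hold automatically, so membership
  only restricts the direction d there.\<close>

lemma bubble_V_tau:
  assumes "midpoint a b \<notin> closure \<Gamma>0" "midpoint a b \<in> \<Gamma>1 \<Longrightarrow> d \<bullet> tangent n = 0"
  shows "(\<lambda>x. bubble x *\<^sub>R d) \<in> V\<tau>"
proof -
  have "poly_on 2 T (\<lambda>x. (bubble x *\<^sub>R d) $ i)" if T: "T \<in> \<T>" for T i
  proof -
    obtain \<alpha> \<beta> \<gamma> \<delta> where "\<And>x. x \<in> T \<Longrightarrow> \<psi>a x = \<alpha> + \<beta> \<bullet> x" "\<And>x. x \<in> T \<Longrightarrow> \<psi>b x = \<gamma> + \<delta> \<bullet> x"
      using hat_cell[OF hats(1) T] hat_cell[OF hats(2) T] by metis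
    then have "poly_on 2 T (\<lambda>x. d $ i * bubble x)"
      unfolding bubble_def by (intro poly_on_cmult affine_product_poly_on_2)
    then show ?thesis by (simp add: mult.commute)
  qed
  moreover have "continuous_on (closure \<Omega>) (\<lambda>x. bubble x *\<^sub>R d)"
    by (intro continuous_intros pc1_continuous[OF pc1_bubble])
  ultimately have "(\<lambda>x. bubble x *\<^sub>R d) \<in> V" unfolding V_space_def by blast
  moreover have "bubble x *\<^sub>R d = 0" if "x \<in> closure \<Gamma>0 \<inter> mesh_nodes \<T>" for x
    using bubble_node[of x] that assms(1) by (cases "x = midpoint a b") auto
  moreover have "(bubble x *\<^sub>R d) \<bullet> tangent n = 0" if "x \<in> \<Gamma>1 \<inter> mesh_nodes \<T>" for x
    using bubble_node[of x] that assms(2) by (cases "x = midpoint a b") auto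
  ultimately show ?thesis unfolding V_tau_space_def by blast
qed

lemma b_form_bubble:
  assumes "pc1 p"
  shows "b_form \<Omega> (\<lambda>x. bubble x *\<^sub>R d) p = - (LINT x|lebesgue_on \<Omega>. directional d bubble x * p x)"
proof -
  have comp: "AE x in lebesgue_on \<Omega>. weak_deriv_comp \<Omega> i i (\<lambda>x. bubble x *\<^sub>R d) x = d $ i * partial_deriv i bubble x" for i
  proof -
    have eq: "(\<lambda>y. (bubble y *\<^sub>R d) $ i) = (\<lambda>y. d $ i * bubble y)" by (simp add: mult.commute)
    show ?thesis unfolding eq
      using weak_deriv_linear(2)[OF pc1_bubble pc1_bubble, where j = i and r = "d $ i"] weak_deriv_pc1[OF pc1_bubble, of i]
      by eventually_elim simp
  qed
  have "AE x in lebesgue_on \<Omega>. divergence \<Omega> (\<lambda>x. bubble x *\<^sub>R d) x * p x = directional d bubble x * p x"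
    using comp[of 1] comp[of 2] by eventually_elim (simp add: divergence_def directional_def sum_2)
  then have "(LINT x|lebesgue_on \<Omega>. divergence \<Omega> (\<lambda>x. bubble x *\<^sub>R d) x * p x) = (LINT x|lebesgue_on \<Omega>. directional d bubble x * p x)"
    by (intro LINT_cong_bounded_meas(1)[OF open_domain] bounded_meas_mult bounded_meas_directional pc1_bubble bounded_meas_pc1 assms)
  then show ?thesis unfolding b_form_def by simp
qed

text \<open>On a cell containing the side \<open>[a, b]\<close> the derivative of \<open>p\<close> along \<open>b - a\<close> is \<open>p b - p a\<close>.\<close>

lemma b_form_inner_bubble:
  assumes p: "\<forall>T\<in>\<T>. \<exists>\<alpha> \<beta>. \<forall>x\<in>T. p x = \<alpha> + \<beta> \<bullet> x" and inner: "open_segment a b \<subseteq> \<Omega>"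
  shows "b_form \<Omega> (\<lambda>x. bubble x *\<^sub>R (b - a)) p = (p b - p a) * (LINT x|lebesgue_on \<Omega>. bubble x)"
proof -
  let ?d = "b - a"
  have pp: "pc1 p" using pc1_affine[OF p] .
  have zero: "bubble y = 0" if "y \<in> frontier \<Omega>" for y
    using bubble_frontier[OF that] inner frontier_not_domain[OF that] by blast
  note bm = bounded_meas_pc1[OF pc1_bubble] bounded_meas_pc1[OF pp] bounded_meas_deriv[OF pp] bounded_meas_deriv[OF pc1_bubble]
  note int = bounded_meas_integrable[OF open_domain bounded_domain]
  \<comment> \<open>The bubble of an inner side vanishes on the whole frontier, so no boundary term
    appears.\<close>
  have parts: "(LINT x|lebesgue_on \<Omega>. partial_deriv j bubble x * p x) = - (LINT x|lebesgue_on \<Omega>. bubble x * partial_deriv j p x)" for j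
    using integral_by_parts[OF pc1_bubble pp, of j] zero by simp
  have "(LINT x|lebesgue_on \<Omega>. directional ?d bubble x * p x) = (LINT x|lebesgue_on \<Omega>. (\<Sum>j\<in>UNIV. ?d $ j * (partial_deriv j bubble x * p x)))"
    unfolding directional_def by (simp add: sum_distrib_right mult.assoc)
  also have "\<dots> = (\<Sum>j\<in>UNIV. ?d $ j * (LINT x|lebesgue_on \<Omega>. partial_deriv j bubble x * p x))"
    by (subst Bochner_Integration.integral_sum) (auto intro!: integrable_mult_right int bounded_meas_mult bm)
  also have "\<dots> = - (\<Sum>j\<in>UNIV. ?d $ j * (LINT x|lebesgue_on \<Omega>. bubble x * partial_deriv j p x))"
    unfolding parts by (simp add: sum_negf)
  also have "(\<Sum>j\<in>UNIV. ?d $ j * (LINT x|lebesgue_on \<Omega>. bubble x * partial_deriv j p x)) =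
      (LINT x|lebesgue_on \<Omega>. (\<Sum>j\<in>UNIV. ?d $ j * (bubble x * partial_deriv j p x)))"
    by (subst Bochner_Integration.integral_sum) (auto intro!: integrable_mult_right int bounded_meas_mult bm)
  also have "\<dots> = (LINT x|lebesgue_on \<Omega>. bubble x * directional ?d p x)"
    unfolding directional_def by (simp add: sum_distrib_left mult.left_commute)
  also have "\<dots> = (LINT x|lebesgue_on \<Omega>. (p b - p a) * bubble x)"
  proof (rule LINT_cong_bounded_meas(1)[OF open_domain])
    show "bounded_meas \<Omega> (\<lambda>x. (p b - p a) * bubble x)" by (intro bounded_meas_cmult bm)
    show "AE x in lebesgue_on \<Omega>. bubble x * directional ?d p x = (p b - p a) * bubble x"
      using AE_core_on
    proof eventually_elim
      case (elim x)
      then obtain T where T: "T \<in> \<T>" "x \<in> interior T" unfolding core_def by blast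
      show ?case
      proof (cases "a \<in> vertices_of T \<and> b \<in> vertices_of T")
        case True
        obtain \<alpha> \<beta> where ab: "\<And>x. x \<in> T \<Longrightarrow> p x = \<alpha> + \<beta> \<bullet> x" using p T(1) by blast
        have "a \<in> T" "b \<in> T" using True vertices_subset by blast+
        then have "directional ?d p x = p b - p a"
          using directional_affine(2)[OF ab T(2)] ab by (simp add: inner_diff_right)
        then show ?thesis by simp
      next
        case False
        then show ?thesis using bubble_outside[OF T(1) _ False] T(2) interior_subset[of T] by auto
      qed
    qed
  qed
  finally show ?thesis unfolding b_form_bubble[OF pp] by simp
qed

end

end

section \<open>Pressures annihilated by all test velocities vanish\<close>

context fe_mesh
begin

lemma third_vertex:
  assumes "T \<in> \<T>" "a \<in> vertices_of T" "b \<in> vertices_of T" "a \<noteq> b"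
  obtains c where "\<not> collinear {a, b, c}" "T = convex hull {a, b, c}" "vertices_of T = {a, b, c}"
proof -
  obtain p q r where pqr: "p \<noteq> q" "p \<noteq> r" "q \<noteq> r" "\<not> collinear {p, q, r}" "T = convex hull {p, q, r}" "vertices_of T = {p, q, r}"
    using triangle_vertices[OF triangle[OF assms(1)]] by metis
  have "{p, q, r} = {a, b, p} \<or> {p, q, r} = {a, b, q} \<or> {p, q, r} = {a, b, r}"
    using assms(2-4) pqr(1-3,6) by auto
  then obtain c where "{p, q, r} = {a, b, c}" by blast
  then show thesis using that[of c] pqr by simp
qed

text \<open>All sides issuing from a vertex off the frontier are inner sides, and their bubbles
  equate the vertex values, so the pressure is constant on each cell. A continuous function with
  finitely many values on a connected set is constant.\<close>

lemma pressure_constant: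
  assumes p: "p \<in> Q_space \<Omega> \<T>" and zero: "\<And>v. v \<in> V\<tau> \<Longrightarrow> b_form \<Omega> v p = 0"
  shows "\<exists>c. \<forall>x\<in>closure \<Omega>. p x = c"
proof -
  have aff: "\<forall>T\<in>\<T>. \<exists>\<alpha> \<beta>. \<forall>x\<in>T. p x = \<alpha> + \<beta> \<bullet> x"
    using p poly_on_1_affine unfolding Q_space_def by blast
  have edge: "p a = p b" if T: "T \<in> \<T>" "a \<in> vertices_of T" "b \<in> vertices_of T" and a: "a \<notin> frontier \<Omega>" for T a b
  proof (cases "a = b")
    case False
    note T = T False
    have "\<not> closed_segment a b \<subseteq> frontier \<Omega>" using a by auto
    then have inn: "open_segment a b \<subseteq> \<Omega>" using side_dichotomy[OF T] by blast
    obtain \<psi>a \<psi>b where h: "hat a \<psi>a" "hat b \<psi>b" using hat_exists by metis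
    have "midpoint a b \<in> \<Omega>" using inn midpoint_in_open_segment[OF False] by blast
    then have "midpoint a b \<notin> frontier \<Omega>" using frontier_not_domain by blast
    then have "midpoint a b \<notin> closure \<Gamma>0" "midpoint a b \<notin> \<Gamma>1" using parts_cover \<Gamma>1_frontier(1) by blast+
    then have "(\<lambda>x. bubble \<psi>a \<psi>b x *\<^sub>R (b - a)) \<in> V\<tau>" using bubble_V_tau[OF T h] by blast
    then have "(p b - p a) * (LINT x|lebesgue_on \<Omega>. bubble \<psi>a \<psi>b x) = 0"
      using b_form_inner_bubble[OF T h aff inn] zero by simp
    then show ?thesis using integral_bubble_pos[OF T h] by simp
  qed simp
  have cell: "\<exists>c. \<forall>x\<in>T. p x = c" if T: "T \<in> \<T>" for T
  proof -
    obtain v0 where v0: "v0 \<in> vertices_of T" "v0 \<notin> frontier \<Omega>" using free_vertex[OF T] by blast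
    obtain \<alpha> \<beta> where ab: "\<And>x. x \<in> T \<Longrightarrow> p x = \<alpha> + \<beta> \<bullet> x" using aff T by blast
    have vert: "(\<alpha> - p v0) + \<beta> \<bullet> v = 0" if v: "v \<in> vertices_of T" for v
    proof -
      have "v \<in> T" using v vertices_subset by blast
      then show ?thesis using edge[OF T v0(1) v v0(2)] ab[of v] by simp
    qed
    have "p x = p v0" if x: "x \<in> T" for x
    proof -
      have "x \<in> convex hull vertices_of T" using x cell_hull[OF T] by simp
      from affine_zero_on_hull[OF vert this] have "(\<alpha> - p v0) + \<beta> \<bullet> x = 0" .
      then show ?thesis using ab[OF x] by simp
    qed
    then show ?thesis by blast
  qed
  then obtain c where c: "\<And>T x. T \<in> \<T> \<Longrightarrow> x \<in> T \<Longrightarrow> p x = c T" by metis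
  have "p ` closure \<Omega> \<subseteq> c ` \<T>"
  proof
    fix y assume "y \<in> p ` closure \<Omega>"
    then obtain x where "x \<in> closure \<Omega>" "y = p x" by blast
    moreover from this obtain T where "T \<in> \<T>" "x \<in> T" using Union_cells by blast
    ultimately show "y \<in> c ` \<T>" using c by blast
  qed
  then have "finite (p ` closure \<Omega>)" using finite_mesh finite_subset by blast
  moreover have "connected (closure \<Omega>)" by (rule connected_imp_connected_closure[OF connected_domain])
  moreover have "continuous_on (closure \<Omega>) p" using p unfolding Q_space_def by blast
  ultimately have "p constant_on closure \<Omega>" by (intro continuous_finite_range_constant)
  then show ?thesis unfolding constant_on_def .
qed

text \<open>Otherwise the cell would be degenerate or contain points
  \<open>m0 + t *\<^sub>R n\<close> with small positive t, against the definition of the outer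
  normal at the midpoint m0 of the edge.\<close>

lemma outward_third_vertex:
  assumes "vertices_of T = {M 1, M 2, c}" "T = convex hull {M 1, M 2, c}" "\<not> collinear {M 1, M 2, c}" "T \<in> \<T>"
  shows "(c - M 1) \<bullet> n < 0"
proof (rule ccontr)
  assume "\<not> ?thesis"
  then have q0: "0 \<le> (c - M 1) \<bullet> n" by simp
  have i: "1 \<in> {1..m + 1}" "2 \<in> {1..m + 1}" "1 \<in> {1..m}" using abscissa_ends(3) by auto
  define l where "l = (abscissa 2 - abscissa 1) / 2"
  define m0 where "m0 = half_node M 1"
  have l: "0 < l" unfolding l_def using abscissa_less[OF i(1,2)] by simp
  have m0': "m0 = A + ((abscissa 1 + abscissa 2) / 2) *\<^sub>R \<sigma>" "m0 \<in> \<Gamma>1"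
    unfolding m0_def using half_node_param[OF i(3)] by (simp_all add: numeral_2_eq_2)
  have M12: "M 1 = m0 - l *\<^sub>R \<sigma>" "M 2 = m0 + l *\<^sub>R \<sigma>"
    unfolding m0'(1) l_def by (subst vertices_param(1)[OF i(1)] vertices_param(1)[OF i(2)], simp add: vec_eq_iff field_simps)+
  have frame: "\<sigma> \<bullet> \<sigma> = 1" "n \<bullet> n = 1" "n \<bullet> \<sigma> = 0" "\<sigma> \<bullet> n = 0"
    using side_direction(1,2) tangent_frame(2) by (simp_all add: norm_eq_1 inner_commute)
  define q where "q = (c - M 1) \<bullet> n"
  define r where "r = (c - m0) \<bullet> \<sigma>"
  have qm: "(c - m0) \<bullet> n = q" unfolding q_def M12(1) using frame by (simp add: inner_diff_left inner_add_left)
  have "c - m0 - (r *\<^sub>R \<sigma> + q *\<^sub>R n) = 0"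
    by (rule orthonormal_zero[OF frame(2,1,3)]) (simp_all add: inner_diff_left inner_add_left frame qm[unfolded inner_diff_left] r_def)
  then have c: "c = m0 + r *\<^sub>R \<sigma> + q *\<^sub>R n" by (simp add: algebra_simps)
  show False
  proof (cases "q = 0")
    case True
    have line: "\<exists>t. x = m0 + t *\<^sub>R \<sigma>" if "x \<in> {M 1, M 2, c}" for x
    proof -
      have "M 1 = m0 + (- l) *\<^sub>R \<sigma>" "M 2 = m0 + l *\<^sub>R \<sigma>" "c = m0 + r *\<^sub>R \<sigma>"
        using M12 c True by simp_all
      then show ?thesis using that by blast
    qed
    have "\<exists>t. x - y = t *\<^sub>R \<sigma>" if xy: "x \<in> {M 1, M 2, c}" "y \<in> {M 1, M 2, c}" for x y
    proof -
      obtain s t where "x = m0 + s *\<^sub>R \<sigma>" "y = m0 + t *\<^sub>R \<sigma>" using line[OF xy(1)] line[OF xy(2)] by blast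
      then have "x - y = (s - t) *\<^sub>R \<sigma>" by (simp add: scaleR_diff_left)
      then show ?thesis ..
    qed
    then have "collinear {M 1, M 2, c}" unfolding collinear_def by blast
    then show False using assms(3) by blast
  next
    case False
    then have q: "0 < q" using q0 unfolding q_def by simp
    obtain \<epsilon> where \<epsilon>: "\<epsilon> > 0" "\<And>t. 0 < t \<Longrightarrow> t < \<epsilon> \<Longrightarrow> m0 + t *\<^sub>R n \<notin> closure \<Omega>"
      using normal m0'(2) unfolding outer_unit_normal_def by blast
    \<comment> \<open>The weight of c in a convex combination with a point of the edge: small enough
      for the compensating point to lie on the edge and for the height u q to stay below
      \<epsilon>.\<close>
    define u where "u = min (1/2) (min (l / (2 * (\<bar>r\<bar> + 1))) (\<epsilon> / (2 * q)))"
    have u: "0 < u" "u \<le> 1/2" "u * (2 * (\<bar>r\<bar> + 1)) \<le> l" "u * q < \<epsilon>"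
    proof -
      show "0 < u" unfolding u_def using l \<epsilon>(1) q by simp
      show "u \<le> 1/2" unfolding u_def by (rule min.cobounded1)
      have "u \<le> l / (2 * (\<bar>r\<bar> + 1))" "u \<le> \<epsilon> / (2 * q)" unfolding u_def
        by (rule min.coboundedI2, rule min.cobounded1) (rule min.coboundedI2, rule min.cobounded2)
      then show "u * (2 * (\<bar>r\<bar> + 1)) \<le> l" "u * q < \<epsilon>" using q \<epsilon>(1) by (simp_all add: field_simps)
    qed
    \<comment> \<open>The offset along the edge that cancels the tangential offset r of c, so that
      the combination lies on the normal line through m0.\<close>
    define w where "w = - (u * r) / (1 - u)"
    have "\<bar>u * r\<bar> \<le> l * (1 - u)"
    proof -
      have "\<bar>u * r\<bar> = u * \<bar>r\<bar>" using u(1) by (simp add: abs_mult)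
      also have "\<dots> \<le> l / 2" using u(1,3) by (simp add: algebra_simps)
      also have "\<dots> \<le> l * (1 - u)" using u(2) l by simp
      finally show ?thesis .
    qed
    then have w: "\<bar>w\<bar> \<le> l" unfolding w_def using u(2) by (simp add: abs_divide field_simps)
    define z where "z = m0 + w *\<^sub>R \<sigma>"
    have "z \<in> closed_segment (M 1) (M 2)"
      unfolding in_segment z_def M12 using w l
      by (intro exI[of _ "(w + l) / (2 * l)"]) (auto simp: vec_eq_iff field_simps)
    moreover have sub: "M 1 \<in> T" "M 2 \<in> T" "c \<in> T" using assms(1) vertices_subset by blast+
    ultimately have "z \<in> T" using closed_segment_subset[OF sub(1,2) convex_cell[OF assms(4)]] by blast
    then have "(1 - u) *\<^sub>R z + u *\<^sub>R c \<in> T" using convexD_alt[OF convex_cell[OF assms(4)] _ sub(3)] u by simp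
    moreover have "(1 - u) *\<^sub>R z + u *\<^sub>R c = m0 + (u * q) *\<^sub>R n"
    proof -
      have "(1 - u) * w = - (u * r)" unfolding w_def using u(2) by simp
      then have "(1 - u) *\<^sub>R z + u *\<^sub>R c = m0 + (- (u * r) + u * r) *\<^sub>R \<sigma> + (u * q) *\<^sub>R n"
        unfolding z_def c by (simp add: scaleR_add_right scaleR_add_left scaleR_left_diff_distrib)
      then show ?thesis by simp
    qed
    moreover have "0 < u * q" using u(1) q by simp
    ultimately show False using \<epsilon>(2)[of "u * q"] u(4) cell_subset[OF assms(4)] by auto
  qed
qed

text \<open>Passes from the measure on \<Omega> to Borel measure on the plane, where the involution
  of the triangle acts; the open and the closed cell differ by a null set.\<close>

lemma cell_integral:
  assumes T: "T \<in> \<T>" and f: "continuous_on UNIV f"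
  shows "(LINT x|lebesgue_on \<Omega>. indicator (interior T) x * f x) = (LINT x|lborel. indicator T x * f x)"
    and "bounded_meas \<Omega> (\<lambda>x. indicator (interior T) x * f x)"
proof -
  have "closed T" using compact_cell[OF T] by (rule compact_imp_closed)
  have meas: "f \<in> borel_measurable borel" by (rule borel_measurable_continuous_onI[OF f])
  have m: "(\<lambda>x. indicator (interior T) x * f x) \<in> borel_measurable borel" "(\<lambda>x. indicator T x * f x) \<in> borel_measurable borel"
    using \<open>closed T\<close> meas by (auto intro!: borel_measurable_times borel_measurable_indicator)
  have "frontier T \<in> null_sets lebesgue"
    using negligible_convex_frontier[OF convex_cell[OF T]] by (simp add: negligible_iff_null_sets)
  then have "AE x in lebesgue. x \<notin> frontier T" by (rule AE_not_in)
  then have AE: "AE x in lebesgue. indicator \<Omega> x * (indicator (interior T) x * f x) = indicator T x * f x"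
  proof eventually_elim
    case (elim x)
    then show ?case using interior_cell_subset[OF T] interior_subset[of T] \<open>closed T\<close>
      by (auto simp: frontier_def indicator_def)
  qed
  have "(LINT x|lebesgue_on \<Omega>. indicator (interior T) x * f x) = (LINT x|lebesgue. indicator T x * f x)"
    unfolding integral_lebesgue_on(1)[OF open_domain] using m open_domain AE
    by (intro integral_cong_AE measurable_completion borel_measurable_times borel_measurable_indicator)
      (auto simp: meas \<open>closed T\<close>)
  also have "\<dots> = (LINT x|lborel. indicator T x * f x)" using m(2) by (intro integral_completion) simp
  finally show "(LINT x|lebesgue_on \<Omega>. indicator (interior T) x * f x) = (LINT x|lborel. indicator T x * f x)" .
  have "bounded_meas \<Omega> f"
    using continuous_on_subset[OF f] by (intro bounded_meas_continuous open_domain bounded_domain) simp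
  moreover have "bounded_meas \<Omega> (indicator (interior T))"
    unfolding bounded_meas_def
    by (intro conjI measurable_restrict_space1 borel_measurable_indicator exI[of _ 1]) auto
  ultimately show "bounded_meas \<Omega> (\<lambda>x. indicator (interior T) x * f x)" by (intro bounded_meas_mult)
qed

text \<open>On a cell with this edge the normal derivative of the bubble is a combination of two
  barycentric coordinates, whose integrals agree by symmetry. What remains is the sign of (\<beta>a
  + \<beta>b) \<bullet> n; the vector \<beta>a + \<beta>b is minus the gradient of the third
  barycentric coordinate and so points outwards.\<close>

lemma boundary_bubble_flux:
  assumes h: "hat (M 1) \<psi>a" "hat (M 2) \<psi>b" and "T0 \<in> \<T>" "M 1 \<in> vertices_of T0" "M 2 \<in> vertices_of T0" "M 1 \<noteq> M 2"
  shows "0 < (LINT x|lebesgue_on \<Omega>. directional n (bubble \<psi>a \<psi>b) x)"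
proof -
  let ?a = "M 1" and ?b = "M 2"
  \<comment> \<open>All cells with this edge are summed; each contributes a positive amount, so
    their number need not be known.\<close>
  define S where "S = {T \<in> \<T>. ?a \<in> vertices_of T \<and> ?b \<in> vertices_of T}"
  have "finite S" "T0 \<in> S" unfolding S_def using finite_mesh assms by auto
  have "\<exists>F. continuous_on UNIV F \<and> (\<forall>x\<in>interior T. directional n (bubble \<psi>a \<psi>b) x = F x) \<and> 0 < (LINT x|lborel. indicator T x * F x)"
    if "T \<in> S" for T
  proof -
    have T: "T \<in> \<T>" "?a \<in> vertices_of T" "?b \<in> vertices_of T" using \<open>T \<in> S\<close> unfolding S_def by auto
    obtain c where c: "\<not> collinear {?a, ?b, c}" "T = convex hull {?a, ?b, c}" "vertices_of T = {?a, ?b, c}"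
      using third_vertex[OF T assms(6)] by metis
    obtain \<alpha>a \<beta>a where la: "\<And>x. x \<in> T \<Longrightarrow> \<psi>a x = \<alpha>a + \<beta>a \<bullet> x" "\<And>v. v \<in> vertices_of T \<Longrightarrow> \<alpha>a + \<beta>a \<bullet> v = (if v = ?a then 1 else 0)"
      using hat_cell[OF h(1) T(1)] by metis
    obtain \<alpha>b \<beta>b where lb: "\<And>x. x \<in> T \<Longrightarrow> \<psi>b x = \<alpha>b + \<beta>b \<bullet> x" "\<And>v. v \<in> vertices_of T \<Longrightarrow> \<alpha>b + \<beta>b \<bullet> v = (if v = ?b then 1 else 0)"
      using hat_cell[OF h(2) T(1)] by metis
    have ne: "c \<noteq> ?a" "c \<noteq> ?b" using c(1) by (auto simp: insert_commute)
    define La where "La x = \<alpha>a + \<beta>a \<bullet> x" for x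
    define Lb where "Lb x = \<alpha>b + \<beta>b \<bullet> x" for x
    have La: "La ?a = 1" "La ?b = 0" "La c = 0" and Lb: "Lb ?a = 0" "Lb ?b = 1" "Lb c = 0"
      unfolding La_def Lb_def using la(2) lb(2) c(3) ne assms(6) by auto
    have cont: "continuous_on UNIV La" "continuous_on UNIV Lb" unfolding La_def[abs_def] Lb_def[abs_def] by (intro continuous_intros)+
    define F where "F x = (\<beta>a \<bullet> n) * Lb x + (\<beta>b \<bullet> n) * La x" for x
    define G where "G L = (LINT x|lborel. indicator T x * L x)" for L :: "real^2 \<Rightarrow> real"
    have G_lebesgue: "G L = (LINT x|lebesgue_on \<Omega>. indicator (interior T) x * L x)" if "continuous_on UNIV L" for L
      unfolding G_def using cell_integral(1)[OF T(1) that] by simp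
    have bm: "bounded_meas \<Omega> (\<lambda>x. indicator (interior T) x * La x)" "bounded_meas \<Omega> (\<lambda>x. indicator (interior T) x * Lb x)"
      by (intro cell_integral(2) T cont)+
    note int = bounded_meas_integrable[OF open_domain bounded_domain]
    have Fc: "continuous_on UNIV F" unfolding F_def[abs_def] by (intro continuous_intros cont)
    have deriv: "directional n (bubble \<psi>a \<psi>b) x = F x" if x: "x \<in> interior T" for x
    proof -
      have "(bubble \<psi>a \<psi>b has_derivative (\<lambda>h. \<psi>a x * (\<beta>b \<bullet> h) + (\<beta>a \<bullet> h) * \<psi>b x)) (at x)"
        unfolding bubble_def[OF T assms(6) h, abs_def]
        by (rule has_derivative_mult[OF directional_affine(1)[OF la(1) x] directional_affine(1)[OF lb(1) x]])
      then have "directional n (bubble \<psi>a \<psi>b) x = \<psi>a x * (\<beta>b \<bullet> n) + (\<beta>a \<bullet> n) * \<psi>b x" by (rule directional_eq)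
      moreover have "x \<in> T" using x interior_subset by blast
      ultimately show ?thesis unfolding F_def La_def Lb_def using la(1) lb(1) by simp
    qed
    have swap: "G La = G Lb"
      unfolding G_def c(2) La_def Lb_def
      by (rule integral_barycentric_swap) (use La Lb in \<open>simp_all add: La_def Lb_def\<close>)
    have "G F = (LINT x|lebesgue_on \<Omega>. (\<beta>a \<bullet> n) * (indicator (interior T) x * Lb x) + (\<beta>b \<bullet> n) * (indicator (interior T) x * La x))"
      unfolding G_lebesgue[OF Fc] F_def by (simp add: algebra_simps)
    also have "\<dots> = (\<beta>a \<bullet> n) * G Lb + (\<beta>b \<bullet> n) * G La"
      unfolding G_lebesgue[OF cont(1)] G_lebesgue[OF cont(2)] using int[OF bm(1)] int[OF bm(2)]
      by (subst Bochner_Integration.integral_add) auto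
    finally have GF: "G F = ((\<beta>a + \<beta>b) \<bullet> n) * G La" using swap by (simp add: inner_add_left algebra_simps)
    have "0 < (\<beta>a + \<beta>b) \<bullet> n"
    proof -
      \<comment> \<open>Orthogonal to the edge and with product -1 with c - M 1; since c lies on the
        inner side, the component along n is positive.\<close>
      define \<gamma> where "\<gamma> = \<beta>a + \<beta>b"
      have q: "(c - ?a) \<bullet> n < 0" using outward_third_vertex[OF c(3,2,1) T(1)] .
      have \<gamma>: "\<gamma> \<bullet> (?b - ?a) = 0" "\<gamma> \<bullet> (c - ?a) = - 1"
        using La Lb unfolding \<gamma>_def La_def Lb_def by (simp_all add: inner_add_left inner_diff_right)
      have i: "1 \<in> {1..m + 1}" "2 \<in> {1..m + 1}" using abscissa_ends(3) by auto
      have "?b - ?a = (abscissa 2 - abscissa 1) *\<^sub>R \<sigma>"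
        using vertices_param(1)[OF i(1)] vertices_param(1)[OF i(2)] by (metis add_diff_cancel_left scaleR_diff_left)
      then have g\<sigma>: "\<gamma> \<bullet> \<sigma> = 0" using \<gamma>(1) abscissa_less[OF i] by simp
      have frame: "\<sigma> \<bullet> \<sigma> = 1" "n \<bullet> n = 1" "n \<bullet> \<sigma> = 0" "\<sigma> \<bullet> n = 0"
        using side_direction(1,2) tangent_frame(2) by (simp_all add: norm_eq_1 inner_commute)
      define d where "d = c - ?a"
      have "d - ((d \<bullet> \<sigma>) *\<^sub>R \<sigma> + (d \<bullet> n) *\<^sub>R n) = 0"
        by (rule orthonormal_zero[OF frame(2,1,3)]) (simp_all add: inner_diff_left inner_add_left frame)
      then have "d = (d \<bullet> \<sigma>) *\<^sub>R \<sigma> + (d \<bullet> n) *\<^sub>R n" by simp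
      then have "\<gamma> \<bullet> d = (d \<bullet> \<sigma>) * (\<gamma> \<bullet> \<sigma>) + (d \<bullet> n) * (\<gamma> \<bullet> n)" by (metis inner_add_right inner_scaleR_right)
      then have "(d \<bullet> n) * (\<gamma> \<bullet> n) = - 1" using \<gamma>(2) g\<sigma> unfolding d_def by simp
      then show ?thesis using q unfolding d_def[symmetric] \<gamma>_def[symmetric] by (smt (verit) mult_nonpos_nonpos)
    qed
    moreover have "0 < G La"
    proof -
      have nonneg: "AE x in lebesgue_on \<Omega>. 0 \<le> indicator (interior T) x * La x"
      proof (rule AE_I2)
        fix x
        have "0 \<le> La x" if "x \<in> interior T"
        proof -
          have "x \<in> T" using that interior_subset by blast
          then show ?thesis using hat_nonneg[OF h(1), of x] la(1)[of x] cell_subset[OF T(1)] unfolding La_def by auto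
        qed
        then show "0 \<le> indicator (interior T) x * La x" by (simp add: indicator_def)
      qed
      have "G La \<noteq> 0"
      proof
        assume "G La = 0"
        then have "AE x in lebesgue_on \<Omega>. indicator (interior T) x * La x = 0"
          unfolding G_lebesgue[OF cont(1)] using integral_nonneg_eq_0_iff_AE[OF int[OF bm(1)] nonneg] by simp
        then have *: "AE x in lebesgue_on \<Omega>. x \<in> interior T \<longrightarrow> La x = 0" by eventually_elim (auto simp: indicator_def split: if_splits)
        obtain x where x: "x \<in> interior T" "0 < bubble \<psi>a \<psi>b x" using bubble_positive[OF T assms(6) h] by blast
        have "continuous_on (interior T) La" using cont(1) continuous_on_subset by blast
        from open_AE_zero[OF this open_interior interior_cell_subset[OF T(1)] * x(1)] have "La x = 0" .
        moreover have "\<psi>a x = La x" using la(1) x(1) interior_subset unfolding La_def by blast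
        ultimately show False using x(2) unfolding bubble_def[OF T assms(6) h] by simp
      qed
      moreover have "0 \<le> G La" unfolding G_lebesgue[OF cont(1)] using nonneg by (rule integral_nonneg_AE)
      ultimately show ?thesis by simp
    qed
    ultimately have "0 < G F" unfolding GF by simp
    then show ?thesis using Fc deriv unfolding G_def by blast
  qed
  then obtain F where F: "\<And>T. T \<in> S \<Longrightarrow> continuous_on UNIV (F T)"
    "\<And>T x. T \<in> S \<Longrightarrow> x \<in> interior T \<Longrightarrow> directional n (bubble \<psi>a \<psi>b) x = F T x"
    "\<And>T. T \<in> S \<Longrightarrow> 0 < (LINT x|lborel. indicator T x * F T x)" by metis
  have ST: "T \<in> \<T>" if "T \<in> S" for T using that unfolding S_def by blast
  have AE: "AE x in lebesgue_on \<Omega>. directional n (bubble \<psi>a \<psi>b) x = (\<Sum>T\<in>S. indicator (interior T) x * F T x)"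
    using AE_core_on
  proof eventually_elim
    case (elim x)
    then obtain T where T: "T \<in> \<T>" "x \<in> interior T" unfolding core_def by blast
    have other: "indicator (interior T') x * F T' x = 0" if "T' \<in> S" "T' \<noteq> T" for T'
      using interior_cell_unique[OF T(1) ST[OF that(1)] T(2)] that(2) interior_subset[of T'] by (auto simp: indicator_def)
    show ?case
    proof (cases "T \<in> S")
      case True
      have "(\<Sum>T'\<in>S. indicator (interior T') x * F T' x) = indicator (interior T) x * F T x"
        using sum.remove[OF \<open>finite S\<close> True, of "\<lambda>T'. indicator (interior T') x * F T' x"]
          sum.neutral[of "S - {T}" "\<lambda>T'. indicator (interior T') x * F T' x"] other by simp
      then show ?thesis using F(2)[OF True T(2)] T(2) by simp
    next
      case False
      have zero: "bubble \<psi>a \<psi>b y = 0" if "y \<in> T" for y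
        using bubble_outside[OF assms(3-6) h T(1) that] False T(1) unfolding S_def by blast
      have "directional n (bubble \<psi>a \<psi>b) x = 0 \<bullet> n"
        by (rule directional_affine(2)[OF _ T(2), where \<alpha> = 0]) (use zero in simp)
      moreover have "(\<Sum>T'\<in>S. indicator (interior T') x * F T' x) = 0" using other False by (intro sum.neutral) blast
      ultimately show ?thesis by simp
    qed
  qed
  have bm: "bounded_meas \<Omega> (\<lambda>x. indicator (interior T) x * F T x)" if "T \<in> S" for T
    by (rule cell_integral(2)[OF ST[OF that] F(1)[OF that]])
  have "(LINT x|lebesgue_on \<Omega>. directional n (bubble \<psi>a \<psi>b) x) = (LINT x|lebesgue_on \<Omega>. (\<Sum>T\<in>S. indicator (interior T) x * F T x))"
    by (rule LINT_cong_bounded_meas(1)[OF open_domain bounded_meas_sum[OF bm] AE])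
  also have "\<dots> = (\<Sum>T\<in>S. LINT x|lebesgue_on \<Omega>. indicator (interior T) x * F T x)"
    by (intro Bochner_Integration.integral_sum bounded_meas_integrable[OF open_domain bounded_domain] bm)
  also have "\<dots> = (\<Sum>T\<in>S. LINT x|lborel. indicator T x * F T x)"
    by (intro sum.cong refl cell_integral(1) ST F(1))
  also have "\<dots> > 0" using F(3) \<open>finite S\<close> \<open>T0 \<in> S\<close> by (intro sum_pos) auto
  finally show ?thesis .
qed

theorem b_form_injective:
  assumes p: "p \<in> Q_space \<Omega> \<T>" and zero: "\<And>v. v \<in> V\<tau> \<Longrightarrow> b_form \<Omega> v p = 0" and x: "x \<in> closure \<Omega>"
  shows "p x = 0"
proof -
  obtain c where c: "\<forall>x\<in>closure \<Omega>. p x = c" using pressure_constant[OF p zero] by blast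
  have i: "1 \<in> {1..m}" "1 \<in> {1..m + 1}" "2 \<in> {1..m + 1}" using abscissa_ends(3) by auto
  obtain T where T: "T \<in> \<T>" "M 1 \<in> vertices_of T" "M 2 \<in> vertices_of T" using boundary_edge[OF i(1)] by (auto simp: numeral_2_eq_2)
  have ne: "M 1 \<noteq> M 2" using abscissa_less[OF i(2,3)] unfolding abscissa_def by auto
  note T = T ne
  obtain \<psi>a \<psi>b where h: "hat (M 1) \<psi>a" "hat (M 2) \<psi>b" using hat_exists by metis
  have mid: "midpoint (M 1) (M 2) \<in> \<Gamma>1" using half_node_param(2)[OF i(1)] by (simp add: numeral_2_eq_2)
  then have "midpoint (M 1) (M 2) \<notin> closure \<Gamma>0" using \<Gamma>1_not_\<Gamma>0 by blast
  moreover have "n \<bullet> tangent n = 0" using tangent_frame(3) by (simp add: inner_commute)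
  ultimately have "(\<lambda>x. bubble \<psi>a \<psi>b x *\<^sub>R n) \<in> V\<tau>" using bubble_V_tau[OF T h] by blast
  from zero[OF this] have "(LINT x|lebesgue_on \<Omega>. directional n (bubble \<psi>a \<psi>b) x * p x) = 0"
    using b_form_bubble[OF T h pc1_Q_space[OF p]] by simp
  also have "(LINT x|lebesgue_on \<Omega>. directional n (bubble \<psi>a \<psi>b) x * p x) = (LINT x|lebesgue_on \<Omega>. directional n (bubble \<psi>a \<psi>b) x * c)"
    using c closure_subset by (intro Bochner_Integration.integral_cong) (auto simp: space_restrict_space)
  also have "\<dots> = (LINT x|lebesgue_on \<Omega>. directional n (bubble \<psi>a \<psi>b) x) * c" by simp
  finally have "c = 0" using boundary_bubble_flux[OF h T] by simp
  then show ?thesis using c x by simp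
qed

end

section \<open>The Uzawa iteration for the finite element spaces\<close>

lemma bilinear_onI:
  assumes "subspace E" "subspace F"
    and left: "\<And>r x y z. x \<in> E \<Longrightarrow> y \<in> E \<Longrightarrow> z \<in> F \<Longrightarrow> B (r *\<^sub>R x + y) z = r * B x z + B y z"
    and right: "\<And>r x y z. x \<in> E \<Longrightarrow> y \<in> F \<Longrightarrow> z \<in> F \<Longrightarrow> B x (r *\<^sub>R y + z) = r * B x y + B x z"
  shows "bilinear_on E F B"
proof -
  have "B 0 z = 0" if "z \<in> F" for z
    using left[of 0 0 z 1] subspace_0[OF assms(1)] that by simp
  moreover have "B x 0 = 0" if "x \<in> E" for x
    using right[of x 0 0 1] subspace_0[OF assms(2)] that by simp
  ultimately have "B (r *\<^sub>R x) z = r * B x z" "B x (r *\<^sub>R z) = r * B x z" if "x \<in> E" "z \<in> F" for r x z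
    using left[of x 0 z r] right[of x z 0 r] subspace_0[OF assms(1)] subspace_0[OF assms(2)] that by simp_all
  moreover have "B (x + y) z = B x z + B y z" if "x \<in> E" "y \<in> E" "z \<in> F" for x y z
    using left[OF that, of 1] by simp
  moreover have "B x (y + z) = B x y + B x z" if "x \<in> E" "y \<in> F" "z \<in> F" for x y z
    using right[OF that, of 1] by simp
  ultimately show ?thesis unfolding bilinear_on_def by blast
qed

lemma symmetric_bilinear_onI:
  assumes "subspace E" and sym: "\<And>x y. B x y = B y x"
    and left: "\<And>r x y z. x \<in> E \<Longrightarrow> y \<in> E \<Longrightarrow> z \<in> E \<Longrightarrow> B (r *\<^sub>R x + y) z = r * B x z + B y z"
  shows "bilinear_on E E B"
proof (rule bilinear_onI[OF assms(1,1) left])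
  fix r x y z assume "x \<in> E" "y \<in> E" "z \<in> E"
  then show "B x (r *\<^sub>R y + z) = r * B x y + B x z" using left[of y z x r] by (simp add: sym[of x])
qed

lemma LINT_restrict_cong: "(\<And>x. x \<in> \<Omega> \<Longrightarrow> f x = g x) \<Longrightarrow> (LINT x|lebesgue_on \<Omega>. f x) = (LINT x|lebesgue_on \<Omega>. g x)"
  by (intro Bochner_Integration.integral_cong) (auto simp: space_restrict_space)

text \<open>Functions equal on \<Omega> satisfy the same defining predicate, so \<open>SOME\<close>
  selects the same weak derivative and equality holds everywhere, not just almost
  everywhere.\<close>

lemma weak_deriv_cong:
  assumes "\<And>x. x \<in> \<Omega> \<Longrightarrow> v x = w x"
  shows "weak_deriv \<Omega> j v = weak_deriv \<Omega> j w"
proof -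
  have "v absolutely_integrable_on C \<longleftrightarrow> w absolutely_integrable_on C" if "C \<subseteq> \<Omega>" for C
    using assms that by (intro set_integrable_cong refl) blast
  moreover have "(LINT x|lebesgue_on \<Omega>. v x * \<phi> x) = (LINT x|lebesgue_on \<Omega>. w x * \<phi> x)" for \<phi> :: "real^2 \<Rightarrow> real"
    using assms by (intro LINT_restrict_cong) simp
  ultimately have "has_weak_deriv \<Omega> j v = has_weak_deriv \<Omega> j w"
    unfolding has_weak_deriv_def[abs_def] by (intro ext) auto
  then show ?thesis unfolding weak_deriv_def by simp
qed

lemma weak_deriv_comp_cong: "(\<And>x. x \<in> \<Omega> \<Longrightarrow> v x = w x) \<Longrightarrow> weak_deriv_comp \<Omega> i j v = weak_deriv_comp \<Omega> i j w"
  by (rule weak_deriv_cong) simp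

lemma strain_cong: "(\<And>x. x \<in> \<Omega> \<Longrightarrow> v x = w x) \<Longrightarrow> strain \<Omega> i j v = strain \<Omega> i j w"
  unfolding strain_def[abs_def] using weak_deriv_comp_cong[of \<Omega> v w] by simp

lemma a_form_cong:
  assumes "\<And>x. x \<in> \<Omega> \<Longrightarrow> u x = u' x" "\<And>x. x \<in> \<Omega> \<Longrightarrow> v x = v' x"
  shows "a_form \<Omega> \<nu> u v = a_form \<Omega> \<nu> u' v'"
  unfolding a_form_def using strain_cong[OF assms(1)] strain_cong[OF assms(2)] by simp

lemma b_form_cong:
  assumes "\<And>x. x \<in> \<Omega> \<Longrightarrow> v x = v' x" "\<And>x. x \<in> \<Omega> \<Longrightarrow> q x = q' x"
  shows "b_form \<Omega> v q = b_form \<Omega> v' q'"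
  unfolding b_form_def divergence_def using weak_deriv_comp_cong[OF assms(1)] assms(2)
  by (intro arg_cong[of _ _ uminus] LINT_restrict_cong) simp

lemma L2_inner_cong:
  assumes "\<And>x. x \<in> \<Omega> \<Longrightarrow> v x = v' x" "\<And>x. x \<in> \<Omega> \<Longrightarrow> w x = w' x"
  shows "L2_inner \<Omega> v w = L2_inner \<Omega> v' w'"
  unfolding L2_inner_def using assms by (intro LINT_restrict_cong) simp

lemma L2_inner_sym: "L2_inner \<Omega> v w = L2_inner \<Omega> w v"
  unfolding L2_inner_def by (simp add: inner_commute)

lemma L2_inner_nonneg: "0 \<le> L2_inner \<Omega> v v"
  unfolding L2_inner_def by (rule Bochner_Integration.integral_nonneg) simp

text \<open>Introduced so that the triangle inequality for \<open>H1_norm\<close> comes from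
  Cauchy-Schwarz.\<close>

definition H1_inner :: "(real^2) set \<Rightarrow> (real^2 \<Rightarrow> real^2) \<Rightarrow> (real^2 \<Rightarrow> real^2) \<Rightarrow> real" where
  "H1_inner \<Omega> v w = L2_inner \<Omega> v w +
     (\<Sum>i\<in>UNIV. \<Sum>j\<in>UNIV. L2_inner \<Omega> (weak_deriv_comp \<Omega> i j v) (weak_deriv_comp \<Omega> i j w))"

lemma H1_norm_inner: "H1_norm \<Omega> v = sqrt (H1_inner \<Omega> v v)"
  unfolding H1_norm_def H1_inner_def L2_norm_def by (simp add: L2_inner_nonneg)

lemma H1_norm_cong:
  assumes "\<And>x. x \<in> \<Omega> \<Longrightarrow> v x = w x"
  shows "H1_norm \<Omega> v = H1_norm \<Omega> w"
  unfolding H1_norm_inner H1_inner_def using L2_inner_cong[OF assms assms] weak_deriv_comp_cong[OF assms] by simp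

lemma Lam_inner_sym: "Lam_inner g m M \<eta> \<mu> = Lam_inner g m M \<mu> \<eta>"
  unfolding Lam_inner_def by (simp add: mult.commute mult.left_commute)

lemma Lam_inner_bilinear: "bilinear_on UNIV UNIV (Lam_inner g m M)"
proof -
  have left: "Lam_inner g m M (r *\<^sub>R x + y) z = r * Lam_inner g m M x z + Lam_inner g m M y z" for r x y z
    unfolding Lam_inner_def by (simp add: sum.distrib sum_distrib_left algebra_simps)
  show ?thesis
    by (rule symmetric_bilinear_onI) (rule subspace_UNIV Lam_inner_sym left)+
qed

section \<open>Nodes on the side, and finite element functions extended by zero\<close>

context fe_mesh
begin

lemma edge_nodes:
  assumes "i \<in> {1..m}"
  shows "M i \<in> closure \<Gamma>1" "M (i + 1) \<in> closure \<Gamma>1" "half_node M i \<in> closure \<Gamma>1" "dist (M i) (M (i + 1)) > 0"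
proof -
  have i: "i \<in> {1..m + 1}" "i + 1 \<in> {1..m + 1}" using assms by auto
  show "M i \<in> closure \<Gamma>1" "M (i + 1) \<in> closure \<Gamma>1"
    unfolding whole_side(2) using vertices i unfolding boundary_vertices_def by blast+
  show "half_node M i \<in> closure \<Gamma>1" using half_node_param(2)[OF assms] closure_subset by blast
  show "dist (M i) (M (i + 1)) > 0" using edge_param(3)[OF assms, of 0] abscissa_less[OF i] by simp
qed

lemma closure_\<Gamma>1_subset: "closure \<Gamma>1 \<subseteq> closure \<Omega>"
  unfolding whole_side(2) using \<Gamma>1_frontier(2) unfolding frontier_def by blast

lemma end_or_\<Gamma>1:
  assumes "i \<in> {1..m + 1}"
  shows "i = 1 \<or> i = m + 1 \<or> M i \<in> \<Gamma>1"
proof (cases "i = 1 \<or> i = m + 1")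
  case False
  have ends: "1 \<in> {1..m + 1}" "m + 1 \<in> {1..m + 1}" by auto
  have "abscissa 1 < abscissa i" "abscissa i < abscissa (m + 1)"
    using abscissa_less[OF ends(1) assms] abscissa_less[OF assms ends(2)] assms False by auto
  then have "A + abscissa i *\<^sub>R \<sigma> \<in> \<Gamma>1" unfolding side_param(3) abscissa_ends(1,2) by simp
  then show ?thesis using vertices_param(1)[OF assms] by simp
qed auto

lemma Lam_inner_cong:
  assumes "\<And>x. x \<in> closure \<Gamma>1 \<Longrightarrow> \<eta> x = \<eta>' x" "\<And>x. x \<in> closure \<Gamma>1 \<Longrightarrow> \<mu> x = \<mu>' x"
  shows "Lam_inner g m M \<eta> \<mu> = Lam_inner g m M \<eta>' \<mu>'"
proof -
  have "dist (M i) (M (i + 1)) * (g (M i) * \<eta> (M i) * \<mu> (M i)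
      + 4 * g (half_node M i) * \<eta> (half_node M i) * \<mu> (half_node M i)
      + g (M (i + 1)) * \<eta> (M (i + 1)) * \<mu> (M (i + 1))) =
    dist (M i) (M (i + 1)) * (g (M i) * \<eta>' (M i) * \<mu>' (M i)
      + 4 * g (half_node M i) * \<eta>' (half_node M i) * \<mu>' (half_node M i)
      + g (M (i + 1)) * \<eta>' (M (i + 1)) * \<mu>' (M (i + 1)))" if "i \<in> {1..m}" for i
    using assms edge_nodes[OF that] by simp
  then show ?thesis unfolding Lam_inner_def by (simp only: cong: sum.cong)
qed

text \<open>At the two ends of the side the bound comes from the zero boundary values, as
  \<open>Lam_tilde\<close> constrains only nodes in the open side.\<close>

lemma Lam_tilde_nodes:
  assumes \<mu>: "\<mu> \<in> Lam_tilde \<Gamma>1 \<T> m M" and i: "i \<in> {1..m}"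
  shows "\<bar>\<mu> (M i)\<bar> \<le> 1" "\<bar>\<mu> (M (i + 1))\<bar> \<le> 1" "\<bar>\<mu> (half_node M i)\<bar> \<le> 1"
proof -
  have bound: "\<bar>\<mu> x\<bar> \<le> 1" if "x \<in> \<Gamma>1" "x \<in> mesh_nodes \<T>" for x using \<mu> that unfolding Lam_tilde_def by blast
  have ends: "\<mu> (M 1) = 0" "\<mu> (M (m + 1)) = 0" using \<mu> unfolding Lam_tilde_def Lam_space_def by auto
  have vertex: "\<bar>\<mu> (M j)\<bar> \<le> 1" if j: "j \<in> {1..m + 1}" for j
    using end_or_\<Gamma>1[OF j] ends bound[OF _ vertex_node[OF vertices_param(3)[OF j]]] by auto
  show "\<bar>\<mu> (M i)\<bar> \<le> 1" "\<bar>\<mu> (M (i + 1))\<bar> \<le> 1" using vertex i by auto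
  have i': "i \<in> {1..m + 1}" "i + 1 \<in> {1..m + 1}" using i by auto
  obtain T where T: "T \<in> \<T>" "M i \<in> vertices_of T" "M (i + 1) \<in> vertices_of T" using boundary_edge[OF i] by blast
  have "M i \<noteq> M (i + 1)" using edge_nodes(4)[OF i] by auto
  then have "half_node M i \<in> mesh_nodes \<T>" by (rule midpoint_node[OF T])
  then show "\<bar>\<mu> (half_node M i)\<bar> \<le> 1" using bound half_node_param(2)[OF i] by blast
qed

text \<open>Finite element functions are only determined on the closed domain, or on the closed side for
  multipliers. Extension by zero makes the spaces finite-dimensional and the forms definite.\<close>

definition E_space :: "(real^2 \<Rightarrow> real^2) set" where
  "E_space = {v \<in> V\<tau>. \<forall>x. x \<notin> closure \<Omega> \<longrightarrow> v x = 0}"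

definition P_space :: "(real^2 \<Rightarrow> real) set" where
  "P_space = {q \<in> Q_space \<Omega> \<T>. \<forall>x. x \<notin> closure \<Omega> \<longrightarrow> q x = 0}"

definition L_space :: "(real^2 \<Rightarrow> real) set" where
  "L_space = {\<mu> \<in> Lam_space \<Gamma>1 m M. \<forall>x. x \<notin> closure \<Gamma>1 \<longrightarrow> \<mu> x = 0}"

definition K_set :: "(real^2 \<Rightarrow> real) set" where
  "K_set = {\<mu> \<in> Lam_tilde \<Gamma>1 \<T> m M. \<forall>x. x \<notin> closure \<Gamma>1 \<longrightarrow> \<mu> x = 0}"

lemma spaces_subset: "E_space \<subseteq> V\<tau>" "E_space \<subseteq> V" "P_space \<subseteq> Q_space \<Omega> \<T>" "K_set \<subseteq> Lam_tilde \<Gamma>1 \<T> m M" "K_set \<subseteq> L_space"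
  unfolding E_space_def P_space_def K_set_def L_space_def V_tau_space_def Lam_tilde_def by auto

lemma V_tau_cong:
  assumes "v \<in> V\<tau>" "\<And>x. x \<in> closure \<Omega> \<Longrightarrow> w x = v x"
  shows "w \<in> V\<tau>"
proof -
  have "closure \<Gamma>0 \<subseteq> closure \<Omega>" using parts_cover unfolding frontier_def by blast
  moreover have "\<Gamma>1 \<subseteq> closure \<Omega>" using closure_\<Gamma>1_subset closure_subset by blast
  moreover have "poly_on 2 T (\<lambda>x. w x $ i) \<longleftrightarrow> poly_on 2 T (\<lambda>x. v x $ i)" if "T \<in> \<T>" for T i
    using assms(2) cell_subset[OF that] by (intro poly_on_cong) auto
  moreover have "continuous_on (closure \<Omega>) w \<longleftrightarrow> continuous_on (closure \<Omega>) v"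
    using assms(2) by (intro continuous_on_cong) auto
  ultimately show ?thesis using assms unfolding V_tau_space_def V_space_def by (auto simp: subset_iff)
qed

lemma Q_space_cong:
  assumes "v \<in> Q_space \<Omega> \<T>" "\<And>x. x \<in> closure \<Omega> \<Longrightarrow> w x = v x"
  shows "w \<in> Q_space \<Omega> \<T>"
proof -
  have "poly_on 1 T w \<longleftrightarrow> poly_on 1 T v" if "T \<in> \<T>" for T
    using assms(2) cell_subset[OF that] by (intro poly_on_cong) auto
  moreover have "continuous_on (closure \<Omega>) w \<longleftrightarrow> continuous_on (closure \<Omega>) v"
    using assms(2) by (intro continuous_on_cong) auto
  ultimately show ?thesis using assms unfolding Q_space_def by auto
qed

lemma Lam_tilde_cong:
  assumes "\<eta> \<in> Lam_tilde \<Gamma>1 \<T> m M" "\<And>x. x \<in> closure \<Gamma>1 \<Longrightarrow> \<mu> x = \<eta> x"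
  shows "\<mu> \<in> Lam_tilde \<Gamma>1 \<T> m M"
proof -
  have "poly_on 2 (closed_segment (M i) (M (i + 1))) \<mu> \<longleftrightarrow> poly_on 2 (closed_segment (M i) (M (i + 1))) \<eta>" if "i \<in> {1..m}" for i
    using assms(2) closure_\<Gamma>1_edges that by (intro poly_on_cong) blast
  moreover have "continuous_on (closure \<Gamma>1) \<mu> \<longleftrightarrow> continuous_on (closure \<Gamma>1) \<eta>"
    using assms(2) by (intro continuous_on_cong) auto
  moreover have "M 1 \<in> closure \<Gamma>1" "M (m + 1) \<in> closure \<Gamma>1"
    using edge_nodes(1)[of 1] edge_nodes(2)[of m] abscissa_ends(3) by auto
  moreover have "\<Gamma>1 \<subseteq> closure \<Gamma>1" by (rule closure_subset)
  ultimately show ?thesis using assms unfolding Lam_tilde_def Lam_space_def by (auto simp: subset_iff)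
qed

lemma subspace_E: "subspace E_space"
  unfolding subspace_def
proof (intro conjI ballI allI)
  show "0 \<in> E_space" unfolding E_space_def V_tau_space_def V_space_def by (simp add: zero_fun_def poly_on_zero)
  fix v w assume "v \<in> E_space" "w \<in> E_space"
  then show "v + w \<in> E_space"
    unfolding E_space_def V_tau_space_def V_space_def
    by (auto simp: plus_fun_def inner_add_left intro: continuous_on_add poly_on_add)
next
  fix r v assume "v \<in> E_space"
  then show "r *\<^sub>R v \<in> E_space"
    unfolding E_space_def V_tau_space_def V_space_def
    by (auto simp: scaleR_fun_def intro: continuous_on_scaleR poly_on_cmult)
qed

lemma subspace_P: "subspace P_space"
  unfolding subspace_def
proof (intro conjI ballI allI)
  show "0 \<in> P_space" unfolding P_space_def Q_space_def by (simp add: zero_fun_def poly_on_zero)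
  fix v w assume "v \<in> P_space" "w \<in> P_space"
  then show "v + w \<in> P_space"
    unfolding P_space_def Q_space_def by (auto simp: plus_fun_def intro: continuous_on_add poly_on_add)
next
  fix r v assume "v \<in> P_space"
  then show "r *\<^sub>R v \<in> P_space"
    unfolding P_space_def Q_space_def by (auto simp: scaleR_fun_def intro: continuous_on_mult_left poly_on_cmult)
qed

lemma subspace_L: "subspace L_space"
  unfolding subspace_def
proof (intro conjI ballI allI)
  show "0 \<in> L_space" unfolding L_space_def Lam_space_def by (simp add: zero_fun_def poly_on_zero)
  fix v w assume "v \<in> L_space" "w \<in> L_space"
  then show "v + w \<in> L_space"
    unfolding L_space_def Lam_space_def by (auto simp: plus_fun_def intro: continuous_on_add poly_on_add)
next
  fix r v assume "v \<in> L_space"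
  then show "r *\<^sub>R v \<in> L_space"
    unfolding L_space_def Lam_space_def by (auto simp: scaleR_fun_def intro: continuous_on_mult_left poly_on_cmult)
qed

lemma fin_dim_spaces: "fin_dim E_space" "fin_dim P_space" "fin_dim L_space"
proof -
  show "fin_dim E_space"
  proof (rule fin_dim_piecewise_poly[OF subspace_E finite_mesh])
    fix v x assume "v \<in> E_space" "x \<notin> \<Union>\<T>"
    then show "v x = 0" unfolding Union_cells E_space_def by blast
  next
    fix v T b assume "v \<in> E_space" "T \<in> \<T>"
    then show "poly_on 2 T (\<lambda>x. v x \<bullet> b)" using V_space_poly spaces_subset(2) by blast
  qed
  show "fin_dim P_space"
    by (rule fin_dim_piecewise_poly[OF subspace_P finite_mesh, where k = 1])
      (use Union_cells in \<open>auto simp: P_space_def Q_space_def\<close>)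
  show "fin_dim L_space"
    by (rule fin_dim_piecewise_poly[OF subspace_L, of "(\<lambda>i. closed_segment (M i) (M (i + 1))) ` {1..m}", where k = 2])
      (use closure_\<Gamma>1_edges in \<open>auto simp: L_space_def Lam_space_def\<close>)
qed

lemma bounded_meas_inner:
  fixes v w :: "real^2 \<Rightarrow> 'b::euclidean_space"
  assumes "continuous_on (closure \<Omega>) v" "continuous_on (closure \<Omega>) w"
  shows "bounded_meas \<Omega> (\<lambda>x. v x \<bullet> w x)"
  by (intro bounded_meas_continuous open_domain bounded_domain continuous_on_inner assms)

lemma seminorm_L2: "seminorm_on P_space (L2_norm \<Omega>)"
proof -
  have left: "L2_inner \<Omega> (r *\<^sub>R x + y) z = r * L2_inner \<Omega> x z + L2_inner \<Omega> y z"
    if "x \<in> P_space" "y \<in> P_space" "z \<in> P_space" for r x y z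
  proof -
    have bm: "bounded_meas \<Omega> x" "bounded_meas \<Omega> y" "bounded_meas \<Omega> z"
      using that spaces_subset(3) pc1_Q_space bounded_meas_pc1 by blast+
    show ?thesis unfolding L2_inner_def inner_real_def by (rule LINT_product_linear[OF bm]) simp
  qed
  have "bilinear_on P_space P_space (L2_inner \<Omega>)"
    by (rule symmetric_bilinear_onI[OF subspace_P]) (rule L2_inner_sym, rule left)
  from seminorm_on_sqrt_bilinear[OF this subspace_P] show ?thesis
    unfolding L2_norm_def[abs_def] using L2_inner_sym L2_inner_nonneg by blast
qed

lemma L2_inner_component:
  assumes "v \<in> V" "w \<in> V"
  shows "L2_inner \<Omega> v w = (\<Sum>i\<in>UNIV. L2_inner \<Omega> (\<lambda>x. v x $ i) (\<lambda>x. w x $ i))"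
proof -
  have "integrable (lebesgue_on \<Omega>) (\<lambda>x. v x $ i * w x $ i)" for i
    by (intro bounded_meas_integrable[OF open_domain bounded_domain] bounded_meas_mult bounded_meas_pc1 pc1_component assms)
  then show ?thesis unfolding L2_inner_def by (simp add: inner_vec_def)
qed

lemma seminorm_H1: "seminorm_on E_space (H1_norm \<Omega>)"
proof -
  have left: "H1_inner \<Omega> (r *\<^sub>R u + v) w = r * H1_inner \<Omega> u w + H1_inner \<Omega> v w"
    if "u \<in> E_space" "v \<in> E_space" "w \<in> E_space" for r u v w
  proof -
    have V: "u \<in> V" "v \<in> V" "w \<in> V" using that spaces_subset(2) by auto
    have "r *\<^sub>R u + v \<in> E_space" using that subspace_E by (simp add: subspace_add subspace_scale)
    then have V': "r *\<^sub>R u + v \<in> V" using spaces_subset(2) by blast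
    note bm = bounded_meas_pc1 bounded_meas_weak_deriv
    have "L2_inner \<Omega> (\<lambda>x. (r *\<^sub>R u + v) x $ i) (\<lambda>x. w x $ i) =
        r * L2_inner \<Omega> (\<lambda>x. u x $ i) (\<lambda>x. w x $ i) + L2_inner \<Omega> (\<lambda>x. v x $ i) (\<lambda>x. w x $ i)" for i
      unfolding L2_inner_def inner_real_def by (intro LINT_product_linear bm pc1_component V) simp
    then have 1: "L2_inner \<Omega> (r *\<^sub>R u + v) w = r * L2_inner \<Omega> u w + L2_inner \<Omega> v w"
      unfolding L2_inner_component[OF V(1,3)] L2_inner_component[OF V(2,3)] L2_inner_component[OF V' V(3)]
      by (simp add: sum.distrib sum_distrib_left)
    have "L2_inner \<Omega> (weak_deriv_comp \<Omega> i j (r *\<^sub>R u + v)) (weak_deriv_comp \<Omega> i j w) =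
        r * L2_inner \<Omega> (weak_deriv_comp \<Omega> i j u) (weak_deriv_comp \<Omega> i j w) +
        L2_inner \<Omega> (weak_deriv_comp \<Omega> i j v) (weak_deriv_comp \<Omega> i j w)" for i j
      unfolding L2_inner_def inner_real_def
      by (intro LINT_product_linear bm pc1_component V weak_deriv_comp_linear)
    then show ?thesis unfolding H1_inner_def 1 by (simp add: sum.distrib sum_distrib_left algebra_simps)
  qed
  have sym: "H1_inner \<Omega> u v = H1_inner \<Omega> v u" for u v
    unfolding H1_inner_def by (intro arg_cong2[where f = "(+)"] sum.cong refl L2_inner_sym)
  have nonneg: "0 \<le> H1_inner \<Omega> v v" for v
    unfolding H1_inner_def by (intro add_nonneg_nonneg sum_nonneg L2_inner_nonneg)
  have "bilinear_on E_space E_space (H1_inner \<Omega>)"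
    by (rule symmetric_bilinear_onI[OF subspace_E]) (rule sym, rule left)
  from seminorm_on_sqrt_bilinear[OF this subspace_E] show ?thesis
    unfolding H1_norm_inner[abs_def] using sym nonneg by blast
qed

text \<open>Integrability is the point: the product with f is bounded by the sum of the squared
  norms, f being square integrable and discrete velocities bounded.\<close>

lemma load_linear:
  assumes f: "f \<in> L2 \<Omega>" and "u \<in> V" "v \<in> V"
  shows "L2_inner \<Omega> f (r *\<^sub>R u + v) = r * L2_inner \<Omega> f u + L2_inner \<Omega> f v"
proof -
  have int: "integrable (lebesgue_on \<Omega>) (\<lambda>x. f x \<bullet> w x)" if "w \<in> V" for w
  proof (rule Bochner_Integration.integrable_bound)
    have c: "continuous_on (closure \<Omega>) w" using that unfolding V_space_def by blast
    then have "integrable (lebesgue_on \<Omega>) (\<lambda>x. w x \<bullet> w x)"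
      by (intro bounded_meas_integrable[OF open_domain bounded_domain] bounded_meas_inner)
    moreover have "integrable (lebesgue_on \<Omega>) (\<lambda>x. (norm (f x))\<^sup>2)" using f unfolding L2_def by blast
    ultimately show "integrable (lebesgue_on \<Omega>) (\<lambda>x. (norm (f x))\<^sup>2 + w x \<bullet> w x)" by (intro Bochner_Integration.integrable_add)
    have "w \<in> borel_measurable (lebesgue_on \<Omega>)"
      using continuous_on_subset[OF c closure_subset] open_domain by (intro continuous_imp_measurable_on_sets_lebesgue) auto
    moreover have "f \<in> borel_measurable (lebesgue_on \<Omega>)" using f unfolding L2_def by blast
    ultimately show "(\<lambda>x. f x \<bullet> w x) \<in> borel_measurable (lebesgue_on \<Omega>)" by (intro borel_measurable_inner)
    have "\<bar>f x \<bullet> w x\<bar> \<le> (norm (f x))\<^sup>2 + w x \<bullet> w x" for x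
    proof -
      have "\<bar>f x \<bullet> w x\<bar> \<le> norm (f x) * norm (w x)" by (rule Cauchy_Schwarz_ineq2)
      also have "\<dots> \<le> (norm (f x))\<^sup>2 + (norm (w x))\<^sup>2"
      proof -
        have "0 \<le> norm (f x) * norm (w x)" by simp
        then show ?thesis using sum_squares_bound[of "norm (f x)" "norm (w x)"] unfolding mult.assoc by linarith
      qed
      finally show ?thesis by (simp add: power2_norm_eq_inner)
    qed
    then show "AE x in lebesgue_on \<Omega>. norm (f x \<bullet> w x) \<le> norm ((norm (f x))\<^sup>2 + w x \<bullet> w x)"
      by (intro AE_I2) (simp add: order_trans[OF _ abs_ge_self])
  qed
  show ?thesis
    unfolding L2_inner_def using int[OF assms(2)] int[OF assms(3)] by (simp add: inner_add_right)
qed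

end

text \<open>\<open>C\<close> is a parameter with the trace bound as an assumption, so that one value
  fixed before the mesh can be used for every h.\<close>

locale fe_problem = fe_mesh +
  fixes \<nu> :: real and f :: "real^2 \<Rightarrow> real^2" and g :: "real^2 \<Rightarrow> real" and C :: real
  assumes nu_pos: "\<nu> > 0" and f_L2: "f \<in> L2 \<Omega>"
    and g_cont: "continuous_on (closure \<Gamma>1) g" and g_pos: "\<And>x. x \<in> \<Gamma>1 \<Longrightarrow> g x > 0"
    and C_pos: "C > 0"
    and trace: "\<And>v. v \<in> V\<tau> \<Longrightarrow> Lam_inner g m M (normal_comp n v) (normal_comp n v) \<le> C * a_form \<Omega> \<nu> v v"
begin

lemma g_nonneg: "x \<in> closure \<Gamma>1 \<Longrightarrow> 0 \<le> g x"
  by (rule continuous_ge_on_closure[OF g_cont _ less_imp_le[OF g_pos]])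

definition edge_sum :: "(real^2 \<Rightarrow> real) \<Rightarrow> nat \<Rightarrow> real" where
  "edge_sum \<mu> i = dist (M i) (M (i + 1)) * (g (M i) * \<mu> (M i) * \<mu> (M i)
      + 4 * g (half_node M i) * \<mu> (half_node M i) * \<mu> (half_node M i)
      + g (M (i + 1)) * \<mu> (M (i + 1)) * \<mu> (M (i + 1)))"

lemma Lam_inner_edges: "Lam_inner g m M \<mu> \<mu> = 1 / 6 * (\<Sum>i=1..m. edge_sum \<mu> i)"
  unfolding Lam_inner_def edge_sum_def ..

lemma edge_terms:
  assumes "i \<in> {1..m}"
  shows "0 \<le> g (M i) * \<mu> (M i) * \<mu> (M i)" "0 \<le> 4 * g (half_node M i) * \<mu> (half_node M i) * \<mu> (half_node M i)"
    "0 \<le> g (M (i + 1)) * \<mu> (M (i + 1)) * \<mu> (M (i + 1))"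
  using g_nonneg[OF edge_nodes(1)[OF assms]] g_nonneg[OF edge_nodes(2)[OF assms]] g_nonneg[OF edge_nodes(3)[OF assms]]
  by (simp_all add: mult.assoc)

lemma edge_sum_nonneg: "i \<in> {1..m} \<Longrightarrow> 0 \<le> edge_sum \<mu> i"
  unfolding edge_sum_def by (intro mult_nonneg_nonneg add_nonneg_nonneg edge_terms) simp_all

lemma Lam_inner_nonneg: "0 \<le> Lam_inner g m M \<mu> \<mu>"
  unfolding Lam_inner_edges using edge_sum_nonneg by (intro mult_nonneg_nonneg sum_nonneg) auto

text \<open>g may vanish at A and B, but there multipliers are 0 by definition; at the other nodes
  the weights are positive. Three nodal zeros on each edge annihilate the quadratic.\<close>

lemma Lam_inner_definite:
  assumes \<mu>: "\<mu> \<in> L_space" and zero: "Lam_inner g m M \<mu> \<mu> = 0"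
  shows "\<mu> = 0"
proof -
  have lam: "\<mu> (M 1) = 0" "\<mu> (M (m + 1)) = 0" "\<And>i. i \<in> {1..m} \<Longrightarrow> poly_on 2 (closed_segment (M i) (M (i + 1))) \<mu>"
    "\<And>x. x \<notin> closure \<Gamma>1 \<Longrightarrow> \<mu> x = 0"
    using \<mu> unfolding L_space_def Lam_space_def by auto
  have node: "\<mu> x = 0" if "g x * \<mu> x * \<mu> x = 0" "x \<in> \<Gamma>1" for x using g_pos[OF that(2)] that(1) by simp
  have "(\<Sum>i=1..m. edge_sum \<mu> i) = 0" using zero unfolding Lam_inner_edges by simp
  then have "edge_sum \<mu> i = 0" if "i \<in> {1..m}" for i
    using sum_nonneg_eq_0_iff[of "{1..m}" "edge_sum \<mu>"] edge_sum_nonneg that by simp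
  then have "g (M i) * \<mu> (M i) * \<mu> (M i) + 4 * g (half_node M i) * \<mu> (half_node M i) * \<mu> (half_node M i)
      + g (M (i + 1)) * \<mu> (M (i + 1)) * \<mu> (M (i + 1)) = 0" if "i \<in> {1..m}" for i
    unfolding edge_sum_def using edge_nodes(4)[OF that] that by (metis less_irrefl mult_eq_0_iff)
  then have terms: "g (M i) * \<mu> (M i) * \<mu> (M i) = 0" "4 * g (half_node M i) * \<mu> (half_node M i) * \<mu> (half_node M i) = 0"
      "g (M (i + 1)) * \<mu> (M (i + 1)) * \<mu> (M (i + 1)) = 0" if "i \<in> {1..m}" for i
    using edge_terms[OF that, of \<mu>] that by (metis add_nonneg_eq_0_iff add_nonneg_nonneg)+
  have seg: "\<mu> x = 0" if i: "i \<in> {1..m}" and x: "x \<in> closed_segment (M i) (M (i + 1))" for i x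
  proof (rule quadratic_on_segment_zero[OF lam(3)[OF i] subset_refl _ _ _ x])
    have i': "i \<in> {1..m + 1}" "i + 1 \<in> {1..m + 1}" using i by auto
    show "\<mu> (M i) = 0" using end_or_\<Gamma>1[OF i'(1)] lam(1,2) node[OF terms(1)[OF i]] by metis
    show "\<mu> (M (i + 1)) = 0" using end_or_\<Gamma>1[OF i'(2)] lam(1,2) node[OF terms(3)[OF i]] by metis
    show "\<mu> (half_node M i) = 0" using terms(2)[OF i] half_node_param(2)[OF i] by (intro node) auto
  qed
  have "\<mu> x = 0" for x using seg lam(4)[of x] closure_\<Gamma>1_edges by blast
  then show ?thesis by (simp add: fun_eq_iff)
qed

lemma Lam_inner_bounded:
  assumes "\<mu> \<in> Lam_tilde \<Gamma>1 \<T> m M"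
  shows "Lam_inner g m M \<mu> \<mu> \<le> Lam_inner g m M (\<lambda>x. 1) (\<lambda>x. 1)"
proof -
  have "edge_sum \<mu> i \<le> edge_sum (\<lambda>x. 1) i" if i: "i \<in> {1..m}" for i
  proof -
    have node: "g x * \<mu> x * \<mu> x \<le> g x * 1 * 1" if "x \<in> closure \<Gamma>1" "\<bar>\<mu> x\<bar> \<le> 1" for x
    proof -
      have "\<mu> x * \<mu> x \<le> 1" using abs_square_le_1[of "\<mu> x"] that(2) by (simp add: power2_eq_square)
      then show ?thesis using mult_left_mono[OF _ g_nonneg[OF that(1)], of "\<mu> x * \<mu> x" 1] by (simp add: mult.assoc)
    qed
    show ?thesis unfolding edge_sum_def
      using node[OF edge_nodes(1)[OF i] Lam_tilde_nodes(1)[OF assms i]] node[OF edge_nodes(2)[OF i] Lam_tilde_nodes(2)[OF assms i]]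
        node[OF edge_nodes(3)[OF i] Lam_tilde_nodes(3)[OF assms i]]
      by (intro mult_left_mono) (simp_all add: mult.assoc)
  qed
  then show ?thesis unfolding Lam_inner_edges by (intro mult_left_mono sum_mono) auto
qed

lemma seminorm_Lam: "seminorm_on L_space (\<lambda>\<mu>. sqrt (Lam_inner g m M \<mu> \<mu>))"
  using seminorm_on_sqrt_bilinear[OF Lam_inner_bilinear subspace_UNIV, of g m M] Lam_inner_sym Lam_inner_nonneg
  unfolding seminorm_on_def by blast

lemma K_convex: "convex K_set"
  unfolding convex_def
proof (intro ballI allI impI)
  fix x y and u v :: real assume xy: "x \<in> K_set" "y \<in> K_set" and uv: "0 \<le> u" "0 \<le> v" "u + v = 1"
  have "u *\<^sub>R x + v *\<^sub>R y \<in> L_space"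
    using xy spaces_subset(5) subspace_L by (auto intro: subspace_add subspace_scale)
  moreover have "\<bar>(u *\<^sub>R x + v *\<^sub>R y) z\<bar> \<le> 1" if z: "z \<in> \<Gamma>1 \<inter> mesh_nodes \<T>" for z
  proof -
    have b: "\<bar>x z\<bar> \<le> 1" "\<bar>y z\<bar> \<le> 1" using xy z unfolding K_set_def Lam_tilde_def by auto
    have "\<bar>u * x z + v * y z\<bar> \<le> u * \<bar>x z\<bar> + v * \<bar>y z\<bar>"
      using abs_triangle_ineq[of "u * x z" "v * y z"] uv by (simp add: abs_mult)
    also have "\<dots> \<le> u * 1 + v * 1" using b uv by (intro add_mono mult_left_mono) auto
    finally show ?thesis using uv(3) by simp
  qed
  ultimately show "u *\<^sub>R x + v *\<^sub>R y \<in> K_set" unfolding K_set_def Lam_tilde_def L_space_def by blast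
qed

text \<open>Evaluation at a node is continuous for the multiplier norm, by finite dimension and
  definiteness, so the nodal bounds pass to the limit.\<close>

lemma K_closed:
  assumes x: "\<And>k::nat. x k \<in> K_set" and y: "y \<in> L_space"
    and lim: "(\<lambda>k. sqrt (Lam_inner g m M (x k - y) (x k - y))) \<longlonglongrightarrow> 0"
  shows "y \<in> K_set"
proof -
  have "\<bar>y z\<bar> \<le> 1" if z: "z \<in> \<Gamma>1 \<inter> mesh_nodes \<T>" for z
  proof -
    have "seminorm_on L_space (\<lambda>\<mu>. \<bar>\<mu> z\<bar>)" by (rule seminorm_on_abs_linear) simp_all
    moreover have "x k - y \<in> L_space" for k using x y spaces_subset(5) subspace_L by (auto intro: subspace_diff)
    moreover have "\<mu> = 0" if "\<mu> \<in> L_space" "sqrt (Lam_inner g m M \<mu> \<mu>) = 0" for \<mu> using Lam_inner_definite[OF that(1)] that(2) by simp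
    ultimately have "(\<lambda>k. \<bar>(x k - y) z\<bar>) \<longlonglongrightarrow> 0"
      using fin_dim_seminorm_tendsto[OF fin_dim_spaces(3) seminorm_Lam, of "\<lambda>\<mu>. \<bar>\<mu> z\<bar>" "\<lambda>k. x k - y"] lim by blast
    then have "(\<lambda>k. x k z) \<longlonglongrightarrow> y z" unfolding tendsto_rabs_zero_iff by (simp add: LIM_zero_iff)
    then have "(\<lambda>k. \<bar>x k z\<bar>) \<longlonglongrightarrow> \<bar>y z\<bar>" by (rule tendsto_rabs)
    moreover have "\<bar>x k z\<bar> \<le> 1" for k using x[of k] z unfolding K_set_def Lam_tilde_def by auto
    ultimately show ?thesis by (intro LIMSEQ_le_const2) auto
  qed
  then show ?thesis using y unfolding K_set_def Lam_tilde_def L_space_def by blast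
qed

lemma uzawa_setting:
  "uzawa_setting E_space P_space L_space K_set (a_form \<Omega> \<nu>) (b_form \<Omega>) (Lam_inner g m M) (normal_comp n)
     (L2_inner \<Omega> f) C (sqrt (Lam_inner g m M (\<lambda>x. 1) (\<lambda>x. 1)))"
proof
  note V = spaces_subset(2)[THEN subsetD]
  have Pbm: "bounded_meas \<Omega> q" if "q \<in> P_space" for q
    using that spaces_subset(3) pc1_Q_space bounded_meas_pc1 by blast
  show "fin_dim E_space" "fin_dim P_space" "fin_dim L_space" by (rule fin_dim_spaces)+
  show "bilinear_on E_space E_space (a_form \<Omega> \<nu>)"
    by (rule symmetric_bilinear_onI[OF subspace_E]) (rule a_form_sym, rule a_form_linear[OF V V V])
  show "a_form \<Omega> \<nu> x y = a_form \<Omega> \<nu> y x" for x y by (rule a_form_sym)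
  show "0 \<le> a_form \<Omega> \<nu> x x" for x using nu_pos by (intro a_form_nonneg) simp
  show "x = 0" if "x \<in> E_space" "a_form \<Omega> \<nu> x x = 0" for x
  proof -
    have x: "x \<in> V\<tau>" "\<And>z. z \<notin> closure \<Omega> \<Longrightarrow> x z = 0" using that(1) unfolding E_space_def by auto
    have "x z = 0" for z
      using a_form_definite[OF x(1) nu_pos that(2), of z] x(2)[of z] by blast
    then show ?thesis by (simp add: fun_eq_iff)
  qed
  show "bilinear_on E_space P_space (b_form \<Omega>)"
    by (intro bilinear_onI subspace_E subspace_P b_form_linear b_form_linear_right V Pbm)
  \<comment> \<open>Injectivity is known against all of \<open>V\<tau>\<close>; cutting a test
    velocity to 0 off the closed domain does not change the form.\<close>
  show "q = 0" if q: "q \<in> P_space" "\<And>v. v \<in> E_space \<Longrightarrow> b_form \<Omega> v q = 0" for q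
  proof -
    have q': "q \<in> Q_space \<Omega> \<T>" "\<And>z. z \<notin> closure \<Omega> \<Longrightarrow> q z = 0" using q(1) unfolding P_space_def by auto
    have "b_form \<Omega> v q = 0" if v: "v \<in> V\<tau>" for v
    proof -
      define w where "w x = (if x \<in> closure \<Omega> then v x else 0)" for x
      have "w \<in> E_space" unfolding E_space_def using V_tau_cong[OF v, of w] unfolding w_def by auto
      moreover have "b_form \<Omega> v q = b_form \<Omega> w q"
        unfolding w_def using closure_subset by (intro b_form_cong) auto
      ultimately show ?thesis using q(2) by simp
    qed
    then have "q z = 0" for z using b_form_injective[OF q'(1), of z] q'(2)[of z] by blast
    then show ?thesis by (simp add: fun_eq_iff)
  qed
  show "bilinear_on UNIV UNIV (Lam_inner g m M)" by (rule Lam_inner_bilinear)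
  show "Lam_inner g m M x y = Lam_inner g m M y x" for x y by (rule Lam_inner_sym)
  show "0 \<le> Lam_inner g m M x x" for x by (rule Lam_inner_nonneg)
  show "x = 0" if "x \<in> L_space" "Lam_inner g m M x x = 0" for x by (rule Lam_inner_definite[OF that])
  show "normal_comp n (x + y) = normal_comp n x + normal_comp n y" for x y by (simp add: fun_eq_iff inner_add_left)
  show "normal_comp n (r *\<^sub>R x) = r *\<^sub>R normal_comp n x" for x r by (simp add: fun_eq_iff)
  show "Lam_inner g m M (normal_comp n v) (normal_comp n v) \<le> C * a_form \<Omega> \<nu> v v" if "v \<in> E_space" for v
    using trace that spaces_subset(1) by blast
  show "C > 0" by (rule C_pos)
  have zero: "0 \<in> V" using subspace_0[OF subspace_E] spaces_subset(2) by blast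
  have load0: "L2_inner \<Omega> f 0 = 0" unfolding L2_inner_def by simp
  show "L2_inner \<Omega> f (x + y) = L2_inner \<Omega> f x + L2_inner \<Omega> f y" if "x \<in> E_space" "y \<in> E_space" for x y
    using load_linear[OF f_L2 V[OF that(1)] V[OF that(2)], of 1] by simp
  show "L2_inner \<Omega> f (r *\<^sub>R x) = r * L2_inner \<Omega> f x" if "x \<in> E_space" for x r
    using load_linear[OF f_L2 V[OF that] zero, of r] load0 by simp
  show "K_set \<subseteq> L_space" by (rule spaces_subset(5))
  show "convex K_set" by (rule K_convex)
  show "sqrt (Lam_inner g m M \<mu> \<mu>) \<le> sqrt (Lam_inner g m M (\<lambda>x. 1) (\<lambda>x. 1))" if "\<mu> \<in> K_set" for \<mu>
    using Lam_inner_bounded that spaces_subset(4) by (intro real_sqrt_le_mono) blast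
  show "y \<in> K_set" if "\<And>k::nat. x k \<in> K_set" "y \<in> L_space"
    "(\<lambda>k. sqrt (Lam_inner g m M (x k - y) (x k - y))) \<longlonglongrightarrow> 0" for x y
    by (rule K_closed[OF that])
qed

text \<open>Forms and norms see only \<Omega> or the closed side, so iterates may be replaced by
  their extensions by zero, and conversely the limit may be tested against arbitrary discrete
  functions after cutting these off.\<close>

theorem uzawa_iterates_converge:
  assumes \<rho>: "0 < \<rho>" "\<rho> < 2 / C" and it: "uzawa_iterates \<Omega> \<Gamma>0 \<Gamma>1 n \<nu> f g \<T> m M \<rho> u p l"
  shows "\<exists>u' p' l'. VE_solution \<Omega> \<Gamma>0 \<Gamma>1 n \<nu> f g \<T> m M u' p' l' \<and>
        (\<lambda>k. H1_norm \<Omega> (\<lambda>x. u k x - u' x)) \<longlonglongrightarrow> 0 \<and>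
        (\<lambda>k. L2_norm \<Omega> (\<lambda>x. p k x - p' x)) \<longlonglongrightarrow> 0 \<and>
        (\<lambda>k. Lam_norm g m M (\<lambda>x. l k x - l' x)) \<longlonglongrightarrow> 0"
proof -
  interpret uzawa_setting E_space P_space L_space K_set "a_form \<Omega> \<nu>" "b_form \<Omega>" "Lam_inner g m M" "normal_comp n"
    "L2_inner \<Omega> f" C "sqrt (Lam_inner g m M (\<lambda>x. 1) (\<lambda>x. 1))"
    by (rule uzawa_setting)
  note in_closure = subsetD[OF closure_subset, of _ \<Omega>]
  have u: "u k \<in> V\<tau>" and p: "p k \<in> Q_space \<Omega> \<T>"
    and mom: "\<And>v. v \<in> V\<tau> \<Longrightarrow> a_form \<Omega> \<nu> (u k) v + b_form \<Omega> v (p k) = L2_inner \<Omega> f v - Lam_inner g m M (normal_comp n v) (l k)"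
    and inc: "\<And>q. q \<in> Q_space \<Omega> \<T> \<Longrightarrow> b_form \<Omega> (u k) q = 0"
    and proj: "is_Lam_proj \<Gamma>1 g \<T> m M (\<lambda>x. l k x + \<rho> * normal_comp n (u k) x) (l (k + 1))" if "k \<ge> 1" for k
    using it that unfolding uzawa_iterates_def by auto
  have l: "l k \<in> Lam_tilde \<Gamma>1 \<T> m M" if "k \<ge> 1" for k
  proof (cases "k = 1")
    case True
    then show ?thesis using it unfolding uzawa_iterates_def by blast
  next
    case False
    then have "k - 1 \<ge> 1" "k - 1 + 1 = k" using that by auto
    then show ?thesis using proj[of "k - 1"] unfolding is_Lam_proj_def is_arg_min_def by metis
  qed
  \<comment> \<open>The index shift matters: the given iteration starts at 1, the abstract one at
    0.\<close>
  define U where "U k x = (if x \<in> closure \<Omega> then u (Suc k) x else 0)" for k x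
  define P where "P k x = (if x \<in> closure \<Omega> then p (Suc k) x else 0)" for k x
  define \<Lambda> where "\<Lambda> k x = (if x \<in> closure \<Gamma>1 then l (Suc k) x else 0)" for k x
  have U: "U k \<in> E_space" "\<And>x. x \<in> closure \<Omega> \<Longrightarrow> U k x = u (Suc k) x" for k
    using V_tau_cong[OF u[of "Suc k"], of "U k"] unfolding E_space_def U_def by auto
  have P: "P k \<in> P_space" "\<And>x. x \<in> closure \<Omega> \<Longrightarrow> P k x = p (Suc k) x" for k
    using Q_space_cong[OF p[of "Suc k"], of "P k"] unfolding P_space_def P_def by auto
  have \<Lambda>: "\<Lambda> k \<in> K_set" "\<And>x. x \<in> closure \<Gamma>1 \<Longrightarrow> \<Lambda> k x = l (Suc k) x" for k
    using Lam_tilde_cong[OF l[of "Suc k"], of "\<Lambda> k"] unfolding K_set_def \<Lambda>_def by auto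
  have momentum: "a_form \<Omega> \<nu> (U k) v + b_form \<Omega> v (P k) = L2_inner \<Omega> f v - Lam_inner g m M (normal_comp n v) (\<Lambda> k)"
    if v: "v \<in> E_space" for k v
  proof -
    have "a_form \<Omega> \<nu> (U k) v = a_form \<Omega> \<nu> (u (Suc k)) v" by (rule a_form_cong) (use U(2) in_closure in auto)
    moreover have "b_form \<Omega> v (P k) = b_form \<Omega> v (p (Suc k))" by (rule b_form_cong) (use P(2) in_closure in auto)
    moreover have "Lam_inner g m M (normal_comp n v) (\<Lambda> k) = Lam_inner g m M (normal_comp n v) (l (Suc k))"
      by (rule Lam_inner_cong) (use \<Lambda>(2) in auto)
    ultimately show ?thesis using mom[of "Suc k" v] v spaces_subset(1) by auto
  qed
  have incompressible: "b_form \<Omega> (U k) q = 0" if "q \<in> P_space" for k q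
  proof -
    have "b_form \<Omega> (U k) q = b_form \<Omega> (u (Suc k)) q" by (rule b_form_cong) (use U(2) in_closure in auto)
    then show ?thesis using inc[of "Suc k" q] that spaces_subset(3) by auto
  qed
  have projection: "Lam_inner g m M (\<Lambda> k + \<rho> *\<^sub>R normal_comp n (U k) - \<Lambda> (Suc k)) (\<mu> - \<Lambda> (Suc k)) \<le> 0"
    if \<mu>: "\<mu> \<in> K_set" for k \<mu>
  proof (rule nearest_point_variational[OF Lam_inner_bilinear Lam_inner_sym K_convex \<Lambda>(1) \<mu>])
    fix \<xi> assume \<xi>: "\<xi> \<in> K_set"
    define w where "w x = l (Suc k) x + \<rho> * normal_comp n (u (Suc k)) x" for x
    \<comment> \<open>Extended and original functions agree on the closed side, where
      \<open>Lam_inner\<close> evaluates, so the nearest-point property carries over.\<close>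
    have W: "(\<Lambda> k + \<rho> *\<^sub>R normal_comp n (U k) - \<eta>) x = w x - \<eta>' x" if "x \<in> closure \<Gamma>1" "\<eta> x = \<eta>' x" for x \<eta> \<eta>'
      using that U(2)[of x k] \<Lambda>(2)[of x k] closure_\<Gamma>1_subset unfolding w_def by auto
    have "\<not> Lam_norm g m M (\<lambda>x. w x - \<xi> x) < Lam_norm g m M (\<lambda>x. w x - l (Suc (Suc k)) x)"
      using proj[of "Suc k"] \<xi> spaces_subset(4) unfolding is_Lam_proj_def is_arg_min_def w_def by auto
    then have "Lam_inner g m M (\<lambda>x. w x - l (Suc (Suc k)) x) (\<lambda>x. w x - l (Suc (Suc k)) x) \<le>
        Lam_inner g m M (\<lambda>x. w x - \<xi> x) (\<lambda>x. w x - \<xi> x)"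
      unfolding Lam_norm_def by simp
    moreover have "Lam_inner g m M (\<Lambda> k + \<rho> *\<^sub>R normal_comp n (U k) - \<Lambda> (Suc k)) (\<Lambda> k + \<rho> *\<^sub>R normal_comp n (U k) - \<Lambda> (Suc k)) =
        Lam_inner g m M (\<lambda>x. w x - l (Suc (Suc k)) x) (\<lambda>x. w x - l (Suc (Suc k)) x)"
      by (rule Lam_inner_cong) (use W \<Lambda>(2) in blast)+
    moreover have "Lam_inner g m M (\<Lambda> k + \<rho> *\<^sub>R normal_comp n (U k) - \<xi>) (\<Lambda> k + \<rho> *\<^sub>R normal_comp n (U k) - \<xi>) =
        Lam_inner g m M (\<lambda>x. w x - \<xi> x) (\<lambda>x. w x - \<xi> x)"
      by (rule Lam_inner_cong) (use W in blast)+
    ultimately show "Lam_inner g m M (\<Lambda> k + \<rho> *\<^sub>R normal_comp n (U k) - \<Lambda> (Suc k)) (\<Lambda> k + \<rho> *\<^sub>R normal_comp n (U k) - \<Lambda> (Suc k)) \<le>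
        Lam_inner g m M (\<Lambda> k + \<rho> *\<^sub>R normal_comp n (U k) - \<xi>) (\<Lambda> k + \<rho> *\<^sub>R normal_comp n (U k) - \<xi>)" by simp
  qed
  obtain u' p' l' where sp: "saddle_point u' p' l'"
    and limu: "\<And>N. seminorm_on E_space N \<Longrightarrow> (\<lambda>k. N (U k - u')) \<longlonglongrightarrow> 0"
    and limp: "\<And>N. seminorm_on P_space N \<Longrightarrow> (\<lambda>k. N (P k - p')) \<longlonglongrightarrow> 0"
    and liml: "(\<lambda>k. sqrt (Lam_inner g m M (\<Lambda> k - l') (\<Lambda> k - l'))) \<longlonglongrightarrow> 0"
    using uzawa_converges[of U P \<Lambda> \<rho>, OF U(1) P(1) \<Lambda>(1) momentum incompressible projection \<rho>] by blast
  have sol: "u' \<in> E_space" "p' \<in> P_space" "l' \<in> K_set"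
    and eq1: "\<And>v. v \<in> E_space \<Longrightarrow> a_form \<Omega> \<nu> u' v + b_form \<Omega> v p' + Lam_inner g m M (normal_comp n v) l' = L2_inner \<Omega> f v"
    and eq2: "\<And>q. q \<in> P_space \<Longrightarrow> b_form \<Omega> u' q = 0"
    and eq3: "\<And>\<mu>. \<mu> \<in> K_set \<Longrightarrow> Lam_inner g m M (normal_comp n u') (\<mu> - l') \<le> 0"
    using sp unfolding saddle_point_def by auto
  have "VE_solution \<Omega> \<Gamma>0 \<Gamma>1 n \<nu> f g \<T> m M u' p' l'"
    unfolding VE_solution_def
  proof (intro conjI ballI)
    show "u' \<in> V\<tau>" "p' \<in> Q_space \<Omega> \<T>" "l' \<in> Lam_tilde \<Gamma>1 \<T> m M" using sol spaces_subset by auto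
    fix v assume v: "v \<in> V\<tau>"
    define w where "w x = (if x \<in> closure \<Omega> then v x else 0)" for x
    have w: "w \<in> E_space" unfolding E_space_def using V_tau_cong[OF v, of w] unfolding w_def by auto
    have eq: "w x = v x" if "x \<in> \<Omega>" for x using in_closure[OF that] unfolding w_def by simp
    have "a_form \<Omega> \<nu> u' w = a_form \<Omega> \<nu> u' v" by (rule a_form_cong) (use eq in auto)
    moreover have "b_form \<Omega> w p' = b_form \<Omega> v p'" by (rule b_form_cong) (use eq in auto)
    moreover have "L2_inner \<Omega> f w = L2_inner \<Omega> f v" by (rule L2_inner_cong) (use eq in auto)
    moreover have "Lam_inner g m M (normal_comp n w) l' = Lam_inner g m M (normal_comp n v) l'"
      by (rule Lam_inner_cong) (use closure_\<Gamma>1_subset in \<open>auto simp: w_def\<close>)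
    ultimately show "a_form \<Omega> \<nu> u' v + b_form \<Omega> v p' + Lam_inner g m M (normal_comp n v) l' = L2_inner \<Omega> f v"
      using eq1[OF w] by simp
  next
    fix q assume q: "q \<in> Q_space \<Omega> \<T>"
    define r where "r x = (if x \<in> closure \<Omega> then q x else 0)" for x
    have r: "r \<in> P_space" unfolding P_space_def using Q_space_cong[OF q, of r] unfolding r_def by auto
    have "b_form \<Omega> u' r = b_form \<Omega> u' q" by (rule b_form_cong) (use in_closure in \<open>auto simp: r_def\<close>)
    then show "b_form \<Omega> u' q = 0" using eq2[OF r] by simp
  next
    fix \<mu> assume \<mu>: "\<mu> \<in> Lam_tilde \<Gamma>1 \<T> m M"
    define \<xi> where "\<xi> x = (if x \<in> closure \<Gamma>1 then \<mu> x else 0)" for x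
    have \<xi>: "\<xi> \<in> K_set" unfolding K_set_def using Lam_tilde_cong[OF \<mu>, of \<xi>] unfolding \<xi>_def by auto
    have "Lam_inner g m M (normal_comp n u') (\<xi> - l') = Lam_inner g m M (normal_comp n u') (\<lambda>x. \<mu> x - l' x)"
      by (rule Lam_inner_cong) (auto simp: \<xi>_def)
    then show "Lam_inner g m M (normal_comp n u') (\<lambda>x. \<mu> x - l' x) \<le> 0" using eq3[OF \<xi>] by simp
  qed
  moreover have "(\<lambda>k. H1_norm \<Omega> (\<lambda>x. u k x - u' x)) \<longlonglongrightarrow> 0"
  proof -
    have eq: "H1_norm \<Omega> (U k - u') = H1_norm \<Omega> (\<lambda>x. u (Suc k) x - u' x)" for k
      by (rule H1_norm_cong) (use U(2) in_closure in auto)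
    show ?thesis using limu[OF seminorm_H1] unfolding eq by (rule LIMSEQ_imp_Suc)
  qed
  moreover have "(\<lambda>k. L2_norm \<Omega> (\<lambda>x. p k x - p' x)) \<longlonglongrightarrow> 0"
  proof -
    have eq: "L2_norm \<Omega> (P k - p') = L2_norm \<Omega> (\<lambda>x. p (Suc k) x - p' x)" for k
      unfolding L2_norm_def by (intro arg_cong[of _ _ sqrt] L2_inner_cong) (use P(2) in_closure in auto)
    show ?thesis using limp[OF seminorm_L2] unfolding eq by (rule LIMSEQ_imp_Suc)
  qed
  moreover have "(\<lambda>k. Lam_norm g m M (\<lambda>x. l k x - l' x)) \<longlonglongrightarrow> 0"
  proof -
    have eq: "sqrt (Lam_inner g m M (\<Lambda> k - l') (\<Lambda> k - l')) = Lam_norm g m M (\<lambda>x. l (Suc k) x - l' x)" for k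
      unfolding Lam_norm_def by (intro arg_cong[of _ _ sqrt] Lam_inner_cong) (use \<Lambda>(2) in auto)
    show ?thesis using liml unfolding eq by (rule LIMSEQ_imp_Suc)
  qed
  ultimately show ?thesis by blast
qed

end

theorem theorem5p4:
  fixes \<Omega> \<Gamma>0 \<Gamma>1 :: "(real^2) set" and \<P> :: "(real^2) list set"
    and A B n :: "real^2"
    and \<nu> :: real and f :: "real^2 \<Rightarrow> real^2" and g :: "real^2 \<Rightarrow> real"
    and K K' :: real and H :: "real set" and \<T> :: "real \<Rightarrow> (real^2) set set"
    and m :: "real \<Rightarrow> nat" and M :: "real \<Rightarrow> nat \<Rightarrow> real^2"
  assumes domain: "polygonal_domain \<Omega> \<P>"
    and parts_open: "openin (top_of_set (frontier \<Omega>)) \<Gamma>0" "openin (top_of_set (frontier \<Omega>)) \<Gamma>1"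
    and parts_nonempty: "\<Gamma>0 \<noteq> {}" "\<Gamma>1 \<noteq> {}"
    and parts_disjoint: "\<Gamma>0 \<inter> \<Gamma>1 = {}"
    and parts_cover: "frontier \<Omega> = closure \<Gamma>0 \<union> closure \<Gamma>1"
    and whole_side: "closed_segment A B \<in> (\<Union>vs\<in>\<P>. polygon_sides vs)"
      "closure \<Gamma>1 = closed_segment A B" "\<Gamma>1 = open_segment A B"
    and normal: "outer_unit_normal \<Omega> \<Gamma>1 n"
    and nu_pos: "\<nu> > 0"
    and f_L2: "f \<in> L2 \<Omega>"
    and g_cont: "continuous_on (closure \<Gamma>1) g"
    and g_pos: "\<forall>x\<in>\<Gamma>1. g x > 0"
    and K_pos: "K > 0" "K' > 0"
    and mesh: "\<forall>h\<in>H. admissible_mesh \<Omega> K K' h (\<T> h)"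
    and vertices: "\<forall>h\<in>H. boundary_vertices A B (\<T> h) (m h) (M h)"
  shows "\<exists>\<rho>0>0. \<forall>h\<in>H. \<forall>\<rho> u p l.
     0 < \<rho> \<and> \<rho> < \<rho>0 \<and>
     uzawa_iterates \<Omega> \<Gamma>0 \<Gamma>1 n \<nu> f g (\<T> h) (m h) (M h) \<rho> u p l \<longrightarrow>
     (\<exists>u' p' l'. VE_solution \<Omega> \<Gamma>0 \<Gamma>1 n \<nu> f g (\<T> h) (m h) (M h) u' p' l' \<and>
        (\<lambda>k. H1_norm \<Omega> (\<lambda>x. u k x - u' x)) \<longlonglongrightarrow> 0 \<and>
        (\<lambda>k. L2_norm \<Omega> (\<lambda>x. p k x - p' x)) \<longlonglongrightarrow> 0 \<and>
        (\<lambda>k. Lam_norm g (m h) (M h) (\<lambda>x. l k x - l' x)) \<longlonglongrightarrow> 0)"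
proof -
  have "compact (g ` closed_segment A B)"
    using g_cont unfolding whole_side(2) by (intro compact_continuous_image) auto
  then have "bounded (g ` closed_segment A B)" by (rule compact_imp_bounded)
  then obtain G where G: "\<And>x. x \<in> closed_segment A B \<Longrightarrow> \<bar>g x\<bar> \<le> G" unfolding bounded_iff by auto
  have "0 \<le> \<bar>g A\<bar>" by simp
  also have "\<dots> \<le> G" using G by simp
  finally have G0: "0 \<le> G" .
  have gG: "g x \<le> G" if "x \<in> closed_segment A B" for x using G[OF that] by simp
  have "bounded (closure \<Omega>)" using domain unfolding polygonal_domain_def by (simp add: bounded_closure)
  then obtain r where r: "r > 0" "\<And>y. y \<in> closure \<Omega> \<Longrightarrow> norm y < r" unfolding bounded_pos_less by blast
  have R: "norm (y - z) < 2 * r" if "y \<in> closure \<Omega>" "z \<in> closure \<Omega>" for y z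
    using norm_triangle_ineq4[of y z] r(2)[OF that(1)] r(2)[OF that(2)] by simp
  \<comment> \<open>Fixed before any mesh is chosen; adding 1 makes positivity immediate.\<close>
  define C where "C = 5 / 2 * G * (2 * r) / (2 * \<nu>) + 1"
  have C: "C > 0" unfolding C_def using G0 r(1) nu_pos by (simp add: add_nonneg_pos)
  show ?thesis
  \<comment> \<open>Below 2/C the energy decreases and the distances to saddle points do not
    increase.\<close>
  proof (intro exI[of _ "2 / C"] conjI ballI allI impI)
    show "2 / C > 0" using C by simp
    fix h \<rho> u p l assume h: "h \<in> H"
      and it: "0 < \<rho> \<and> \<rho> < 2 / C \<and> uzawa_iterates \<Omega> \<Gamma>0 \<Gamma>1 n \<nu> f g (\<T> h) (m h) (M h) \<rho> u p l"
    have adm: "triangulation (\<T> h)" "\<And>T. T \<in> \<T> h \<Longrightarrow> 2 simplex T" "\<Union>(\<T> h) = closure \<Omega>"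
      "\<And>T. T \<in> \<T> h \<Longrightarrow> \<exists>v\<in>vertices_of T. v \<notin> frontier \<Omega>"
      using mesh h unfolding admissible_mesh_def by auto
    interpret fe_mesh \<Omega> \<Gamma>0 \<Gamma>1 \<P> A B n "\<T> h" "m h" "M h"
      using vertices h
      by (intro fe_mesh.intro domain parts_open parts_nonempty(2) parts_disjoint parts_cover whole_side normal adm) auto
    interpret fe_problem \<Omega> \<Gamma>0 \<Gamma>1 \<P> A B n "\<T> h" "m h" "M h" \<nu> f g C
    proof unfold_locales
      show "\<nu> > 0" "f \<in> L2 \<Omega>" "continuous_on (closure \<Gamma>1) g" "C > 0" by fact+
      show "g x > 0" if "x \<in> \<Gamma>1" for x using g_pos that by blast
      fix v assume v: "v \<in> V\<tau>"
      have "Lam_inner g (m h) (M h) (normal_comp n v) (normal_comp n v) \<le> (5 / 2 * G * (2 * r) / (2 * \<nu>)) * a_form \<Omega> \<nu> v v"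
        using r(1) by (intro Lam_trace v nu_pos G0 gG R) auto
      also have "\<dots> \<le> C * a_form \<Omega> \<nu> v v"
        unfolding C_def using a_form_nonneg[of \<nu> v] nu_pos by (intro mult_right_mono) auto
      finally show "Lam_inner g (m h) (M h) (normal_comp n v) (normal_comp n v) \<le> C * a_form \<Omega> \<nu> v v" .
    qed
    show "\<exists>u' p' l'. VE_solution \<Omega> \<Gamma>0 \<Gamma>1 n \<nu> f g (\<T> h) (m h) (M h) u' p' l' \<and>
        (\<lambda>k. H1_norm \<Omega> (\<lambda>x. u k x - u' x)) \<longlonglongrightarrow> 0 \<and>
        (\<lambda>k. L2_norm \<Omega> (\<lambda>x. p k x - p' x)) \<longlonglongrightarrow> 0 \<and>
        (\<lambda>k. Lam_norm g (m h) (M h) (\<lambda>x. l k x - l' x)) \<longlonglongrightarrow> 0"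
      using uzawa_iterates_converge it by blast
  qed
qed

end
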